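(* Let $G=GL(m|n)$ over a field $K$ of characteristic $p>2$ and let $\Gamma$ be a (not necessarily finitely generated) ideal of $X(T)^+$. Let $\mathbb Z_\Gamma$ be the set of integers $l$ such that $\Gamma$ contains a weight $\lambda$ with $|\lambda|=l$. Then $\ker(\pi_\Gamma)\cap Dist(T)$ is the $K$-span of the elements $h^{(q)}_\alpha(e)$, over all $q=p^r$ ($r\ge0$) and all $\alpha=(\alpha_1,\dots,\alpha_{m+n})$ with $0\le\alpha_i\le q-1$, such that $|\alpha|\not\equiv l\pmod q$ for every $l\in\mathbb Z_\Gamma$.
   Context: $K$ is a field of characteristic $p>2$, $m,n\ge1$, $G=GL(m|n)$ with coordinate Hopf superalgebra $K[G]$ generated by matrix entries $x_{ij}$; left $G$-supermodules are right $K[G]$-supercomodules, $\rho_r$ is the structure on $K[G]$ given by $\Delta_G$. $T$ is the diagonal torus, $X(T)=\mathbb Z^{m+n}$ with basis $\epsilon_i$, $|\lambda|=\sum_i\lambda_i$. $X(T)^+$ is the set of dominant weights ($\lambda_1\ge\dots\ge\lambda_m$, $\lambda_{m+1}\ge\dots\ge\lambda_{m+n}$), ordered by $\mu\unlhd\lambda$ iff $\lambda-\mu$ is a nonnegative integer combination of $\epsilon_i-\epsilon_j$, $i<j$; an ideal is a down-closed subset. $L_-(\lambda)$ is the simple socle of $H^0_-(\lambda)=\mathrm{ind}^G_{B^-}K_\lambda$ ($B^-$ lower triangular Borel); irreducible $G$-supermodules are $L_-(\lambda)$, $\Pi L_-(\lambda)$ ($\Pi$ parity shift). $C_\Gamma=O_\Gamma(K[G])$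 is the largest subsupermodule of $(K[G],\rho_r)$ all of whose composition factors are $L_-(\lambda)$ or $\Pi L_-(\lambda)$ with $\lambda\in\Gamma$. $Dist(G)=\bigcup_{t\ge0}(K[G]/\mathfrak m^{t+1})^*$, $\mathfrak m=\ker\epsilon_G$, and $\pi_\Gamma:Dist(G)\to S_\Gamma=C_\Gamma^*$ is the restriction $\xi\mapsto\xi|_{C_\Gamma}$. $e_i=e_{ii}$ is the diagonal matrix unit in $\mathrm{Lie}(G)\subseteq Dist(G)$. $Dist(T)\subseteq Dist(G)$ has $K$-basis the products $\prod_i\binom{e_i}{s_i}$, $s_i\ge0$, where $\binom{e_i}{s}$ is the image of $e_i(e_i-1)\cdots(e_i-s+1)/s!$ from the Kostant $\mathbb Z$-form; $\binom{e_i}{s}$ acts on a vector of weight $\mu$ as the scalar $\binom{\mu_i}{s}$. For $q=p^r$ and $0\le t\le q-1$ put $h^{(q)}_t(x)=\sum_{t\le k\le q-1}(-1)^{k-t}\binom kt\binom xk$, and $h^{(q)}_\alpha(e)=\prod_{1\le i\le m+n}h^{(q)}_{\alpha_i}(e_i)\in Dist(T)$. *)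

theory Defs
  imports
    Complex_Main
    "HOL-Library.Poly_Mapping"
    "HOL-Library.Function_Algebras"
    "HOL-Library.FuncSet"
    "HOL-Number_Theory.Cong"
begin

section \<open>Indices and parities\<close>

text \<open>
  The index set \<open>{1, ..., m + n}\<close> is modelled by \<open>('m, 'n) idx\<close> with \<open>m = CARD('m)\<close> and
  \<open>n = CARD('n)\<close>: first the \<open>m\<close> even indices \<open>Ev i\<close>, then the \<open>n\<close> odd indices \<open>Od j\<close>.
\<close>

datatype ('m, 'n) idx = Ev 'm | Od 'n

instantiation idx :: (linorder, linorder) linorder
begin

fun less_eq_idx :: "('a, 'b) idx \<Rightarrow> ('a, 'b) idx \<Rightarrow> bool" where
  "less_eq_idx (Ev i) (Ev j) = (i \<le> j)"
| "less_eq_idx (Ev i) (Od j) = True"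
| "less_eq_idx (Od i) (Ev j) = False"
| "less_eq_idx (Od i) (Od j) = (i \<le> j)"

definition less_idx :: "('a, 'b) idx \<Rightarrow> ('a, 'b) idx \<Rightarrow> bool" where
  "less_idx i j \<longleftrightarrow> i \<le> j \<and> \<not> j \<le> i"

instance
proof
  fix x y z :: "('a, 'b) idx"
  show "x < y \<longleftrightarrow> x \<le> y \<and> \<not> y \<le> x" by (rule less_idx_def)
  show "x \<le> x" by (cases x) auto
  show "x \<le> y \<Longrightarrow> y \<le> z \<Longrightarrow> x \<le> z" by (cases x; cases y; cases z) auto
  show "x \<le> y \<Longrightarrow> y \<le> x \<Longrightarrow> x = y" by (cases x; cases y) auto
  show "x \<le> y \<or> y \<le> x" by (cases x; cases y) auto
qed

end

lemma UNIV_idx: "UNIV = range Ev \<union> range Od"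
  by (metis UNIV_eq_I UnCI idx.exhaust rangeI)

instance idx :: (finite, finite) finite
  by standard (simp add: UNIV_idx)

abbreviation all_idx :: "('m :: {finite, linorder}, 'n :: {finite, linorder}) idx list" where
  "all_idx \<equiv> sorted_list_of_set UNIV"

lemma sum_list_all_idx: "(\<Sum>k\<leftarrow>all_idx. f k) = (\<Sum>k\<in>UNIV. f k)"
  by (simp add: sum_list_distinct_conv_sum_set)

fun odd_idx :: "('m, 'n) idx \<Rightarrow> bool" where
  "odd_idx (Ev _) = False"
| "odd_idx (Od _) = True"


section \<open>The coordinate superalgebra of a power of \<open>GL(m|n)\<close>\<close>

text \<open>
  \<open>GL(m|n)\<close> is the functor assigning to a supercommutative superalgebra the group of its even
  invertible supermatrices of size \<open>m|n\<close>. Accordingly \<open>K[G]\<close> is the supercommutative superalgebra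
  generated by the entries \<open>x\<^sub>i\<^sub>j\<close> of the generic matrix and the entries \<open>y\<^sub>i\<^sub>j\<close> of its inverse, with
  \<open>\<bar>x\<^sub>i\<^sub>j\<bar> = \<bar>y\<^sub>i\<^sub>j\<bar> = \<bar>i\<bar> + \<bar>j\<bar>\<close>. Adjoining the \<open>y\<^sub>i\<^sub>j\<close> is the same as inverting the determinants of
  the two diagonal blocks of \<open>(x\<^sub>i\<^sub>j)\<close>.

  The type \<open>'c\<close> indexes factors, i.e. the construction gives \<open>K[G\<^sup>C] = K[G]\<^sup>\<otimes>\<^sup>C\<close> with
  the tensor product of superalgebras (generators from different factors supercommute).
  It is used for \<open>K[G]\<close> (one factor) and for \<open>K[G] \<otimes> K[G]\<close> (two factors).

  In characteristic different from 2 supercommutativity forces odd elements to square to zero.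
\<close>

datatype ('c, 'm, 'n) gen =
    Entry 'c "('m, 'n) idx" "('m, 'n) idx"
  | Inv_entry 'c "('m, 'n) idx" "('m, 'n) idx"

fun odd_gen :: "('c, 'm, 'n) gen \<Rightarrow> bool" where
  "odd_gen (Entry _ i j) \<longleftrightarrow> odd_idx i \<noteq> odd_idx j"
| "odd_gen (Inv_entry _ i j) \<longleftrightarrow> odd_idx i \<noteq> odd_idx j"

definition ksign :: "bool \<Rightarrow> bool \<Rightarrow> 'a :: ring_1" where
  "ksign p q = (if p \<and> q then - 1 else 1)"

datatype ('k, 'g) expr =
    Const 'k
  | Gen 'g
  | Plus "('k, 'g) expr" "('k, 'g) expr"
  | Times "('k, 'g) expr" "('k, 'g) expr"

definition Sum_expr :: "('a \<Rightarrow> ('k :: zero, 'g) expr) \<Rightarrow> 'a list \<Rightarrow> ('k, 'g) expr" where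
  "Sum_expr f xs = foldr (\<lambda>x. Plus (f x)) xs (Const 0)"

inductive alg_eq ::
  "('k :: field, ('c, 'm :: {finite, linorder}, 'n :: {finite, linorder}) gen) expr \<Rightarrow>
   ('k, ('c, 'm, 'n) gen) expr \<Rightarrow> bool" where
  eq_refl: "alg_eq a a"
| eq_sym: "alg_eq a b \<Longrightarrow> alg_eq b a"
| eq_trans: "alg_eq a b \<Longrightarrow> alg_eq b c \<Longrightarrow> alg_eq a c"
| eq_plus_cong: "alg_eq a a' \<Longrightarrow> alg_eq b b' \<Longrightarrow> alg_eq (Plus a b) (Plus a' b')"
| eq_times_cong: "alg_eq a a' \<Longrightarrow> alg_eq b b' \<Longrightarrow> alg_eq (Times a b) (Times a' b')"
| eq_plus_assoc: "alg_eq (Plus (Plus a b) c) (Plus a (Plus b c))"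
| eq_plus_comm: "alg_eq (Plus a b) (Plus b a)"
| eq_plus_zero: "alg_eq (Plus (Const 0) a) a"
| eq_plus_minus: "alg_eq (Plus (Times (Const (- 1)) a) a) (Const 0)"
| eq_times_assoc: "alg_eq (Times (Times a b) c) (Times a (Times b c))"
| eq_times_one: "alg_eq (Times (Const 1) a) a"
| eq_distrib_left: "alg_eq (Times a (Plus b c)) (Plus (Times a b) (Times a c))"
| eq_distrib_right: "alg_eq (Times (Plus a b) c) (Plus (Times a c) (Times b c))"
| eq_const_plus: "alg_eq (Plus (Const r) (Const s)) (Const (r + s))"
| eq_const_times: "alg_eq (Times (Const r) (Const s)) (Const (r * s))"
| eq_const_central: "alg_eq (Times (Const r) a) (Times a (Const r))"
| eq_supercomm: "alg_eq (Times (Gen g) (Gen h))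
    (Times (Const (ksign (odd_gen g) (odd_gen h))) (Times (Gen h) (Gen g)))"
| eq_right_inverse: "alg_eq (Sum_expr (\<lambda>k. Times (Gen (Entry c i k)) (Gen (Inv_entry c k j))) all_idx)
    (Const (of_bool (i = j)))"
| eq_left_inverse: "alg_eq (Sum_expr (\<lambda>k. Times (Gen (Inv_entry c i k)) (Gen (Entry c k j))) all_idx)
    (Const (of_bool (i = j)))"

quotient_type (overloaded) ('c, 'k, 'm, 'n) coords =
  "('k :: field, ('c, 'm :: {finite, linorder}, 'n :: {finite, linorder}) gen) expr" / alg_eq
proof (rule equivpI)
  show "reflp (alg_eq :: ('k, ('c, 'm, 'n) gen) expr \<Rightarrow> _)" by (rule reflpI) (rule alg_eq.eq_refl)
  show "symp (alg_eq :: ('k, ('c, 'm, 'n) gen) expr \<Rightarrow> _)" by (rule sympI) (rule alg_eq.eq_sym)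
  show "transp (alg_eq :: ('k, ('c, 'm, 'n) gen) expr \<Rightarrow> _)" by (rule transpI) (rule alg_eq.eq_trans)
qed


subsection \<open>Evaluation at a matrix and its inverse\<close>

primrec eval_expr :: "('k \<Rightarrow> 'a :: ring_1) \<Rightarrow> ('g \<Rightarrow> 'a) \<Rightarrow> ('k, 'g) expr \<Rightarrow> 'a" where
  "eval_expr s \<phi> (Const r) = s r"
| "eval_expr s \<phi> (Gen g) = \<phi> g"
| "eval_expr s \<phi> (Plus a b) = eval_expr s \<phi> a + eval_expr s \<phi> b"
| "eval_expr s \<phi> (Times a b) = eval_expr s \<phi> a * eval_expr s \<phi> b"

definition admissible ::
  "('k :: field \<Rightarrow> 'a :: ring_1) \<Rightarrow>
   (('c, 'm :: {finite, linorder}, 'n :: {finite, linorder}) gen \<Rightarrow> 'a) \<Rightarrow> bool" where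
  "admissible s \<phi> \<longleftrightarrow>
     s 1 = 1 \<and> (\<forall>r t. s (r + t) = s r + s t) \<and> (\<forall>r t. s (r * t) = s r * s t) \<and>
     (\<forall>r a. s r * a = a * s r) \<and>
     (\<forall>g h. \<phi> g * \<phi> h = ksign (odd_gen g) (odd_gen h) * (\<phi> h * \<phi> g)) \<and>
     (\<forall>c i j. (\<Sum>k\<in>UNIV. \<phi> (Entry c i k) * \<phi> (Inv_entry c k j)) = of_bool (i = j)) \<and>
     (\<forall>c i j. (\<Sum>k\<in>UNIV. \<phi> (Inv_entry c i k) * \<phi> (Entry c k j)) = of_bool (i = j))"

lemma eval_Sum_expr: "s 0 = 0 \<Longrightarrow> eval_expr s \<phi> (Sum_expr f xs) = (\<Sum>x\<leftarrow>xs. eval_expr s \<phi> (f x))"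
  by (induction xs) (auto simp: Sum_expr_def)

lemma admissibleD:
  assumes "admissible s \<phi>"
  shows "s 0 = 0" "s 1 = 1" "s (- 1) = - 1" "s (r + t) = s r + s t" "s (r * t) = s r * s t"
    "s r * a = a * s r" "\<phi> g * \<phi> h = ksign (odd_gen g) (odd_gen h) * (\<phi> h * \<phi> g)"
    "(\<Sum>k\<in>UNIV. \<phi> (Entry c i k) * \<phi> (Inv_entry c k j)) = of_bool (i = j)"
    "(\<Sum>k\<in>UNIV. \<phi> (Inv_entry c i k) * \<phi> (Entry c k j)) = of_bool (i = j)"
proof -
  show 1: "s 1 = 1" and plus: "s (r + t) = s r + s t" for r t
    using assms unfolding admissible_def by blast+
  from plus[of 0 0] show 0: "s 0 = 0" by simp
  from plus[of "- 1" 1] show "s (- 1) = - 1" by (simp add: 0 1 eq_neg_iff_add_eq_0)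
  show "s (r * t) = s r * s t" "s r * a = a * s r"
    "\<phi> g * \<phi> h = ksign (odd_gen g) (odd_gen h) * (\<phi> h * \<phi> g)"
    "(\<Sum>k\<in>UNIV. \<phi> (Entry c i k) * \<phi> (Inv_entry c k j)) = of_bool (i = j)"
    "(\<Sum>k\<in>UNIV. \<phi> (Inv_entry c i k) * \<phi> (Entry c k j)) = of_bool (i = j)"
    using assms unfolding admissible_def by blast+
qed

lemma eval_alg_eq:
  assumes "admissible s \<phi>" "alg_eq a b"
  shows "eval_expr s \<phi> a = eval_expr s \<phi> b"
  using assms(2)
proof (induction rule: alg_eq.induct)
  case (eq_supercomm g h)
  have "s (ksign p q) = ksign p q" for p q
    by (simp add: ksign_def admissibleD(2,3)[OF assms(1)])
  then show ?case by (simp only: eval_expr.simps admissibleD(7)[OF assms(1), of g h])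
next
  case (eq_const_central r a)
  show ?case by (simp only: eval_expr.simps admissibleD(6)[OF assms(1)])
qed (simp_all add: admissibleD(1-5,8,9)[OF assms(1)] eval_Sum_expr sum_list_all_idx algebra_simps)

lemma of_bool_matrix_one:
  "(\<Sum>k\<in>UNIV. of_bool (i = k) * of_bool (k = j)) = (of_bool (i = j) :: 'a :: semiring_1)"
  for i j :: "'b :: finite"
  by (simp add: of_bool_def if_distrib[of "\<lambda>x. x * _"] cong: if_cong)

fun counit_gen :: "('c, 'm, 'n) gen \<Rightarrow> 'k :: field" where
  "counit_gen (Entry _ i j) = of_bool (i = j)"
| "counit_gen (Inv_entry _ i j) = of_bool (i = j)"

lemma counit_gen_odd: "odd_gen g \<Longrightarrow> counit_gen g = 0"
  by (cases g) auto

lemma admissible_counit: "admissible (\<lambda>r. r) counit_gen"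
  by (auto simp: admissible_def of_bool_matrix_one ksign_def mult.commute counit_gen_odd)

instantiation coords :: (type, field, "{finite, linorder}", "{finite, linorder}") ring_1
begin

lift_definition zero_coords :: "('a, 'b, 'c, 'd) coords" is "Const 0" .
lift_definition one_coords :: "('a, 'b, 'c, 'd) coords" is "Const 1" .
lift_definition plus_coords ::
  "('a, 'b, 'c, 'd) coords \<Rightarrow> ('a, 'b, 'c, 'd) coords \<Rightarrow> ('a, 'b, 'c, 'd) coords"
  is Plus by (rule alg_eq.eq_plus_cong)
lift_definition times_coords ::
  "('a, 'b, 'c, 'd) coords \<Rightarrow> ('a, 'b, 'c, 'd) coords \<Rightarrow> ('a, 'b, 'c, 'd) coords"
  is Times by (rule alg_eq.eq_times_cong)
lift_definition uminus_coords :: "('a, 'b, 'c, 'd) coords \<Rightarrow> ('a, 'b, 'c, 'd) coords"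
  is "Times (Const (- 1))" by (rule alg_eq.eq_times_cong[OF alg_eq.eq_refl])
definition minus_coords ::
  "('a, 'b, 'c, 'd) coords \<Rightarrow> ('a, 'b, 'c, 'd) coords \<Rightarrow> ('a, 'b, 'c, 'd) coords" where
  "minus_coords a b = a + - b"

instance
proof
  fix a b c :: "('a, 'b, 'c, 'd) coords"
  show "a + b + c = a + (b + c)" by transfer (rule alg_eq.eq_plus_assoc)
  show "a + b = b + a" by transfer (rule alg_eq.eq_plus_comm)
  show "0 + a = a" by transfer (rule alg_eq.eq_plus_zero)
  show "- a + a = 0" by transfer (rule alg_eq.eq_plus_minus)
  show "a - b = a + - b" by (rule minus_coords_def)
  show "a * b * c = a * (b * c)" by transfer (rule alg_eq.eq_times_assoc)
  show "1 * a = a" by transfer (rule alg_eq.eq_times_one)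
  show "a * 1 = a" by transfer (meson alg_eq.eq_const_central alg_eq.eq_times_one alg_eq.eq_sym alg_eq.eq_trans)
  show "(a + b) * c = a * c + b * c" by transfer (rule alg_eq.eq_distrib_right)
  show "a * (b + c) = a * b + a * c" by transfer (rule alg_eq.eq_distrib_left)
  show "(0 :: ('a, 'b, 'c, 'd) coords) \<noteq> 1"
  proof transfer
    show "\<not> alg_eq (Const 0 :: ('b, ('a, 'c, 'd) gen) expr) (Const 1)"
      using eval_alg_eq[OF admissible_counit, of "Const 0" "Const 1"] by fastforce
  qed
qed

end

lift_definition const :: "'k :: field \<Rightarrow> ('c, 'k, 'm :: {finite, linorder}, 'n :: {finite, linorder}) coords"
  is Const .
lift_definition gen ::
  "('c, 'm, 'n) gen \<Rightarrow> ('c, 'k :: field, 'm :: {finite, linorder}, 'n :: {finite, linorder}) coords"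
  is Gen .

text \<open>The unique algebra homomorphism extending an admissible assignment of the generators.\<close>

definition extend ::
  "('k :: field \<Rightarrow> 'a :: ring_1) \<Rightarrow>
   (('c, 'm :: {finite, linorder}, 'n :: {finite, linorder}) gen \<Rightarrow> 'a) \<Rightarrow>
   ('c, 'k, 'm, 'n) coords \<Rightarrow> 'a" where
  "extend s \<phi> f = eval_expr s \<phi> (rep_coords f)"

lemma extend_abs:
  assumes "admissible s \<phi>" shows "extend s \<phi> (abs_coords e) = eval_expr s \<phi> e"
  unfolding extend_def
  by (rule eval_alg_eq[OF assms])
     (rule Quotient3_rep_abs[OF Quotient3_coords alg_eq.eq_refl])

lemma extend_hom:
  assumes "admissible s \<phi>"
  shows "extend s \<phi> (gen g) = \<phi> g" "extend s \<phi> (const r) = s r"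
    "extend s \<phi> 0 = 0" "extend s \<phi> 1 = 1"
    "extend s \<phi> (a + b) = extend s \<phi> a + extend s \<phi> b"
    "extend s \<phi> (a * b) = extend s \<phi> a * extend s \<phi> b"
proof -
  note [simp] = extend_abs[OF assms] admissibleD(1,2)[OF assms]
  show "extend s \<phi> (gen g) = \<phi> g" by (simp add: gen.abs_eq)
  show "extend s \<phi> (const r) = s r" by (simp add: const.abs_eq)
  show "extend s \<phi> 0 = 0" by (simp add: zero_coords.abs_eq)
  show "extend s \<phi> 1 = 1" by (simp add: one_coords.abs_eq)
  show "extend s \<phi> (a + b) = extend s \<phi> a + extend s \<phi> b"
    by (induction a rule: coords.abs_induct, induction b rule: coords.abs_induct)
       (simp add: plus_coords.abs_eq)
  show "extend s \<phi> (a * b) = extend s \<phi> a * extend s \<phi> b"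
    by (induction a rule: coords.abs_induct, induction b rule: coords.abs_induct)
       (simp add: times_coords.abs_eq)
qed

lemma const_hom:
  "const 0 = 0" "const 1 = 1" "const (r + t) = const r + const t"
  "const (r * t) = const r * const t" "const r * a = a * const r"
  by (transfer, rule alg_eq.eq_refl alg_eq.eq_const_central alg_eq.eq_const_plus[THEN alg_eq.eq_sym]
      alg_eq.eq_const_times[THEN alg_eq.eq_sym])+

lemma const_minus_1: "const (- 1) = - 1"
  using const_hom(3)[of "- 1" 1] by (simp add: const_hom(1,2) eq_neg_iff_add_eq_0)

lemma abs_Sum_expr: "abs_coords (Sum_expr f xs) = (\<Sum>x\<leftarrow>xs. abs_coords (f x))"
  by (induction xs) (simp_all add: Sum_expr_def zero_coords.abs_eq flip: plus_coords.abs_eq)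

lemma gen_relations:
  "gen g * gen h = ksign (odd_gen g) (odd_gen h) * (gen h * gen g)"
  "(\<Sum>k\<in>UNIV. gen (Entry c i k) * gen (Inv_entry c k j)) = of_bool (i = j)"
  "(\<Sum>k\<in>UNIV. gen (Inv_entry c i k) * gen (Entry c k j)) = of_bool (i = j)"
proof -
  have "gen g * gen h = const (ksign (odd_gen g) (odd_gen h)) * (gen h * gen g)"
    by transfer (rule alg_eq.eq_supercomm)
  then show "gen g * gen h = ksign (odd_gen g) (odd_gen h) * (gen h * gen g)"
    by (cases "odd_gen g \<and> odd_gen h") (auto simp: ksign_def const_hom(2) const_minus_1)
  have *: "const (of_bool b) = of_bool b" for b
    by (simp add: const_hom)
  show "(\<Sum>k\<in>UNIV. gen (Entry c i k) * gen (Inv_entry c k j)) = of_bool (i = j)"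
    using alg_eq.eq_right_inverse[of c i j, THEN coords.abs_eq_iff[THEN iffD2]]
    by (simp add: abs_Sum_expr sum_list_all_idx * flip: gen.abs_eq times_coords.abs_eq const.abs_eq)
  show "(\<Sum>k\<in>UNIV. gen (Inv_entry c i k) * gen (Entry c k j)) = of_bool (i = j)"
    using alg_eq.eq_left_inverse[of c i j, THEN coords.abs_eq_iff[THEN iffD2]]
    by (simp add: abs_Sum_expr sum_list_all_idx * flip: gen.abs_eq times_coords.abs_eq const.abs_eq)
qed

definition scale :: "'k :: field \<Rightarrow> ('c, 'k, 'm :: {finite, linorder}, 'n :: {finite, linorder}) coords \<Rightarrow>
    ('c, 'k, 'm, 'n) coords" where
  "scale r f = const r * f"

global_interpretation coords: vector_space scale
  by unfold_locales (simp_all add: scale_def const_hom(1-4) algebra_simps)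

text \<open>Homogeneous components: \<open>True\<close> is the odd part.\<close>

definition part :: "bool \<Rightarrow> ('c, 'k :: field, 'm :: {finite, linorder}, 'n :: {finite, linorder}) coords set" where
  "part p = coords.span {prod_list (map gen gs) | gs. odd (length (filter odd_gen gs)) = p}"


section \<open>Hopf structure and supermodules\<close>

type_synonym ('k, 'm, 'n) KG = "(unit, 'k, 'm, 'n) coords"
type_synonym ('k, 'm, 'n) KGG = "(bool, 'k, 'm, 'n) coords"

definition counit :: "('k :: field, 'm :: {finite, linorder}, 'n :: {finite, linorder}) KG \<Rightarrow> 'k" where
  "counit = extend (\<lambda>r. r) counit_gen"

fun copy_gen :: "'c \<Rightarrow> (unit, 'm, 'n) gen \<Rightarrow>
    ('c, 'k :: field, 'm :: {finite, linorder}, 'n :: {finite, linorder}) coords" where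
  "copy_gen c (Entry _ i j) = gen (Entry c i j)"
| "copy_gen c (Inv_entry _ i j) = gen (Inv_entry c i j)"

lemma admissible_copy: "admissible const (copy_gen c)"
proof -
  have *: "copy_gen c g * copy_gen c h =
      ksign (odd_gen g) (odd_gen h) * (copy_gen c h * copy_gen c g)" for c g h
    by (cases g; cases h; simp; subst gen_relations(1); simp)
  show ?thesis
    unfolding admissible_def
    by (intro conjI allI) (rule * const_hom | simp add: gen_relations(2,3))+
qed

definition tensor :: "('k :: field, 'm :: {finite, linorder}, 'n :: {finite, linorder}) KG \<Rightarrow>
    ('k, 'm, 'n) KG \<Rightarrow> ('k, 'm, 'n) KGG" (infixl \<open>\<otimes>\<close> 70) where
  "a \<otimes> b = extend const (copy_gen False) a * extend const (copy_gen True) b"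

definition tensor_space :: "('k :: field, 'm :: {finite, linorder}, 'n :: {finite, linorder}) KG set \<Rightarrow>
    ('k, 'm, 'n) KG set \<Rightarrow> ('k, 'm, 'n) KGG set" (infixl \<open>\<otimes>\<^sub>s\<close> 70) where
  "A \<otimes>\<^sub>s B = coords.span {a \<otimes> b | a b. a \<in> A \<and> b \<in> B}"

text \<open>
  \<open>\<Delta> x\<^sub>i\<^sub>j = \<Sum>\<^sub>k x\<^sub>i\<^sub>k \<otimes> x\<^sub>k\<^sub>j\<close>. The second clause is forced by the first, since the inverse of a
  product of two matrices is the product of the inverses in the opposite order.
\<close>

fun comult_gen :: "(unit, 'm, 'n) gen \<Rightarrow>
    ('k :: field, 'm :: {finite, linorder}, 'n :: {finite, linorder}) KGG" where
  "comult_gen (Entry _ i j) = (\<Sum>k\<in>UNIV. gen (Entry False i k) * gen (Entry True k j))"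
| "comult_gen (Inv_entry _ i j) = (\<Sum>k\<in>UNIV. gen (Inv_entry True i k) * gen (Inv_entry False k j))"

lemma admissible_comult:
  "admissible const (comult_gen ::
    (unit, 'm, 'n) gen \<Rightarrow> ('k :: field, 'm :: {finite, linorder}, 'n :: {finite, linorder}) KGG)"
proof -
  define sc where "sc p q a b \<longleftrightarrow> a * b = ksign p q * (b * a)"
    for p q and a b :: "('k, 'm, 'n) KGG"
  have ksign_central: "ksign p q * a = a * ksign p q" for p q and a :: "('k, 'm, 'n) KGG"
    by (simp add: ksign_def)
  have gen: "sc (odd_gen g) (odd_gen h) (gen g) (gen h)" for g h
    unfolding sc_def by (rule gen_relations)
  have sc_sym: "sc q p b a" if "sc p q a b" for p q a b
    using that by (auto simp: sc_def ksign_def split: if_splits)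
  have sum: "sc p q (\<Sum>k\<in>A. f k) b" if "\<And>k. sc p q (f k) b"
    for p q b and f :: "('m, 'n) idx \<Rightarrow> _" and A
    using that by (simp add: sc_def sum_distrib_left sum_distrib_right)
  have mult: "sc (p \<noteq> p') q (a * a') b" if "sc p q a b" "sc p' q a' b" for p p' q a a' b
  proof -
    have "a * a' * b = ksign p' q * (a * b) * a'"
      using that(2) by (simp add: sc_def ksign_def mult.assoc split: if_splits)
    also have "\<dots> = (ksign p' q * ksign p q) * (b * (a * a'))"
      using that(1) by (simp add: sc_def ksign_def mult.assoc split: if_splits)
    also have "ksign p' q * ksign p q = (ksign (p \<noteq> p') q :: ('k, 'm, 'n) KGG)"
      by (simp add: ksign_def)
    finally show ?thesis by (simp add: sc_def)
  qed
  have mult_gen: "sc p q (gen g * gen h) b"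
    if "sc (odd_gen g) q (gen g) b" "sc (odd_gen h) q (gen h) b" "p = (odd_gen g \<noteq> odd_gen h)"
    for p q b and g h :: "(bool, 'm, 'n) gen"
    using mult[OF that(1,2)] that(3) by simp
  have left: "sc (odd_gen g) q (comult_gen g) b" if "\<And>h. sc (odd_gen h) q (gen h) b" for g q b
    by (cases g) (auto intro!: sum mult_gen that)
  have comm: "sc (odd_gen g) (odd_gen h) (comult_gen g) (comult_gen h)" for g h
    by (rule left) (rule sc_sym, rule left, rule gen)
  have triple: "(\<Sum>k\<in>UNIV. (\<Sum>a\<in>UNIV. P a * Q a k) * (\<Sum>b\<in>UNIV. R k b * S b)) =
      (\<Sum>a\<in>UNIV. \<Sum>b\<in>UNIV. P a * (\<Sum>k\<in>UNIV. Q a k * R k b) * S b)"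
    for P S :: "('m, 'n) idx \<Rightarrow> ('k, 'm, 'n) KGG" and Q R :: "('m, 'n) idx \<Rightarrow> ('m, 'n) idx \<Rightarrow> _"
  proof -
    have "(\<Sum>k\<in>UNIV. (\<Sum>a\<in>UNIV. P a * Q a k) * (\<Sum>b\<in>UNIV. R k b * S b)) =
        (\<Sum>k\<in>UNIV. \<Sum>a\<in>UNIV. \<Sum>b\<in>UNIV. P a * (Q a k * R k b) * S b)"
      by (simp add: sum_product mult.assoc)
    also have "\<dots> = (\<Sum>a\<in>UNIV. \<Sum>k\<in>UNIV. \<Sum>b\<in>UNIV. P a * (Q a k * R k b) * S b)"
      by (rule sum.swap)
    also have "\<dots> = (\<Sum>a\<in>UNIV. \<Sum>b\<in>UNIV. \<Sum>k\<in>UNIV. P a * (Q a k * R k b) * S b)"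
      by (rule sum.cong[OF refl], rule sum.swap)
    finally show ?thesis by (simp add: sum_distrib_left sum_distrib_right)
  qed
  have delta: "(\<Sum>a\<in>UNIV. \<Sum>b\<in>UNIV. P a * of_bool (a = b) * S b) = (\<Sum>a\<in>UNIV. P a * S a)"
    for P S :: "('m, 'n) idx \<Rightarrow> ('k, 'm, 'n) KGG"
    by (simp add: of_bool_def if_distrib[of "\<lambda>x. x * _"] if_distrib[of "\<lambda>x. _ * x"] cong: if_cong)
  have inv: "(\<Sum>k\<in>UNIV. comult_gen (Entry c i k) * comult_gen (Inv_entry c k j)) =
      (of_bool (i = j) :: ('k, 'm, 'n) KGG)"
    "(\<Sum>k\<in>UNIV. comult_gen (Inv_entry c i k) * comult_gen (Entry c k j)) =
      (of_bool (i = j) :: ('k, 'm, 'n) KGG)"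
    for c :: unit and i j :: "('m, 'n) idx"
    unfolding comult_gen.simps by (subst triple, simp only: gen_relations(2,3) delta)+
  show ?thesis
    unfolding admissible_def
  proof (intro conjI allI)
    fix g h :: "(unit, 'm, 'n) gen"
    show "comult_gen g * comult_gen h =
        (ksign (odd_gen g) (odd_gen h) * (comult_gen h * comult_gen g) :: ('k, 'm, 'n) KGG)"
      using comm[of g h] by (simp only: sc_def)
  qed (rule const_hom inv)+
qed

definition comult :: "('k :: field, 'm :: {finite, linorder}, 'n :: {finite, linorder}) KG \<Rightarrow>
    ('k, 'm, 'n) KGG" (\<open>\<Delta>\<close>) where
  "\<Delta> = extend const comult_gen"

lemmas counit_hom = extend_hom[OF admissible_counit, folded counit_def]
lemmas comult_hom = extend_hom[OF admissible_comult, folded comult_def]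

text \<open>Subsupermodules of \<open>(K[G], \<rho>\<^sub>r)\<close>: graded subspaces \<open>M\<close> with \<open>\<Delta> M \<subseteq> M \<otimes> K[G]\<close>.\<close>

definition subsupermodule :: "('k :: field, 'm :: {finite, linorder}, 'n :: {finite, linorder}) KG set \<Rightarrow> bool" where
  "subsupermodule M \<longleftrightarrow>
     coords.subspace M \<and>
     (\<forall>f\<in>M. \<exists>f\<^sub>0\<in>M \<inter> part False. \<exists>f\<^sub>1\<in>M \<inter> part True. f = f\<^sub>0 + f\<^sub>1) \<and>
     (\<forall>f\<in>M. \<Delta> f \<in> M \<otimes>\<^sub>s UNIV)"

text \<open>
  \<open>supermodule_hom d N L \<phi>\<close>: \<open>\<phi>\<close> is a homomorphism of supercomodules from \<open>N\<close> to \<open>L\<close> (\<open>d = False\<close>)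
  or to \<open>\<Pi>L\<close> (\<open>d = True\<close>). The last conjunct says \<open>(\<phi> \<otimes> id) \<circ> \<Delta> = \<Delta> \<circ> \<phi>\<close> on \<open>N\<close>.
\<close>

definition supermodule_hom :: "bool \<Rightarrow>
    ('k :: field, 'm :: {finite, linorder}, 'n :: {finite, linorder}) KG set \<Rightarrow> ('k, 'm, 'n) KG set \<Rightarrow>
    (('k, 'm, 'n) KG \<Rightarrow> ('k, 'm, 'n) KG) \<Rightarrow> bool" where
  "supermodule_hom d N L \<phi> \<longleftrightarrow>
     \<phi> ` N \<subseteq> L \<and>
     (\<forall>f\<in>N. \<forall>g\<in>N. \<phi> (f + g) = \<phi> f + \<phi> g) \<and>
     (\<forall>r. \<forall>f\<in>N. \<phi> (scale r f) = scale r (\<phi> f)) \<and>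
     (\<forall>p. \<phi> ` (N \<inter> part p) \<subseteq> part (p \<noteq> d)) \<and>
     (\<forall>f\<in>N. \<forall>ts. fst ` set ts \<subseteq> N \<and> \<Delta> f = (\<Sum>(a, b)\<leftarrow>ts. a \<otimes> b) \<longrightarrow>
        \<Delta> (\<phi> f) = (\<Sum>(a, b)\<leftarrow>ts. \<phi> a \<otimes> b))"

text \<open>\<open>N\<^sub>1 / N\<^sub>2\<close> is isomorphic to \<open>L\<close> or to \<open>\<Pi>L\<close>; a quotient is handled through its projection.\<close>

definition quotient_iso :: "('k :: field, 'm :: {finite, linorder}, 'n :: {finite, linorder}) KG set \<Rightarrow>
    ('k, 'm, 'n) KG set \<Rightarrow> ('k, 'm, 'n) KG set \<Rightarrow> bool" where
  "quotient_iso N\<^sub>1 N\<^sub>2 L \<longleftrightarrow>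
     (\<exists>d \<phi>. supermodule_hom d N\<^sub>1 L \<phi> \<and> \<phi> ` N\<^sub>1 = L \<and> {f \<in> N\<^sub>1. \<phi> f = 0} = N\<^sub>2)"

definition irreducible_quotient :: "('k :: field, 'm :: {finite, linorder}, 'n :: {finite, linorder}) KG set \<Rightarrow>
    ('k, 'm, 'n) KG set \<Rightarrow> bool" where
  "irreducible_quotient N\<^sub>1 N\<^sub>2 \<longleftrightarrow>
     subsupermodule N\<^sub>1 \<and> subsupermodule N\<^sub>2 \<and> N\<^sub>2 \<subset> N\<^sub>1 \<and>
     (\<forall>N. subsupermodule N \<and> N\<^sub>2 \<subseteq> N \<and> N \<subseteq> N\<^sub>1 \<longrightarrow> N = N\<^sub>2 \<or> N = N\<^sub>1)"

definition socle :: "('k :: field, 'm :: {finite, linorder}, 'n :: {finite, linorder}) KG set \<Rightarrow>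
    ('k, 'm, 'n) KG set" where
  "socle M = coords.span (\<Union>{N. N \<subseteq> M \<and> irreducible_quotient N {0}})"


section \<open>Weights and the supermodules \<open>L\<^sub>-(\<nu>)\<close>\<close>

type_synonym ('m, 'n) weight = "('m, 'n) idx \<Rightarrow> int"

definition unit_wt :: "('m, 'n) idx \<Rightarrow> ('m, 'n) weight" where
  "unit_wt i = (\<lambda>k. of_bool (k = i))"

definition wt_degree :: "('m :: finite, 'n :: finite) weight \<Rightarrow> int" where
  "wt_degree \<nu> = (\<Sum>i\<in>UNIV. \<nu> i)"

definition dominant_weights :: "('m :: linorder, 'n :: linorder) weight set" where
  "dominant_weights =
     {\<nu>. (\<forall>i j. i \<le> j \<longrightarrow> \<nu> (Ev j) \<le> \<nu> (Ev i)) \<and> (\<forall>i j. i \<le> j \<longrightarrow> \<nu> (Od j) \<le> \<nu> (Od i))}"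

definition dominated :: "('m :: {finite, linorder}, 'n :: {finite, linorder}) weight \<Rightarrow>
    ('m, 'n) weight \<Rightarrow> bool" (infix \<open>\<unlhd>\<close> 50) where
  "\<mu> \<unlhd> \<nu> \<longleftrightarrow> (\<exists>c :: _ \<Rightarrow> _ \<Rightarrow> nat. \<forall>k.
     \<nu> k - \<mu> k = (\<Sum>(i, j)\<in>{(i, j). i < j}. int (c i j) * (unit_wt i k - unit_wt j k)))"

definition weight_ideal :: "('m :: {finite, linorder}, 'n :: {finite, linorder}) weight set \<Rightarrow> bool" where
  "weight_ideal \<Gamma> \<longleftrightarrow>
     \<Gamma> \<subseteq> dominant_weights \<and> (\<forall>\<nu>\<in>\<Gamma>. \<forall>\<mu>\<in>dominant_weights. \<mu> \<unlhd> \<nu> \<longrightarrow> \<mu> \<in> \<Gamma>)"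

definition degree_set :: "('m :: finite, 'n :: finite) weight set \<Rightarrow> int set" where
  "degree_set \<Gamma> = {l. \<exists>\<nu>\<in>\<Gamma>. wt_degree \<nu> = l}"

definition borel_ideal :: "('k :: field, 'm :: {finite, linorder}, 'n :: {finite, linorder}) KG set" where
  "borel_ideal = coords.span {a * gen (Entry () i j) * b | a b i j. i < j}"

text \<open>
  A representative in \<open>K[G]\<close> of the character \<open>\<nu>\<close> of \<open>B\<^sup>-\<close>: modulo the ideal of \<open>B\<^sup>-\<close> the
  matrices \<open>(x\<^sub>i\<^sub>j)\<close> and \<open>(y\<^sub>i\<^sub>j)\<close> are lower triangular, so that \<open>y\<^sub>i\<^sub>i\<close> is inverse to \<open>x\<^sub>i\<^sub>i\<close>.
\<close>

definition borel_character :: "('m, 'n) weight \<Rightarrow>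
    ('k :: field, 'm :: {finite, linorder}, 'n :: {finite, linorder}) KG" where
  "borel_character \<nu> =
     (\<Prod>i\<leftarrow>all_idx. gen (Entry () i i) ^ nat (\<nu> i) * gen (Inv_entry () i i) ^ nat (- \<nu> i))"

text \<open>
  The induced supermodule is the cotensor product \<open>K\<^sub>\<nu> \<box>\<^bsub>K[B\<^sup>-]\<^esub> K[G]\<close>, which consists of the
  \<open>f \<in> K[G]\<close> with \<open>\<Delta> f = \<nu> \<otimes> f\<close> in \<open>K[B\<^sup>-] \<otimes> K[G]\<close>.
\<close>

definition H_minus :: "('m, 'n) weight \<Rightarrow>
    ('k :: field, 'm :: {finite, linorder}, 'n :: {finite, linorder}) KG set" where
  "H_minus \<nu> = {f. \<Delta> f - borel_character \<nu> \<otimes> f \<in> borel_ideal \<otimes>\<^sub>s UNIV}"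

definition L_minus :: "('m, 'n) weight \<Rightarrow>
    ('k :: field, 'm :: {finite, linorder}, 'n :: {finite, linorder}) KG set" where
  "L_minus \<nu> = socle (H_minus \<nu>)"

definition belongs_to :: "('m, 'n) weight set \<Rightarrow>
    ('k :: field, 'm :: {finite, linorder}, 'n :: {finite, linorder}) KG set \<Rightarrow> bool" where
  "belongs_to \<Gamma> M \<longleftrightarrow> subsupermodule M \<and>
     (\<forall>N\<^sub>1 N\<^sub>2. N\<^sub>1 \<subseteq> M \<and> irreducible_quotient N\<^sub>1 N\<^sub>2 \<longrightarrow> (\<exists>\<nu>\<in>\<Gamma>. quotient_iso N\<^sub>1 N\<^sub>2 (L_minus \<nu>)))"

definition C_sub :: "('m, 'n) weight set \<Rightarrow>
    ('k :: field, 'm :: {finite, linorder}, 'n :: {finite, linorder}) KG set" where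
  "C_sub \<Gamma> = (GREATEST M. belongs_to \<Gamma> M)"


section \<open>Distributions\<close>

definition ideal_power :: "('k :: field \<Rightarrow> 'a \<Rightarrow> 'a) \<Rightarrow> 'a set \<Rightarrow> nat \<Rightarrow> ('a :: ring_1) set" where
  "ideal_power s I t = module.span s {prod_list as | as. length as = t \<and> set as \<subseteq> I}"

definition distributions :: "('k :: field \<Rightarrow> 'a \<Rightarrow> 'a) \<Rightarrow> ('a :: ring_1 \<Rightarrow> 'k) \<Rightarrow> ('a \<Rightarrow> 'k) set" where
  "distributions s e = {\<xi>. Vector_Spaces.linear s (*) \<xi> \<and>
     (\<exists>t. \<forall>a\<in>ideal_power s {a. e a = 0} (t + 1). \<xi> a = 0)}"

definition Dist_G :: "(('k :: field, 'm :: {finite, linorder}, 'n :: {finite, linorder}) KG \<Rightarrow> 'k) set" where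
  "Dist_G = distributions scale counit"

definition pi_map :: "('m, 'n) weight set \<Rightarrow>
    (('k :: field, 'm :: {finite, linorder}, 'n :: {finite, linorder}) KG \<Rightarrow> 'k) \<Rightarrow>
    ('k, 'm, 'n) KG \<Rightarrow> 'k" where
  "pi_map \<Gamma> \<xi> = restrict \<xi> (C_sub \<Gamma>)"

definition ker_pi :: "('m, 'n) weight set \<Rightarrow>
    (('k :: field, 'm :: {finite, linorder}, 'n :: {finite, linorder}) KG \<Rightarrow> 'k) set" where
  "ker_pi \<Gamma> = {\<xi> \<in> Dist_G. \<forall>f\<in>C_sub \<Gamma>. pi_map \<Gamma> \<xi> f = 0}"


subsection \<open>Distributions on the torus\<close>

text \<open>
  \<open>K[T]\<close> is the algebra of Laurent polynomials, i.e. the group algebra of \<open>X(T)\<close>; the character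
  \<open>t\<^sup>\<mu>\<close> is \<open>single \<mu> 1\<close>, and \<open>\<Delta>\<^sub>T t\<^sup>\<mu> = t\<^sup>\<mu> \<otimes> t\<^sup>\<mu>\<close>.
\<close>

type_synonym ('k, 'm, 'n) KT = "('m, 'n) weight \<Rightarrow>\<^sub>0 'k"

definition scale_T :: "'k :: field \<Rightarrow> ('k, 'm, 'n) KT \<Rightarrow> ('k, 'm, 'n) KT" where
  "scale_T r f = Poly_Mapping.single 0 r * f"

global_interpretation KT: vector_space scale_T
proof
  fix r t :: 'a and f g :: "('a, 'b, 'c) KT"
  have "Poly_Mapping.single 0 (r * t) =
      Poly_Mapping.single 0 r * (Poly_Mapping.single 0 t :: ('a, 'b, 'c) KT)"
    by (simp add: mult_single)
  then show "scale_T r (scale_T t f) = scale_T (r * t) f"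
    by (simp add: scale_T_def mult.assoc)
qed (simp_all add: scale_T_def single_add algebra_simps)

fun res_gen :: "(unit, 'm, 'n) gen \<Rightarrow> ('k :: field, 'm, 'n) KT" where
  "res_gen (Entry _ i j) = (if i = j then Poly_Mapping.single (unit_wt i) 1 else 0)"
| "res_gen (Inv_entry _ i j) = (if i = j then Poly_Mapping.single (- unit_wt i) 1 else 0)"

lemma res_gen_odd: "odd_gen g \<Longrightarrow> res_gen g = 0"
  by (cases g) auto

lemma admissible_res: "admissible (Poly_Mapping.single 0) res_gen"
proof -
  have "(\<Sum>k\<in>UNIV. res_gen (Entry c i k) * res_gen (Inv_entry c k j)) = (of_bool (i = j) :: ('k :: field, 'm, 'n) KT)"
    "(\<Sum>k\<in>UNIV. res_gen (Inv_entry c i k) * res_gen (Entry c k j)) = (of_bool (i = j) :: ('k, 'm, 'n) KT)"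
    for c :: unit and i j :: "('m :: finite, 'n :: finite) idx"
    by (simp_all add: mult_single if_distrib[of "\<lambda>x. x * _"] cong: if_cong)
  moreover have "res_gen g * res_gen h =
      ksign (odd_gen g) (odd_gen h) * (res_gen h * res_gen g)" for g h
    by (cases "odd_gen g \<and> odd_gen h") (auto simp: ksign_def res_gen_odd)
  ultimately show ?thesis
    unfolding admissible_def
    by (intro conjI allI) (simp_all only: single_one single_add mult_single add_0 mult.commute)
qed

definition res_T :: "('k :: field, 'm :: {finite, linorder}, 'n :: {finite, linorder}) KG \<Rightarrow>
    ('k, 'm, 'n) KT" where
  "res_T = extend (Poly_Mapping.single 0) res_gen"

lemmas res_T_hom = extend_hom[OF admissible_res, folded res_T_def]

definition on_characters :: "(('m, 'n) weight \<Rightarrow> 'k :: field) \<Rightarrow> ('k, 'm, 'n) KT \<Rightarrow> 'k" where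
  "on_characters c f = (\<Sum>\<mu>\<in>Poly_Mapping.keys f. Poly_Mapping.lookup f \<mu> * c \<mu>)"

definition counit_T :: "('k :: field, 'm, 'n) KT \<Rightarrow> 'k" where
  "counit_T = on_characters (\<lambda>_. 1)"

text \<open>\<open>Dist(T)\<close>, embedded into \<open>Dist(G)\<close> along \<open>K[G] \<rightarrow> K[T]\<close>.\<close>

definition Dist_T :: "(('k :: field, 'm :: {finite, linorder}, 'n :: {finite, linorder}) KG \<Rightarrow> 'k) set" where
  "Dist_T = {\<xi> \<circ> res_T | \<xi>. \<xi> \<in> distributions scale_T counit_T}"

text \<open>The product of \<open>Dist(T)\<close>, i.e. \<open>(\<xi> \<otimes> \<eta>) \<circ> \<Delta>\<^sub>T\<close>; its unit is \<^term>\<open>counit_T\<close>.\<close>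

definition conv_T :: "(('k :: field, 'm, 'n) KT \<Rightarrow> 'k) \<Rightarrow> (('k, 'm, 'n) KT \<Rightarrow> 'k) \<Rightarrow>
    ('k, 'm, 'n) KT \<Rightarrow> 'k" where
  "conv_T \<xi> \<eta> = on_characters (\<lambda>\<mu>. \<xi> (Poly_Mapping.single \<mu> 1) * \<eta> (Poly_Mapping.single \<mu> 1))"

text \<open>The division is exact; this is \<^const>\<open>gbinomial\<close> on integers.\<close>

definition int_binom :: "int \<Rightarrow> nat \<Rightarrow> int" where
  "int_binom a s = (\<Prod>i = 0..<s. a - int i) div fact s"

lemma fact_times_int_binom: "fact s * int_binom a s = (\<Prod>i = 0..<s. a - int i)"
  using gbinomial_int_mult_fact[of s a] unfolding gbinomial_prod_rev int_binom_def by simp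

lemma int_binom_Suc: "int (Suc s) * int_binom a (Suc s) = int_binom a s * (a - int s)"
proof -
  have "fact s * (int (Suc s) * int_binom a (Suc s)) = fact (Suc s) * int_binom a (Suc s)"
    by (simp add: algebra_simps)
  also have "\<dots> = fact s * (int_binom a s * (a - int s))"
    by (simp only: fact_times_int_binom prod.atLeast0_lessThan_Suc flip: mult.assoc)
  finally show ?thesis by simp
qed

text \<open>
  \<open>e\<^sub>i\<close> is the derivation at the unit element with \<open>e\<^sub>i(t\<^sub>j) = \<delta>\<^sub>i\<^sub>j\<close>, so \<open>e\<^sub>i(t\<^sup>\<mu>) = \<mu>\<^sub>i\<close>. Over the
  rationals \<open>e\<^sub>i (e\<^sub>i - 1) ... (e\<^sub>i - s + 1) / s!\<close> therefore takes the integral value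
  \<open>int_binom \<mu>\<^sub>i s\<close> on \<open>t\<^sup>\<mu>\<close>, and its image over \<open>K\<close> takes the residue of that value.
\<close>

definition e_binom :: "('m, 'n) idx \<Rightarrow> nat \<Rightarrow> ('k :: field, 'm, 'n) KT \<Rightarrow> 'k" where
  "e_binom i s = on_characters (\<lambda>\<mu>. of_int (int_binom (\<mu> i) s))"

lemma on_characters_single [simp]: "on_characters c (Poly_Mapping.single \<mu> 1) = c \<mu>"
  by (simp add: on_characters_def)

lemma e_binom_0: "e_binom i 0 = counit_T"
  by (simp add: e_binom_def counit_T_def int_binom_def)

lemma e_binom_Suc:
  fixes f :: "('k :: field, 'm, 'n) KT"
  shows "of_nat (Suc s) * e_binom i (Suc s) f =
    conv_T (e_binom i s) (\<lambda>g. e_binom i 1 g - of_nat s * counit_T g) f"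
proof -
  have *: "of_nat (Suc s) * (r * of_int (int_binom a (Suc s))) =
      r * (of_int (int_binom a s) * (of_int a - of_nat s) :: 'k)" for a r
    using arg_cong[OF int_binom_Suc[of s a], of "of_int :: int \<Rightarrow> 'k"]
    by (simp only: of_int_mult of_int_diff of_int_of_nat_eq mult.left_commute[of _ r])
  have "int_binom a 1 = a" for a by (simp add: int_binom_def)
  then show ?thesis
    unfolding e_binom_def conv_T_def counit_T_def on_characters_single
    by (simp only: on_characters_def sum_distrib_left * mult_1_right)
qed

definition h_T :: "nat \<Rightarrow> nat \<Rightarrow> ('m, 'n) idx \<Rightarrow> ('k :: field, 'm, 'n) KT \<Rightarrow> 'k" where
  "h_T q t i = (\<lambda>f. \<Sum>k\<in>{t..q - 1}. (- 1) ^ (k - t) * of_nat (k choose t) * e_binom i k f)"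

definition h_elem :: "nat \<Rightarrow> (('m, 'n) idx \<Rightarrow> nat) \<Rightarrow>
    ('k :: field, 'm :: {finite, linorder}, 'n :: {finite, linorder}) KG \<Rightarrow> 'k" where
  "h_elem q \<alpha> = foldr (\<lambda>i. conv_T (h_T q (\<alpha> i) i)) all_idx counit_T \<circ> res_T"

definition scale_fun :: "'k :: field \<Rightarrow> ('a \<Rightarrow> 'k) \<Rightarrow> 'a \<Rightarrow> 'k" where
  "scale_fun r \<xi> = (\<lambda>a. r * \<xi> a)"

global_interpretation functionals: vector_space scale_fun
  by unfold_locales (simp_all add: scale_fun_def fun_eq_iff algebra_simps)

end

theory Submission
  imports "HOL-Analysis.Determinants" "HOL-Computational_Algebra.Formal_Power_Series" Defs
begin

text \<open>
  An element of \<open>Dist(T)\<close> is determined by its values on the characters \<open>t\<^sup>\<mu>\<close>. Since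
  \<open>(t\<^sup>\<mu> - 1)\<^sup>q = t\<^bsup>q \<mu>\<^esup> - 1\<close> for \<open>q = p\<^sup>r\<close>, the elements of \<open>Dist(T)\<close> are the functionals for which
  these values depend only on \<open>\<mu>\<close> modulo some \<open>q\<close>, and \<open>h\<^sub>\<alpha>(e)\<close> is the indicator function of the class
  of \<open>\<alpha>\<close>. Scalar matrices are central, so a character occurring in the restriction of \<open>C\<^sub>\<Gamma>\<close> to \<open>T\<close>
  has the degree of some weight in \<open>\<Gamma>\<close>; hence the listed elements kill \<open>C\<^sub>\<Gamma>\<close>.

  Conversely, for \<open>\<nu> \<in> \<Gamma>\<close> the highest weight vector of \<open>L\<^sub>-(\<nu>) \<subseteq> C\<^sub>\<Gamma>\<close> restricts to \<open>t\<^sup>\<nu>\<close>, so an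
  element of the kernel vanishes on the class of \<open>\<nu>\<close>. Every class \<open>\<alpha>\<close> with \<open>|\<alpha>| \<equiv> |\<kappa>|\<close> modulo \<open>q\<close> for
  some \<open>\<kappa> \<in> \<Gamma>\<close> contains such a \<open>\<nu>\<close>: moving weight from even to odd coordinates leads from \<open>\<kappa>\<close> to a
  dominant \<open>\<nu> \<unlhd> \<kappa>\<close> with prescribed residues.

  This uses that \<open>L\<^sub>-(\<nu>)\<close> is simple. A product of minors is a nonzero element of \<open>H\<^sup>0\<^sub>-(\<nu>)\<close>; a vector
  of highest weight in \<open>H\<^sup>0\<^sub>-(\<nu>)\<close> that vanishes at the unit element vanishes on the big cell and
  therefore is zero, where the density of the big cell is replaced by the triangular factorisation of
  \<open>1 + X Z\<close> over formal power series.
\<close>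

text \<open>\<open>K[G]\<close> is given by generators and relations, without a basis or normal
  forms, so non-vanishing has to be detected by maps constructed on it. This already concerns tensor
  products: nothing in the presentation says that the algebra with two factors behaves like a tensor
  product of vector spaces. What is needed of this is the contraction
  \<open>id \<otimes> \<psi>\<close> for every linear functional \<open>\<psi>\<close>. Once it
  exists, supercomodules are treated as modules over the linear functionals and the grading as an
  involution; subsupermodules are the subspaces stable under both.

  That 2 is invertible enters twice: it splits elements into eigenvectors of the involution, and it
  makes odd generators square to zero, so that an even element that is a unit modulo odd elements is
  a unit.

  Torus weights take values in an arbitrary abelian group, so that one construction serves the
  characters of \<open>T\<close>, the total degree, and a one-parameter subgroup that separates the
  indices.\<close>

hide_const (open) real_vector.scale

section \<open>Homomorphisms out of coordinate superalgebras\<close>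

lemma abs_coords_induct_aux:
  assumes "\<And>r. P (const r)" "\<And>g. P (gen g)"
    "\<And>a b. P a \<Longrightarrow> P b \<Longrightarrow> P (a + b)" "\<And>a b. P a \<Longrightarrow> P b \<Longrightarrow> P (a * b)"
  shows "P (abs_coords e)"
proof (induction e)
  case (Const r)
  then show ?case using assms(1)[of r] by (simp add: const.abs_eq)
next
  case (Gen g)
  then show ?case using assms(2)[of g] by (simp add: gen.abs_eq)
next
  case (Plus a b)
  then show ?case using assms(3)[OF Plus] by (simp add: plus_coords.abs_eq)
next
  case (Times a b)
  then show ?case using assms(4)[OF Times] by (simp add: times_coords.abs_eq)
qed

lemma coords_induct [case_names const gen plus times, induct type: coords]:
  assumes "\<And>r. P (const r)" "\<And>g. P (gen g)"
    "\<And>a b. P a \<Longrightarrow> P b \<Longrightarrow> P (a + b)" "\<And>a b. P a \<Longrightarrow> P b \<Longrightarrow> P (a * b)"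
  shows "P f"
  by (induction f rule: coords.abs_induct) (rule abs_coords_induct_aux[of P, OF assms])

definition alg_hom :: "('k :: field \<Rightarrow> 'a :: ring_1) \<Rightarrow>
    (('c, 'k, 'm :: {finite, linorder}, 'n :: {finite, linorder}) coords \<Rightarrow> 'a) \<Rightarrow> bool" where
  "alg_hom s f \<longleftrightarrow> (\<forall>a b. f (a + b) = f a + f b) \<and> (\<forall>a b. f (a * b) = f a * f b) \<and>
     (\<forall>r. f (const r) = s r)"

lemma alg_homD:
  assumes "alg_hom s f"
  shows "f (a + b) = f a + f b" "f (a * b) = f a * f b" "f (const r) = s r" "f 0 = 0"
    "f (- a) = - f a" "f (a - b) = f a - f b" "f (sum h A) = (\<Sum>x\<in>A. f (h x))"
    "f (scale r a) = s r * f a" "f 1 = s 1" "s 0 = 0"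
proof -
  show add: "f (a + b) = f a + f b" for a b
    using assms by (auto simp: alg_hom_def)
  show "f (a * b) = f a * f b" "f (const r) = s r"
    using assms by (auto simp: alg_hom_def)
  show 0: "f 0 = 0" using add[of 0 0] by simp
  show minus: "f (- a) = - f a" for a
    using add[of a "- a"] by (simp add: 0 minus_unique)
  show "f (a - b) = f a - f b" using add[of a "- b"] by (simp add: minus)
  show "f (sum h A) = (\<Sum>x\<in>A. f (h x))"
    by (induction A rule: infinite_finite_induct) (simp_all add: 0 add)
  show "f (scale r a) = s r * f a" using assms by (simp add: alg_hom_def scale_def)
  show "f 1 = s 1" using assms by (metis alg_hom_def const_hom(2))
  show "s 0 = 0" using assms 0 by (metis alg_hom_def const_hom(1))
qed

lemma alg_hom_extend: "admissible s \<phi> \<Longrightarrow> alg_hom s (extend s \<phi>)"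
  by (simp add: alg_hom_def extend_hom)

lemma alg_hom_id: "alg_hom const (\<lambda>x. x)"
  by (simp add: alg_hom_def)

lemma alg_hom_comp: "alg_hom const f \<Longrightarrow> alg_hom s g \<Longrightarrow> alg_hom s (\<lambda>x. g (f x))"
  by (simp add: alg_hom_def)

text \<open>Uniqueness in the universal property. Most identities on \<open>K[G]\<close> below are
  proved by recognising both sides as homomorphisms, which leaves a check on generators.\<close>

lemma alg_hom_eqI:
  assumes "alg_hom s f" "alg_hom s g" "\<And>x. f (gen x) = g (gen x)"
  shows "f x = g x"
  by (induction x) (simp_all add: alg_homD(1-3)[OF assms(1)] alg_homD(1-3)[OF assms(2)] assms(3))

lemma scale_one_const: "scale r 1 = const r"
  by (simp add: scale_def)

lemma scale_times: "scale r a * b = scale r (a * b)" "a * scale r b = scale r (a * b)"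
proof -
  show "scale r a * b = scale r (a * b)" by (simp add: scale_def mult.assoc)
  show "a * scale r b = scale r (a * b)"
    unfolding scale_def by (metis const_hom(5) mult.assoc)
qed

lemma scale_minus_one: "scale (- 1) a = - a"
  by (simp add: scale_def const_minus_1)


section \<open>Parities\<close>

lemma parity_mult_prod_list:
  "a \<in> {prod_list (map gen gs) | gs. odd (length (filter odd_gen gs)) = p} \<Longrightarrow>
   b \<in> {prod_list (map gen gs) | gs. odd (length (filter odd_gen gs)) = q} \<Longrightarrow>
   a * b \<in> {prod_list (map gen gs) | gs. odd (length (filter odd_gen gs)) = (p \<noteq> q)}"
proof clarsimp
  fix gs hs
  show "\<exists>gsa. prod_list (map gen gs) * prod_list (map gen hs) = prod_list (map gen gsa) \<and>
    odd (length (filter odd_gen gsa)) =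
    (odd (length (filter odd_gen gs)) = even (length (filter odd_gen hs)))"
    by (rule exI[of _ "gs @ hs"]) auto
qed

lemma span_mult:
  assumes "a \<in> coords.span S" "b \<in> coords.span S'"
    and "\<And>x y. x \<in> S \<Longrightarrow> y \<in> S' \<Longrightarrow> x * y \<in> coords.span S''"
  shows "a * b \<in> coords.span S''"
proof -
  have *: "x * b \<in> coords.span S''" if "x \<in> S" for x
    using assms(2)
  proof (induction rule: coords.span_induct_alt)
    case base
    then show ?case by (simp add: coords.span_zero)
  next
    case (step c y z)
    then show ?case
      by (simp add: distrib_left scale_times coords.span_add coords.span_scale assms(3)[OF that])
  qed
  show ?thesis using assms(1)
  proof (induction rule: coords.span_induct_alt)
    case base
    then show ?case by (simp add: coords.span_zero)
  next
    case (step c y z)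
    then show ?case by (simp add: distrib_right scale_times coords.span_add coords.span_scale *)
  qed
qed

lemma part_mult: "a \<in> part p \<Longrightarrow> b \<in> part q \<Longrightarrow> a * b \<in> part (p \<noteq> q)"
  unfolding part_def by (erule (1) span_mult) (rule coords.span_base, rule parity_mult_prod_list)

lemma part_subspace: "coords.subspace (part p)"
  unfolding part_def by (rule coords.subspace_span)

lemmas part_closed =
  coords.subspace_add[OF part_subspace] coords.subspace_scale[OF part_subspace]
  coords.subspace_diff[OF part_subspace] coords.subspace_sum[OF part_subspace]
  coords.subspace_0[OF part_subspace] coords.subspace_neg[OF part_subspace]

lemma gen_in_part: "gen g \<in> part (odd_gen g)"
  unfolding part_def
  by (rule coords.span_base, rule CollectI, rule exI[of _ "[g]"]) (cases "odd_gen g"; simp)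

lemma one_in_part: "1 \<in> part False"
  unfolding part_def by (rule coords.span_base, rule CollectI, rule exI[of _ "[]"]) simp

lemma const_in_part: "const r \<in> part False"
  using part_closed(2)[OF one_in_part, of r] by (simp add: scale_one_const)

lemma ksign_simps [simp]: "ksign p False = 1" "ksign False p = 1"
  by (auto simp: ksign_def)

lemma ksign_ksign [simp]: "ksign p q * (ksign p q * a) = a"
  by (simp add: ksign_def)

lemma ksign_commute: "ksign p q = ksign q p"
  by (auto simp: ksign_def)

text \<open>The parities are labels of the relation and not attributes of the elements, so
  supercommutation makes sense in rings without a grading, such as the endomorphism rings used
  below.\<close>

definition sc :: "bool \<Rightarrow> bool \<Rightarrow> 'a :: ring_1 \<Rightarrow> 'a \<Rightarrow> bool" where
  "sc p q a b \<longleftrightarrow> a * b = ksign p q * (b * a)"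

lemma sc_sym: "sc p q a b \<Longrightarrow> sc q p b a"
  unfolding sc_def ksign_commute[of q p] by simp

lemma sc_mult: "sc p q a b \<Longrightarrow> sc p' q a' b \<Longrightarrow> sc (p \<noteq> p') q (a * a') b"
  unfolding sc_def ksign_def
  by (smt (verit) mult.assoc mult_minus_left mult_minus_right mult_1_left minus_minus)

lemma sc_span:
  assumes "a \<in> coords.span S" "\<And>x. x \<in> S \<Longrightarrow> sc p q x b"
  shows "sc p q a b"
  using assms(1)
proof (induction rule: coords.span_induct_alt)
  case base
  then show ?case by (simp add: sc_def)
next
  case (step c x y)
  then show ?case using assms(2)[of x]
    by (auto simp: sc_def distrib_left distrib_right scale_times ksign_def scale_minus_one)
qed

lemma sc_gens: "sc (odd (length (filter odd_gen gs))) q (prod_list (map gen gs)) b"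
  if "\<And>g. sc (odd_gen g) q (gen g) b"
proof (induction gs)
  case Nil
  then show ?case by (simp add: sc_def)
next
  case (Cons g gs)
  have "sc (odd_gen g \<noteq> odd (length (filter odd_gen gs))) q (gen g * prod_list (map gen gs)) b"
    by (rule sc_mult[OF that Cons])
  moreover have "(odd_gen g \<noteq> odd (length (filter odd_gen gs))) =
      odd (length (filter odd_gen (g # gs)))"
    by auto
  ultimately show ?case by simp
qed

text \<open>Supercommutation is additive and multiplicative in its first argument and symmetric, so
  it passes from pairs of generators to one argument and then to the other.\<close>

lemma part_supercommute:
  assumes "a \<in> part p" "b \<in> part q"
  shows "a * b = ksign p q * (b * a)"
proof -
  have 1: "sc (odd_gen g) (odd_gen h) (gen g) (gen h)" for g h
    unfolding sc_def by (rule gen_relations)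
  have 2: "sc p (odd_gen h) a (gen h)" for h
    by (rule sc_span[OF assms(1)[unfolded part_def]]) (auto intro: sc_gens 1)
  have "sc q p b a"
    by (rule sc_span[OF assms(2)[unfolded part_def]]) (auto intro: sc_gens sc_sym 2)
  from sc_sym[OF this] show ?thesis by (simp add: sc_def)
qed

text \<open>Existence only. That the two parts meet in 0 depends on 2 being invertible and comes
  from \<open>part_iff_parity\<close>.\<close>

lemma part_decompose: "\<exists>a\<in>part False. \<exists>b\<in>part True. f = a + b"
proof (induction f)
  case (const r)
  show ?case using const_in_part[of r] part_closed(5)[of True] by (metis add.right_neutral)
next
  case (gen g)
  show ?case
  proof (cases "odd_gen g")
    case True
    then show ?thesis using gen_in_part[of g] part_closed(5)[of False] by (metis add.left_neutral)
  next
    case False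
    then show ?thesis using gen_in_part[of g] part_closed(5)[of True] by (metis add.right_neutral)
  qed
next
  case (plus f g)
  then obtain a b a' b' where "a \<in> part False" "b \<in> part True" "f = a + b"
    "a' \<in> part False" "b' \<in> part True" "g = a' + b'" by blast
  moreover have "a + b + (a' + b') = (a + a') + (b + b')" by simp
  ultimately show ?case by (metis part_closed(1))
next
  case (times f g)
  then obtain a b a' b' where *: "a \<in> part False" "b \<in> part True" "f = a + b"
    "a' \<in> part False" "b' \<in> part True" "g = a' + b'" by blast
  have "f * g = (a * a' + b * b') + (a * b' + b * a')"
    by (simp add: * algebra_simps)
  moreover have "a * a' + b * b' \<in> part False" "a * b' + b * a' \<in> part True"
    using part_mult[OF *(1,4)] part_mult[OF *(2,5)] part_mult[OF *(1,5)] part_mult[OF *(2,4)]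
    by (auto intro: part_closed(1))
  ultimately show ?case by blast
qed

subsection \<open>Homomorphisms of products\<close>

fun factor :: "('c, 'm, 'n) gen \<Rightarrow> 'c" where
  "factor (Entry c i j) = c"
| "factor (Inv_entry c i j) = c"

fun unit_gen :: "('c, 'm, 'n) gen \<Rightarrow> (unit, 'm, 'n) gen" where
  "unit_gen (Entry c i j) = Entry () i j"
| "unit_gen (Inv_entry c i j) = Inv_entry () i j"

lemma odd_unit_gen [simp]: "odd_gen (unit_gen g) = odd_gen g"
  by (cases g) auto

lemma unit_gen_unit [simp]: "unit_gen (g :: (unit, 'm, 'n) gen) = g"
  by (cases g) auto

text \<open>The family \<open>P\<close> stands in for a grading of the target ring: all that matters
  is that its members supercommute. It is instantiated with the homogeneous parts of coordinate
  algebras, of group algebras over them and of power series over them.\<close>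

lemma admissible_matI:
  fixes P :: "bool \<Rightarrow> 'a :: ring_1 set"
  assumes "s 1 = 1" "\<And>r t. s (r + t) = s r + s t" "\<And>r t. s (r * t) = s r * s t"
    and "\<And>r a. s r * a = a * s r"
    and "\<And>p q a b. a \<in> P p \<Longrightarrow> b \<in> P q \<Longrightarrow> a * b = ksign p q * (b * a)"
    and "\<And>g. \<phi> g \<in> P (odd_gen g)"
    and "\<And>c i j. (\<Sum>k\<in>UNIV. \<phi> (Entry c i k) * \<phi> (Inv_entry c k j)) = of_bool (i = j)"
    and "\<And>c i j. (\<Sum>k\<in>UNIV. \<phi> (Inv_entry c i k) * \<phi> (Entry c k j)) = of_bool (i = j)"
  shows "admissible s \<phi>"
  unfolding admissible_def using assms by (intro conjI allI) blast+

text \<open>Tensor products are coproducts of supercommutative superalgebras: homomorphisms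
  \<open>f c\<close> on the single factors, with supercommuting images, combine into one on all
  factors.\<close>

definition join :: "('k :: field \<Rightarrow> 'a) \<Rightarrow>
    ('c \<Rightarrow> (unit, 'k, 'm :: {finite, linorder}, 'n :: {finite, linorder}) coords \<Rightarrow> 'a :: ring_1) \<Rightarrow>
    ('c, 'k, 'm, 'n) coords \<Rightarrow> 'a" where
  "join s f = extend s (\<lambda>g. f (factor g) (gen (unit_gen g)))"

lemma of_bool_hom: "alg_hom s f \<Longrightarrow> s 1 = 1 \<Longrightarrow> f (of_bool b) = of_bool b"
  by (cases b) (simp_all add: alg_homD)

lemma admissible_join:
  fixes P :: "bool \<Rightarrow> 'a :: ring_1 set"
  assumes "s 1 = 1" "\<And>r t. s (r + t) = s r + s t" "\<And>r t. s (r * t) = s r * s t"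
    and "\<And>r a. s r * a = a * s r"
    and "\<And>p q a b. a \<in> P p \<Longrightarrow> b \<in> P q \<Longrightarrow> a * b = ksign p q * (b * a)"
    and "\<And>c g. f c (gen g) \<in> P (odd_gen g)"
    and hom: "\<And>c. alg_hom s (f c)"
  shows "admissible s (\<lambda>g. f (factor g) (gen (unit_gen g)))"
proof (rule admissible_matI[where P = P], fact+)
  show "f (factor g) (gen (unit_gen g)) \<in> P (odd_gen g)" for g
    using assms(6)[of "factor g" "unit_gen g"] by simp
  show "(\<Sum>k\<in>UNIV. f (factor (Entry c i k)) (gen (unit_gen (Entry c i k))) *
      f (factor (Inv_entry c k j)) (gen (unit_gen (Inv_entry c k j)))) = of_bool (i = j)" for c i j
    using gen_relations(2)[of "()" i j, THEN arg_cong[where f = "f c"]]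
    by (simp add: alg_homD[OF hom] of_bool_hom[OF hom assms(1)])
  show "(\<Sum>k\<in>UNIV. f (factor (Inv_entry c i k)) (gen (unit_gen (Inv_entry c i k))) *
      f (factor (Entry c k j)) (gen (unit_gen (Entry c k j)))) = of_bool (i = j)" for c i j
    using gen_relations(3)[of "()" i j, THEN arg_cong[where f = "f c"]]
    by (simp add: alg_homD[OF hom] of_bool_hom[OF hom assms(1)])
qed

lemma join_gen:
  assumes "admissible s (\<lambda>g. f (factor g) (gen (unit_gen g)))"
  shows "join s f (gen g) = f (factor g) (gen (unit_gen g))"
  unfolding join_def by (rule extend_hom(1)[OF assms])

abbreviation incl :: "'c \<Rightarrow> (unit, 'k :: field, 'm :: {finite, linorder}, 'n :: {finite, linorder}) coords \<Rightarrow>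
    ('c, 'k, 'm, 'n) coords" where
  "incl c \<equiv> extend const (copy_gen c)"

lemma alg_hom_incl: "alg_hom const (incl c)"
  by (rule alg_hom_extend[OF admissible_copy])

lemma copy_unit_gen: "copy_gen (factor g) (unit_gen g) = gen g"
  by (cases g) auto

lemma factor_copy:
  assumes "admissible s (\<lambda>g. f (factor g) (gen (unit_gen g)))" "alg_hom s (f c)"
  shows "join s f (incl c a) = f c a"
proof (rule alg_hom_eqI[of s])
  show "alg_hom s (\<lambda>a. join s f (incl c a))"
    unfolding join_def by (rule alg_hom_comp[OF alg_hom_incl alg_hom_extend[OF assms(1)]])
  show "alg_hom s (f c)" by fact
  show "join s f (incl c (gen x)) = f c (gen x)" for x
    by (cases x) (simp_all add: extend_hom(1)[OF admissible_copy] join_gen[OF assms(1)])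
qed

lemma incl_gen: "incl c (gen g) = copy_gen c g"
  by (rule extend_hom(1)[OF admissible_copy])

lemma alg_hom_counit: "alg_hom (\<lambda>r. r) counit"
  unfolding counit_def by (rule alg_hom_extend[OF admissible_counit])

lemma alg_hom_comult: "alg_hom const \<Delta>"
  unfolding comult_def by (rule alg_hom_extend[OF admissible_comult])

lemma hom_part:
  assumes "alg_hom const f" "\<And>g. f (gen g) \<in> part (odd_gen g)" "a \<in> part p"
  shows "f a \<in> part p"
proof -
  have "a \<in> coords.span {prod_list (map gen gs) | gs. odd (length (filter odd_gen gs)) = p}"
    using assms(3) by (simp add: part_def)
  then show ?thesis
proof (induction rule: coords.span_induct_alt)
  case base
  show ?case by (simp add: alg_homD[OF assms(1)] part_closed)
next
  case (step c x y)
  then obtain gs where gs: "x = prod_list (map gen gs)" "odd (length (filter odd_gen gs)) = p" by auto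
  have "f (prod_list (map gen gs)) \<in> part (odd (length (filter odd_gen gs)))"
  proof (induction gs)
    case Nil
    then show ?case by (simp add: alg_homD(9)[OF assms(1)] const_hom(2) one_in_part)
  next
    case (Cons g gs)
    from part_mult[OF assms(2)[of g] this]
    have "f (gen g) * f (prod_list (map gen gs)) \<in> part (odd_gen g \<noteq> odd (length (filter odd_gen gs)))" .
    moreover have "(odd_gen g \<noteq> odd (length (filter odd_gen gs))) =
        odd (length (filter odd_gen (g # gs)))" by auto
    ultimately show ?case by (simp add: alg_homD[OF assms(1)])
  qed
  with gs step show ?case
    by (simp add: alg_homD(1,8)[OF assms(1)] part_closed flip: scale_def)
qed
qed

lemma copy_gen_part: "copy_gen c g \<in> part (odd_gen g)"
proof (cases g)
  case (Entry u i j)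
  then show ?thesis using gen_in_part[of "Entry c i j"] by simp
next
  case (Inv_entry u i j)
  then show ?thesis using gen_in_part[of "Inv_entry c i j"] by simp
qed

lemma incl_part: "a \<in> part p \<Longrightarrow> incl c a \<in> part p"
  by (rule hom_part[OF alg_hom_incl]) (simp_all add: incl_gen copy_gen_part)

lemma comult_gen_part: "\<Delta> (gen g) \<in> part (odd_gen g)"
proof -
  have 1: "gen (Entry c i k) * gen (Entry c' k j) \<in> part (odd_idx i \<noteq> odd_idx j)" for c c' :: bool and i j k
    using part_mult[OF gen_in_part[of "Entry c i k"] gen_in_part[of "Entry c' k j"]]
    by (cases "odd_idx i"; cases "odd_idx k"; cases "odd_idx j"; simp)
  have 2: "gen (Inv_entry c i k) * gen (Inv_entry c' k j) \<in> part (odd_idx i \<noteq> odd_idx j)" for c c' :: bool and i j k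
    using part_mult[OF gen_in_part[of "Inv_entry c i k"] gen_in_part[of "Inv_entry c' k j"]]
    by (cases "odd_idx i"; cases "odd_idx k"; cases "odd_idx j"; simp)
  show ?thesis
    by (cases g) (simp_all only: comult_hom(1) comult_gen.simps odd_gen.simps part_closed(4) 1 2)
qed

lemma comult_part: "f \<in> part p \<Longrightarrow> \<Delta> f \<in> part p"
  by (rule hom_part[OF alg_hom_comult comult_gen_part])

subsection \<open>The parity automorphism\<close>

text \<open>The operator with eigenvalue 1 on the even and -1 on the odd part. It turns graded
  subspaces into subspaces stable under an involution.\<close>

definition parity :: "('c, 'k :: field, 'm :: {finite, linorder}, 'n :: {finite, linorder}) coords \<Rightarrow>
    ('c, 'k, 'm, 'n) coords" where
  "parity = extend const (\<lambda>g. if odd_gen g then - gen g else gen g)"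

lemma admissible_parity: "admissible const (\<lambda>g. if odd_gen g then - gen g else gen g)"
proof (rule admissible_matI[where P = part, OF const_hom(2-5) part_supercommute])
  show "(if odd_gen g then - gen g else gen g) \<in> part (odd_gen g)" for g
    using gen_in_part[of g] by (auto intro: part_closed)
  show "(\<Sum>k\<in>UNIV. (if odd_gen (Entry c i k) then - gen (Entry c i k) else gen (Entry c i k)) *
       (if odd_gen (Inv_entry c k j) then - gen (Inv_entry c k j) else gen (Inv_entry c k j))) =
    of_bool (i = j)" for c i j
  proof -
    \<comment> \<open>The signs of the two factors combine to a sign that depends on
      \<open>i\<close> and \<open>j\<close> only and is 1 for \<open>i = j\<close>.\<close>
    have "(\<Sum>k\<in>UNIV. (if odd_gen (Entry c i k) then - gen (Entry c i k) else gen (Entry c i k)) *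
       (if odd_gen (Inv_entry c k j) then - gen (Inv_entry c k j) else gen (Inv_entry c k j))) =
      (\<Sum>k\<in>UNIV. (if odd_idx i = odd_idx j then 1 else - 1) *
        (gen (Entry c i k) * gen (Inv_entry c k j)))"
      by (rule sum.cong) auto
    then show ?thesis
      by (simp only: gen_relations(2) flip: sum_distrib_left) auto
  qed
  show "(\<Sum>k\<in>UNIV. (if odd_gen (Inv_entry c i k) then - gen (Inv_entry c i k) else gen (Inv_entry c i k)) *
       (if odd_gen (Entry c k j) then - gen (Entry c k j) else gen (Entry c k j))) =
    of_bool (i = j)" for c i j
  proof -
    have "(\<Sum>k\<in>UNIV. (if odd_gen (Inv_entry c i k) then - gen (Inv_entry c i k) else gen (Inv_entry c i k)) *
       (if odd_gen (Entry c k j) then - gen (Entry c k j) else gen (Entry c k j))) =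
      (\<Sum>k\<in>UNIV. (if odd_idx i = odd_idx j then 1 else - 1) *
        (gen (Inv_entry c i k) * gen (Entry c k j)))"
      by (rule sum.cong) auto
    then show ?thesis
      by (simp only: gen_relations(3) flip: sum_distrib_left) auto
  qed
qed

lemma alg_hom_parity: "alg_hom const parity"
  unfolding parity_def by (rule alg_hom_extend[OF admissible_parity])

lemma parity_gen: "parity (gen g) = (if odd_gen g then - gen g else gen g)"
  unfolding parity_def by (rule extend_hom(1)[OF admissible_parity])

lemma parity_parity [simp]: "parity (parity f) = f"
  using alg_hom_eqI[OF alg_hom_comp[OF alg_hom_parity alg_hom_parity] alg_hom_id, of f]
  by (auto simp: parity_gen alg_homD[OF alg_hom_parity])

lemma parity_on_part:
  fixes f :: "('c, 'k :: field, 'm :: {finite, linorder}, 'n :: {finite, linorder}) coords"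
  shows "f \<in> part p \<Longrightarrow> parity f = (if p then - f else f)"
  unfolding part_def
proof (induction rule: coords.span_induct_alt)
  case base
  show ?case by (simp add: alg_homD[OF alg_hom_parity])
next
  case (step c x y)
  then obtain gs where gs: "x = prod_list (map gen gs)" "odd (length (filter odd_gen gs)) = p" by auto
  have "parity (prod_list (map gen gs) :: ('c, 'k, 'm, 'n) coords) =
      (if odd (length (filter odd_gen gs)) then - prod_list (map gen gs) else prod_list (map gen gs))"
    by (induction gs) (auto simp: alg_homD[OF alg_hom_parity] const_hom(2) parity_gen)
  with gs have "parity x = (if p then - x else x)" by simp
  with step show ?case
    by (simp add: alg_homD(1)[OF alg_hom_parity] alg_homD(8)[OF alg_hom_parity] flip: scale_def)
qed

lemma hom_parity:
  assumes "alg_hom const f" "\<And>g. f (gen g) \<in> part (odd_gen g)"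
  shows "f (parity a) = parity (f a)"
  by (rule alg_hom_eqI[OF alg_hom_comp[OF alg_hom_parity assms(1)] alg_hom_comp[OF assms(1) alg_hom_parity]])
     (auto simp: parity_gen alg_homD[OF assms(1)] parity_on_part[OF assms(2)])

lemma two_cancel:
  fixes f :: "('c, 'k :: field, 'm :: {finite, linorder}, 'n :: {finite, linorder}) coords"
  assumes "(2 :: 'k) \<noteq> 0" "f + f = 0" shows "f = 0"
proof -
  have "scale 2 f = 0" using assms(2) coords.scale_left_distrib[of 1 1 f] by simp
  then show ?thesis using assms(1) by simp
qed

text \<open>In a decomposition \<open>f = a + b\<close> the eigenvalue equation forces the component
  of the wrong parity to be its own negative.\<close>

lemma part_iff_parity:
  fixes f :: "('c, 'k :: field, 'm :: {finite, linorder}, 'n :: {finite, linorder}) coords"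
  assumes "(2 :: 'k) \<noteq> 0"
  shows "f \<in> part p \<longleftrightarrow> parity f = (if p then - f else f)"
proof
  assume *: "parity f = (if p then - f else f)"
  obtain a b where ab: "a \<in> part False" "b \<in> part True" "f = a + b" using part_decompose by blast
  have "parity f = a - b"
    using ab by (simp add: alg_homD(1)[OF alg_hom_parity] parity_on_part)
  show "f \<in> part p"
  proof (cases p)
    case True
    have "a + a = (a - b) + (a + b)" by simp
    also have "\<dots> = 0" using * ab True by (simp flip: \<open>parity f = a - b\<close>)
    finally have "a + a = 0" .
    with two_cancel[OF assms] have "a = 0" by blast
    with ab True show ?thesis by simp
  next
    case False
    have "b + b = (a + b) - (a - b)" by simp
    also have "\<dots> = 0" using * ab False by (simp flip: \<open>parity f = a - b\<close>)
    finally have "b + b = 0" .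
    with two_cancel[OF assms] have "b = 0" by blast
    with ab False show ?thesis by simp
  qed
qed (rule parity_on_part)

section \<open>Contraction with functionals\<close>

text \<open>Linearity over \<open>K\<close> is expressed by a set of central elements of the ring
  itself. In this form the class is closed under passing to linear endomorphisms, and the
  construction \<open>endo\<close> can be applied twice.\<close>

class scalar_ring = ring_1 +
  fixes scalars :: "'a set"
  assumes scalars_central: "z \<in> scalars \<Longrightarrow> z * a = a * z"

instantiation coords :: (type, field, "{finite, linorder}", "{finite, linorder}") scalar_ring
begin

definition scalars_coords :: "('a, 'b, 'c, 'd) coords set" where
  "scalars_coords = range const"

instance
  by standard (auto simp: scalars_coords_def const_hom(5))

end

typedef (overloaded) 'a endo = "{f :: 'a :: scalar_ring \<Rightarrow> 'a.
    (\<forall>x y. f (x + y) = f x + f y) \<and> (\<forall>z\<in>scalars. \<forall>x. f (z * x) = z * f x)}"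
  morphisms app Endo
  by (rule exI[of _ "\<lambda>x. x"]) simp

setup_lifting type_definition_endo

lemma scalars_left_commute: "z \<in> scalars \<Longrightarrow> z * (a * b) = a * (z * b)"
  by (metis mult.assoc scalars_central)

instantiation endo :: (scalar_ring) ring_1
begin

lift_definition zero_endo :: "'a endo" is "\<lambda>_. 0" by simp
lift_definition one_endo :: "'a endo" is "\<lambda>x. x" by simp
lift_definition plus_endo :: "'a endo \<Rightarrow> 'a endo \<Rightarrow> 'a endo" is "\<lambda>f g x. f x + g x"
  by (auto simp: algebra_simps)
lift_definition uminus_endo :: "'a endo \<Rightarrow> 'a endo" is "\<lambda>f x. - f x" by auto
lift_definition minus_endo :: "'a endo \<Rightarrow> 'a endo \<Rightarrow> 'a endo" is "\<lambda>f g x. f x - g x"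
  by (auto simp: algebra_simps)
lift_definition times_endo :: "'a endo \<Rightarrow> 'a endo \<Rightarrow> 'a endo" is "\<lambda>f g x. f (g x)" by auto

instance
proof
  show "(0 :: 'a endo) \<noteq> 1" by transfer (metis zero_neq_one)
qed (transfer; auto simp: fun_eq_iff algebra_simps)+

end

lift_definition lmul :: "'a :: scalar_ring \<Rightarrow> 'a endo" is "\<lambda>a x. a * x"
  by (auto simp: algebra_simps scalars_left_commute)
lift_definition rmul :: "'a :: scalar_ring \<Rightarrow> 'a endo" is "\<lambda>a x. x * a"
  by (auto simp: algebra_simps)

instantiation endo :: (scalar_ring) scalar_ring
begin

definition scalars_endo :: "'a endo set" where
  "scalars_endo = lmul ` scalars"

instance
proof
  fix z a :: "'a endo"
  assume "z \<in> scalars"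
  then obtain x where x: "x \<in> scalars" "z = lmul x" by (auto simp: scalars_endo_def)
  from x(1) show "z * a = a * z"
    unfolding x(2) by transfer auto
qed

end

lemma app_simps [simp]: "app (f + g) x = app f x + app g x" "app (f * g) x = app f (app g x)"
  "app 1 x = x" "app 0 x = 0" "app (lmul a) x = a * x" "app (rmul a) x = x * a"
  "app (- f) x = - app f x"
  by (transfer; simp)+

lemma endo_eqI: "(\<And>x. app f x = app g x) \<Longrightarrow> f = g"
  by transfer auto

lemma lmul_hom: "lmul (a * b) = lmul a * lmul b" "lmul (a + b) = lmul a + lmul b" "lmul 1 = 1"
  "lmul 0 = 0" "lmul (- a) = - lmul a"
  by (rule endo_eqI, simp add: algebra_simps)+

lemma rmul_hom: "rmul (a * b) = rmul b * rmul a" "rmul (a + b) = rmul a + rmul b" "rmul 1 = 1"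
  "rmul 0 = 0" "rmul (- a) = - rmul a"
  by (rule endo_eqI, simp add: algebra_simps)+

lemma lmul_rmul: "rmul b * lmul a = lmul a * rmul b" "rmul b * (lmul a * c) = lmul a * (rmul b * c)"
  by (rule endo_eqI, simp add: algebra_simps)+

lemma rmul_sum: "rmul (sum f A) = (\<Sum>x\<in>A. rmul (f x))"
  by (induction A rule: infinite_finite_induct) (simp_all add: rmul_hom)

lift_definition parity_endo ::
  "('c, 'k :: field, 'm :: {finite, linorder}, 'n :: {finite, linorder}) coords endo" is parity
  by (auto simp: scalars_coords_def alg_homD[OF alg_hom_parity])

lemma app_parity_endo [simp]: "app parity_endo = parity"
  by transfer simp

definition sign_endo :: "bool \<Rightarrow>
    ('c, 'k :: field, 'm :: {finite, linorder}, 'n :: {finite, linorder}) coords endo" where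
  "sign_endo p = (if p then parity_endo else 1)"

lemma sign_endo_mult: "sign_endo p * sign_endo q = sign_endo (p \<noteq> q)"
  by (auto simp: sign_endo_def intro: endo_eqI)

lemma sign_endo_lmul: "sign_endo p * lmul (gen g) = ksign p (odd_gen g) * (lmul (gen g) * sign_endo p)"
  by (auto simp: sign_endo_def ksign_def intro!: endo_eqI)
     (simp_all add: alg_homD[OF alg_hom_parity] parity_gen)

text \<open>
  The representation of \<open>A = K[G\<^sup>C \<times> G]\<close> on \<open>End(A)\<close> in which the first factors act by
  \<open>a F = (a \<cdot>) \<circ> F\<close> and an element \<open>b\<close> of the last factor acts by \<open>b F = F \<circ> (\<cdot> b)\<close> up to
  a sign. Applied to an \<open>F\<close> built from a functional \<open>\<psi>\<close>, it yields the contraction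
  \<open>id \<otimes> \<psi>\<close>, whose existence expresses that \<open>A\<close> is a tensor product.
\<close>

definition rep_gen :: "('c option, 'm, 'n) gen \<Rightarrow>
    ('c option, 'k :: field, 'm :: {finite, linorder}, 'n :: {finite, linorder}) coords endo endo" where
  "rep_gen g = (if factor g = None then lmul (sign_endo (odd_gen g)) * rmul (rmul (gen g))
     else lmul (lmul (gen g)))"

abbreviation rep_scalar :: "'k \<Rightarrow>
    ('c option, 'k :: field, 'm :: {finite, linorder}, 'n :: {finite, linorder}) coords endo endo" where
  "rep_scalar r \<equiv> lmul (lmul (const r))"

text \<open>The first factors act on the values of an operator and the last factor on its argument,
  so these actions would commute; the parity operator attached to odd generators of the last factor
  supplies the sign. Since \<open>rmul\<close> reverses products, nesting it twice restores their
  order.\<close>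

lemma admissible_rep: "admissible rep_scalar (rep_gen :: _ \<Rightarrow>
    ('c option, 'k :: field, 'm :: {finite, linorder}, 'n :: {finite, linorder}) coords endo endo)"
proof -
  have scal: "(rep_scalar r :: ('c option, 'k, 'm, 'n) coords endo endo) \<in> scalars" for r :: 'k
    by (simp add: scalars_endo_def scalars_coords_def)
  have sum_None: "(\<Sum>k\<in>UNIV. lmul (sign_endo (odd_idx i \<noteq> odd_idx k)) * rmul (rmul (f k)) *
      (lmul (sign_endo (odd_idx k \<noteq> odd_idx j)) * rmul (rmul (h k)))) = of_bool (i = j)"
    if "(\<Sum>k\<in>UNIV. f k * h k) = of_bool (i = j)"
    for f h :: "('m, 'n) idx \<Rightarrow> ('c option, 'k, 'm, 'n) coords" and i j
  proof -
    have "lmul (sign_endo (odd_idx i \<noteq> odd_idx k)) * rmul (rmul (f k)) *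
      (lmul (sign_endo (odd_idx k \<noteq> odd_idx j)) * rmul (rmul (h k))) =
      lmul (sign_endo (odd_idx i \<noteq> odd_idx j)) * rmul (rmul (f k * h k))" for k
    proof -
      have "((odd_idx i \<noteq> odd_idx k) \<noteq> (odd_idx k \<noteq> odd_idx j)) = (odd_idx i \<noteq> odd_idx j)"
        by auto
      then have "lmul (sign_endo (odd_idx i \<noteq> odd_idx k)) * lmul (sign_endo (odd_idx k \<noteq> odd_idx j)) =
          (lmul (sign_endo (odd_idx i \<noteq> odd_idx j)) :: ('c option, 'k, 'm, 'n) coords endo endo)"
        by (simp only: sign_endo_mult flip: lmul_hom(1))
      moreover have "rmul (rmul (f k)) * rmul (rmul (h k)) = rmul (rmul (f k * h k))"
        by (simp add: rmul_hom)
      ultimately show ?thesis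
        by (metis (no_types) lmul_rmul(1) mult.assoc)
    qed
    then have "(\<Sum>k\<in>UNIV. lmul (sign_endo (odd_idx i \<noteq> odd_idx k)) * rmul (rmul (f k)) *
      (lmul (sign_endo (odd_idx k \<noteq> odd_idx j)) * rmul (rmul (h k)))) =
      lmul (sign_endo (odd_idx i \<noteq> odd_idx j)) * rmul (rmul (of_bool (i = j)))"
      by (simp only: that flip: sum_distrib_left rmul_sum)
    also have "\<dots> = of_bool (i = j)"
      by (auto simp: rmul_hom lmul_hom sign_endo_def)
    finally show ?thesis .
  qed
  have lsum: "(\<Sum>k\<in>UNIV. lmul (lmul (f k)) * lmul (lmul (h k))) = of_bool (i = j)"
    if "(\<Sum>k\<in>UNIV. f k * h k) = of_bool (i = j)"
    for f h :: "('m, 'n) idx \<Rightarrow> ('c option, 'k, 'm, 'n) coords" and i j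
  proof -
    have "(\<Sum>k\<in>A. lmul (lmul (f k)) * lmul (lmul (h k))) = lmul (lmul (\<Sum>k\<in>A. f k * h k))" for A
      by (induction A rule: infinite_finite_induct) (simp_all add: lmul_hom)
    with that show ?thesis by (auto simp: lmul_hom)
  qed
  have mixed: "lmul (sign_endo (odd_gen g)) * rmul (rmul (gen g)) * lmul (lmul (gen h)) =
      ksign (odd_gen g) (odd_gen h) *
        (lmul (lmul (gen h)) * (lmul (sign_endo (odd_gen g)) * rmul (rmul (gen g))) ::
          ('c option, 'k, 'm, 'n) coords endo endo)"
    for g h :: "('c option, 'm, 'n) gen"
  proof -
    have ks: "lmul (ksign p q) = (ksign p q :: ('c option, 'k, 'm, 'n) coords endo endo)" for p q by (simp add: ksign_def lmul_hom)
    have "lmul (sign_endo (odd_gen g)) * rmul (rmul (gen g)) * lmul (lmul (gen h)) =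
        (lmul (sign_endo (odd_gen g) * lmul (gen h)) * rmul (rmul (gen g)) ::
          ('c option, 'k, 'm, 'n) coords endo endo)"
      by (simp add: lmul_hom(1) mult.assoc lmul_rmul)
    then show ?thesis by (simp add: sign_endo_lmul lmul_hom(1) ks mult.assoc)
  qed
  have sc_gen: "sc (odd_gen g) (odd_gen h) (rep_gen g) (rep_gen h :: ('c option, 'k, 'm, 'n) coords endo endo)" for g h
  proof -
    consider "factor g = None" "factor h = None" | "factor g = None" "factor h \<noteq> None"
      | "factor g \<noteq> None" "factor h = None" | "factor g \<noteq> None" "factor h \<noteq> None" by blast
    then show ?thesis
    proof cases
      case 1
      have "rmul (rmul (gen g)) * rmul (rmul (gen h)) =
          (rmul (rmul (gen g * gen h)) :: ('c option, 'k, 'm, 'n) coords endo endo)"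
        by (simp add: rmul_hom)
      also have "\<dots> = ksign (odd_gen g) (odd_gen h) * rmul (rmul (gen h * gen g))"
        by (simp add: gen_relations(1)[of g h]) (simp add: ksign_def rmul_hom)
      finally have "rmul (rmul (gen g)) * rmul (rmul (gen h)) =
          (ksign (odd_gen g) (odd_gen h) * (rmul (rmul (gen h)) * rmul (rmul (gen g))) ::
          ('c option, 'k, 'm, 'n) coords endo endo)"
        by (simp add: rmul_hom)
      moreover have "lmul (sign_endo (odd_gen g)) * lmul (sign_endo (odd_gen h)) =
          (lmul (sign_endo (odd_gen h)) * lmul (sign_endo (odd_gen g)) :: ('c option, 'k, 'm, 'n) coords endo endo)"
        by (simp add: sign_endo_mult eq_commute flip: lmul_hom(1))
      ultimately have "lmul (sign_endo (odd_gen g)) * lmul (sign_endo (odd_gen h)) *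
          (rmul (rmul (gen g)) * rmul (rmul (gen h))) =
          lmul (sign_endo (odd_gen h)) * lmul (sign_endo (odd_gen g)) *
          (ksign (odd_gen g) (odd_gen h) * (rmul (rmul (gen h)) * rmul (rmul (gen g))) ::
            ('c option, 'k, 'm, 'n) coords endo endo)"
        by (simp only:)
      then show ?thesis
        unfolding sc_def using 1
        by (simp add: rep_gen_def mult.assoc lmul_rmul)
           (auto simp add: mult.assoc ksign_def)
    next
      case 2
      then show ?thesis by (auto simp: sc_def rep_gen_def mixed)
    next
      case 3
      then show ?thesis by (intro sc_sym[of "odd_gen h"]) (auto simp: sc_def rep_gen_def mixed)
    next
      case 4
      have "lmul (lmul (gen g)) * lmul (lmul (gen h)) =
          (lmul (lmul (gen g * gen h)) :: ('c option, 'k, 'm, 'n) coords endo endo)"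
        by (simp add: lmul_hom)
      also have "\<dots> = ksign (odd_gen g) (odd_gen h) * lmul (lmul (gen h * gen g))"
        by (simp add: gen_relations(1)[of g h]) (simp add: ksign_def lmul_hom)
      finally show ?thesis using 4 by (auto simp: sc_def rep_gen_def lmul_hom)
    qed
  qed
  show ?thesis
    unfolding admissible_def
  proof (intro conjI allI)
    show "rep_scalar r * a = a * rep_scalar r"
      for r :: 'k and a :: "('c option, 'k, 'm, 'n) coords endo endo"
      by (rule scalars_central[OF scal])
    show "rep_gen g * rep_gen h = (ksign (odd_gen g) (odd_gen h) * (rep_gen h * rep_gen g) ::
      ('c option, 'k, 'm, 'n) coords endo endo)" for g h
      using sc_gen[of g h] by (simp add: sc_def)
    show "(\<Sum>k\<in>UNIV. rep_gen (Entry c i k) * rep_gen (Inv_entry c k j)) =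
      (of_bool (i = j) :: ('c option, 'k, 'm, 'n) coords endo endo)" for c i j
      using sum_None[OF gen_relations(2)[of c i j]] lsum[OF gen_relations(2)[of c i j]]
      by (cases c) (simp_all add: rep_gen_def)
    show "(\<Sum>k\<in>UNIV. rep_gen (Inv_entry c i k) * rep_gen (Entry c k j)) =
      (of_bool (i = j) :: ('c option, 'k, 'm, 'n) coords endo endo)" for c i j
      using sum_None[OF gen_relations(3)[of c i j]] lsum[OF gen_relations(3)[of c i j]]
      by (cases c) (simp_all add: rep_gen_def)
  qed (simp_all add: const_hom(1-4) lmul_hom)
qed

definition linfun :: "(('c, 'k :: field, 'm :: {finite, linorder}, 'n :: {finite, linorder}) coords \<Rightarrow> 'k) \<Rightarrow> bool" where
  "linfun \<psi> \<longleftrightarrow> (\<forall>a b. \<psi> (a + b) = \<psi> a + \<psi> b) \<and> (\<forall>r a. \<psi> (scale r a) = r * \<psi> a)"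

lemma linfunD:
  assumes "linfun \<psi>"
  shows "\<psi> (a + b) = \<psi> a + \<psi> b" "\<psi> (scale r a) = r * \<psi> a" "\<psi> 0 = 0"
proof -
  show "\<psi> (a + b) = \<psi> a + \<psi> b" "\<psi> (scale r a) = r * \<psi> a" for r a
    using assms by (auto simp: linfun_def)
  from this(2)[of 0 0] show "\<psi> 0 = 0" by simp
qed

section \<open>Forgetting tensor factors by means of the counit\<close>

abbreviation const_counit :: "(unit, 'k :: field, 'm :: {finite, linorder}, 'n :: {finite, linorder}) coords \<Rightarrow>
    ('c, 'k, 'm, 'n) coords" where
  "const_counit \<equiv> (\<lambda>a. const (counit a))"

lemma counit_gen: "counit (gen g) = counit_gen g"
  unfolding counit_def by (rule extend_hom(1)[OF admissible_counit])

lemma alg_hom_const_counit: "alg_hom const const_counit"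
  by (simp add: alg_hom_def const_hom(1-4) alg_homD[OF alg_hom_counit])

lemma const_counit_part: "const_counit (gen g) \<in> part (odd_gen g)"
  by (cases "odd_gen g") (simp_all add: counit_gen counit_gen_odd const_hom(1-4) const_in_part part_closed)

lemma incl_gen_part: "incl c (gen g) \<in> part (odd_gen g)"
  by (rule incl_part[OF gen_in_part])

text \<open>Applying the counit to a factor erases it. This gives one-sided inverses of the
  inclusions: \<open>last_factor\<close> for that of the last factor, \<open>drop_last\<close> for
  that of all the others.\<close>

definition last_factor :: "('c option, 'k :: field, 'm :: {finite, linorder}, 'n :: {finite, linorder}) coords \<Rightarrow>
    (unit, 'k, 'm, 'n) coords" where
  "last_factor = join const (\<lambda>d. case d of None \<Rightarrow> (\<lambda>a. a) | Some _ \<Rightarrow> const_counit)"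

lemma admissible_last_factor: "admissible const (\<lambda>g. (\<lambda>d. case d of None \<Rightarrow> (\<lambda>a. a) | Some _ \<Rightarrow> const_counit)
    (factor g) (gen (unit_gen g)))"
  by (rule admissible_join[where s = const and P = part, OF const_hom(2-5) part_supercommute, where f = "\<lambda>d. case d of None \<Rightarrow> (\<lambda>a. a) | Some _ \<Rightarrow> const_counit"])
     (auto split: option.splits simp: alg_hom_id alg_hom_const_counit const_counit_part gen_in_part)

lemma alg_hom_last_factor: "alg_hom const last_factor"
  unfolding last_factor_def join_def by (rule alg_hom_extend[OF admissible_last_factor])

lemma last_factor_incl: "last_factor (incl None a) = a"
  unfolding last_factor_def by (subst factor_copy[OF admissible_last_factor]) (simp_all add: alg_hom_id)

definition drop_last :: "('c option, 'k :: field, 'm :: {finite, linorder}, 'n :: {finite, linorder}) coords \<Rightarrow>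
    ('c, 'k, 'm, 'n) coords" where
  "drop_last = join const (\<lambda>d. case d of None \<Rightarrow> const_counit | Some c \<Rightarrow> incl c)"

lemma admissible_drop_last: "admissible const (\<lambda>g. (\<lambda>d. case d of None \<Rightarrow> const_counit | Some c \<Rightarrow> incl c)
    (factor g) (gen (unit_gen g)))"
  by (rule admissible_join[where s = const and P = part, OF const_hom(2-5) part_supercommute, where f = "\<lambda>d. case d of None \<Rightarrow> const_counit | Some c \<Rightarrow> incl c"])
     (auto split: option.splits simp: alg_hom_incl alg_hom_const_counit const_counit_part incl_gen_part)

lemma alg_hom_drop_last: "alg_hom const drop_last"
  unfolding drop_last_def join_def by (rule alg_hom_extend[OF admissible_drop_last])

definition emb_some :: "('c, 'k :: field, 'm :: {finite, linorder}, 'n :: {finite, linorder}) coords \<Rightarrow>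
    ('c option, 'k, 'm, 'n) coords" where
  "emb_some = join const (\<lambda>c. incl (Some c))"

lemma admissible_emb_some: "admissible const (\<lambda>g. (\<lambda>c. incl (Some c)) (factor g) (gen (unit_gen g)))"
  by (rule admissible_join[where s = const and P = part, OF const_hom(2-5) part_supercommute, where f = "\<lambda>c. incl (Some c)"]) (auto simp: alg_hom_incl incl_gen_part)

lemma alg_hom_emb_some: "alg_hom const emb_some"
  unfolding emb_some_def join_def by (rule alg_hom_extend[OF admissible_emb_some])

lemma emb_some_incl: "emb_some (incl c a) = incl (Some c) a"
  unfolding emb_some_def
  by (subst factor_copy[OF admissible_emb_some]) (simp_all add: alg_hom_incl)

lemma drop_last_emb:
  fixes x :: "('c, 'k :: field, 'm :: {finite, linorder}, 'n :: {finite, linorder}) coords"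
  shows "drop_last (emb_some x) = x"
proof -
  have "drop_last (emb_some (gen g)) = (gen g :: ('c, 'k, 'm, 'n) coords)" for g
    by (cases g) (simp_all add: emb_some_def join_gen[OF admissible_emb_some] incl_gen
      drop_last_def join_gen[OF admissible_drop_last])
  then show ?thesis
    using alg_hom_eqI[OF alg_hom_comp[OF alg_hom_emb_some alg_hom_drop_last] alg_hom_id, of x] by blast
qed

abbreviation rep :: "('c option, 'k :: field, 'm :: {finite, linorder}, 'n :: {finite, linorder}) coords \<Rightarrow>
    ('c option, 'k, 'm, 'n) coords endo endo" where
  "rep \<equiv> extend rep_scalar rep_gen"

lemmas alg_hom_rep = alg_hom_extend[OF admissible_rep]

lemma rep_emb:
  fixes x :: "('c, 'k :: field, 'm :: {finite, linorder}, 'n :: {finite, linorder}) coords"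
  shows "rep (emb_some x) = lmul (lmul (emb_some x))"
proof -
  have 1: "alg_hom rep_scalar (\<lambda>x :: ('c, 'k, 'm, 'n) coords. rep (emb_some x))"
    by (rule alg_hom_comp[OF alg_hom_emb_some alg_hom_rep])
  have 2: "alg_hom rep_scalar (\<lambda>x :: ('c, 'k, 'm, 'n) coords. lmul (lmul (emb_some x)))"
    by (simp add: alg_hom_def alg_homD[OF alg_hom_emb_some] lmul_hom)
  have 3: "rep (emb_some (gen g :: ('c, 'k, 'm, 'n) coords)) = lmul (lmul (emb_some (gen g)))" for g
    by (cases g) (simp_all add: emb_some_def join_gen[OF admissible_emb_some] incl_gen
      extend_hom(1)[OF admissible_rep] rep_gen_def)
  show ?thesis by (rule alg_hom_eqI[OF 1 2 3])
qed

lemma rep_last_monomial: "rep (incl None (prod_list (map gen gs)) ::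
      ('c option, 'k :: field, 'm :: {finite, linorder}, 'n :: {finite, linorder}) coords) =
    lmul (sign_endo (odd (length (filter odd_gen gs)))) * rmul (rmul (incl None (prod_list (map gen gs))))"
proof (induction gs)
  case Nil
  then show ?case
    by (simp add: alg_homD(9)[OF alg_hom_incl] alg_homD(9)[OF alg_hom_rep] const_hom(1-4) lmul_hom rmul_hom sign_endo_def)
next
  case (Cons g gs)
  obtain g' where g': "copy_gen None g = (gen g' :: ('c option, 'k, 'm, 'n) coords)" "factor g' = None" "odd_gen g' = odd_gen g"
    by (cases g) (auto intro: that[of "Entry None _ _"] that[of "Inv_entry None _ _"])
  have xor: "(odd_gen g \<noteq> odd (length (filter odd_gen gs))) =
        odd (length (filter odd_gen (g # gs)))" by auto
  have "rep (incl None (prod_list (map gen (g # gs))) :: ('c option, 'k, 'm, 'n) coords) =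
      lmul (sign_endo (odd_gen g)) * rmul (rmul (gen g')) *
      (lmul (sign_endo (odd (length (filter odd_gen gs)))) * rmul (rmul (incl None (prod_list (map gen gs)))))"
    by (simp add: alg_homD(2)[OF alg_hom_incl] alg_homD(2)[OF alg_hom_rep] Cons.IH incl_gen g'
      extend_hom(1)[OF admissible_rep] rep_gen_def)
  also have "\<dots> = lmul (sign_endo (odd_gen g) * sign_endo (odd (length (filter odd_gen gs)))) *
      rmul (rmul (gen g' * incl None (prod_list (map gen gs))))"
    by (simp add: mult.assoc lmul_rmul rmul_hom lmul_hom)
  finally show ?case
    by (simp only: sign_endo_mult xor list.map prod_list.Cons alg_homD(2)[OF alg_hom_incl] incl_gen g'(1))
qed

definition functional_endo :: "((unit, 'k :: field, 'm :: {finite, linorder}, 'n :: {finite, linorder}) coords \<Rightarrow> 'k) \<Rightarrow>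
    ('c option, 'k, 'm, 'n) coords endo" where
  "functional_endo \<psi> = Endo (\<lambda>x. const (\<psi> (last_factor x)))"

lemma app_functional_endo:
  fixes \<psi> :: "(unit, 'k :: field, 'm :: {finite, linorder}, 'n :: {finite, linorder}) coords \<Rightarrow> 'k"
  assumes "linfun \<psi>"
  shows "app (functional_endo \<psi>) = (\<lambda>x. const (\<psi> (last_factor x)))"
  unfolding functional_endo_def
proof (rule Endo_inverse, clarsimp, intro conjI allI ballI)
  fix x y z :: "('c option, 'k, 'm, 'n) coords"
  show "const (\<psi> (last_factor (x + y))) = const (\<psi> (last_factor x)) + const (\<psi> (last_factor y))"
    by (simp add: alg_homD[OF alg_hom_last_factor] linfunD[OF assms] const_hom(1-4))
  assume "z \<in> scalars"
  then obtain r where "z = const r" by (auto simp: scalars_coords_def)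
  then show "const (\<psi> (last_factor (z * x))) = z * const (\<psi> (last_factor x))"
    using linfunD(2)[OF assms, of r "last_factor x"]
    by (simp add: alg_homD[OF alg_hom_last_factor] const_hom(1-4) flip: scale_def)
qed

text \<open>Under \<open>rep\<close> the last factor of \<open>x\<close> enters the argument of
  \<open>\<psi>\<close> and the other factors multiply the value; evaluation at 1 leaves
  \<open>(id \<otimes> \<psi>) x\<close>.\<close>

definition contract :: "((unit, 'k :: field, 'm :: {finite, linorder}, 'n :: {finite, linorder}) coords \<Rightarrow> 'k) \<Rightarrow>
    ('c option, 'k, 'm, 'n) coords \<Rightarrow> ('c, 'k, 'm, 'n) coords" where
  "contract \<psi> x = drop_last (app (app (rep x) (functional_endo \<psi>)) 1)"

lemma contract_linear:
  "contract \<psi> (x + y) = contract \<psi> x + contract \<psi> y" "contract \<psi> (scale r x) = scale r (contract \<psi> x)"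
  by (simp_all add: contract_def scale_def alg_homD[OF alg_hom_rep] alg_homD[OF alg_hom_drop_last])

lemma parity_const: "parity (const r) = const r"
  by (simp add: alg_homD[OF alg_hom_parity])

lemma contract_tensor:
  fixes x :: "('c, 'k :: field, 'm :: {finite, linorder}, 'n :: {finite, linorder}) coords"
  assumes \<psi>: "linfun \<psi>"
  shows "contract \<psi> (emb_some x * incl None b) = scale (\<psi> b) x"
proof -
  let ?v = "\<lambda>b. app (app (rep (incl None b)) (functional_endo \<psi>)) (1 :: ('c option, 'k, 'm, 'n) coords)"
  have lin: "?v (a + b) = ?v a + ?v b" "?v (scale r b) = const r * ?v b" "?v 0 = 0" for a b r
    by (simp_all add: scale_def alg_homD[OF alg_hom_rep] alg_homD[OF alg_hom_incl])
  \<comment> \<open>The parity operator in \<open>rep\<close> meets a value of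
    \<open>\<psi>\<close>, which is a constant, and so leaves no sign.\<close>
  have mono: "?v (prod_list (map gen gs)) = const (\<psi> (prod_list (map gen gs)))" for gs
    by (simp add: rep_last_monomial app_functional_endo[OF \<psi>] last_factor_incl sign_endo_def parity_const)
  have part: "?v b = const (\<psi> b)" if "b \<in> part p" for b p
    using that unfolding part_def
  proof (induction rule: coords.span_induct_alt)
    case base
    show ?case by (simp add: lin linfunD[OF \<psi>] const_hom(1-4))
  next
    case (step c x y)
    then show ?case by (auto simp: lin linfunD[OF \<psi>] const_hom(1-4) mono)
  qed
  obtain b0 b1 where "b0 \<in> part False" "b1 \<in> part True" "b = b0 + b1"
    using part_decompose by blast
  then have "?v b = const (\<psi> b)" by (simp add: lin(1) part linfunD[OF \<psi>] const_hom(1-4))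
  then have "contract \<psi> (emb_some x * incl None b) = x * const (\<psi> b)"
    by (simp add: contract_def alg_homD(2)[OF alg_hom_rep] rep_emb alg_homD[OF alg_hom_drop_last] drop_last_emb)
  then show ?thesis by (simp add: scale_def const_hom(5))
qed

section \<open>Convolution action of functionals\<close>

lemma join_tensor:
  assumes "admissible s (\<lambda>g. f (factor g) (gen (unit_gen g)))" "\<And>c. alg_hom s (f c)"
  shows "join s f (a \<otimes> b) = f False a * f True b"
proof -
  have "alg_hom s (join s f)"
    unfolding join_def by (rule alg_hom_extend[OF assms(1)])
  then show ?thesis
    by (simp add: tensor_def alg_homD(2) factor_copy[OF assms(1) assms(2)])
qed

lemma tensor_add: "(a + a') \<otimes> b = a \<otimes> b + a' \<otimes> b" "a \<otimes> (b + b') = a \<otimes> b + a \<otimes> b'"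
  "scale r a \<otimes> b = scale r (a \<otimes> b)" "a \<otimes> scale r b = scale r (a \<otimes> b)" "0 \<otimes> b = 0" "a \<otimes> 0 = 0"
  by (simp_all add: tensor_def alg_homD[OF alg_hom_incl] algebra_simps flip: scale_def)
     (simp_all add: scale_times scale_def mult.assoc flip: scale_def)

lemma tensor_sum: "a \<otimes> sum f A = (\<Sum>x\<in>A. a \<otimes> f x)" "sum f A \<otimes> b = (\<Sum>x\<in>A. f x \<otimes> b)"
  by (induction A rule: infinite_finite_induct) (simp_all add: tensor_add)

lemma tensor_mult:
  assumes "b \<in> part q" "a' \<in> part p"
  shows "(a \<otimes> b) * (a' \<otimes> b') = scale (ksign q p) ((a * a') \<otimes> (b * b'))"
proof -
  have "incl True b * incl False a' = ksign q p * (incl False a' * incl True b)"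
    by (rule part_supercommute[OF incl_part[OF assms(1)] incl_part[OF assms(2)]])
  moreover have "(a \<otimes> b) * (a' \<otimes> b') = incl False a * (incl True b * incl False a') * incl True b'"
    unfolding tensor_def by (simp add: mult.assoc)
  ultimately have "(a \<otimes> b) * (a' \<otimes> b') =
      incl False a * (ksign q p * (incl False a' * incl True b)) * incl True b'"
    by (simp only:)
  then show ?thesis
    by (cases "q \<and> p")
       (auto simp: tensor_def alg_homD(2)[OF alg_hom_incl] mult.assoc scale_def ksign_def const_hom(2) const_minus_1)
qed

lemma tensor_span:
  fixes x :: "('k :: field, 'm :: {finite, linorder}, 'n :: {finite, linorder}) KGG"
  shows "x \<in> coords.span {a \<otimes> b | a b. True}"
proof -
  let ?S = "{a \<otimes> b | a b. True}"
  have copy: "incl c (a :: ('k, 'm, 'n) KG) \<in> coords.span ?S" for c a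
    by (rule coords.span_base, rule CollectI, cases c)
      (rule exI[of _ 1], rule exI[of _ a],
        simp add: tensor_def alg_homD(9)[OF alg_hom_incl] const_hom(2),
        rule exI[of _ a], rule exI[of _ 1],
        simp add: tensor_def alg_homD(9)[OF alg_hom_incl] const_hom(2))
  show ?thesis
  proof (induction x)
    case (const r)
    show ?case using copy[of False "const r"] by (simp add: alg_homD(3)[OF alg_hom_incl])
  next
    case (gen g)
    show ?case using copy[of "factor g" "gen (unit_gen g)"] by (simp add: incl_gen copy_unit_gen)
  next
    case (plus x y)
    then show ?case by (rule coords.span_add)
  next
    case (times x y)
    show ?case
    proof (rule span_mult[OF times])
      fix u v :: "('k, 'm, 'n) KGG"
      assume "u \<in> ?S" "v \<in> ?S"
      then obtain a b a' b' where uv: "u = a \<otimes> b" "v = a' \<otimes> b'" by auto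
      obtain b0 b1 where b: "b0 \<in> part False" "b1 \<in> part True" "b = b0 + b1"
        using part_decompose by blast
      obtain a0 a1 where a: "a0 \<in> part False" "a1 \<in> part True" "a' = a0 + a1"
        using part_decompose by blast
      have *: "(a \<otimes> b') \<in> coords.span ?S" for a b' :: "('k, 'm, 'n) KG"
        by (rule coords.span_base) auto
      show "u * v \<in> coords.span ?S"
        by (simp only: uv a(3) b(3) tensor_add distrib_left distrib_right
            tensor_mult[OF b(1) a(1)] tensor_mult[OF b(1) a(2)] tensor_mult[OF b(2) a(1)]
            tensor_mult[OF b(2) a(2)] ; intro coords.span_add coords.span_scale *)
    qed
  qed
qed

lemma tensor_induct [case_names zero tensor add]:
  assumes "P 0" "\<And>a b. P (a \<otimes> b)" "\<And>x y. P x \<Longrightarrow> P y \<Longrightarrow> P (x + y)"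
  shows "P x"
  using tensor_span[of x]
proof (induction rule: coords.span_induct_alt)
  case base
  show ?case by fact
next
  case (step c y z)
  then obtain a b where "y = a \<otimes> b" by auto
  with step assms(2)[of "scale c a" b] show ?case
    by (simp add: assms(3) tensor_add)
qed

subsection \<open>Contraction of the second factor\<close>

lemma incl_unit: "incl () a = a"
  by (rule alg_hom_eqI[OF alg_hom_incl alg_hom_id]) (metis (full_types) copy_unit_gen incl_gen unit_gen_unit unit.exhaust factor.simps)

text \<open>Renames the two factors so that the second one becomes the factor \<open>None\<close>,
  the one that \<open>contract\<close> removes.\<close>

definition split_bool :: "bool \<Rightarrow> ('k :: field, 'm :: {finite, linorder}, 'n :: {finite, linorder}) KG \<Rightarrow> (unit option, 'k, 'm, 'n) coords" where
  "split_bool = (\<lambda>b. if b then incl None else incl (Some ()))"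

lemma split_bool_simps [simp]: "split_bool True = incl None" "split_bool False = incl (Some ())"
  by (simp_all add: split_bool_def)


lemma admissible_split: "admissible const (\<lambda>g. split_bool (factor g) (gen (unit_gen g)))"
  by (rule admissible_join[where s = const and P = part, OF const_hom(2-5) part_supercommute, where f = split_bool])
     (auto simp: incl_gen_part alg_hom_incl split_bool_def)

lemma alg_hom_split_bool: "alg_hom const (split_bool b)"
  by (cases b) (simp_all add: alg_hom_incl)

definition con :: "(('k, 'm, 'n) KG \<Rightarrow> 'k) \<Rightarrow> ('k :: field, 'm :: {finite, linorder}, 'n :: {finite, linorder}) KGG \<Rightarrow>
    ('k, 'm, 'n) KG" where
  "con \<psi> x = contract \<psi> (join const split_bool x)"

lemma con_linear: "con \<psi> (x + y) = con \<psi> x + con \<psi> y" "con \<psi> (scale r x) = scale r (con \<psi> x)" "con \<psi> 0 = 0"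
proof -
  have h: "alg_hom const (join const split_bool)"
    unfolding join_def by (rule alg_hom_extend[OF admissible_split])
  show "con \<psi> (x + y) = con \<psi> x + con \<psi> y" "con \<psi> (scale r x) = scale r (con \<psi> x)" for x y r
    by (simp_all add: con_def alg_homD[OF h] contract_linear flip: scale_def)
  from this(2)[of 0 0] show "con \<psi> 0 = 0" by simp
qed

lemma con_tensor: "linfun \<psi> \<Longrightarrow> con \<psi> (a \<otimes> b) = scale (\<psi> b) a"
  using contract_tensor[of \<psi> a b]
  by (simp add: con_def join_tensor[OF admissible_split alg_hom_split_bool] emb_some_incl incl_unit
      flip: emb_some_incl[of "()" a])

lemma con_diff: "con \<psi> (x - y) = con \<psi> x - con \<psi> y"
  using con_linear(1)[of \<psi> "x - y" y] by simp

text \<open>The action of the dual of \<open>K[G]\<close> on the right supercomodule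
  \<open>K[G]\<close>. No sign is attached to an odd functional; this matches
  \<open>supermodule_hom\<close>, where homomorphisms to \<open>L\<close> and to its parity shift
  both commute with the action.\<close>

definition act :: "(('k, 'm, 'n) KG \<Rightarrow> 'k) \<Rightarrow> ('k :: field, 'm :: {finite, linorder}, 'n :: {finite, linorder}) KG \<Rightarrow>
    ('k, 'm, 'n) KG" (infixr \<open>\<rhd>\<close> 75) where
  "\<psi> \<rhd> f = con \<psi> (\<Delta> f)"

lemma act_linear: "\<psi> \<rhd> (f + g) = \<psi> \<rhd> f + \<psi> \<rhd> g" "\<psi> \<rhd> scale r f = scale r (\<psi> \<rhd> f)" "\<psi> \<rhd> 0 = 0"
  "\<psi> \<rhd> (f - g) = \<psi> \<rhd> f - \<psi> \<rhd> g"
  by (simp_all add: act_def alg_homD[OF alg_hom_comult] con_linear con_diff flip: scale_def)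

lemma con_add_functional:
  assumes "linfun \<psi>" "linfun \<phi>"
  shows "con (\<lambda>a. \<psi> a + \<phi> a) x = con \<psi> x + con \<phi> x"
proof -
  have "linfun (\<lambda>a. \<psi> a + \<phi> a)"
    by (simp add: linfun_def linfunD[OF assms(1)] linfunD[OF assms(2)] algebra_simps)
  then show ?thesis
    by (induction x rule: tensor_induct)
       (simp_all add: con_linear con_tensor assms coords.scale_left_distrib)
qed

lemma con_scale_functional:
  assumes "linfun \<psi>"
  shows "con (\<lambda>a. r * \<psi> a) x = scale r (con \<psi> x)"
proof -
  have "linfun (\<lambda>a. r * \<psi> a)"
    by (simp add: linfun_def linfunD[OF assms(1)] algebra_simps)
  then show ?thesis
    by (induction x rule: tensor_induct)
       (simp_all add: con_linear con_tensor assms coords.scale_right_distrib)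
qed

lemma linfun_add: "linfun \<psi> \<Longrightarrow> linfun \<phi> \<Longrightarrow> linfun (\<lambda>a. \<psi> a + \<phi> a)"
  and linfun_scale: "linfun \<psi> \<Longrightarrow> linfun (\<lambda>a. r * \<psi> a)"
  and linfun_zero: "linfun (\<lambda>a. 0)"
  by (simp_all add: linfun_def algebra_simps)

lemma linfun_counit: "linfun counit"
  by (simp add: linfun_def alg_homD[OF alg_hom_counit])

lemma linfun_act: "linfun \<phi> \<Longrightarrow> linfun (\<lambda>a. \<phi> (\<psi> \<rhd> a))"
  by (simp add: linfun_def act_linear)

lemma linfun_parity: "linfun \<phi> \<Longrightarrow> linfun (\<lambda>a. \<phi> (parity a))"
  by (simp add: linfun_def alg_homD[OF alg_hom_parity] flip: scale_def)

subsection \<open>Coassociativity\<close>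

text \<open>With \<open>right_comult\<close> below, joining gives
  \<open>\<Delta> \<otimes> id\<close> and \<open>id \<otimes> \<Delta>\<close>. Both take values in
  an algebra with three factors, the last of which is \<open>None\<close> so that it can be
  contracted.\<close>

definition left_comult :: "bool \<Rightarrow> ('k :: field, 'm :: {finite, linorder}, 'n :: {finite, linorder}) KG \<Rightarrow> (bool option, 'k, 'm, 'n) coords" where
  "left_comult = (\<lambda>b. if b then incl None else (\<lambda>a. emb_some (\<Delta> a)))"

lemma left_comult_simps [simp]: "left_comult True = incl None" "left_comult False = (\<lambda>a. emb_some (\<Delta> a))"
  by (simp_all add: left_comult_def)


lemma emb_some_part: "a \<in> part p \<Longrightarrow> emb_some a \<in> part p"
proof (rule hom_part[OF alg_hom_emb_some])
  show "emb_some (gen g) \<in> part (odd_gen g)" for g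
    using incl_gen_part[of "Some (factor g)" "unit_gen g"]
    by (simp add: emb_some_def join_gen[OF admissible_emb_some])
qed

lemma left_comult_props: "left_comult c (gen g) \<in> part (odd_gen g)" "alg_hom const (left_comult c)"
  using emb_some_part[OF comult_gen_part[of g]] alg_hom_comp[OF alg_hom_comult alg_hom_emb_some]
  by (auto simp: incl_gen_part alg_hom_incl left_comult_def)

lemma admissible_left_comult: "admissible const (\<lambda>g. left_comult (factor g) (gen (unit_gen g)))"
  by (rule admissible_join[where s = const and P = part, OF const_hom(2-5) part_supercommute,
        where f = left_comult]) (simp_all only: left_comult_props)

definition shift_bool :: "bool \<Rightarrow> ('k :: field, 'm :: {finite, linorder}, 'n :: {finite, linorder}) KG \<Rightarrow> (bool option, 'k, 'm, 'n) coords" where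
  "shift_bool = (\<lambda>b. if b then incl None else incl (Some True))"

lemma shift_bool_simps [simp]: "shift_bool True = incl None" "shift_bool False = incl (Some True)"
  by (simp_all add: shift_bool_def)


lemma admissible_shift: "admissible const (\<lambda>g. shift_bool (factor g) (gen (unit_gen g)))"
  by (rule admissible_join[where s = const and P = part, OF const_hom(2-5) part_supercommute, where f = shift_bool])
     (auto simp: incl_gen_part alg_hom_incl shift_bool_def)

lemma alg_hom_shift_bool: "alg_hom const (shift_bool b)"
  by (cases b) (simp_all add: alg_hom_incl)

abbreviation "shift \<equiv> join const shift_bool"

lemma alg_hom_shift: "alg_hom const shift"
  unfolding join_def by (rule alg_hom_extend[OF admissible_shift])

lemma shift_part: "a \<in> part p \<Longrightarrow> shift a \<in> part p"
proof (rule hom_part[OF alg_hom_shift])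
  show "shift (gen g) \<in> part (odd_gen g)" for g
    using incl_gen_part[of None "unit_gen g"] incl_gen_part[of "Some True" "unit_gen g"]
    by (cases "factor g") (simp_all add: join_gen[OF admissible_shift])
qed

definition right_comult :: "bool \<Rightarrow> ('k :: field, 'm :: {finite, linorder}, 'n :: {finite, linorder}) KG \<Rightarrow> (bool option, 'k, 'm, 'n) coords" where
  "right_comult = (\<lambda>b. if b then (\<lambda>a. shift (\<Delta> a)) else incl (Some False))"

lemma right_comult_simps [simp]: "right_comult True = (\<lambda>a. shift (\<Delta> a))" "right_comult False = incl (Some False)"
  by (simp_all add: right_comult_def)


lemma right_comult_props: "right_comult c (gen g) \<in> part (odd_gen g)" "alg_hom const (right_comult c)"
  using shift_part[OF comult_gen_part[of g]] alg_hom_comp[OF alg_hom_comult alg_hom_shift]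
  by (auto simp: incl_gen_part alg_hom_incl right_comult_def)

lemma admissible_right_comult: "admissible const (\<lambda>g. right_comult (factor g) (gen (unit_gen g)))"
  by (rule admissible_join[where s = const and P = part, OF const_hom(2-5) part_supercommute,
        where f = right_comult]) (simp_all only: right_comult_props)

lemmas alg_hom_left_comult = alg_hom_extend[OF admissible_left_comult, folded join_def]
lemmas alg_hom_right_comult = alg_hom_extend[OF admissible_right_comult, folded join_def]

lemma emb_some_gen: "emb_some (gen g) = copy_gen (Some (factor g)) (unit_gen g)"
  by (simp add: emb_some_def join_gen[OF admissible_emb_some] incl_gen)

lemma coassoc:
  fixes f :: "('k :: field, 'm :: {finite, linorder}, 'n :: {finite, linorder}) KG"
  shows "join const left_comult (\<Delta> f) = join const right_comult (\<Delta> f)"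
proof -
  have "join const left_comult (\<Delta> (gen g :: ('k, 'm, 'n) KG)) = join const right_comult (\<Delta> (gen g :: ('k, 'm, 'n) KG))" for g
  proof (cases g)
    case (Entry u i j)
    have "join const left_comult (\<Delta> (gen g :: ('k, 'm, 'n) KG)) =
        (\<Sum>k\<in>UNIV. \<Sum>l\<in>UNIV. gen (Entry (Some False) i l) * gen (Entry (Some True) l k) * gen (Entry None k j))"
      by (simp add: Entry comult_hom(1) alg_homD[OF alg_hom_left_comult] join_gen[OF admissible_left_comult]
         alg_homD[OF alg_hom_emb_some] emb_some_gen incl_gen sum_distrib_right)
    moreover have "join const right_comult (\<Delta> (gen g :: ('k, 'm, 'n) KG)) =
        (\<Sum>l\<in>UNIV. \<Sum>k\<in>UNIV. gen (Entry (Some False) i l) * gen (Entry (Some True) l k) * gen (Entry None k j))"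
      by (simp add: Entry comult_hom(1) alg_homD[OF alg_hom_right_comult] join_gen[OF admissible_right_comult]
         join_gen[OF admissible_shift] alg_homD[OF alg_hom_shift] incl_gen sum_distrib_left mult.assoc)
    ultimately show ?thesis by (simp only:) (rule sum.swap)
  next
    case (Inv_entry u i j)
    have "join const left_comult (\<Delta> (gen g :: ('k, 'm, 'n) KG)) =
        (\<Sum>k\<in>UNIV. \<Sum>l\<in>UNIV. gen (Inv_entry None i k) * gen (Inv_entry (Some True) k l) * gen (Inv_entry (Some False) l j))"
      by (simp add: Inv_entry comult_hom(1) alg_homD[OF alg_hom_left_comult] join_gen[OF admissible_left_comult]
         alg_homD[OF alg_hom_emb_some] emb_some_gen incl_gen sum_distrib_left mult.assoc)
    moreover have "join const right_comult (\<Delta> (gen g :: ('k, 'm, 'n) KG)) =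
        (\<Sum>l\<in>UNIV. \<Sum>k\<in>UNIV. gen (Inv_entry None i k) * gen (Inv_entry (Some True) k l) * gen (Inv_entry (Some False) l j))"
      by (simp add: Inv_entry comult_hom(1) alg_homD[OF alg_hom_right_comult] join_gen[OF admissible_right_comult]
         join_gen[OF admissible_shift] alg_homD[OF alg_hom_shift] incl_gen sum_distrib_right)
    ultimately show ?thesis by (simp only:) (rule sum.swap)
  qed
  then show ?thesis
    by (rule alg_hom_eqI[OF alg_hom_comp[OF alg_hom_comult alg_hom_left_comult]
          alg_hom_comp[OF alg_hom_comult alg_hom_right_comult]])
qed

definition act_right :: "(('k, 'm, 'n) KG \<Rightarrow> 'k) \<Rightarrow> ('k :: field, 'm :: {finite, linorder}, 'n :: {finite, linorder}) KGG \<Rightarrow>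
    ('k, 'm, 'n) KGG" where
  "act_right \<psi> x = contract \<psi> (join const right_comult x)"

lemma act_right_linear: "act_right \<psi> (x + y) = act_right \<psi> x + act_right \<psi> y"
  "act_right \<psi> (scale r x) = scale r (act_right \<psi> x)" "act_right \<psi> 0 = 0"
proof -
  show "act_right \<psi> (x + y) = act_right \<psi> x + act_right \<psi> y" "act_right \<psi> (scale r x) = scale r (act_right \<psi> x)" for x y r
    by (simp_all add: act_right_def alg_homD[OF alg_hom_right_comult] contract_linear flip: scale_def)
  from this(2)[of 0 0] show "act_right \<psi> 0 = 0" by simp
qed

lemma contract_zero: "contract \<psi> 0 = 0"
  using contract_linear(2)[of \<psi> 0 0] by simp

lemma act_right_tensor:
  assumes "linfun \<psi>"
  shows "act_right \<psi> (a \<otimes> b) = a \<otimes> (\<psi> \<rhd> b)"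
proof -
  have "contract \<psi> (incl (Some False) a * shift y) = a \<otimes> con \<psi> y" for y
  proof (induction y rule: tensor_induct)
    case zero
    show ?case by (simp add: alg_homD[OF alg_hom_shift] con_linear tensor_add contract_zero)
  next
    case (tensor c d)
    have "shift (c \<otimes> d) = incl (Some True) c * incl None d"
      by (simp add: join_tensor[OF admissible_shift alg_hom_shift_bool])
    then have "incl (Some False) a * shift (c \<otimes> d) = emb_some (a \<otimes> c) * incl None d"
      by (simp add: tensor_def[of a c] alg_homD[OF alg_hom_emb_some] emb_some_incl mult.assoc)
    then show ?case
      by (simp add: contract_tensor[OF assms] con_tensor[OF assms] tensor_add)
  next
    case (add x y)
    then show ?case
      by (simp add: alg_homD[OF alg_hom_shift] con_linear tensor_add contract_linear distrib_left)
  qed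
  moreover have "join const right_comult (a \<otimes> b) = incl (Some False) a * shift (\<Delta> b)"
    by (simp add: join_tensor[OF admissible_right_comult right_comult_props(2)])
  ultimately show ?thesis by (simp add: act_right_def act_def)
qed

text \<open>This is coassociativity after contraction of the last of the three factors.\<close>

lemma comult_act:
  assumes "linfun \<psi>"
  shows "\<Delta> (\<psi> \<rhd> f) = act_right \<psi> (\<Delta> f)"
proof -
  have "\<Delta> (con \<psi> x) = contract \<psi> (join const left_comult x)" for x
  proof (induction x rule: tensor_induct)
    case zero
    show ?case by (simp add: alg_homD[OF alg_hom_left_comult] con_linear alg_homD[OF alg_hom_comult] contract_zero)
  next
    case (tensor a b)
    have "join const left_comult (a \<otimes> b) = emb_some (\<Delta> a) * incl None b"
      by (simp add: join_tensor[OF admissible_left_comult left_comult_props(2)])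
    then show ?case
      by (simp add: contract_tensor[OF assms] con_tensor[OF assms] alg_homD[OF alg_hom_comult] flip: scale_def)
  next
    case (add x y)
    then show ?case
      by (simp add: alg_homD[OF alg_hom_left_comult] con_linear contract_linear alg_homD[OF alg_hom_comult])
  qed
  then show ?thesis by (simp add: act_def act_right_def coassoc)
qed

lemma con_act_right:
  assumes "linfun \<psi>" "linfun \<phi>"
  shows "con \<phi> (act_right \<psi> x) = con (\<lambda>a. \<phi> (\<psi> \<rhd> a)) x"
  by (induction x rule: tensor_induct)
     (simp_all add: con_linear act_right_linear act_right_tensor con_tensor assms linfun_act)

text \<open>Functionals form an algebra under convolution, so the orbit of an element under all of
  them is stable. It also allows two actions to be interchanged by comparing two
  functionals.\<close>

lemma act_act:
  assumes "linfun \<psi>" "linfun \<phi>"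
  shows "\<phi> \<rhd> \<psi> \<rhd> f = (\<lambda>a. \<phi> (\<psi> \<rhd> a)) \<rhd> f"
  unfolding act_def[of \<phi>] comult_act[OF assms(1)] con_act_right[OF assms] by (simp add: act_def)

subsection \<open>Counit axioms\<close>

definition counit_bool :: "bool \<Rightarrow> bool \<Rightarrow> ('k :: field, 'm :: {finite, linorder}, 'n :: {finite, linorder}) KG \<Rightarrow> ('k, 'm, 'n) KG" where
  "counit_bool d = (\<lambda>b. if b = d then const_counit else (\<lambda>a. a))"

lemma counit_bool_simps [simp]: "counit_bool d d = const_counit" "counit_bool True False = (\<lambda>a. a)"
  "counit_bool False True = (\<lambda>a. a)"
  by (simp_all add: counit_bool_def)


lemma counit_bool_props: "counit_bool d c (gen g) \<in> part (odd_gen g)" "alg_hom const (counit_bool d c)"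
  by (auto simp: const_counit_part gen_in_part alg_hom_const_counit alg_hom_id counit_bool_def)

lemma admissible_counit_bool: "admissible const (\<lambda>g. counit_bool d (factor g) (gen (unit_gen g)))"
  by (rule admissible_join[where s = const and P = part, OF const_hom(2-5) part_supercommute,
        where f = "counit_bool d"]) (simp_all only: counit_bool_props)

lemmas alg_hom_counit_bool = alg_hom_extend[OF admissible_counit_bool, folded join_def]

lemma counit_axiom: "join const (counit_bool d) (\<Delta> f) = f"
proof -
  have "join const (counit_bool d) (\<Delta> (gen g)) = gen g" for g
    by (cases g; cases d)
       (simp_all add: comult_hom(1) alg_homD[OF alg_hom_counit_bool] join_gen[OF admissible_counit_bool]
         counit_gen of_bool_def if_distrib[of const] const_hom(1,2) if_distrib[of "\<lambda>x. x * _"]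
         if_distrib[of "\<lambda>x. _ * x"] cong: if_cong)
  then show ?thesis
    by (rule alg_hom_eqI[OF alg_hom_comp[OF alg_hom_comult alg_hom_counit_bool] alg_hom_id])
qed

lemma act_counit:
  fixes f :: "('k :: field, 'm :: {finite, linorder}, 'n :: {finite, linorder}) KG"
  shows "counit \<rhd> f = f"
proof -
  have "con counit x = join const (counit_bool True) x" for x :: "('k, 'm, 'n) KGG"
    by (induction x rule: tensor_induct)
       (simp_all add: con_linear con_tensor[OF linfun_counit] alg_homD[OF alg_hom_counit_bool]
         join_tensor[OF admissible_counit_bool counit_bool_props(2)] scale_def const_hom(5))
  then show ?thesis by (simp add: act_def counit_axiom)
qed

lemma counit_con:
  assumes "linfun \<psi>"
  shows "counit (con \<psi> x) = \<psi> (join const (counit_bool False) x)"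
proof (induction x rule: tensor_induct)
  case zero
  show ?case by (simp add: con_linear alg_homD[OF alg_hom_counit_bool] alg_homD(4)[OF alg_hom_counit] linfunD[OF assms])
next
  case (tensor a b)
  have "join const (counit_bool False) (a \<otimes> b) = scale (counit a) b"
    by (simp add: join_tensor[OF admissible_counit_bool counit_bool_props(2)] scale_def)
  then show ?case
    by (simp add: con_tensor[OF assms] linfunD(2)[OF assms] alg_homD(8)[OF alg_hom_counit])
next
  case (add x y)
  then show ?case by (simp add: con_linear alg_homD(1)[OF alg_hom_counit_bool] alg_homD(1)[OF alg_hom_counit] linfunD[OF assms])
qed

text \<open>Any value of a functional is seen at the unit element of some translate. Hence nonzero
  subsupermodules are detected by the counit.\<close>

lemma counit_act: "linfun \<psi> \<Longrightarrow> counit (\<psi> \<rhd> f) = \<psi> f"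
  by (simp add: act_def counit_con counit_axiom)

lemma parity_tensor:
  fixes a b :: "('k :: field, 'm :: {finite, linorder}, 'n :: {finite, linorder}) KG"
  shows "parity (a \<otimes> b) = parity a \<otimes> parity b"
proof -
  have "parity (incl c a) = incl c (parity a)" for c :: bool and a :: "('k, 'm, 'n) KG"
    by (rule hom_parity[symmetric, OF alg_hom_incl]) (simp add: incl_gen copy_gen_part)
  then show ?thesis by (simp add: tensor_def alg_homD(2)[OF alg_hom_parity])
qed

lemma parity_act:
  assumes "linfun \<psi>"
  shows "parity (\<psi> \<rhd> f) = (\<lambda>a. \<psi> (parity a)) \<rhd> parity f"
proof -
  have "parity (con \<psi> x) = con (\<lambda>a. \<psi> (parity a)) (parity x)" for x
    by (induction x rule: tensor_induct)
       (simp_all add: con_linear con_tensor assms linfun_parity parity_tensor alg_homD[OF alg_hom_parity] flip: scale_def)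
  moreover have "\<Delta> (parity f) = parity (\<Delta> f)"
    by (rule hom_parity[OF alg_hom_comult comult_gen_part])
  ultimately show ?thesis by (simp add: act_def)
qed

subsection \<open>Expansion in a basis\<close>

text \<open>The coefficients are the contractions with the dual functionals of a basis. Validity for
  every larger finite set lets the expansions of two tensors be added over a common index
  set.\<close>

lemma tensor_expansion:
  fixes B :: "('k :: field, 'm :: {finite, linorder}, 'n :: {finite, linorder}) KG set"
  assumes B: "coords.independent B" "coords.span B = UNIV"
  defines "dual \<equiv> (\<lambda>v f. coords.representation B f v)"
  shows "\<exists>F. finite F \<and> F \<subseteq> B \<and> (\<forall>F'. finite F' \<and> F \<subseteq> F' \<and> F' \<subseteq> B \<longrightarrow>
    x = (\<Sum>v\<in>F'. con (dual v) x \<otimes> v))"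
proof -
  have lin: "linfun (dual v)" for v
    unfolding linfun_def dual_def
    using B by (auto simp: coords.representation_add coords.representation_scale)
  show ?thesis
  proof (induction x rule: tensor_induct)
    case zero
    show ?case by (rule exI[of _ "{}"]) (simp add: con_linear tensor_add)
  next
    case (tensor a b)
    let ?F = "{v. coords.representation B b v \<noteq> 0}"
    have "finite ?F" "?F \<subseteq> B"
      by (auto simp: coords.finite_representation coords.representation_ne_zero)
    moreover have "a \<otimes> b = (\<Sum>v\<in>F'. con (dual v) (a \<otimes> b) \<otimes> v)"
      if "finite F'" "?F \<subseteq> F'" "F' \<subseteq> B" for F'
    proof -
      have "b = (\<Sum>v\<in>?F. scale (coords.representation B b v) v)"
        using coords.sum_nonzero_representation_eq[OF B(1), of b] B(2) by simp
      also have "\<dots> = (\<Sum>v\<in>F'. scale (coords.representation B b v) v)"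
        by (rule sum.mono_neutral_left) (use that in auto)
      finally have "b = (\<Sum>v\<in>F'. scale (coords.representation B b v) v)" .
      from arg_cong[where f = "\<lambda>z. a \<otimes> z", OF this]
      have "a \<otimes> b = (\<Sum>v\<in>F'. a \<otimes> scale (coords.representation B b v) v)"
        by (simp only: tensor_sum(1))
      moreover have "(\<Sum>v\<in>F'. con (dual v) (a \<otimes> b) \<otimes> v) =
          (\<Sum>v\<in>F'. a \<otimes> scale (coords.representation B b v) v)"
        by (simp only: con_tensor[OF lin] tensor_add(3,4)) (simp only: dual_def)
      ultimately show ?thesis by (rule trans[OF _ sym])
    qed
    ultimately show ?case by blast
  next
    case (add x y)
    from add(1) obtain F where F: "finite F" "F \<subseteq> B"
      "\<forall>F'. finite F' \<and> F \<subseteq> F' \<and> F' \<subseteq> B \<longrightarrow> x = (\<Sum>v\<in>F'. con (dual v) x \<otimes> v)"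
      by (elim exE conjE)
    from add(2) obtain F' where F': "finite F'" "F' \<subseteq> B"
      "\<forall>G. finite G \<and> F' \<subseteq> G \<and> G \<subseteq> B \<longrightarrow> y = (\<Sum>v\<in>G. con (dual v) y \<otimes> v)"
      by (elim exE conjE)
    have "x + y = (\<Sum>v\<in>G. con (dual v) (x + y) \<otimes> v)" if "finite G" "F \<union> F' \<subseteq> G" "G \<subseteq> B" for G
    proof -
      have "x + y = (\<Sum>v\<in>G. con (dual v) x \<otimes> v) + (\<Sum>v\<in>G. con (dual v) y \<otimes> v)"
        using that by (intro arg_cong2[where f = "(+)"] F(3)[rule_format] F'(3)[rule_format]) auto
      then show ?thesis unfolding con_linear(1) tensor_add(1) sum.distrib .
    qed
    with F(1,2) F'(1,2) show ?case
      by (intro exI[of _ "F \<union> F'"] conjI allI impI) (simp_all only: finite_Un Un_subset_iff)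
  qed
qed

lemma coords_basis:
  obtains B :: "('c, 'k :: field, 'm :: {finite, linorder}, 'n :: {finite, linorder}) coords set"
  where "coords.independent B" "coords.span B = UNIV"
  using coords.maximal_independent_subset[of UNIV] by (metis subset_UNIV top.extremum_unique)

lemma linfun_representation:
  assumes "coords.independent B" "coords.span B = UNIV"
  shows "linfun (\<lambda>f. coords.representation B f v)"
  unfolding linfun_def
  using assms by (auto simp: coords.representation_add coords.representation_scale)

lemma con_eqI:
  fixes x y :: "('k :: field, 'm :: {finite, linorder}, 'n :: {finite, linorder}) KGG"
  assumes "\<And>\<psi>. linfun \<psi> \<Longrightarrow> con \<psi> x = con \<psi> y"
  shows "x = y"
proof -
  obtain B :: "('k, 'm, 'n) KG set" where B: "coords.independent B" "coords.span B = UNIV"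
    by (rule coords_basis)
  obtain F where "x - y = (\<Sum>v\<in>F. con (\<lambda>f. coords.representation B f v) (x - y) \<otimes> v)"
    using tensor_expansion[OF B, of "x - y"] by blast
  also have "\<dots> = 0"
    by (simp add: con_diff assms linfun_representation[OF B] tensor_add)
  finally show ?thesis by simp
qed

lemma con_in_subspace:
  assumes "coords.subspace M" "x \<in> M \<otimes>\<^sub>s UNIV" "linfun \<psi>"
  shows "con \<psi> x \<in> M"
  using assms(2) unfolding tensor_space_def
proof (induction rule: coords.span_induct_alt)
  case base
  show ?case by (simp add: con_linear coords.subspace_0[OF assms(1)])
next
  case (step c y z)
  then show ?case
    by (auto simp: con_linear con_tensor[OF assms(3)] intro!: coords.subspace_add[OF assms(1)] coords.subspace_scale[OF assms(1)])
qed

text \<open>Turns the comodule condition \<open>\<Delta> M \<subseteq> M \<otimes> K[G]\<close> into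
  stability under functionals. One direction contracts, the other expands in a basis of the second
  factor.\<close>

lemma tensor_space_iff:
  fixes x :: "('k :: field, 'm :: {finite, linorder}, 'n :: {finite, linorder}) KGG"
  assumes "coords.subspace M"
  shows "x \<in> M \<otimes>\<^sub>s UNIV \<longleftrightarrow> (\<forall>\<psi>. linfun \<psi> \<longrightarrow> con \<psi> x \<in> M)"
proof
  assume *: "\<forall>\<psi>. linfun \<psi> \<longrightarrow> con \<psi> x \<in> M"
  obtain B :: "('k, 'm, 'n) KG set" where B: "coords.independent B" "coords.span B = UNIV"
    by (rule coords_basis)
  obtain F where F: "x = (\<Sum>v\<in>F. con (\<lambda>f. coords.representation B f v) x \<otimes> v)"
    using tensor_expansion[OF B, of x] by blast
  have "(\<Sum>v\<in>F. con (\<lambda>f. coords.representation B f v) x \<otimes> v) \<in> M \<otimes>\<^sub>s UNIV"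
    unfolding tensor_space_def
    by (rule coords.span_sum, rule coords.span_base) (use * linfun_representation[OF B] in blast)
  with F show "x \<in> M \<otimes>\<^sub>s UNIV" by simp
qed (use con_in_subspace[OF assms] in blast)

lemma tensor_space_list:
  assumes "coords.subspace M" "x \<in> M \<otimes>\<^sub>s UNIV"
  obtains ts where "fst ` set ts \<subseteq> M" "x = (\<Sum>(a, b)\<leftarrow>ts. a \<otimes> b)"
proof -
  have "\<exists>ts. fst ` set ts \<subseteq> M \<and> x = (\<Sum>(a, b)\<leftarrow>ts. a \<otimes> b)"
    using assms(2) unfolding tensor_space_def
  proof (induction rule: coords.span_induct_alt)
    case base
    show ?case by (rule exI[of _ "[]"]) simp
  next
    case (step c y z)
    then obtain a b ts where "a \<in> M" "y = a \<otimes> b" "fst ` set ts \<subseteq> M" "z = (\<Sum>(a, b)\<leftarrow>ts. a \<otimes> b)"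
      by auto
    then show ?case
      using coords.subspace_scale[OF assms(1)] by (intro exI[of _ "(scale c a, b) # ts"]) (auto simp: tensor_add)
  qed
  then show ?thesis using that by blast
qed

section \<open>Subsupermodules and their subquotients\<close>

lemma act_zero_functional: "(\<lambda>a. 0) \<rhd> f = 0"
  using con_scale_functional[OF linfun_counit, of 0] by (simp add: act_def)

text \<open>The projections \<open>(f + parity f) / 2\<close> and \<open>(f - parity f) / 2\<close>
  trade the grading for stability under \<open>parity\<close>. In this form, closure under sums and
  intersections is evident.\<close>

lemma subsupermodule_iff:
  fixes M :: "('k :: field, 'm :: {finite, linorder}, 'n :: {finite, linorder}) KG set"
  assumes "(2 :: 'k) \<noteq> 0"
  shows "subsupermodule M \<longleftrightarrow> coords.subspace M \<and> (\<forall>f\<in>M. parity f \<in> M) \<and>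
    (\<forall>\<psi>. linfun \<psi> \<longrightarrow> (\<forall>f\<in>M. \<psi> \<rhd> f \<in> M))" (is "?L \<longleftrightarrow> ?R")
proof
  assume L: ?L
  then have M: "coords.subspace M" by (simp add: subsupermodule_def)
  have "parity f \<in> M" if f: "f \<in> M" for f
  proof -
    obtain a b where "a \<in> M" "a \<in> part False" "b \<in> M" "b \<in> part True" "f = a + b"
      using L f unfolding subsupermodule_def by blast
    then show ?thesis
      by (simp add: alg_homD(1)[OF alg_hom_parity] parity_on_part coords.subspace_diff[OF M])
  qed
  moreover have "\<psi> \<rhd> f \<in> M" if "linfun \<psi>" "f \<in> M" for f \<psi>
    using L that con_in_subspace[OF M] unfolding subsupermodule_def act_def by blast
  ultimately show ?R using M by blast
next
  assume R: ?R
  then have M: "coords.subspace M" by blast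
  have "\<exists>f\<^sub>0\<in>M \<inter> part False. \<exists>f\<^sub>1\<in>M \<inter> part True. f = f\<^sub>0 + f\<^sub>1" if f: "f \<in> M" for f
  proof (intro bexI)
    let ?a = "scale (1 / 2) (f + parity f)" and ?b = "scale (1 / 2) (f - parity f)"
    have "?a + ?b = scale (1 / 2) (f + f)"
      by (simp flip: coords.scale_right_distrib)
    also have "f + f = scale 2 f"
      using coords.scale_left_distrib[of 1 1 f] by simp
    finally show "f = ?a + ?b" using assms by simp
    show "?a \<in> M \<inter> part False" "?b \<in> M \<inter> part True"
      using R f assms coords.subspace_add[OF M] coords.subspace_diff[OF M] coords.subspace_scale[OF M]
      by (auto simp: part_iff_parity alg_homD[OF alg_hom_parity] simp flip: scale_def coords.scale_minus_right)
  qed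
  moreover have "\<Delta> f \<in> M \<otimes>\<^sub>s UNIV" if "f \<in> M" for f
    using R that by (simp add: tensor_space_iff[OF M] flip: act_def)
  ultimately show ?L using M unfolding subsupermodule_def by blast
qed

definition lin_on :: "('k :: field, 'm :: {finite, linorder}, 'n :: {finite, linorder}) KG set \<Rightarrow>
    (('k, 'm, 'n) KG \<Rightarrow> ('k, 'm, 'n) KG) \<Rightarrow> bool" where
  "lin_on N \<phi> \<longleftrightarrow> (\<forall>f\<in>N. \<forall>g\<in>N. \<phi> (f + g) = \<phi> f + \<phi> g) \<and> (\<forall>r. \<forall>f\<in>N. \<phi> (scale r f) = scale r (\<phi> f))"

text \<open>A homomorphism to the parity shift is one that anticommutes with \<open>parity\<close>;
  compatibility with \<open>\<Delta>\<close> is tested by contractions, which separate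
  tensors.\<close>

lemma supermodule_hom_iff:
  fixes N :: "('k :: field, 'm :: {finite, linorder}, 'n :: {finite, linorder}) KG set"
  assumes two: "(2 :: 'k) \<noteq> 0" and N: "subsupermodule N"
  shows "supermodule_hom d N L \<phi> \<longleftrightarrow> \<phi> ` N \<subseteq> L \<and> lin_on N \<phi> \<and>
    (\<forall>f\<in>N. \<phi> (parity f) = (if d then - parity (\<phi> f) else parity (\<phi> f))) \<and>
    (\<forall>\<psi>. linfun \<psi> \<longrightarrow> (\<forall>f\<in>N. \<phi> (\<psi> \<rhd> f) = \<psi> \<rhd> \<phi> f))" (is "?L \<longleftrightarrow> ?R")
proof
  note N' = N[unfolded subsupermodule_iff[OF two]]
  then have sub: "coords.subspace N" by blast
  {
    assume L: ?L
    have lin: "lin_on N \<phi>" using L unfolding supermodule_hom_def lin_on_def by blast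
    have neg: "\<phi> (- f) = - \<phi> f" if "f \<in> N" for f
      using lin that unfolding lin_on_def by (metis scale_minus_one)
    have part: "\<phi> f \<in> part (p \<noteq> d)" if "f \<in> N" "f \<in> part p" for f p
      using L that unfolding supermodule_hom_def by blast
    have "\<phi> (parity f) = (if d then - parity (\<phi> f) else parity (\<phi> f))" if f: "f \<in> N" for f
    proof -
      obtain a b where ab: "a \<in> N" "a \<in> part False" "b \<in> N" "b \<in> part True" "f = a + b"
        using N f unfolding subsupermodule_def by blast
      have "- b \<in> N" using ab(3) by (rule coords.subspace_neg[OF sub])
      then have "\<phi> (a + - b) = \<phi> a - \<phi> b" using lin ab neg[OF ab(3)] unfolding lin_on_def
        by (metis diff_conv_add_uminus)
      moreover have "\<phi> (a + b) = \<phi> a + \<phi> b"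
        using lin ab unfolding lin_on_def by blast
      ultimately show ?thesis
        using parity_on_part[OF part[OF ab(1,2)]] parity_on_part[OF part[OF ab(3,4)]]
        by (auto simp: ab(5) alg_homD(1)[OF alg_hom_parity] parity_on_part[OF ab(2)] parity_on_part[OF ab(4)])
    qed
    moreover have "\<phi> (\<psi> \<rhd> f) = \<psi> \<rhd> \<phi> f" if \<psi>: "linfun \<psi>" and f: "f \<in> N" for \<psi> f
    proof -
      have "\<Delta> f \<in> N \<otimes>\<^sub>s UNIV" using N f unfolding subsupermodule_def by blast
      then obtain ts where ts: "fst ` set ts \<subseteq> N" "\<Delta> f = (\<Sum>(a, b)\<leftarrow>ts. a \<otimes> b)"
        using tensor_space_list[OF sub] by blast
      have "\<Delta> (\<phi> f) = (\<Sum>(a, b)\<leftarrow>ts. \<phi> a \<otimes> b)"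
        using L f ts unfolding supermodule_hom_def by blast
      \<comment> \<open>Linearity of \<open>\<phi>\<close> is known on \<open>N\<close> only, so
        membership of the partial contractions in \<open>N\<close> is carried through the
        induction.\<close>
      moreover have "con \<psi> (\<Sum>(a, b)\<leftarrow>ts. \<phi> a \<otimes> b) = \<phi> (con \<psi> (\<Sum>(a, b)\<leftarrow>ts. a \<otimes> b)) \<and>
          con \<psi> (\<Sum>(a, b)\<leftarrow>ts. a \<otimes> b) \<in> N"
        using ts(1)
      proof (induction ts)
        case Nil
        have "\<phi> 0 = 0" using lin coords.subspace_0[OF sub] unfolding lin_on_def
          by (metis coords.scale_zero_left)
        then show ?case by (simp add: con_linear coords.subspace_0[OF sub])
      next
        case (Cons t ts)
        obtain a b where t: "t = (a, b)" by fastforce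
        with Cons have "a \<in> N" "scale (\<psi> b) a \<in> N" by (auto intro: coords.subspace_scale[OF sub])
        with Cons t lin show ?case
          by (auto simp: con_linear con_tensor[OF \<psi>] lin_on_def intro: coords.subspace_add[OF sub])
      qed
      ultimately show ?thesis by (simp add: act_def ts(2))
    qed
    moreover have "\<phi> ` N \<subseteq> L" using L unfolding supermodule_hom_def by (elim conjE)
    ultimately show ?R using lin by (intro conjI ballI allI impI) simp_all
  }
  {
    assume R: ?R
    then have lin: "lin_on N \<phi>" by blast
    have "\<phi> f \<in> part (p \<noteq> d)" if "f \<in> N" "f \<in> part p" for f p
    proof -
      have "\<phi> (- f) = - \<phi> f"
        using lin that(1) unfolding lin_on_def by (metis scale_minus_one)
      moreover have "\<phi> (parity f) = (if d then - parity (\<phi> f) else parity (\<phi> f))"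
        using R that(1) by blast
      moreover from this have "parity (\<phi> f) = (if d then - \<phi> (parity f) else \<phi> (parity f))"
        by (cases d) simp_all
      ultimately show ?thesis
        unfolding part_iff_parity[OF two] using parity_on_part[OF that(2)]
        by (cases p; cases d) simp_all
    qed
    moreover have "\<Delta> (\<phi> f) = (\<Sum>(a, b)\<leftarrow>ts. \<phi> a \<otimes> b)"
      if f: "f \<in> N" and ts: "fst ` set ts \<subseteq> N" "\<Delta> f = (\<Sum>(a, b)\<leftarrow>ts. a \<otimes> b)" for f ts
    proof (rule con_eqI)
      fix \<psi> :: "('k, 'm, 'n) KG \<Rightarrow> 'k" assume \<psi>: "linfun \<psi>"
      have "con \<psi> (\<Sum>(a, b)\<leftarrow>ts. \<phi> a \<otimes> b) = \<phi> (con \<psi> (\<Sum>(a, b)\<leftarrow>ts. a \<otimes> b)) \<and>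
          con \<psi> (\<Sum>(a, b)\<leftarrow>ts. a \<otimes> b) \<in> N"
        using ts(1)
      proof (induction ts)
        case Nil
        have "\<phi> 0 = 0" using lin coords.subspace_0[OF sub] unfolding lin_on_def
          by (metis coords.scale_zero_left)
        then show ?case by (simp add: con_linear coords.subspace_0[OF sub])
      next
        case (Cons t ts)
        obtain a b where t: "t = (a, b)" by fastforce
        with Cons have "a \<in> N" "scale (\<psi> b) a \<in> N" by (auto intro: coords.subspace_scale[OF sub])
        with Cons t lin show ?case
          by (auto simp: con_linear con_tensor[OF \<psi>] lin_on_def intro: coords.subspace_add[OF sub])
      qed
      moreover have "\<phi> (\<psi> \<rhd> f) = \<psi> \<rhd> \<phi> f" using R f \<psi> by blast
      ultimately show "con \<psi> (\<Delta> (\<phi> f)) = con \<psi> (\<Sum>(a, b)\<leftarrow>ts. \<phi> a \<otimes> b)"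
        unfolding act_def ts(2) by simp
    qed
    ultimately show ?L using R unfolding supermodule_hom_def lin_on_def by blast
  }
qed

section \<open>Sums of subsupermodules and the second isomorphism theorem\<close>

definition msum :: "('k :: field, 'm :: {finite, linorder}, 'n :: {finite, linorder}) KG set \<Rightarrow>
    ('k, 'm, 'n) KG set \<Rightarrow> ('k, 'm, 'n) KG set" where
  "msum N M = {a + b | a b. a \<in> N \<and> b \<in> M}"

lemma msumI [intro]: "x = a + b \<Longrightarrow> a \<in> N \<Longrightarrow> b \<in> M \<Longrightarrow> x \<in> msum N M"
  unfolding msum_def by blast

lemma msumE [elim!]:
  assumes "x \<in> msum N M" obtains a b where "x = a + b" "a \<in> N" "b \<in> M"
  using assms unfolding msum_def by blast

context
  fixes dummy :: "'k :: field itself"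
  assumes two: "(2 :: 'k) \<noteq> 0"
begin

lemma sub_inter:
  fixes N M :: "('k, 'm :: {finite, linorder}, 'n :: {finite, linorder}) KG set"
  shows "subsupermodule N \<Longrightarrow> subsupermodule M \<Longrightarrow> subsupermodule (N \<inter> M)"
  by (auto simp: subsupermodule_iff[OF two] coords.subspace_inter)

lemma sub_msum:
  fixes N M :: "('k, 'm :: {finite, linorder}, 'n :: {finite, linorder}) KG set"
  assumes "subsupermodule N" "subsupermodule M"
  shows "subsupermodule (msum N M)"
proof -
  have "coords.subspace (msum N M)"
    using assms unfolding msum_def by (auto simp: subsupermodule_iff[OF two] coords.subspace_sums)
  moreover have "parity f \<in> msum N M" if f: "f \<in> msum N M" for f
  proof -
    from f obtain a b where "f = a + b" "a \<in> N" "b \<in> M" ..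
    then show ?thesis using assms
      by (intro msumI[of _ "parity a" "parity b"]) (auto simp: subsupermodule_iff[OF two] alg_homD(1)[OF alg_hom_parity])
  qed
  moreover have "\<psi> \<rhd> f \<in> msum N M" if \<psi>: "linfun \<psi>" and f: "f \<in> msum N M" for \<psi> f
  proof -
    from f obtain a b where "f = a + b" "a \<in> N" "b \<in> M" ..
    then show ?thesis using assms \<psi>
      by (intro msumI[of _ "\<psi> \<rhd> a" "\<psi> \<rhd> b"]) (auto simp: subsupermodule_iff[OF two] act_linear)
  qed
  ultimately show ?thesis unfolding subsupermodule_iff[OF two] by blast
qed

lemma subD:
  fixes N :: "('k, 'm :: {finite, linorder}, 'n :: {finite, linorder}) KG set"
  assumes "subsupermodule N"
  shows "coords.subspace N" "0 \<in> N" "a \<in> N \<Longrightarrow> b \<in> N \<Longrightarrow> a + b \<in> N"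
    "a \<in> N \<Longrightarrow> b \<in> N \<Longrightarrow> a - b \<in> N" "a \<in> N \<Longrightarrow> scale r a \<in> N"
    "a \<in> N \<Longrightarrow> parity a \<in> N" "a \<in> N \<Longrightarrow> linfun \<psi> \<Longrightarrow> \<psi> \<rhd> a \<in> N"
proof -
  show sub: "coords.subspace N" using assms by (simp add: subsupermodule_def)
  show "0 \<in> N" "a \<in> N \<Longrightarrow> b \<in> N \<Longrightarrow> a + b \<in> N" "a \<in> N \<Longrightarrow> b \<in> N \<Longrightarrow> a - b \<in> N"
    "a \<in> N \<Longrightarrow> scale r a \<in> N"
    using coords.subspace_0[OF sub] coords.subspace_add[OF sub] coords.subspace_diff[OF sub]
      coords.subspace_scale[OF sub] by blast+
  show "a \<in> N \<Longrightarrow> parity a \<in> N" "a \<in> N \<Longrightarrow> linfun \<psi> \<Longrightarrow> \<psi> \<rhd> a \<in> N"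
    using assms by (auto simp: subsupermodule_iff[OF two])
qed

lemma sub_msum_left: "subsupermodule M \<Longrightarrow> N \<subseteq> msum N M"
  for N M :: "('k, 'm :: {finite, linorder}, 'n :: {finite, linorder}) KG set"
  using subD(2)[of M] by (auto intro: msumI[of _ _ 0])

lemma sub_msum_right: "subsupermodule N \<Longrightarrow> M \<subseteq> msum N M"
  for N M :: "('k, 'm :: {finite, linorder}, 'n :: {finite, linorder}) KG set"
  using subD(2)[of N] by (auto intro: msumI[of _ 0])

text \<open>For \<open>P = N + P2\<close> the subquotients \<open>P / P2\<close> and
  \<open>N / (N \<inter> P2)\<close> agree. This and the next three lemmas transport irreducibility
  and the isomorphism type in both directions without forming quotients.\<close>

lemma irreducible_restrict:
  fixes P P2 N :: "('k, 'm :: {finite, linorder}, 'n :: {finite, linorder}) KG set"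
  assumes irr: "irreducible_quotient P P2" and N: "subsupermodule N" "N \<subseteq> P"
    and sum: "P \<subseteq> msum N P2"
  shows "irreducible_quotient N (N \<inter> P2)"
proof -
  have P2: "subsupermodule P2" "P2 \<subset> P" and P: "subsupermodule P"
    and max: "\<And>Q. subsupermodule Q \<Longrightarrow> P2 \<subseteq> Q \<Longrightarrow> Q \<subseteq> P \<Longrightarrow> Q = P2 \<or> Q = P"
    using irr unfolding irreducible_quotient_def by auto
  have "\<not> N \<subseteq> P2"
  proof
    assume "N \<subseteq> P2"
    with sum have "P \<subseteq> P2" using subD(3)[OF P2(1)] by blast
    with P2(2) show False by blast
  qed
  moreover have "Q = N \<inter> P2 \<or> Q = N" if Q: "subsupermodule Q" "N \<inter> P2 \<subseteq> Q" "Q \<subseteq> N" for Q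
  proof -
    have "msum Q P2 \<subseteq> P" using Q(3) N(2) P2(2) subD(3)[OF P] by blast
    with max[OF sub_msum[OF Q(1) P2(1)] sub_msum_right[OF Q(1)]]
    have "msum Q P2 = P2 \<or> msum Q P2 = P" by blast
    then show ?thesis
    proof
      assume "msum Q P2 = P2"
      then have "Q \<subseteq> P2" using sub_msum_left[OF P2(1), of Q] by simp
      then show ?thesis using Q by blast
    next
      assume eq: "msum Q P2 = P"
      have "N \<subseteq> Q"
      proof
        fix x assume x: "x \<in> N"
        then obtain a b where ab: "a \<in> Q" "b \<in> P2" "x = a + b" using eq N(2) by blast
        then have "b = x - a" by simp
        then have "b \<in> N \<inter> P2" using ab x Q(3) subD(4)[OF N(1)] by blast
        then show "x \<in> Q" using ab Q subD(3)[OF Q(1)] by blast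
      qed
      with Q show ?thesis by blast
    qed
  qed
  ultimately show ?thesis
    unfolding irreducible_quotient_def using N sub_inter[OF N(1) P2(1)] by blast
qed

lemma irreducible_extend:
  fixes P P2 N :: "('k, 'm :: {finite, linorder}, 'n :: {finite, linorder}) KG set"
  assumes irr: "irreducible_quotient N (N \<inter> P2)" and P: "subsupermodule P" and P2: "subsupermodule P2" "P2 \<subseteq> P"
    and N: "N \<subseteq> P" and sum: "P \<subseteq> msum N P2"
  shows "irreducible_quotient P P2"
proof -
  have subN: "subsupermodule N" and strict: "\<not> N \<subseteq> P2"
    and max: "\<And>Q. subsupermodule Q \<Longrightarrow> N \<inter> P2 \<subseteq> Q \<Longrightarrow> Q \<subseteq> N \<Longrightarrow> Q = N \<inter> P2 \<or> Q = N"
    using irr unfolding irreducible_quotient_def by auto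
  have "Q = P2 \<or> Q = P" if Q: "subsupermodule Q" "P2 \<subseteq> Q" "Q \<subseteq> P" for Q
  proof -
    have 1: "Q \<inter> N = N \<inter> P2 \<or> Q \<inter> N = N"
      using max[OF sub_inter[OF Q(1) subN]] Q by blast
    have 2: "Q \<subseteq> msum (Q \<inter> N) P2"
    proof
      fix x assume x: "x \<in> Q"
      then obtain a b where ab: "a \<in> N" "b \<in> P2" "x = a + b" using sum Q(3) by blast
      then have "a = x - b" by simp
      then have "a \<in> Q" using x ab Q(2) subD(4)[OF Q(1)] by blast
      with ab show "x \<in> msum (Q \<inter> N) P2" by blast
    qed
    have 3: "msum (N \<inter> P2) P2 \<subseteq> P2" using subD(3)[OF P2(1)] by blast
    have 4: "P \<subseteq> Q" if "N \<subseteq> Q" using sum that Q(2) subD(3)[OF Q(1)] by blast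
    show ?thesis
    proof (cases "N \<subseteq> Q")
      case True
      then show ?thesis using 4 Q(3) by simp
    next
      case False
      then have "Q \<inter> N = N \<inter> P2" using 1 by blast
      with 2 3 have "Q \<subseteq> P2" by simp
      then show ?thesis using Q(2) by simp
    qed
  qed
  with strict show ?thesis
    unfolding irreducible_quotient_def using P P2 N by blast
qed

lemma quotient_iso_restrict:
  fixes P P2 N :: "('k, 'm :: {finite, linorder}, 'n :: {finite, linorder}) KG set"
  assumes iso: "quotient_iso P P2 L" and N: "subsupermodule N" "N \<subseteq> P"
    and P: "subsupermodule P" and sum: "P \<subseteq> msum N P2"
  shows "quotient_iso N (N \<inter> P2) L"
proof -
  obtain d \<phi> where \<phi>: "supermodule_hom d P L \<phi>" "\<phi> ` P = L" "{f \<in> P. \<phi> f = 0} = P2"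
    using iso unfolding quotient_iso_def by blast
  note h = \<phi>(1)[unfolded supermodule_hom_iff[OF two P]]
  have "supermodule_hom d N L \<phi>"
    unfolding supermodule_hom_iff[OF two N(1)] using h N(2) unfolding lin_on_def by blast
  moreover have "L \<subseteq> \<phi> ` N"
  proof
    fix y assume "y \<in> L"
    then obtain x where x: "x \<in> P" "y = \<phi> x" using \<phi>(2) by blast
    then obtain a b where ab: "a \<in> N" "b \<in> P2" "x = a + b" using sum by blast
    then have "b \<in> P" "\<phi> b = 0" using \<phi>(3) by blast+
    then have "\<phi> x = \<phi> a" using h ab N(2) unfolding lin_on_def by auto
    with x ab show "y \<in> \<phi> ` N" by blast
  qed
  moreover have "\<phi> ` N \<subseteq> L" using \<phi>(2) N(2) by blast
  moreover have "{f \<in> N. \<phi> f = 0} = N \<inter> P2" using \<phi>(3) N(2) by blast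
  ultimately show ?thesis unfolding quotient_iso_def by blast
qed

lemma quotient_iso_extend:
  fixes P P2 N :: "('k, 'm :: {finite, linorder}, 'n :: {finite, linorder}) KG set"
  assumes iso: "quotient_iso N (N \<inter> P2) L" and N: "subsupermodule N" "N \<subseteq> P"
    and P: "subsupermodule P" and P2: "subsupermodule P2" "P2 \<subseteq> P" and sum: "P \<subseteq> msum N P2"
  shows "quotient_iso P P2 L"
proof -
  obtain d \<phi> where \<phi>: "supermodule_hom d N L \<phi>" "\<phi> ` N = L" "{f \<in> N. \<phi> f = 0} = N \<inter> P2"
    using iso unfolding quotient_iso_def by blast
  note h = \<phi>(1)[unfolded supermodule_hom_iff[OF two N(1)]]
  then have lin: "\<And>f g. f \<in> N \<Longrightarrow> g \<in> N \<Longrightarrow> \<phi> (f + g) = \<phi> f + \<phi> g"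
    "\<And>r f. f \<in> N \<Longrightarrow> \<phi> (scale r f) = scale r (\<phi> f)"
    unfolding lin_on_def by blast+
  \<comment> \<open>The induced map: a representative in \<open>N\<close> modulo \<open>P2\<close>
    is chosen and mapped by \<open>\<phi>\<close>. The choice is immaterial because
    \<open>\<phi>\<close> vanishes on \<open>N \<inter> P2\<close>.\<close>
  define \<theta> where "\<theta> x = \<phi> (SOME a. a \<in> N \<and> x - a \<in> P2)" for x
  have \<theta>: "\<theta> x = \<phi> a" if "a \<in> N" "x - a \<in> P2" for x a
  proof -
    let ?a = "SOME a. a \<in> N \<and> x - a \<in> P2"
    have a: "?a \<in> N \<and> x - ?a \<in> P2" by (rule someI[of _ a]) (use that in blast)
    have "?a - a \<in> N" using a that(1) by (intro subD(4)[OF N(1)]) simp_all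
    moreover have "(x - a) - (x - ?a) \<in> P2" by (rule subD(4)[OF P2(1) that(2) conjunct2[OF a]])
    ultimately have "?a - a \<in> N \<inter> P2" by simp
    then have "\<phi> (?a - a) = 0" "?a - a \<in> N" using \<phi>(3) by blast+
    moreover from this have "\<phi> (?a - a + a) = \<phi> (?a - a) + \<phi> a" using that(1) by (intro lin(1)) simp_all
    ultimately have "\<phi> ?a = \<phi> a" by simp
    then show ?thesis by (simp add: \<theta>_def)
  qed
  have dec: "\<exists>a\<in>N. x - a \<in> P2" if x: "x \<in> P" for x
  proof -
    obtain a b where "a \<in> N" "b \<in> P2" "x = a + b" using sum x by blast
    then show ?thesis by (intro bexI[of _ a]) auto
  qed
  have "supermodule_hom d P L \<theta>"
    unfolding supermodule_hom_iff[OF two P] lin_on_def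
  proof (intro conjI ballI allI impI subsetI)
    fix y assume "y \<in> \<theta> ` P"
    then show "y \<in> L" using dec \<theta> \<phi>(2) by blast
  next
    fix f g assume "f \<in> P" "g \<in> P"
    then obtain a b where *: "a \<in> N" "f - a \<in> P2" "b \<in> N" "g - b \<in> P2" using dec by metis
    then have "a + b \<in> N" "(f + g) - (a + b) \<in> P2"
      using subD(3)[OF N(1)] subD(3)[OF P2(1) *(2,4)] by (auto simp: algebra_simps)
    then show "\<theta> (f + g) = \<theta> f + \<theta> g" using * \<theta> lin by metis
  next
    fix f r assume "f \<in> P"
    then obtain a where *: "a \<in> N" "f - a \<in> P2" using dec by metis
    then have "scale r a \<in> N" "scale r f - scale r a \<in> P2"
      using subD(5)[OF N(1)] subD(5)[OF P2(1) *(2), of r] by (auto simp: coords.scale_right_diff_distrib)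
    then show "\<theta> (scale r f) = scale r (\<theta> f)" using * \<theta> lin by metis
  next
    fix f assume "f \<in> P"
    then obtain a where *: "a \<in> N" "f - a \<in> P2" using dec by metis
    then have "parity a \<in> N" "parity f - parity a \<in> P2"
      using subD(6)[OF N(1)] subD(6)[OF P2(1) *(2)] by (auto simp: alg_homD(6)[OF alg_hom_parity])
    then show "\<theta> (parity f) = (if d then - parity (\<theta> f) else parity (\<theta> f))"
      using * \<theta> h by metis
  next
    fix \<psi> :: "('k, 'm, 'n) KG \<Rightarrow> 'k" and f assume \<psi>: "linfun \<psi>" and "f \<in> P"
    then obtain a where *: "a \<in> N" "f - a \<in> P2" using dec by metis
    then have "\<psi> \<rhd> a \<in> N" "\<psi> \<rhd> f - \<psi> \<rhd> a \<in> P2"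
      using subD(7)[OF N(1) _ \<psi>] subD(7)[OF P2(1) *(2) \<psi>] by (auto simp: act_linear)
    then show "\<theta> (\<psi> \<rhd> f) = \<psi> \<rhd> \<theta> f"
      using * \<theta> h \<psi> by metis
  qed
  moreover have "\<theta> ` P = L"
  proof -
    have "\<theta> a = \<phi> a" if "a \<in> N" for a using \<theta>[of a a] that subD(2)[OF P2(1)] by simp
    then have "L \<subseteq> \<theta> ` P" using \<phi>(2) N(2) by (metis image_cong image_mono)
    moreover have "\<theta> ` P \<subseteq> L" using dec \<theta> \<phi>(2) by blast
    ultimately show ?thesis by blast
  qed
  moreover have "{f \<in> P. \<theta> f = 0} = P2"
  proof (intro equalityI subsetI)
    fix f assume "f \<in> {f \<in> P. \<theta> f = 0}"
    then have f: "f \<in> P" "\<theta> f = 0" by blast+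
    then obtain a where *: "a \<in> N" "f - a \<in> P2" using dec by metis
    then have "\<phi> a = 0" using \<theta> f by metis
    then have "a \<in> P2" using * \<phi>(3) by blast
    then have "(f - a) + a \<in> P2" using subD(3)[OF P2(1)] * by blast
    then show "f \<in> P2" by simp
  next
    fix f assume f: "f \<in> P2"
    have "\<phi> 0 = 0" using lin(2)[OF subD(2)[OF N(1)], of 0] by simp
    then show "f \<in> {f \<in> P. \<theta> f = 0}" using f P2(2) \<theta>[OF subD(2)[OF N(1)], of f] by auto
  qed
  ultimately show ?thesis unfolding quotient_iso_def by blast
qed

subsection \<open>The largest subsupermodule belonging to a set of weights\<close>

text \<open>Irreducibility forces \<open>N\<^sub>1 = (N\<^sub>1 \<inter> M) + N\<^sub>2\<close>, so
  the subquotient already occurs inside \<open>M\<close>.\<close>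

lemma belongs_step:
  fixes M N\<^sub>1 N\<^sub>2 :: "('k, 'm :: {finite, linorder}, 'n :: {finite, linorder}) KG set"
  assumes "belongs_to \<Gamma> M" and irr: "irreducible_quotient N\<^sub>1 N\<^sub>2" and not: "\<not> N\<^sub>1 \<inter> M \<subseteq> N\<^sub>2"
  shows "\<exists>\<nu>\<in>\<Gamma>. quotient_iso N\<^sub>1 N\<^sub>2 (L_minus \<nu>)"
proof -
  have M: "subsupermodule M" using assms(1) by (simp add: belongs_to_def)
  have N: "subsupermodule N\<^sub>1" "subsupermodule N\<^sub>2" "N\<^sub>2 \<subset> N\<^sub>1"
    and max: "\<And>Q. subsupermodule Q \<Longrightarrow> N\<^sub>2 \<subseteq> Q \<Longrightarrow> Q \<subseteq> N\<^sub>1 \<Longrightarrow> Q = N\<^sub>2 \<or> Q = N\<^sub>1"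
    using irr unfolding irreducible_quotient_def by auto
  let ?N = "N\<^sub>1 \<inter> M"
  have sN: "subsupermodule ?N" by (rule sub_inter[OF N(1) M])
  have "msum ?N N\<^sub>2 \<subseteq> N\<^sub>1" using N(3) subD(3)[OF N(1)] by blast
  with max[OF sub_msum[OF sN N(2)] sub_msum_right[OF sN]]
  have "msum ?N N\<^sub>2 = N\<^sub>2 \<or> msum ?N N\<^sub>2 = N\<^sub>1" by blast
  moreover have "msum ?N N\<^sub>2 \<noteq> N\<^sub>2" using not sub_msum_left[OF N(2), of ?N] by metis
  ultimately have sum: "N\<^sub>1 \<subseteq> msum ?N N\<^sub>2" by blast
  have "irreducible_quotient ?N (?N \<inter> N\<^sub>2)"
    by (rule irreducible_restrict[OF irr sN _ sum]) blast
  then obtain \<nu> where "\<nu> \<in> \<Gamma>" "quotient_iso ?N (?N \<inter> N\<^sub>2) (L_minus \<nu>)"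
    using assms(1) unfolding belongs_to_def by blast
  moreover from this(2) have "quotient_iso N\<^sub>1 N\<^sub>2 (L_minus \<nu>)"
    by (rule quotient_iso_extend[OF _ sN _ N(1,2) _ sum]) (use N in blast)+
  ultimately show ?thesis by blast
qed

text \<open>A factor not seen by \<open>M\<close> satisfies
  \<open>N\<^sub>1 \<inter> M \<subseteq> N\<^sub>2\<close> and survives the addition of
  \<open>M\<close> to both terms. Since \<open>N\<^sub>1 + M\<close> is the sum of its intersection
  with \<open>M'\<close> and of \<open>M\<close>, the factor is then seen by
  \<open>M'\<close>.\<close>

lemma belongs_msum:
  fixes M M' :: "('k, 'm :: {finite, linorder}, 'n :: {finite, linorder}) KG set"
  assumes "belongs_to \<Gamma> M" "belongs_to \<Gamma> M'"
  shows "belongs_to \<Gamma> (msum M M')"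
proof -
  have M: "subsupermodule M" and M': "subsupermodule M'"
    using assms by (simp_all add: belongs_to_def)
  have "\<exists>\<nu>\<in>\<Gamma>. quotient_iso N\<^sub>1 N\<^sub>2 (L_minus \<nu>)"
    if N12: "N\<^sub>1 \<subseteq> msum M M'" and irr: "irreducible_quotient N\<^sub>1 N\<^sub>2" for N\<^sub>1 N\<^sub>2
  proof (cases "N\<^sub>1 \<inter> M \<subseteq> N\<^sub>2")
    case False
    then show ?thesis by (rule belongs_step[OF assms(1) irr])
  next
    case True
    have N: "subsupermodule N\<^sub>1" "subsupermodule N\<^sub>2" "N\<^sub>2 \<subset> N\<^sub>1"
      using irr unfolding irreducible_quotient_def by auto
    let ?P = "msum N\<^sub>1 M" and ?P2 = "msum N\<^sub>2 M"
    have P: "subsupermodule ?P" and P2: "subsupermodule ?P2" "?P2 \<subseteq> ?P"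
      using sub_msum N M by auto
    have N1P: "N\<^sub>1 \<subseteq> ?P" by (rule sub_msum_left[OF M])
    have sum1: "?P \<subseteq> msum N\<^sub>1 ?P2"
      using sub_msum_right[OF N(2), of M] by blast
    have int: "N\<^sub>1 \<inter> ?P2 = N\<^sub>2"
    proof (intro equalityI subsetI)
      fix x assume "x \<in> N\<^sub>1 \<inter> ?P2"
      then obtain a b where ab: "x \<in> N\<^sub>1" "a \<in> N\<^sub>2" "b \<in> M" "x = a + b" by blast
      then have "b = x - a" by simp
      then have "b \<in> N\<^sub>1" using ab N(3) subD(4)[OF N(1)] by blast
      then have "b \<in> N\<^sub>2" using True ab by blast
      then show "x \<in> N\<^sub>2" using ab subD(3)[OF N(2)] by blast
    qed (use N(3) sub_msum_left[OF M, of N\<^sub>2] in blast)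
    have irrP: "irreducible_quotient ?P ?P2"
      by (rule irreducible_extend[OF _ P P2 N1P sum1]) (simp only: int irr)
    let ?N = "?P \<inter> M'"
    have sN: "subsupermodule ?N" by (rule sub_inter[OF P M'])
    have sum2: "?P \<subseteq> msum ?N ?P2"
    proof
      fix x assume "x \<in> ?P"
      then obtain a m where x: "a \<in> N\<^sub>1" "m \<in> M" "x = a + m" by blast
      then obtain m1 m' where a: "m1 \<in> M" "m' \<in> M'" "a = m1 + m'" using N12 by blast
      have "m' = a + (0 - m1)" by (simp add: a)
      then have "m' \<in> ?N" using x(1) a subD(4)[OF M subD(2)[OF M] a(1)] by blast
      moreover have "m1 + m \<in> ?P2" using sub_msum_right[OF N(2), of M] subD(3)[OF M a(1) x(2)] by blast
      moreover have "x = m' + (m1 + m)" using x a by simp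
      ultimately show "x \<in> msum ?N ?P2" by blast
    qed
    have "irreducible_quotient ?N (?N \<inter> ?P2)"
      by (rule irreducible_restrict[OF irrP sN _ sum2]) blast
    then obtain \<nu> where \<nu>: "\<nu> \<in> \<Gamma>" "quotient_iso ?N (?N \<inter> ?P2) (L_minus \<nu>)"
      using assms(2) unfolding belongs_to_def by (metis (no_types, lifting) inf_le2)
    have "quotient_iso ?P ?P2 (L_minus \<nu>)"
      by (rule quotient_iso_extend[OF \<nu>(2) sN _ P P2 sum2]) blast
    then have "quotient_iso N\<^sub>1 (N\<^sub>1 \<inter> ?P2) (L_minus \<nu>)"
      by (rule quotient_iso_restrict[OF _ N(1) N1P P sum1])
    with \<nu>(1) int show ?thesis by auto
  qed
  then show ?thesis
    unfolding belongs_to_def using sub_msum[OF M M'] by blast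
qed

lemma belongs_zero: "belongs_to \<Gamma> ({0} :: ('k, 'm :: {finite, linorder}, 'n :: {finite, linorder}) KG set)"
proof -
  have "subsupermodule ({0} :: ('k, 'm, 'n) KG set)"
    by (simp add: subsupermodule_iff[OF two] act_linear alg_homD[OF alg_hom_parity])
  moreover have False if "N\<^sub>1 \<subseteq> {0}" "irreducible_quotient N\<^sub>1 N\<^sub>2" for N\<^sub>1 N\<^sub>2 :: "('k, 'm, 'n) KG set"
    using that subD(2)[of N\<^sub>2] unfolding irreducible_quotient_def by blast
  ultimately show ?thesis unfolding belongs_to_def by blast
qed

text \<open>\<open>GREATEST\<close> has a meaning only if a largest member exists. The union of all
  members is one: it is additively closed by \<open>belongs_msum\<close>, and a subquotient of it is
  detected by a single element of \<open>N\<^sub>1\<close> outside \<open>N\<^sub>2\<close>, hence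
  by a single member.\<close>

lemma C_sub_greatest:
  shows "belongs_to \<Gamma> (C_sub \<Gamma> :: ('k, 'm :: {finite, linorder}, 'n :: {finite, linorder}) KG set)"
    and "belongs_to \<Gamma> (M :: ('k, 'm, 'n) KG set) \<Longrightarrow> M \<subseteq> C_sub \<Gamma>"
proof -
  define C :: "('k, 'm, 'n) KG set" where "C = \<Union>{M. belongs_to \<Gamma> M}"
  have sub: "subsupermodule M" if "belongs_to \<Gamma> M" for M :: "('k, 'm, 'n) KG set"
    using that by (simp add: belongs_to_def)
  have CI: "f \<in> C" if "belongs_to \<Gamma> M" "f \<in> M" for f M
    using that unfolding C_def by blast
  have CE: "\<exists>M. belongs_to \<Gamma> M \<and> f \<in> M" if "f \<in> C" for f
    using that unfolding C_def by blast
  have add: "f + g \<in> C" if fg: "f \<in> C" "g \<in> C" for f g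
  proof -
    obtain M M' where M: "belongs_to \<Gamma> M" "f \<in> M" "belongs_to \<Gamma> M'" "g \<in> M'"
      using CE[OF fg(1)] CE[OF fg(2)] by (elim exE conjE)
    show ?thesis
      by (rule CI[OF belongs_msum[OF M(1,3)]]) (rule msumI[OF refl M(2,4)])
  qed
  have closed: "scale r f \<in> C" "parity f \<in> C" "linfun \<psi> \<Longrightarrow> \<psi> \<rhd> f \<in> C" if f: "f \<in> C" for f r \<psi>
  proof -
    obtain M where M: "belongs_to \<Gamma> M" "f \<in> M" using CE[OF f] by (elim exE conjE)
    show "scale r f \<in> C" "parity f \<in> C" "linfun \<psi> \<Longrightarrow> \<psi> \<rhd> f \<in> C"
      using subD(5-7)[OF sub[OF M(1)] M(2)] CI[OF M(1)] by simp_all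
  qed
  have "coords.subspace C"
    unfolding coords.subspace_def using add closed(1) CI[OF belongs_zero] by simp
  then have "subsupermodule C"
    unfolding subsupermodule_iff[OF two] using closed(2,3) by simp
  moreover have "\<exists>\<nu>\<in>\<Gamma>. quotient_iso N\<^sub>1 N\<^sub>2 (L_minus \<nu>)"
    if "N\<^sub>1 \<subseteq> C" and irr: "irreducible_quotient N\<^sub>1 N\<^sub>2" for N\<^sub>1 N\<^sub>2
  proof -
    obtain f where f: "f \<in> N\<^sub>1" "f \<notin> N\<^sub>2" using irr unfolding irreducible_quotient_def by blast
    then have "f \<in> C" using that(1) by blast
    then obtain M where M: "belongs_to \<Gamma> M" "f \<in> M" using CE by blast
    show ?thesis by (rule belongs_step[OF M(1) irr]) (use M(2) f in blast)
  qed
  ultimately have "belongs_to \<Gamma> C" unfolding belongs_to_def by blast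
  moreover have "M \<subseteq> C" if "belongs_to \<Gamma> M" for M using CI[OF that] by blast
  ultimately have "C_sub \<Gamma> = C" "belongs_to \<Gamma> C" "\<And>M. belongs_to \<Gamma> M \<Longrightarrow> M \<subseteq> C"
    unfolding C_sub_def by (auto intro!: Greatest_equality)
  then show "belongs_to \<Gamma> (C_sub \<Gamma> :: ('k, 'm, 'n) KG set)"
    "belongs_to \<Gamma> (M :: ('k, 'm, 'n) KG set) \<Longrightarrow> M \<subseteq> C_sub \<Gamma>" by auto
qed

subsection \<open>Local finiteness\<close>

text \<open>\<open>\<Delta> f\<close> is a finite sum of tensors, so all
  \<open>\<psi> \<rhd> f\<close> lie in the span of their first components. Adding the orbit of
  \<open>parity f\<close> makes the result graded.\<close>

lemma finite_generation:
  fixes f :: "('k, 'm :: {finite, linorder}, 'n :: {finite, linorder}) KG"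
  shows "\<exists>G S. subsupermodule G \<and> f \<in> G \<and> finite S \<and> G \<subseteq> coords.span S \<and>
    (\<forall>M. subsupermodule M \<longrightarrow> f \<in> M \<longrightarrow> G \<subseteq> M)"
proof -
  define G where "G = {\<psi> \<rhd> f + \<phi> \<rhd> parity f | \<psi> \<phi>. linfun \<psi> \<and> linfun \<phi>}"
  have G_I: "\<psi> \<rhd> f + \<phi> \<rhd> parity f \<in> G" if "linfun \<psi>" "linfun \<phi>" for \<psi> \<phi>
    using that unfolding G_def by blast
  have span: "\<exists>S. finite S \<and> (\<forall>\<psi>. linfun \<psi> \<longrightarrow> \<psi> \<rhd> g \<in> coords.span S)" for g :: "('k, 'm, 'n) KG"
  proof -
    have sp: "\<Delta> g \<in> UNIV \<otimes>\<^sub>s UNIV" using tensor_span[of "\<Delta> g"] by (simp add: tensor_space_def)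
    obtain ts where ts: "\<Delta> g = (\<Sum>(a, b)\<leftarrow>ts. a \<otimes> b)"
      using tensor_space_list[OF coords.subspace_UNIV sp] by blast
    have "con \<psi> (\<Sum>(a, b)\<leftarrow>ts. a \<otimes> b) \<in> coords.span (fst ` set ts)" if "linfun \<psi>" for \<psi>
    proof (induction ts)
      case Nil
      then show ?case by (simp add: con_linear coords.span_zero)
    next
      case (Cons t ts)
      have "con \<psi> (\<Sum>(a, b)\<leftarrow>ts. a \<otimes> b) \<in> coords.span (fst ` set (t # ts))"
        using Cons coords.span_mono[of "fst ` set ts" "fst ` set (t # ts)"] by auto
      moreover have "scale (\<psi> (snd t)) (fst t) \<in> coords.span (fst ` set (t # ts))"
        by (intro coords.span_scale coords.span_base) auto
      ultimately show ?case
        by (cases t) (auto simp: con_linear con_tensor[OF that] intro: coords.span_add)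
    qed
    then show ?thesis unfolding act_def ts by (intro exI[of _ "fst ` set ts"]) auto
  qed
  obtain S1 S2 where S: "finite S1" "\<And>\<psi>. linfun \<psi> \<Longrightarrow> \<psi> \<rhd> f \<in> coords.span S1"
    "finite S2" "\<And>\<psi>. linfun \<psi> \<Longrightarrow> \<psi> \<rhd> parity f \<in> coords.span S2"
    using span[of f] span[of "parity f"] by blast
  have "subsupermodule G"
    unfolding subsupermodule_iff[OF two]
  proof (intro conjI ballI allI impI)
    show "coords.subspace G"
      unfolding coords.subspace_def
    proof (intro conjI ballI allI)
      show "0 \<in> G" using G_I[OF linfun_zero linfun_zero] by (simp add: act_zero_functional)
      fix x assume "x \<in> G"
      then obtain \<psi> \<phi> where x: "linfun \<psi>" "linfun \<phi>" "x = \<psi> \<rhd> f + \<phi> \<rhd> parity f" unfolding G_def by blast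
      show "scale c x \<in> G" for c
        using G_I[OF linfun_scale[OF x(1)] linfun_scale[OF x(2)], of c c]
        by (simp add: x(3) act_def con_scale_functional x(1,2) coords.scale_right_distrib)
      fix y assume "y \<in> G"
      then obtain \<psi>' \<phi>' where y: "linfun \<psi>'" "linfun \<phi>'" "y = \<psi>' \<rhd> f + \<phi>' \<rhd> parity f" unfolding G_def by blast
      show "x + y \<in> G"
        using G_I[OF linfun_add[OF x(1) y(1)] linfun_add[OF x(2) y(2)]]
        by (simp add: x(3) y(3) act_def con_add_functional x(1,2) y(1,2) algebra_simps)
    qed
    fix x assume "x \<in> G"
    then obtain \<psi> \<phi> where x: "linfun \<psi>" "linfun \<phi>" "x = \<psi> \<rhd> f + \<phi> \<rhd> parity f" unfolding G_def by blast
    show "parity x \<in> G"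
      using G_I[OF linfun_parity[OF x(2)] linfun_parity[OF x(1)]]
      by (simp add: x alg_homD(1)[OF alg_hom_parity] parity_act add.commute)
    fix \<theta> :: "('k, 'm, 'n) KG \<Rightarrow> 'k" assume "linfun \<theta>"
    then show "\<theta> \<rhd> x \<in> G"
      using G_I[OF linfun_act[of \<theta> \<psi>] linfun_act[of \<theta> \<phi>]] by (simp add: x act_linear act_act)
  qed
  moreover have "f \<in> G"
    using G_I[OF linfun_counit linfun_zero] by (simp add: act_zero_functional act_counit)
  moreover have "G \<subseteq> coords.span (S1 \<union> S2)"
    using S(2,4) coords.span_mono[of S1 "S1 \<union> S2"] coords.span_mono[of S2 "S1 \<union> S2"]
    unfolding G_def by (auto intro!: coords.span_add)
  moreover have "G \<subseteq> M" if "subsupermodule M" "f \<in> M" for M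
    using subD(3,6,7)[OF that(1)] that(2) unfolding G_def by blast
  ultimately show ?thesis using S(1,3) by (intro exI[of _ G] exI[of _ "S1 \<union> S2"]) auto
qed

lemma dim_strict_mono:
  fixes U W :: "('k, 'm :: {finite, linorder}, 'n :: {finite, linorder}) KG set"
  assumes "coords.subspace U" "coords.subspace W" "U \<subset> W" "W \<subseteq> coords.span S" "finite S"
  shows "coords.dim U < coords.dim W"
proof -
  obtain B where B: "B \<subseteq> U" "coords.independent B" "U \<subseteq> coords.span B"
    using coords.maximal_independent_subset[of U] by blast
  obtain D where D: "B \<subseteq> D" "D \<subseteq> W" "coords.independent D" "W \<subseteq> coords.span D"
    using coords.maximal_independent_subset_extend[of B W] B assms(3) by blast
  have span: "coords.span B = U" "coords.span D = W"
    by (rule coords.span_subspace[OF B(1,3) assms(1)], rule coords.span_subspace[OF D(2,4) assms(2)])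
  have "finite D" using coords.independent_span_bound[OF assms(5) D(3)] D(2) assms(4) by blast
  moreover have "B \<subset> D" using D(1) span assms(3) by blast
  ultimately have "card B < card D" by (rule psubset_card_mono)
  moreover have "coords.dim U = card B" by (rule coords.dim_eq_card[OF _ B(2)]) (metis span(1) coords.span_span)
  moreover have "coords.dim W = card D" by (rule coords.dim_eq_card[OF _ D(3)]) (metis span(2) coords.span_span)
  ultimately show ?thesis by simp
qed

text \<open>Local finiteness leads to a finite-dimensional \<open>G\<close>; among its nonzero
  subsupermodules one of least dimension is simple.\<close>

lemma exists_simple:
  fixes M :: "('k, 'm :: {finite, linorder}, 'n :: {finite, linorder}) KG set"
  assumes M: "subsupermodule M" and "M \<noteq> {0}"
  shows "\<exists>N\<subseteq>M. irreducible_quotient N {0}"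
proof -
  obtain f where f: "f \<in> M" "f \<noteq> 0" using assms subD(2)[OF M] by blast
  obtain G S where G: "subsupermodule G" "f \<in> G" "finite S" "G \<subseteq> coords.span S"
    and min: "\<forall>M. subsupermodule M \<longrightarrow> f \<in> M \<longrightarrow> G \<subseteq> M"
    using finite_generation[of f] by (elim exE conjE)
  from min M f(1) have GM: "G \<subseteq> M" by simp
  define P where "P N \<longleftrightarrow> subsupermodule N \<and> N \<noteq> {0} \<and> N \<subseteq> G" for N
  have "P G" using G f(2) unfolding P_def by blast
  then obtain N where N: "P N" "\<And>N'. P N' \<Longrightarrow> coords.dim N \<le> coords.dim N'"
    using ex_has_least_nat[of P G coords.dim] by blast
  have "subsupermodule {0 :: ('k, 'm, 'n) KG}" by (rule belongs_zero[unfolded belongs_to_def, THEN conjunct1])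
  moreover have "Q = {0} \<or> Q = N" if Q: "subsupermodule Q" "{0} \<subseteq> Q" "Q \<subseteq> N" for Q
  proof (rule ccontr)
    assume *: "\<not> ?thesis"
    then have "coords.dim N \<le> coords.dim Q" using Q N(1) unfolding P_def by (intro N(2)) (auto simp: P_def)
    moreover have "coords.dim Q < coords.dim N"
      by (rule dim_strict_mono[OF subD(1)[OF Q(1)] subD(1) _ _ G(3)])
         (use * Q N(1) G(4) in \<open>auto simp: P_def\<close>)
    ultimately show False by simp
  qed
  ultimately have "irreducible_quotient N {0}"
    using N(1) subD(2)[of N] unfolding irreducible_quotient_def P_def by blast
  then show ?thesis using N(1) GM unfolding P_def by blast
qed

end

section \<open>Gradings\<close>

lemma pm_expand:
  fixes F :: "'g \<Rightarrow>\<^sub>0 'a :: ring_1"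
  shows "F = (\<Sum>k\<in>Poly_Mapping.keys F. Poly_Mapping.single k (Poly_Mapping.lookup F k))"
  by (rule poly_mapping_eqI)
     (simp add: lookup_sum lookup_single when_def sum.If_cases in_keys_iff cong: if_cong)

lemma pm_induct [case_names zero single add]:
  fixes F :: "'g \<Rightarrow>\<^sub>0 'a :: ring_1"
  assumes "P 0" "\<And>k v. P (Poly_Mapping.single k v)" "\<And>a b. P a \<Longrightarrow> P b \<Longrightarrow> P (a + b)"
  shows "P F"
proof -
  have "P (\<Sum>k\<in>A. Poly_Mapping.single k (Poly_Mapping.lookup F k))" for A
    by (induction A rule: infinite_finite_induct) (simp_all add: assms)
  from this[of "Poly_Mapping.keys F"] show ?thesis by (simp only: pm_expand[of F, symmetric])
qed

definition pmap :: "('a :: ring_1 \<Rightarrow> 'b :: ring_1) \<Rightarrow> ('g \<Rightarrow>\<^sub>0 'a) \<Rightarrow> ('g \<Rightarrow>\<^sub>0 'b)" where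
  "pmap h F = Poly_Mapping.map h F"

lemma pmap_props:
  fixes h :: "'a :: ring_1 \<Rightarrow> 'b :: ring_1" and F :: "'c \<Rightarrow>\<^sub>0 'a" and k :: 'c
  assumes "h 0 = 0"
  shows "Poly_Mapping.lookup (pmap h F) k = h (Poly_Mapping.lookup F k)"
    "pmap h (Poly_Mapping.single k v) = Poly_Mapping.single k (h v)" "pmap h (0 :: 'c \<Rightarrow>\<^sub>0 'a) = 0"
proof -
  show *: "Poly_Mapping.lookup (pmap h F) k = h (Poly_Mapping.lookup F k)" for F and k :: 'c
    unfolding pmap_def using assms by (simp add: Poly_Mapping.map.rep_eq when_def)
  show "pmap h (Poly_Mapping.single k v) = Poly_Mapping.single k (h v)"
    by (rule poly_mapping_eqI) (simp add: * lookup_single when_def assms)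
  show "pmap h 0 = (0 :: 'c \<Rightarrow>\<^sub>0 'b)"
    by (rule poly_mapping_eqI) (simp add: * assms)
qed

lemma pmap_hom:
  fixes h :: "'a :: ring_1 \<Rightarrow> 'b :: ring_1" and F G :: "'g :: monoid_add \<Rightarrow>\<^sub>0 'a"
  assumes h: "h 0 = 0" "\<And>x y. h (x + y) = h x + h y" "\<And>x y. h (x * y) = h x * h y"
  shows "pmap h (F + G) = pmap h F + pmap h G" "pmap h (F * G) = pmap h F * pmap h G"
proof -
  show add: "pmap h (F + G) = pmap h F + pmap h G" for F G :: "'g \<Rightarrow>\<^sub>0 'a"
    by (rule poly_mapping_eqI) (simp add: pmap_props[of h, OF h(1)] lookup_add h)
  have "pmap h (Poly_Mapping.single k v * G) = pmap h (Poly_Mapping.single k v) * pmap h G" for k v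
    by (induction G rule: pm_induct)
       (simp_all add: pmap_props[of h, OF h(1)] add distrib_left mult_single h)
  then show "pmap h (F * G) = pmap h F * pmap h G"
    by (induction F rule: pm_induct) (simp_all add: pmap_props[of h, OF h(1)] add distrib_right)
qed

lemma lookup_single0_mult:
  fixes F :: "'g :: monoid_add \<Rightarrow>\<^sub>0 'a :: ring_1"
  shows "Poly_Mapping.lookup (Poly_Mapping.single 0 u * F) g = u * Poly_Mapping.lookup F g"
    "Poly_Mapping.lookup (F * Poly_Mapping.single 0 u) g = Poly_Mapping.lookup F g * u"
  by (induction F rule: pm_induct)
     (simp_all add: mult_single lookup_single when_def lookup_add distrib_left distrib_right)

type_synonym ('g, 'k, 'm, 'n) KGg = "'g \<Rightarrow>\<^sub>0 ('k, 'm, 'n) KG"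

definition pm_part :: "bool \<Rightarrow> ('g \<Rightarrow>\<^sub>0 ('c, 'k :: field, 'm :: {finite, linorder}, 'n :: {finite, linorder}) coords) set" where
  "pm_part p = {F. \<forall>g. Poly_Mapping.lookup F g \<in> part p}"

lemma single_pm_part: "x \<in> part p \<Longrightarrow> Poly_Mapping.single g x \<in> pm_part p"
  by (auto simp: pm_part_def lookup_single when_def part_closed)

abbreviation single0 :: "'k \<Rightarrow> ('g :: ab_group_add, 'k :: field, 'm :: {finite, linorder}, 'n :: {finite, linorder}) KGg" where
  "single0 r \<equiv> Poly_Mapping.single 0 (const r)"

lemma ksign_single: "ksign p q * (Poly_Mapping.single k (v :: 'a :: ring_1)) = Poly_Mapping.single k (ksign p q * v)"
  by (auto simp: ksign_def single_uminus)

lemma single0_props: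
  "single0 1 = 1" "single0 (r + t) = single0 r + single0 t" "single0 (r * t) = single0 r * single0 t"
  "single0 r * a = a * single0 r"
proof -
  show "single0 1 = 1" "single0 (r + t) = single0 r + single0 t" "single0 (r * t) = single0 r * single0 t"
    by (simp_all add: const_hom(1-4) single_add mult_single)
  show "single0 r * a = a * single0 r"
    by (rule poly_mapping_eqI) (simp add: lookup_single0_mult const_hom(5))
qed

lemma pm_part_supercommute:
  fixes F G :: "('g :: ab_group_add, 'k :: field, 'm :: {finite, linorder}, 'n :: {finite, linorder}) KGg"
  assumes "F \<in> pm_part p" "G \<in> pm_part q"
  shows "F * G = ksign p q * (G * F)"
proof -
  have 1: "Poly_Mapping.single k v * G = ksign p q * (G * Poly_Mapping.single k v)" if v: "v \<in> part p" for k v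
  proof -
    let ?S = "\<lambda>l. Poly_Mapping.single l (Poly_Mapping.lookup G l)"
    have *: "Poly_Mapping.single k v * ?S l = ksign p q * (?S l * Poly_Mapping.single k v)" for l
    proof -
      have "Poly_Mapping.lookup G l \<in> part q" using assms(2) by (simp add: pm_part_def)
      from part_supercommute[OF v this] show ?thesis
        by (simp only: mult_single ksign_single add.commute)
    qed
    have "Poly_Mapping.single k v * (\<Sum>l\<in>A. ?S l) = ksign p q * ((\<Sum>l\<in>A. ?S l) * Poly_Mapping.single k v)" for A
      unfolding sum_distrib_left sum_distrib_right by (rule sum.cong[OF refl *])
    from this[of "Poly_Mapping.keys G"] show ?thesis by (simp only: pm_expand[of G, symmetric])
  qed
  let ?S = "\<lambda>l. Poly_Mapping.single l (Poly_Mapping.lookup F l)"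
  have *: "?S l * G = ksign p q * (G * ?S l)" for l
    by (rule 1) (use assms(1) in \<open>simp add: pm_part_def\<close>)
  have "(\<Sum>l\<in>A. ?S l) * G = ksign p q * (G * (\<Sum>l\<in>A. ?S l))" for A
    unfolding sum_distrib_left sum_distrib_right by (rule sum.cong[OF refl *])
  from this[of "Poly_Mapping.keys F"] show ?thesis by (simp only: pm_expand[of F, symmetric])
qed

definition nogr :: "('m, 'n) idx \<Rightarrow> 'g :: ab_group_add" where
  "nogr i = 0"

text \<open>
  The substitution \<open>x\<^sub>i\<^sub>j \<mapsto> t\<^bsup>a i + b j\<^esup> x\<^sub>i\<^sub>j\<close> with values in a group algebra over \<open>K[G]\<close>: left
  multiplication by a torus with weights \<open>a\<close> and right multiplication by one with weights \<open>b\<close>.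
\<close>

fun gr_gen :: "(('m, 'n) idx \<Rightarrow> 'g) \<Rightarrow> (('m, 'n) idx \<Rightarrow> 'g) \<Rightarrow> (unit, 'm, 'n) gen \<Rightarrow>
    ('g :: ab_group_add, 'k :: field, 'm :: {finite, linorder}, 'n :: {finite, linorder}) KGg" where
  "gr_gen a b (Entry u i j) = Poly_Mapping.single (a i + b j) (gen (Entry u i j))"
| "gr_gen a b (Inv_entry u i j) = Poly_Mapping.single (- b i - a j) (gen (Inv_entry u i j))"

lemma gr_gen_part: "gr_gen a b g \<in> pm_part (odd_gen g)"
proof (cases g)
  case (Entry u i j)
  then show ?thesis using single_pm_part[OF gen_in_part[of "Entry u i j"]] by simp
next
  case (Inv_entry u i j)
  then show ?thesis using single_pm_part[OF gen_in_part[of "Inv_entry u i j"]] by simp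
qed

lemma single_sum: "Poly_Mapping.single k (sum f A) = (\<Sum>x\<in>A. Poly_Mapping.single k (f x))"
  by (induction A rule: infinite_finite_induct) (simp_all add: single_add)

lemma admissible_gr:
  fixes a b :: "('m :: {finite, linorder}, 'n :: {finite, linorder}) idx \<Rightarrow> 'g :: ab_group_add"
  shows "admissible (single0 :: 'k :: field \<Rightarrow> _) (gr_gen a b)"
proof (rule admissible_matI[where P = pm_part, OF single0_props pm_part_supercommute gr_gen_part])
  fix c :: unit and i j :: "('m, 'n) idx"
  have "(\<Sum>k\<in>UNIV. gr_gen a b (Entry c i k) * gr_gen a b (Inv_entry c k j) :: ('g, 'k, 'm, 'n) KGg) =
      Poly_Mapping.single (a i - a j) (\<Sum>k\<in>UNIV. gen (Entry c i k) * gen (Inv_entry c k j))"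
    unfolding single_sum by (rule sum.cong) (simp_all add: mult_single)
  then show "(\<Sum>k\<in>UNIV. gr_gen a b (Entry c i k) * gr_gen a b (Inv_entry c k j)) = (of_bool (i = j) :: ('g, 'k, 'm, 'n) KGg)"
    by (simp add: gen_relations(2))
  have "(\<Sum>k\<in>UNIV. gr_gen a b (Inv_entry c i k) * gr_gen a b (Entry c k j) :: ('g, 'k, 'm, 'n) KGg) =
      Poly_Mapping.single (b j - b i) (\<Sum>k\<in>UNIV. gen (Inv_entry c i k) * gen (Entry c k j))"
    unfolding single_sum by (rule sum.cong) (simp_all add: mult_single)
  then show "(\<Sum>k\<in>UNIV. gr_gen a b (Inv_entry c i k) * gr_gen a b (Entry c k j)) = (of_bool (i = j) :: ('g, 'k, 'm, 'n) KGg)"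
    by (simp add: gen_relations(3))
qed

definition gr :: "(('m, 'n) idx \<Rightarrow> 'g) \<Rightarrow> (('m, 'n) idx \<Rightarrow> 'g) \<Rightarrow> ('k, 'm, 'n) KG \<Rightarrow>
    ('g :: ab_group_add, 'k :: field, 'm :: {finite, linorder}, 'n :: {finite, linorder}) KGg" where
  "gr a b = extend single0 (gr_gen a b)"

lemma alg_hom_gr: "alg_hom single0 (gr a b)"
  unfolding gr_def by (rule alg_hom_extend[OF admissible_gr])

lemma gr_of_gen: "gr a b (gen g) = gr_gen a b g"
  unfolding gr_def by (rule extend_hom(1)[OF admissible_gr])

abbreviation component :: "(('m, 'n) idx \<Rightarrow> 'g :: ab_group_add) \<Rightarrow> 'g \<Rightarrow> ('k, 'm, 'n) KG \<Rightarrow>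
    ('k :: field, 'm :: {finite, linorder}, 'n :: {finite, linorder}) KG" where
  "component a g f \<equiv> Poly_Mapping.lookup (gr nogr a f) g"

text \<open>The coefficient of \<open>g\<close> in the restriction of \<open>f\<close> to a torus
  with weights \<open>a\<close>. It is a functional on \<open>K[G]\<close> and so acts on every
  subsupermodule.\<close>

definition weight_coeff :: "(('m :: {finite, linorder}, 'n :: {finite, linorder}) idx \<Rightarrow> 'g :: ab_group_add) \<Rightarrow>
    'g \<Rightarrow> ('k, 'm, 'n) KG \<Rightarrow> 'k :: field" where
  "weight_coeff a g f = counit (component a g f)"

lemma lookup_gr_linear:
  "Poly_Mapping.lookup (gr a b (f + h)) g = Poly_Mapping.lookup (gr a b f) g + Poly_Mapping.lookup (gr a b h) g"
  "Poly_Mapping.lookup (gr a b (scale r f)) g = scale r (Poly_Mapping.lookup (gr a b f) g)"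
  by (simp_all add: alg_homD[OF alg_hom_gr] lookup_add lookup_single0_mult scale_def)

lemma gr_scale: "gr a b (scale r f) = single0 r * gr a b f"
  by (rule alg_homD(8)[OF alg_hom_gr])

lemma linfun_weight_coeff: "linfun (weight_coeff a g)"
  by (simp add: linfun_def weight_coeff_def lookup_gr_linear alg_homD(1-9)[OF alg_hom_counit])

section \<open>Torus translations obtained from the comultiplication\<close>

abbreviation const_counit_map :: "('g :: ab_group_add, 'k :: field, 'm :: {finite, linorder}, 'n :: {finite, linorder}) KGg \<Rightarrow>
    ('g, 'k, 'm, 'n) KGg" where
  "const_counit_map \<equiv> pmap const_counit"

lemma const_counit_props:
  "const_counit 0 = 0" "const_counit (x + y) = const_counit x + const_counit y"
  "const_counit (x * y) = const_counit x * const_counit y"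
  by (simp_all only: alg_homD(1,2,4)[OF alg_hom_counit] const_hom(1-4))

lemma alg_hom_pmap:
  fixes h :: "('k :: field, 'm :: {finite, linorder}, 'n :: {finite, linorder}) KG \<Rightarrow> 'a :: ring_1"
  assumes h: "h 0 = 0" "\<And>x y. h (x + y) = h x + h y" "\<And>x y. h (x * y) = h x * h y"
    and s: "\<And>r. h (const r) = s r"
  shows "alg_hom (\<lambda>r. Poly_Mapping.single 0 (s r)) (\<lambda>f. pmap h (gr a b f))"
  unfolding alg_hom_def
  by (intro conjI allI)
     (simp_all only: alg_homD(1,2)[OF alg_hom_gr] alg_homD(3)[OF alg_hom_gr] pmap_hom[of h, OF h]
       pmap_props(2)[of h, OF h(1)] s)

lemma alg_hom_const_counit_map:
  "alg_hom single0 (\<lambda>f. const_counit_map (gr a b f))"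
  by (rule alg_hom_pmap[OF const_counit_props]) (simp add: alg_homD(3)[OF alg_hom_counit])

lemma const_counit_map_part: "const_counit_map (gr a b (gen g)) \<in> pm_part (odd_gen g)"
  by (cases g)
     (simp_all only: gr_of_gen nogr_def gr_gen.simps pmap_props(2)[of const_counit, OF const_counit_props(1)],
      (rule single_pm_part[OF const_counit_part])+)

lemma alg_hom_single0: "alg_hom single0 (Poly_Mapping.single 0)"
  by (simp add: alg_hom_def single_add mult_single)

text \<open>Restricts the factor \<open>d\<close> to a torus with weights \<open>a\<close> and lets
  a torus with weights \<open>b\<close> act from the right on the other factor. Composed with
  \<open>\<Delta>\<close> it recovers translations of \<open>K[G]\<close> by the torus.\<close>

definition side :: "bool \<Rightarrow> (('m, 'n) idx \<Rightarrow> 'g) \<Rightarrow> (('m, 'n) idx \<Rightarrow> 'g) \<Rightarrow> bool \<Rightarrow> ('k, 'm, 'n) KG \<Rightarrow>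
    ('g :: ab_group_add, 'k :: field, 'm :: {finite, linorder}, 'n :: {finite, linorder}) KGg" where
  "side d a b c = (if c = d then (\<lambda>f. const_counit_map (gr a nogr f)) else gr nogr b)"

lemma side_props: "side d a b c (gen g) \<in> pm_part (odd_gen g)" "alg_hom single0 (side d a b c)"
proof -
  show "side d a b c (gen g) \<in> pm_part (odd_gen g)"
  proof (cases "c = d")
    case True
    show ?thesis unfolding side_def if_P[OF True] by (rule const_counit_map_part)
  next
    case False
    show ?thesis unfolding side_def if_not_P[OF False] gr_of_gen by (rule gr_gen_part)
  qed
  show "alg_hom single0 (side d a b c)"
  proof (cases "c = d")
    case True
    show ?thesis unfolding side_def if_P[OF True] by (rule alg_hom_const_counit_map)
  next
    case False
    show ?thesis unfolding side_def if_not_P[OF False] by (rule alg_hom_gr)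
  qed
qed

lemma admissible_side: "admissible single0 (\<lambda>g. side d a b (factor g) (gen (unit_gen g)))"
  by (rule admissible_join[where P = pm_part, OF single0_props pm_part_supercommute,
        where f = "side d a b"]) (simp_all only: side_props)

lemmas alg_hom_side = alg_hom_extend[OF admissible_side, folded join_def]

lemma delta_simps:
  "single0 0 = 0" "Poly_Mapping.single g (const (of_bool b)) = (if b then Poly_Mapping.single g 1 else 0)"
  by (simp_all add: const_hom(1,2))

lemma right_coact: "join single0 (side True a nogr) (\<Delta> f) = gr nogr a f"
proof -
  have "join single0 (side True a nogr) (\<Delta> (gen g)) = gr nogr a (gen g)" for g
    by (cases g)
       (simp_all add: comult_hom(1) alg_homD(7,2)[OF alg_hom_side] join_gen[OF admissible_side] side_def gr_of_gen nogr_def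
         pmap_props[of const_counit, OF const_counit_props(1)] counit_gen mult_single delta_simps
         if_distrib[of "\<lambda>x. x * _"] if_distrib[of "\<lambda>x. _ * x"] if_distrib[of "Poly_Mapping.single _"] cong: if_cong)
  then show ?thesis
    by (rule alg_hom_eqI[OF alg_hom_comp[OF alg_hom_comult alg_hom_side] alg_hom_gr])
qed

lemma left_coact: "join single0 (side False a b) (\<Delta> f) = gr a b f"
proof -
  have "join single0 (side False a b) (\<Delta> (gen g)) = gr a b (gen g)" for g
    by (cases g)
       (simp_all add: comult_hom(1) alg_homD(7,2)[OF alg_hom_side] join_gen[OF admissible_side] side_def gr_of_gen nogr_def
         pmap_props[of const_counit, OF const_counit_props(1)] counit_gen mult_single delta_simps
         if_distrib[of "\<lambda>x. x * _"] if_distrib[of "\<lambda>x. _ * x"] if_distrib[of "Poly_Mapping.single _"] cong: if_cong)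
  then show ?thesis
    by (rule alg_hom_eqI[OF alg_hom_comp[OF alg_hom_comult alg_hom_side] alg_hom_gr])
qed

text \<open>Translating the unit element from the left or from the right gives the same torus
  element.\<close>

lemma counit_gr_swap:
  fixes f :: "('k :: field, 'm :: {finite, linorder}, 'n :: {finite, linorder}) KG" and a :: "('m, 'n) idx \<Rightarrow> 'g :: ab_group_add"
  shows "pmap counit (gr a nogr f) = pmap counit (gr nogr a f)"
proof -
  have *: "alg_hom (Poly_Mapping.single 0) (\<lambda>f :: ('k, 'm, 'n) KG. pmap counit (gr a b f))"
    for a b :: "('m, 'n) idx \<Rightarrow> 'g"
    by (rule alg_hom_pmap) (simp_all add: alg_homD(1-9)[OF alg_hom_counit])
  show ?thesis
  proof (rule alg_hom_eqI[OF * *])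
    show "pmap counit (gr a nogr (gen g)) = pmap counit (gr nogr a (gen g :: ('k, 'm, 'n) KG))" for g
      by (cases g) (auto simp: gr_of_gen nogr_def pmap_props[of counit, OF alg_homD(4)[OF alg_hom_counit]] counit_gen)
  qed
qed

lemma weight_coeff_left: "counit (Poly_Mapping.lookup (gr a nogr f) g) = weight_coeff a g f"
  using arg_cong[OF counit_gr_swap, of "\<lambda>F. Poly_Mapping.lookup F g" a f]
  by (simp add: pmap_props[of counit, OF alg_homD(4)[OF alg_hom_counit]] weight_coeff_def)

lemma zero_grading: "gr nogr nogr f = Poly_Mapping.single 0 f"
proof (rule alg_hom_eqI[OF alg_hom_gr alg_hom_single0])
  show "gr nogr nogr (gen g) = Poly_Mapping.single 0 (gen g)" for g
    by (cases g) (simp_all add: gr_of_gen nogr_def)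
qed

text \<open>Projections to weight spaces are given by functionals, so a subsupermodule contains the
  weight components of its elements and homomorphisms preserve weights.\<close>

lemma weight_coeff_act:
  fixes f :: "('k :: field, 'm :: {finite, linorder}, 'n :: {finite, linorder}) KG"
  shows "weight_coeff a g \<rhd> f = component a g f"
proof -
  have "con (weight_coeff a g) x = Poly_Mapping.lookup (join single0 (side True a nogr) x) g" for x :: "('k, 'm, 'n) KGG"
  proof (induction x rule: tensor_induct)
    case (tensor u v)
    have "Poly_Mapping.lookup (join single0 (side True a nogr) (u \<otimes> v)) g = u * const (weight_coeff a g v)"
      by (simp add: join_tensor[OF admissible_side side_props(2)] side_def zero_grading lookup_single0_mult
          pmap_props[of const_counit, OF const_counit_props(1)] weight_coeff_left)
    then show ?case
      by (simp add: con_tensor[OF linfun_weight_coeff] scale_def const_hom(5))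
  qed (simp_all add: con_linear alg_homD[OF alg_hom_side] lookup_add)
  then show ?thesis by (simp add: act_def right_coact)
qed

lemma weight_coeff_of_act:
  assumes "linfun \<psi>"
  shows "weight_coeff a g (\<psi> \<rhd> f) = \<psi> (Poly_Mapping.lookup (gr a nogr f) g)"
proof -
  have "weight_coeff a g (con \<psi> x) = \<psi> (Poly_Mapping.lookup (join single0 (side False a nogr) x) g)" for x
  proof (induction x rule: tensor_induct)
    case (tensor u v)
    have "Poly_Mapping.lookup (join single0 (side False a nogr) (u \<otimes> v)) g = scale (weight_coeff a g u) v"
      by (simp add: join_tensor[OF admissible_side side_props(2)] side_def zero_grading lookup_single0_mult
          pmap_props[of const_counit, OF const_counit_props(1)] weight_coeff_left scale_def)
    then show ?case
      by (simp add: con_tensor[OF assms] linfunD(2)[OF assms] linfunD(2)[OF linfun_weight_coeff] mult.commute)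
  qed (simp_all add: con_linear alg_homD[OF alg_hom_side] lookup_add linfunD[OF assms] linfunD[OF linfun_weight_coeff])
  then show ?thesis by (simp add: act_def left_coact)
qed

lemma gr_const_swap: "gr (\<lambda>_. d) nogr f = gr nogr (\<lambda>_. d) f"
proof (rule alg_hom_eqI[OF alg_hom_gr alg_hom_gr])
  show "gr (\<lambda>_. d) nogr (gen g) = gr nogr (\<lambda>_. d) (gen g)" for g
    by (cases g) (simp_all add: gr_of_gen nogr_def)
qed

text \<open>The projection to a degree is an endomorphism of the supercomodule, because by
  \<open>gr_const_swap\<close> it also comes from translation on the other side.\<close>

lemma degree_central:
  assumes "linfun \<psi>"
  shows "component (\<lambda>_. d) g (\<psi> \<rhd> f) = \<psi> \<rhd> component (\<lambda>_. d) g f"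
proof -
  have "component (\<lambda>_. d) g (\<psi> \<rhd> f) = (\<lambda>c. weight_coeff (\<lambda>_. d) g (\<psi> \<rhd> c)) \<rhd> f"
    unfolding weight_coeff_act[symmetric] by (rule act_act[OF assms linfun_weight_coeff])
  also have "(\<lambda>c. weight_coeff (\<lambda>_. d) g (\<psi> \<rhd> c)) = (\<lambda>c. \<psi> (weight_coeff (\<lambda>_. d) g \<rhd> c))"
    by (rule ext) (simp add: weight_coeff_of_act[OF assms] gr_const_swap weight_coeff_act)
  also have "\<dots> \<rhd> f = \<psi> \<rhd> (weight_coeff (\<lambda>_. d) g \<rhd> f)"
    by (rule act_act[OF linfun_weight_coeff assms, symmetric])
  finally show ?thesis by (simp only: weight_coeff_act)
qed

text \<open>\<open>\<phi>\<close> coarsens the weights \<open>a\<close> to \<open>b\<close>. It is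
  used with the identity and with \<open>wt_degree\<close>, which sends a character to its total
  degree. The proof spans \<open>K[G]\<close> by elements homogeneous for both gradings.\<close>

lemma component_homogeneous:
  fixes f :: "('k :: field, 'm :: {finite, linorder}, 'n :: {finite, linorder}) KG"
    and \<phi> :: "'g :: ab_group_add \<Rightarrow> 'h :: ab_group_add"
  assumes \<phi>: "\<phi> 0 = 0" "\<And>x y. \<phi> (x + y) = \<phi> x + \<phi> y" "\<And>i. \<phi> (a i) = b i"
  shows "gr nogr b (component a g f) = Poly_Mapping.single (\<phi> g) (component a g f)"
proof -
  let ?S = "{h :: ('k, 'm, 'n) KG. \<exists>g. gr nogr a h = Poly_Mapping.single g h \<and> gr nogr b h = Poly_Mapping.single (\<phi> g) h}"
  have neg: "\<phi> (- x) = - \<phi> x" for x using \<phi>(2)[of x "- x"] \<phi>(1) by (simp add: minus_unique)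
  have "f \<in> coords.span ?S"
  proof (induction f)
    case (const r)
    have "const r \<in> ?S" by (simp add: alg_homD(3)[OF alg_hom_gr] exI[of _ 0] \<phi>(1))
    then show ?case by (rule coords.span_base)
  next
    case (gen g)
    have "gen g \<in> ?S"
    proof (cases g)
      case (Entry u i j)
      then show ?thesis by (auto simp: gr_of_gen nogr_def \<phi>(3) intro!: exI[of _ "a j"])
    next
      case (Inv_entry u i j)
      then show ?thesis by (auto simp: gr_of_gen nogr_def \<phi>(3) neg intro!: exI[of _ "- a i"])
    qed
    then show ?case by (rule coords.span_base)
  next
    case (plus f h)
    then show ?case by (rule coords.span_add)
  next
    case (times f h)
    show ?case
    proof (rule span_mult[OF times])
      fix x y :: "('k, 'm, 'n) KG"
      assume "x \<in> ?S" "y \<in> ?S"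
      then obtain g g' where "gr nogr a x = Poly_Mapping.single g x" "gr nogr b x = Poly_Mapping.single (\<phi> g) x"
        "gr nogr a y = Poly_Mapping.single g' y" "gr nogr b y = Poly_Mapping.single (\<phi> g') y" by auto
      then have "x * y \<in> ?S"
        by (auto simp: alg_homD(2)[OF alg_hom_gr] mult_single \<phi>(2) intro!: exI[of _ "g + g'"])
      then show "x * y \<in> coords.span ?S" by (rule coords.span_base)
    qed
  qed
  then have "gr nogr b (Poly_Mapping.lookup (gr nogr a f) g) =
      Poly_Mapping.single (\<phi> g) (Poly_Mapping.lookup (gr nogr a f) g)"
  proof (induction rule: coords.span_induct_alt)
    case base
    show ?case by (simp add: alg_homD[OF alg_hom_gr])
  next
    case (step c x y)
    then obtain g' where "gr nogr a x = Poly_Mapping.single g' x" "gr nogr b x = Poly_Mapping.single (\<phi> g') x" by auto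
    then have "gr nogr b (Poly_Mapping.lookup (gr nogr a x) g) =
      Poly_Mapping.single (\<phi> g) (Poly_Mapping.lookup (gr nogr a x) g)"
      by (simp add: lookup_single when_def alg_homD[OF alg_hom_gr])
    with step(2) show ?case
      by (simp only: lookup_gr_linear)
         (simp add: alg_homD(1)[OF alg_hom_gr] gr_scale single_add mult_single, simp add: scale_def)
  qed
  then show ?thesis .
qed

lemma gr_parity:
  fixes f :: "('k :: field, 'm :: {finite, linorder}, 'n :: {finite, linorder}) KG"
  shows "gr a b (parity f) = pmap parity (gr a b f)"
proof -
  have p: "parity 0 = (0 :: ('k, 'm, 'n) KG)" by (simp add: alg_homD[OF alg_hom_parity])
  have "alg_hom single0 (\<lambda>f :: ('k, 'm, 'n) KG. pmap parity (gr a b f))"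
    by (rule alg_hom_pmap) (simp_all add: alg_homD[OF alg_hom_parity])
  then show ?thesis
  proof (rule alg_hom_eqI[OF alg_hom_comp[OF alg_hom_parity alg_hom_gr]])
    show "gr a b (parity (gen g)) = pmap parity (gr a b (gen g :: ('k, 'm, 'n) KG))" for g
      by (cases g) (auto simp: gr_of_gen nogr_def parity_gen alg_homD[OF alg_hom_gr] pmap_props[of parity, OF p] single_uminus)
  qed
qed

section \<open>The induced supermodules\<close>

abbreviation J_ideal :: "('k :: field, 'm :: {finite, linorder}, 'n :: {finite, linorder}) KGG set" where
  "J_ideal \<equiv> borel_ideal \<otimes>\<^sub>s UNIV"

section \<open>Torus weights of the induced supermodules\<close>

fun nmul :: "nat \<Rightarrow> 'g :: ab_group_add \<Rightarrow> 'g" where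
  "nmul 0 x = 0"
| "nmul (Suc n) x = x + nmul n x"

text \<open>The sum of all \<open>\<nu> i\<close> times \<open>a i\<close> in an arbitrary abelian
  group. Positive and negative parts are kept apart as in \<open>borel_character\<close>.\<close>

definition pairing :: "(('m :: finite, 'n :: finite) idx \<Rightarrow> 'g :: ab_group_add) \<Rightarrow> ('m, 'n) weight \<Rightarrow> 'g" where
  "pairing a \<nu> = (\<Sum>i\<in>UNIV. nmul (nat (\<nu> i)) (a i) - nmul (nat (- \<nu> i)) (a i))"

lemma nmul_int: "nmul n (x :: int) = int n * x"
  by (induction n) (simp_all add: algebra_simps)

lemma nmul_minus: "nmul n (- x) = - nmul n x"
  by (induction n) simp_all

lemma nmul_fun: "nmul n f k = nmul n (f k)"
  by (induction n) simp_all

lemma pairing_int: "pairing a \<nu> = (\<Sum>i\<in>UNIV. \<nu> i * a i)" for a :: "_ \<Rightarrow> int"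
  unfolding pairing_def
proof (rule sum.cong[OF refl])
  fix i
  show "nmul (nat (\<nu> i)) (a i) - nmul (nat (- \<nu> i)) (a i) = \<nu> i * a i"
    by (cases "\<nu> i \<ge> 0") (simp_all add: nmul_int)
qed

lemma fun_sum_apply: "sum f A k = (\<Sum>i\<in>A. f i k)" for f :: "'i \<Rightarrow> 'a \<Rightarrow> 'b :: comm_monoid_add"
  by (induction A rule: infinite_finite_induct) simp_all

lemma pairing_unit_wt: "pairing unit_wt \<nu> = \<nu>"
proof
  fix k
  have *: "nmul (nat (\<nu> i)) (unit_wt i) k - nmul (nat (- \<nu> i)) (unit_wt i) k = \<nu> i * of_bool (k = i)" for i
    by (cases "\<nu> i \<ge> 0") (simp_all add: nmul_fun nmul_int unit_wt_def)
  have "pairing unit_wt \<nu> k = (\<Sum>i\<in>UNIV. nmul (nat (\<nu> i)) (unit_wt i) k - nmul (nat (- \<nu> i)) (unit_wt i) k)"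
    unfolding pairing_def using fun_sum_apply[of "\<lambda>i. nmul (nat (\<nu> i)) (unit_wt i) - nmul (nat (- \<nu> i)) (unit_wt i)" UNIV k]
    by (simp add: fun_diff_def)
  also have "\<dots> = \<nu> k"
    unfolding * by (simp add: of_bool_def if_distrib[of "\<lambda>x. _ * x"] cong: if_cong)
  finally show "pairing unit_wt \<nu> k = \<nu> k" .
qed

abbreviation torus_part :: "(('m, 'n) idx \<Rightarrow> 'g) \<Rightarrow> ('k, 'm, 'n) KG \<Rightarrow>
    ('g :: ab_group_add, 'k :: field, 'm :: {finite, linorder}, 'n :: {finite, linorder}) KGg" where
  "torus_part a f \<equiv> const_counit_map (gr a nogr f)"

lemma torus_part_gen:
  "torus_part a (gen (Entry () i j)) = (if i = j then Poly_Mapping.single (a i) 1 else 0)"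
  "torus_part a (gen (Inv_entry () i j)) = (if i = j then Poly_Mapping.single (- a i) 1 else 0)"
  by (simp_all add: gr_of_gen nogr_def pmap_props[of const_counit, OF const_counit_props(1)] counit_gen const_hom(1,2))

lemma torus_part_power:
  assumes "torus_part a (f :: ('k :: field, 'm :: {finite, linorder}, 'n :: {finite, linorder}) KG) = Poly_Mapping.single g 1"
  shows "torus_part a (f ^ n) = Poly_Mapping.single (nmul n g) 1"
proof (induction n)
  case 0
  then show ?case
    by (simp add: alg_homD(9)[OF alg_hom_const_counit_map] const_hom(2))
next
  case (Suc n)
  then show ?case by (simp add: alg_homD(2)[OF alg_hom_const_counit_map] assms mult_single)
qed

lemma torus_part_character:
  fixes a :: "('m :: {finite, linorder}, 'n :: {finite, linorder}) idx \<Rightarrow> 'g :: ab_group_add"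
  shows "torus_part a (borel_character \<nu> :: ('k :: field, 'm, 'n) KG) = Poly_Mapping.single (pairing a \<nu>) 1"
proof -
  have "torus_part a (\<Prod>i\<leftarrow>xs. gen (Entry () i i) ^ nat (\<nu> i) * gen (Inv_entry () i i) ^ nat (- \<nu> i) :: ('k, 'm, 'n) KG) =
      Poly_Mapping.single (\<Sum>i\<leftarrow>xs. nmul (nat (\<nu> i)) (a i) - nmul (nat (- \<nu> i)) (a i)) 1" for xs
  proof (induction xs)
    case Nil
    then show ?case by (simp add: alg_homD(9)[OF alg_hom_const_counit_map] const_hom(2))
  next
    case (Cons i xs)
    have "torus_part a (gen (Entry () i i) ^ nat (\<nu> i) :: ('k, 'm, 'n) KG) = Poly_Mapping.single (nmul (nat (\<nu> i)) (a i)) 1"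
      "torus_part a (gen (Inv_entry () i i) ^ nat (- \<nu> i) :: ('k, 'm, 'n) KG) = Poly_Mapping.single (nmul (nat (- \<nu> i)) (- a i)) 1"
      by (rule torus_part_power, simp add: torus_part_gen)+
    with Cons show ?case
      by (simp add: alg_homD(2)[OF alg_hom_const_counit_map] mult_single nmul_minus)
  qed
  then show ?thesis
    by (simp add: borel_character_def pairing_def sum_list_all_idx)
qed

lemma torus_part_borel_ideal: "f \<in> borel_ideal \<Longrightarrow> torus_part a f = 0"
  unfolding borel_ideal_def
proof (induction rule: coords.span_induct_alt)
  case base
  show ?case by (rule alg_homD(4)[OF alg_hom_const_counit_map])
next
  case (step c x y)
  then show ?case
    by (auto simp: alg_homD(1)[OF alg_hom_const_counit_map] alg_homD(2)[OF alg_hom_const_counit_map]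
        alg_homD(8)[OF alg_hom_const_counit_map] torus_part_gen)
qed

lemma side_tensor: "join single0 (side False a b) (u \<otimes> v) = torus_part a u * gr nogr b v"
  by (simp add: join_tensor[OF admissible_side side_props(2)] side_def)

lemma side_J_ideal: "x \<in> J_ideal \<Longrightarrow> join single0 (side False a b) x = 0"
  unfolding tensor_space_def
proof (induction rule: coords.span_induct_alt)
  case base
  show ?case by (rule alg_homD(4)[OF alg_hom_side])
next
  case (step c x y)
  then show ?case
    by (auto simp: alg_homD(1)[OF alg_hom_side] alg_homD(8)[OF alg_hom_side]
        side_tensor torus_part_borel_ideal)
qed

text \<open>Elements of \<open>H_minus\<close> are the functions with
  \<open>f(b g) = \<nu>(b) f(g)\<close> for \<open>b\<close> in the Borel subgroup; here
  \<open>b\<close> is taken in its torus while a torus element also acts from the right.\<close>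

lemma left_weight:
  assumes "f \<in> H_minus \<nu>"
  shows "gr a b f = Poly_Mapping.single (pairing a \<nu>) 1 * gr nogr b f"
proof -
  have "join single0 (side False a b) (\<Delta> f - borel_character \<nu> \<otimes> f) = 0"
    using assms by (intro side_J_ideal) (simp add: H_minus_def)
  then have "gr a b f = join single0 (side False a b) (borel_character \<nu> \<otimes> f)"
    by (simp add: alg_homD(6)[OF alg_hom_side] left_coact)
  then show ?thesis
    by (simp add: side_tensor torus_part_character)
qed

lemma left_weight_torus:
  assumes "f \<in> H_minus \<nu>"
  shows "gr a nogr f = Poly_Mapping.single (pairing a \<nu>) f"
  using left_weight[OF assms, of a nogr] by (simp add: zero_grading mult_single)

section \<open>Restriction to the torus\<close>

lemma res_T_eq: "res_T f = pmap counit (gr unit_wt nogr f)"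
proof (rule alg_hom_eqI)
  show "alg_hom (Poly_Mapping.single 0) res_T"
    unfolding res_T_def by (rule alg_hom_extend[OF admissible_res])
  show "alg_hom (Poly_Mapping.single 0) (\<lambda>f. pmap counit (gr unit_wt nogr f))"
    by (rule alg_hom_pmap) (simp_all add: alg_homD(1-9)[OF alg_hom_counit])
  show "res_T (gen g) = pmap counit (gr unit_wt nogr (gen g))" for g
    by (cases g) (auto simp: gr_of_gen nogr_def res_T_hom(1) counit_gen
      pmap_props[of counit, OF alg_homD(4)[OF alg_hom_counit]])
qed

lemma lookup_res_T: "Poly_Mapping.lookup (res_T f) \<mu> = weight_coeff unit_wt \<mu> f"
  by (simp add: res_T_eq weight_coeff_left pmap_props[of counit, OF alg_homD(4)[OF alg_hom_counit]])

lemma res_T_H_minus: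
  assumes "f \<in> H_minus \<nu>"
  shows "res_T f = Poly_Mapping.single \<nu> (counit f)"
  by (simp add: res_T_eq left_weight_torus[OF assms] pairing_unit_wt
      pmap_props[of counit, OF alg_homD(4)[OF alg_hom_counit]])

lemma act_right_J_ideal:
  assumes "linfun \<psi>"
  shows "x \<in> J_ideal \<Longrightarrow> act_right \<psi> x \<in> J_ideal"
  unfolding tensor_space_def
proof (induction rule: coords.span_induct_alt)
  case base
  show ?case by (simp add: act_right_linear coords.span_zero)
next
  case (step c x y)
  then have "act_right \<psi> x \<in> {a \<otimes> b |a b. a \<in> borel_ideal \<and> b \<in> UNIV}"
    by (fastforce simp: act_right_tensor[OF assms])
  with step show ?case
    by (auto simp: act_right_linear intro!: coords.span_add coords.span_scale intro: coords.span_base)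
qed

lemma parity_borel_ideal: "f \<in> borel_ideal \<Longrightarrow> parity f \<in> borel_ideal"
  unfolding borel_ideal_def
proof (induction rule: coords.span_induct_alt)
  case base
  show ?case by (simp add: alg_homD(4)[OF alg_hom_parity] coords.span_zero)
next
  case (step c x y)
  then obtain a b i j where x: "x = a * gen (Entry () i j) * b" "i < j" by auto
  have "parity x = scale (if odd_gen (Entry () i j) then - 1 else 1) (parity a * gen (Entry () i j) * parity b)"
    unfolding x(1) alg_homD(2)[OF alg_hom_parity] parity_gen by (simp add: scale_minus_one)
  moreover have "parity a * gen (Entry () i j) * parity b \<in> coords.span {a * gen (Entry () i j) * b | a b i j. i < j}"
    by (rule coords.span_base) (use x(2) in blast)
  ultimately have "parity x \<in> coords.span {a * gen (Entry () i j) * b | a b i j. i < j}"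
    by (simp only: coords.span_scale)
  with step show ?case
    by (simp add: alg_homD(1)[OF alg_hom_parity] alg_homD(8)[OF alg_hom_parity] coords.span_add coords.span_scale flip: scale_def)
qed

lemma parity_J_ideal: "x \<in> J_ideal \<Longrightarrow> parity x \<in> J_ideal"
  unfolding tensor_space_def
proof (induction rule: coords.span_induct_alt)
  case base
  show ?case by (simp add: alg_homD(4)[OF alg_hom_parity] coords.span_zero)
next
  case (step c x y)
  then have "parity x \<in> {a \<otimes> b |a b. a \<in> borel_ideal \<and> b \<in> UNIV}"
    using parity_borel_ideal by (fastforce simp: parity_tensor)
  with step show ?case
    by (auto simp: alg_homD(1)[OF alg_hom_parity] alg_homD(8)[OF alg_hom_parity] simp flip: scale_def
      intro!: coords.span_add coords.span_scale intro: coords.span_base)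
qed

lemma power_even_part: "f \<in> part False \<Longrightarrow> f ^ n \<in> part False"
proof (induction n)
  case 0
  show ?case by (simp add: one_in_part)
next
  case (Suc n)
  then show ?case using part_mult[of f False "f ^ n" False] by simp
qed

lemma prod_list_even_part: "(\<And>x. x \<in> set xs \<Longrightarrow> x \<in> part False) \<Longrightarrow> prod_list xs \<in> part False"
proof (induction xs)
  case Nil
  show ?case by (simp add: one_in_part)
next
  case (Cons x xs)
  then show ?case using part_mult[of x False "prod_list xs" False] by simp
qed

lemma borel_character_part: "borel_character \<nu> \<in> part False"
proof -
  have "gen (Entry () i i) \<in> part False" "gen (Inv_entry () i i) \<in> part False" for i
    using gen_in_part[of "Entry () i i"] gen_in_part[of "Inv_entry () i i"] by simp_all
  then have "gen (Entry () i i) ^ n * gen (Inv_entry () i i) ^ l \<in> part False" for i n l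
    using part_mult[OF power_even_part power_even_part] by fastforce
  then show ?thesis
    unfolding borel_character_def by (intro prod_list_even_part) auto
qed

lemma H_minus_subspace:
  "coords.subspace (H_minus \<nu> :: ('k :: field, 'm :: {finite, linorder}, 'n :: {finite, linorder}) KG set)"
proof -
  have J: "coords.subspace (J_ideal :: ('k, 'm, 'n) KGG set)" unfolding tensor_space_def by (rule coords.subspace_span)
  have "\<Delta> (a + b) - borel_character \<nu> \<otimes> (a + b) =
      (\<Delta> a - borel_character \<nu> \<otimes> a) + (\<Delta> b - borel_character \<nu> \<otimes> b)"
    "\<Delta> (scale r a) - borel_character \<nu> \<otimes> (scale r a) = scale r (\<Delta> a - borel_character \<nu> \<otimes> a)"
    "\<Delta> 0 - borel_character \<nu> \<otimes> 0 = 0" for a b :: "('k, 'm, 'n) KG" and r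
    by (simp_all add: alg_homD(1,4)[OF alg_hom_comult] alg_homD(8)[OF alg_hom_comult] tensor_add
        coords.scale_right_diff_distrib flip: scale_def)
  then show ?thesis
    unfolding coords.subspace_def H_minus_def
    using coords.subspace_add[OF J] coords.subspace_scale[OF J] coords.subspace_0[OF J]
    by (simp add: alg_homD(4)[OF alg_hom_comult] tensor_add(6))
qed

text \<open>The defining condition concerns left translations, while the supercomodule structure
  comes from right translations; the two commute.\<close>

lemma H_minus_subsupermodule:
  assumes "(2 :: 'k :: field) \<noteq> 0"
  shows "subsupermodule (H_minus \<nu> :: ('k, 'm :: {finite, linorder}, 'n :: {finite, linorder}) KG set)"
  unfolding subsupermodule_iff[OF assms]
proof (intro conjI ballI allI impI)
  show "coords.subspace (H_minus \<nu>)" by (rule H_minus_subspace)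
  fix f :: "('k, 'm, 'n) KG" assume f: "f \<in> H_minus \<nu>"
  have "parity (\<Delta> f - borel_character \<nu> \<otimes> f) \<in> J_ideal"
    using f by (intro parity_J_ideal) (simp add: H_minus_def)
  moreover have "parity (\<Delta> f) = \<Delta> (parity f)"
    by (rule hom_parity[OF alg_hom_comult comult_gen_part, symmetric])
  ultimately show "parity f \<in> H_minus \<nu>"
    by (simp add: alg_homD(6)[OF alg_hom_parity] parity_tensor parity_on_part[OF borel_character_part] H_minus_def)
  fix \<psi> :: "('k, 'm, 'n) KG \<Rightarrow> 'k" assume \<psi>: "linfun \<psi>"
  have "act_right \<psi> (\<Delta> f - borel_character \<nu> \<otimes> f) \<in> J_ideal"
    using f by (intro act_right_J_ideal[OF \<psi>]) (simp add: H_minus_def)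
  moreover have "act_right \<psi> (\<Delta> f - borel_character \<nu> \<otimes> f) =
      \<Delta> (\<psi> \<rhd> f) - borel_character \<nu> \<otimes> (\<psi> \<rhd> f)"
    using act_right_linear(1)[of \<psi> "\<Delta> f - borel_character \<nu> \<otimes> f" "borel_character \<nu> \<otimes> f"]
    by (simp add: comult_act[OF \<psi>] act_right_tensor[OF \<psi>])
  ultimately show "\<psi> \<rhd> f \<in> H_minus \<nu>"
    by (simp add: H_minus_def)
qed

lemma L_minus_subset: "L_minus \<nu> \<subseteq> H_minus \<nu>"
  unfolding L_minus_def socle_def
  by (rule coords.span_minimal[OF _ H_minus_subspace]) blast

section \<open>Elements with counit 1, and the degrees that occur in \<open>C_sub\<close>\<close>

lemma exists_linfun:
  assumes "(f :: ('k :: field, 'm :: {finite, linorder}, 'n :: {finite, linorder}) KG) \<noteq> 0"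
  shows "\<exists>\<psi>. linfun \<psi> \<and> \<psi> f \<noteq> 0"
proof -
  obtain B :: "('k, 'm, 'n) KG set" where B: "coords.independent B" "coords.span B = UNIV"
    by (rule coords_basis)
  have "\<exists>v. coords.representation B f v \<noteq> 0"
  proof (rule ccontr)
    assume "\<not> ?thesis"
    then have "f = 0" using coords.sum_nonzero_representation_eq[OF B(1), of f] B(2) by simp
    with assms show False by blast
  qed
  then obtain v where "coords.representation B f v \<noteq> 0" by blast
  then show ?thesis using linfun_representation[OF B, of v] by blast
qed

lemma exists_counit_one:
  fixes N :: "('k :: field, 'm :: {finite, linorder}, 'n :: {finite, linorder}) KG set"
  assumes two: "(2 :: 'k) \<noteq> 0" and N: "subsupermodule N" and "N \<noteq> {0}"
  shows "\<exists>f\<in>N. counit f = 1"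
proof -
  obtain n where n: "n \<in> N" "n \<noteq> 0" using assms subD(2)[OF two N] by blast
  obtain \<psi> where \<psi>: "linfun \<psi>" "\<psi> n \<noteq> 0" using exists_linfun[OF n(2)] by blast
  have "scale (1 / \<psi> n) (\<psi> \<rhd> n) \<in> N"
    by (rule subD(5)[OF two N subD(7)[OF two N n(1) \<psi>(1)]])
  moreover have "counit (scale (1 / \<psi> n) (\<psi> \<rhd> n)) = 1"
    using \<psi>(2) by (simp add: alg_homD(8)[OF alg_hom_counit] counit_act[OF \<psi>(1)])
  ultimately show ?thesis by blast
qed

text \<open>Scalar matrices are central, so the degree seen from the left is also the one seen from the right.\<close>

lemma degree_H_minus:
  assumes "f \<in> H_minus \<nu>"
  shows "gr nogr (\<lambda>_. 1) f = Poly_Mapping.single (wt_degree \<nu>) f"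
proof -
  have "gr (\<lambda>_. 1 :: int) nogr f = Poly_Mapping.single (wt_degree \<nu>) f"
    using left_weight_torus[OF assms, of "\<lambda>_. 1 :: int"] by (simp add: pairing_int wt_degree_def)
  then show ?thesis by (simp only: gr_const_swap)
qed

lemma wt_degree_hom: "wt_degree 0 = 0" "wt_degree (x + y) = wt_degree x + wt_degree y"
  "wt_degree (unit_wt i) = 1"
  by (simp_all add: wt_degree_def sum.distrib unit_wt_def)

text \<open>The elements of \<open>C_sub\<close> whose degree is that of \<open>\<mu>\<close> form a
  subsupermodule by \<open>degree_central\<close>. It is nonzero, as it contains the component of
  \<open>f\<close> of weight \<open>\<mu>\<close>, so it has a simple subsupermodule. This is some
  \<open>L_minus \<nu>\<close> up to parity with \<open>\<nu> \<in> \<Gamma>\<close>, and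
  isomorphisms preserve the degree.\<close>

lemma degree_in_C_sub:
  fixes f :: "('k :: field, 'm :: {finite, linorder}, 'n :: {finite, linorder}) KG"
  assumes two: "(2 :: 'k) \<noteq> 0" and f: "f \<in> C_sub \<Gamma>" and \<mu>: "Poly_Mapping.lookup (res_T f) \<mu> \<noteq> 0"
  shows "wt_degree \<mu> \<in> degree_set \<Gamma>"
proof -
  let ?C = "C_sub \<Gamma> :: ('k, 'm, 'n) KG set" and ?d = "wt_degree \<mu>"
  let ?one = "(\<lambda>_. 1) :: ('m, 'n) idx \<Rightarrow> int"
  have C: "belongs_to \<Gamma> ?C" by (rule C_sub_greatest(1)[OF two])
  then have subC: "subsupermodule ?C" by (simp add: belongs_to_def)
  define g where "g = weight_coeff unit_wt \<mu> \<rhd> f"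
  have "g \<in> ?C" unfolding g_def by (rule subD(7)[OF two subC f linfun_weight_coeff])
  have "counit g \<noteq> 0" using \<mu> by (simp add: g_def counit_act[OF linfun_weight_coeff] lookup_res_T)
  then have "g \<noteq> 0" using alg_homD(4)[OF alg_hom_counit] by metis
  have deg_g: "gr nogr ?one g = Poly_Mapping.single ?d g"
    unfolding g_def weight_coeff_act
    by (rule component_homogeneous) (simp_all only: wt_degree_hom)
  define M where "M = {h \<in> ?C. gr nogr ?one h = Poly_Mapping.single ?d h}"
  have deg_act: "gr nogr ?one (\<psi> \<rhd> h) = Poly_Mapping.single ?d (\<psi> \<rhd> h)"
    if "gr nogr ?one h = Poly_Mapping.single ?d h" "linfun \<psi>" for h \<psi>
  proof -
    have "component ?one ?d (\<psi> \<rhd> h) = \<psi> \<rhd> h"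
      using degree_central[OF that(2), where d = "1 :: int" and g = ?d and f = h] that(1) by simp
    then show ?thesis
      using component_homogeneous[where \<phi> = "\<lambda>x. x" and a = ?one and b = ?one and g = ?d and f = "\<psi> \<rhd> h"] by simp
  qed
  have "subsupermodule M"
    unfolding subsupermodule_iff[OF two]
  proof (intro conjI ballI allI impI)
    show "coords.subspace M"
      unfolding coords.subspace_def M_def
      using subD(2,3,5)[OF two subC]
      by (auto simp: alg_homD(1,4)[OF alg_hom_gr] gr_scale single_add mult_single) (simp_all add: scale_def)
    fix h assume h: "h \<in> M"
    then show "parity h \<in> M"
      using subD(6)[OF two subC] by (auto simp: M_def gr_parity pmap_props[of parity, OF alg_homD(4)[OF alg_hom_parity]])
    fix \<psi> :: "('k, 'm, 'n) KG \<Rightarrow> 'k" assume "linfun \<psi>"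
    with h show "\<psi> \<rhd> h \<in> M"
      using subD(7)[OF two subC] deg_act by (auto simp: M_def)
  qed
  moreover have "M \<noteq> {0}" using \<open>g \<in> ?C\<close> \<open>g \<noteq> 0\<close> deg_g unfolding M_def by blast
  ultimately obtain N where N: "N \<subseteq> M" "irreducible_quotient N {0}"
    using exists_simple[OF two] by blast
  have subN: "subsupermodule N" and "{0} \<subset> N" using N(2) unfolding irreducible_quotient_def by auto
  then obtain n where n: "n \<in> N" "n \<noteq> 0" by blast
  have "N \<subseteq> ?C" using N(1) unfolding M_def by blast
  then obtain \<nu> where \<nu>: "\<nu> \<in> \<Gamma>" "quotient_iso N {0} (L_minus \<nu>)"
    using C N(2) unfolding belongs_to_def by blast
  then obtain d \<phi> where \<phi>: "supermodule_hom d N (L_minus \<nu>) \<phi>" "\<phi> ` N = L_minus \<nu>" "{f \<in> N. \<phi> f = 0} = {0}"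
    unfolding quotient_iso_def by blast
  have "\<phi> n \<noteq> 0" using \<phi>(3) n by blast
  have H: "\<phi> n \<in> H_minus \<nu>" using \<phi>(2) n(1) L_minus_subset by blast
  have "component ?one ?d n = n" using n(1) N(1) unfolding M_def by auto
  then have "weight_coeff ?one ?d \<rhd> n = n" by (simp add: weight_coeff_act)
  moreover have "\<phi> (weight_coeff ?one ?d \<rhd> n) = weight_coeff ?one ?d \<rhd> \<phi> n"
    using \<phi>(1)[unfolded supermodule_hom_iff[OF two subN]] n(1) linfun_weight_coeff by blast
  ultimately have "component ?one ?d (\<phi> n) = \<phi> n" by (simp add: weight_coeff_act)
  then have "Poly_Mapping.lookup (Poly_Mapping.single (wt_degree \<nu>) (\<phi> n)) ?d = \<phi> n"
    by (simp only: degree_H_minus[OF H])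
  then have "wt_degree \<nu> = ?d" using \<open>\<phi> n \<noteq> 0\<close> by (simp add: lookup_single when_def split: if_splits)
  then show ?thesis using \<nu>(1) unfolding degree_set_def by blast
qed

section \<open>Matrices over a ring\<close>

text \<open>Matrices with entries in a noncommutative ring, as a type of class
  \<open>ring_1\<close>, so that power series with matrix coefficients are again a ring.\<close>

typedef ('a, 'i) sqmat = "UNIV :: ('i \<Rightarrow> 'i \<Rightarrow> 'a) set"
  morphisms ent Mat ..

setup_lifting type_definition_sqmat

instantiation sqmat :: (ring_1, finite) ring_1
begin

lift_definition zero_sqmat :: "('a, 'b) sqmat" is "\<lambda>i j. 0" .
lift_definition one_sqmat :: "('a, 'b) sqmat" is "\<lambda>i j. of_bool (i = j)" .
lift_definition plus_sqmat :: "('a, 'b) sqmat \<Rightarrow> ('a, 'b) sqmat \<Rightarrow> ('a, 'b) sqmat" is "\<lambda>A B i j. A i j + B i j" .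
lift_definition minus_sqmat :: "('a, 'b) sqmat \<Rightarrow> ('a, 'b) sqmat \<Rightarrow> ('a, 'b) sqmat" is "\<lambda>A B i j. A i j - B i j" .
lift_definition uminus_sqmat :: "('a, 'b) sqmat \<Rightarrow> ('a, 'b) sqmat" is "\<lambda>A i j. - A i j" .
lift_definition times_sqmat :: "('a, 'b) sqmat \<Rightarrow> ('a, 'b) sqmat \<Rightarrow> ('a, 'b) sqmat"
  is "\<lambda>A B i j. \<Sum>k\<in>UNIV. A i k * B k j" .

instance
proof
  fix A B C :: "('a, 'b) sqmat"
  show "A * B * C = A * (B * C)"
  proof (transfer, intro ext)
    fix A B C :: "'b \<Rightarrow> 'b \<Rightarrow> 'a" and i j
    show "(\<Sum>k\<in>UNIV. (\<Sum>l\<in>UNIV. A i l * B l k) * C k j) = (\<Sum>k\<in>UNIV. A i k * (\<Sum>l\<in>UNIV. B k l * C l j))"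
      unfolding sum_distrib_left sum_distrib_right mult.assoc by (rule sum.swap)
  qed
  show "(0 :: ('a, 'b) sqmat) \<noteq> 1" by transfer (auto simp: fun_eq_iff)
  show "1 * A = A" "A * 1 = A"
    by (transfer, auto simp: of_bool_def if_distrib[of "\<lambda>x. x * _"] if_distrib[of "\<lambda>x. _ * x"] cong: if_cong)+
qed (transfer, auto simp: fun_eq_iff algebra_simps sum.distrib)+

end

lemma ent_simps [simp]: "ent (A + B) i j = ent A i j + ent B i j" "ent (A - B) i j = ent A i j - ent B i j"
  "ent (- A) i j = - ent A i j" "ent 0 i j = 0" "ent 1 i j = of_bool (i = j)"
  by (transfer; simp)+

lemma ent_mult: "ent (A * B) i j = (\<Sum>k\<in>UNIV. ent A i k * ent B k j)"
  by transfer simp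

lemma ent_sum: "ent (sum f S) i j = (\<Sum>x\<in>S. ent (f x) i j)"
  by (induction S rule: infinite_finite_induct) simp_all

lemma sqmat_eqI: "(\<And>i j. ent A i j = ent B i j) \<Longrightarrow> A = B"
  by transfer auto

lemma ent_Mat [simp]: "ent (Mat f) i j = f i j"
  by (simp add: Mat_inverse)

text \<open>The diagonal is counted as lower: the lower factor is to lie in the Borel subgroup and
  the upper one is to be unipotent.\<close>

definition low :: "('a :: ring_1, 'i :: {finite, linorder}) sqmat \<Rightarrow> ('a, 'i) sqmat" where
  "low A = Mat (\<lambda>i j. if j \<le> i then ent A i j else 0)"

definition upp :: "('a :: ring_1, 'i :: {finite, linorder}) sqmat \<Rightarrow> ('a, 'i) sqmat" where
  "upp A = Mat (\<lambda>i j. if i < j then ent A i j else 0)"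

lemma low_upp: "low A + upp A = A"
  by (rule sqmat_eqI) (auto simp: low_def upp_def)


section \<open>Triangular factorisation over formal power series\<close>

lemma fps_two_sided_inverse:
  fixes f :: "'a :: ring_1 fps"
  assumes "fps_nth f 0 = 1"
  shows "\<exists>g. f * g = 1 \<and> g * f = 1 \<and> fps_nth g 0 = 1"
proof -
  have "fps_left_inverse f 1 * f = 1" "f * fps_right_inverse f 1 = 1"
    using fps_left_inverse[of 1 f] fps_right_inverse[of f 1] assms by auto
  moreover have "fps_left_inverse f 1 = fps_right_inverse f 1"
    by (rule fps_left_inverse_eq_fps_right_inverse) (simp_all add: assms)
  ultimately show ?thesis
    by (intro exI[of _ "fps_right_inverse f 1"]) (simp add: fps_lr_inverse_nth_0)
qed

lemma fps_inverse_recursion: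
  fixes f g :: "'a :: ring_1 fps"
  assumes "f * g = 1" "fps_nth f 0 = 1" "n > 0"
  shows "fps_nth g n = - (\<Sum>i=1..n. fps_nth f i * fps_nth g (n - i))"
proof -
  have "(\<Sum>i=0..n. fps_nth f i * fps_nth g (n - i)) = 0"
    using arg_cong[OF assms(1), of "\<lambda>F. fps_nth F n"] assms(3) by (simp add: fps_mult_nth)
  then have "fps_nth g n + (\<Sum>i=1..n. fps_nth f i * fps_nth g (n - i)) = 0"
    by (simp add: sum.atLeast_Suc_atMost assms(2))
  then show ?thesis by (simp add: eq_neg_iff_add_eq_0)
qed

text \<open>With factors \<open>1 + X B\<close> and \<open>1 + X V\<close> the equation
  \<open>(1 + X B) (1 + X V) = 1 + X Z\<close> reads \<open>B + V + X B V = Z\<close>. The recursion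
  compares coefficients; \<open>lu_coeff\<close> gives those of \<open>B + V\<close>, and
  \<open>low\<close> and \<open>upp\<close> separate \<open>B\<close> from \<open>V\<close>.\<close>

function lu_coeff :: "('a :: ring_1, 'i :: {finite, linorder}) sqmat \<Rightarrow> nat \<Rightarrow> ('a, 'i) sqmat" where
  "lu_coeff Z n = (if n = 0 then Z else - (\<Sum>i<n. low (lu_coeff Z i) * upp (lu_coeff Z (n - 1 - i))))"
  by auto
termination by (relation "measure snd") auto

declare lu_coeff.simps [simp del]

definition lu_lower :: "('a :: ring_1, 'i :: {finite, linorder}) sqmat \<Rightarrow> ('a, 'i) sqmat fps" where
  "lu_lower Z = 1 + fps_X * Abs_fps (\<lambda>n. low (lu_coeff Z n))"

definition lu_upper :: "('a :: ring_1, 'i :: {finite, linorder}) sqmat \<Rightarrow> ('a, 'i) sqmat fps" where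
  "lu_upper Z = 1 + fps_X * Abs_fps (\<lambda>n. upp (lu_coeff Z n))"

lemma lu_decomposition: "lu_lower Z * lu_upper Z = 1 + fps_X * fps_const Z"
proof -
  let ?B = "Abs_fps (\<lambda>n. low (lu_coeff Z n))" and ?U = "Abs_fps (\<lambda>n. upp (lu_coeff Z n))"
  have "?B + ?U + fps_X * (?B * ?U) = fps_const Z"
  proof (rule fps_ext)
    fix n
    show "fps_nth (?B + ?U + fps_X * (?B * ?U)) n = fps_nth (fps_const Z) n"
    proof (cases n)
      case 0
      then show ?thesis by (simp add: low_upp lu_coeff.simps[of Z 0])
    next
      case (Suc m)
      have "{..<Suc m} = {0..m}" by auto
      then have "lu_coeff Z (Suc m) + fps_nth (?B * ?U) m = 0"
        by (simp add: lu_coeff.simps[of Z "Suc m"] fps_mult_nth)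
      then show ?thesis using Suc by (simp add: low_upp)
    qed
  qed
  moreover have "lu_lower Z * lu_upper Z = 1 + fps_X * (?B + ?U + fps_X * (?B * ?U))"
  proof -
    have "(fps_X * ?B) * (fps_X * ?U) = fps_X * (fps_X * (?B * ?U))"
    proof -
      have "(fps_X * ?B) * (fps_X * ?U) = fps_X * (?B * fps_X) * ?U" by (simp only: mult.assoc)
      also have "\<dots> = fps_X * (fps_X * ?B) * ?U" by (simp only: fps_mult_fps_X_commute)
      finally show ?thesis by (simp only: mult.assoc)
    qed
    then show ?thesis by (simp add: lu_lower_def lu_upper_def algebra_simps)
  qed
  ultimately show ?thesis by simp
qed

text \<open>Passes from power series with matrix coefficients to matrices of power series.\<close>

definition fent :: "('a :: ring_1, 'i :: finite) sqmat fps \<Rightarrow> 'i \<Rightarrow> 'i \<Rightarrow> 'a fps" where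
  "fent F i j = Abs_fps (\<lambda>n. ent (fps_nth F n) i j)"

lemma fent_mult: "fent (F * G) i j = (\<Sum>k\<in>UNIV. fent F i k * fent G k j)"
proof (rule fps_ext)
  fix n
  have "fps_nth (fent (F * G) i j) n = (\<Sum>l=0..n. \<Sum>k\<in>UNIV. ent (fps_nth F l) i k * ent (fps_nth G (n - l)) k j)"
    by (simp add: fent_def fps_mult_nth ent_sum ent_mult)
  also have "\<dots> = (\<Sum>k\<in>UNIV. \<Sum>l=0..n. ent (fps_nth F l) i k * ent (fps_nth G (n - l)) k j)"
    by (rule sum.swap)
  finally show "fps_nth (fent (F * G) i j) n = fps_nth (\<Sum>k\<in>UNIV. fent F i k * fent G k j) n"
    by (simp add: fps_sum_nth fps_mult_nth fent_def)
qed

lemma fent_one: "fent 1 i j = of_bool (i = j)"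
  by (rule fps_ext) (auto simp: fent_def)

section \<open>Points with values in power series\<close>

definition even_mat :: "(('c, 'k :: field, 'm :: {finite, linorder}, 'n :: {finite, linorder}) coords, ('m, 'n) idx) sqmat \<Rightarrow> bool" where
  "even_mat A \<longleftrightarrow> (\<forall>i j. ent A i j \<in> part (odd_idx i \<noteq> odd_idx j))"

lemma even_mat_mult:
  fixes A B :: "(('c, 'k :: field, 'm :: {finite, linorder}, 'n :: {finite, linorder}) coords, ('m, 'n) idx) sqmat"
  assumes "even_mat A" "even_mat B"
  shows "even_mat (A * B)"
  unfolding even_mat_def ent_mult
proof (intro allI part_closed(4))
  fix i j k :: "('m, 'n) idx"
  note * = assms[unfolded even_mat_def]
  have "((odd_idx i \<noteq> odd_idx k) \<noteq> (odd_idx k \<noteq> odd_idx j)) = (odd_idx i \<noteq> odd_idx j)" by auto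
  with part_mult[OF *(1)[rule_format, of i k] *(2)[rule_format, of k j]]
  show "ent A i k * ent B k j \<in> part (odd_idx i \<noteq> odd_idx j)" by simp
qed

lemma even_mat_sum: "(\<And>x. x \<in> S \<Longrightarrow> even_mat (f x)) \<Longrightarrow> even_mat (sum f S)"
  by (auto simp: even_mat_def ent_sum intro!: part_closed(4))

lemma even_mat_simps: "even_mat A \<Longrightarrow> even_mat (- A)" "even_mat 1"
  "even_mat A \<Longrightarrow> even_mat (low A)" "even_mat A \<Longrightarrow> even_mat (upp A)"
  by (auto simp: even_mat_def low_def upp_def part_closed one_in_part)

definition even_fps_mat :: "(('c, 'k :: field, 'm :: {finite, linorder}, 'n :: {finite, linorder}) coords, ('m, 'n) idx) sqmat fps \<Rightarrow> bool" where
  "even_fps_mat F \<longleftrightarrow> (\<forall>n. even_mat (fps_nth F n))"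

lemma even_fps_mat_mult: "even_fps_mat F \<Longrightarrow> even_fps_mat G \<Longrightarrow> even_fps_mat (F * G)"
  by (auto simp: even_fps_mat_def fps_mult_nth intro!: even_mat_sum even_mat_mult)

lemma even_fps_mat_inverse:
  assumes "f * g = 1" "fps_nth f 0 = 1" "fps_nth g 0 = 1" "even_fps_mat f"
  shows "even_fps_mat g"
proof -
  have "even_mat (fps_nth g n)" for n
  proof (induction n rule: less_induct)
    case (less n)
    show ?case
    proof (cases "n = 0")
      case True
      then show ?thesis by (simp add: assms(3) even_mat_simps)
    next
      case False
      then show ?thesis
        using less assms(4)
        by (auto simp: fps_inverse_recursion[OF assms(1,2)] even_fps_mat_def
            intro!: even_mat_simps(1) even_mat_sum even_mat_mult)
    qed
  qed
  then show ?thesis by (simp add: even_fps_mat_def)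
qed

lemma lu_coeff_even: "even_mat Z \<Longrightarrow> even_mat (lu_coeff Z n)"
proof (induction n rule: less_induct)
  case (less n)
  then show ?case
    by (subst lu_coeff.simps)
       (auto intro!: even_mat_simps(1) even_mat_sum even_mat_mult even_mat_simps(3,4))
qed

lemma even_fps_mat_X: "(\<And>n. even_mat (fps_nth F n)) \<Longrightarrow> even_fps_mat (1 + fps_X * F)"
proof -
  assume *: "\<And>n. even_mat (fps_nth F n)"
  have "even_mat (fps_nth (1 + fps_X * F) n)" for n
    by (cases n) (simp_all add: even_mat_simps *)
  then show ?thesis by (simp add: even_fps_mat_def)
qed

lemma lu_even: "even_mat Z \<Longrightarrow> even_fps_mat (lu_lower Z)" "even_mat Z \<Longrightarrow> even_fps_mat (lu_upper Z)"
  unfolding lu_lower_def lu_upper_def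
  by (rule even_fps_mat_X, simp add: even_mat_simps lu_coeff_even)+

definition fps_part :: "bool \<Rightarrow> ('c, 'k :: field, 'm :: {finite, linorder}, 'n :: {finite, linorder}) coords fps set" where
  "fps_part p = {F. \<forall>n. fps_nth F n \<in> part p}"

lemma fps_part_supercommute:
  fixes F G :: "('c, 'k :: field, 'm :: {finite, linorder}, 'n :: {finite, linorder}) coords fps"
  assumes "F \<in> fps_part p" "G \<in> fps_part q"
  shows "F * G = ksign p q * (G * F)"
proof (rule fps_ext)
  fix n
  have ks: "fps_nth (ksign p q * H) n = ksign p q * fps_nth H n" for H :: "('c, 'k, 'm, 'n) coords fps"
    by (simp add: ksign_def)
  have *: "fps_nth F i * fps_nth G j = ksign p q * (fps_nth G j * fps_nth F i)" for i j
    using assms by (intro part_supercommute) (auto simp: fps_part_def)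
  have "fps_nth (F * G) n = (\<Sum>i=0..n. ksign p q * (fps_nth G (n - i) * fps_nth F i))"
    by (simp only: fps_mult_nth *)
  also have "\<dots> = (\<Sum>i=0..n. ksign p q * (fps_nth G i * fps_nth F (n - i)))"
    by (subst sum.atLeastAtMost_rev) (rule sum.cong, auto)
  also have "\<dots> = fps_nth (ksign p q * (G * F)) n"
    unfolding ks by (simp only: fps_mult_nth sum_distrib_left)
  finally show "fps_nth (F * G) n = fps_nth (ksign p q * (G * F)) n" .
qed

abbreviation fps_scalar :: "'k \<Rightarrow> ('c, 'k :: field, 'm :: {finite, linorder}, 'n :: {finite, linorder}) coords fps" where
  "fps_scalar r \<equiv> fps_const (const r)"

lemma fps_scalar_props: "fps_scalar 1 = 1" "fps_scalar (r + t) = fps_scalar r + fps_scalar t"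
  "fps_scalar (r * t) = fps_scalar r * fps_scalar t" "fps_scalar r * F = F * fps_scalar r"
proof -
  show "fps_scalar 1 = 1" "fps_scalar (r + t) = fps_scalar r + fps_scalar t"
    "fps_scalar (r * t) = fps_scalar r * fps_scalar t"
    by (simp_all only: const_hom(1-4) fps_const_1_eq_1 flip: fps_const_add fps_const_mult)
  show "fps_scalar r * F = F * fps_scalar r"
    by (rule fps_ext) (simp add: const_hom(5))
qed

text \<open>A point of \<open>G\<close> with values in power series over \<open>K[G]\<close>: an
  even invertible supermatrix together with its inverse.\<close>

definition good_pair :: "(('k :: field, 'm :: {finite, linorder}, 'n :: {finite, linorder}) KG, ('m, 'n) idx) sqmat fps \<Rightarrow>
    (('k, 'm, 'n) KG, ('m, 'n) idx) sqmat fps \<Rightarrow> bool" where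
  "good_pair F G \<longleftrightarrow> F * G = 1 \<and> G * F = 1 \<and> even_fps_mat F \<and> even_fps_mat G"

fun point_gen :: "(('k :: field, 'm :: {finite, linorder}, 'n :: {finite, linorder}) KG, ('m, 'n) idx) sqmat fps \<Rightarrow>
    (('k, 'm, 'n) KG, ('m, 'n) idx) sqmat fps \<Rightarrow> (unit, 'm, 'n) gen \<Rightarrow> ('k, 'm, 'n) KG fps" where
  "point_gen F G (Entry u i j) = fent F i j"
| "point_gen F G (Inv_entry u i j) = fent G i j"

definition point :: "(('k :: field, 'm :: {finite, linorder}, 'n :: {finite, linorder}) KG, ('m, 'n) idx) sqmat fps \<Rightarrow>
    (('k, 'm, 'n) KG, ('m, 'n) idx) sqmat fps \<Rightarrow> ('k, 'm, 'n) KG \<Rightarrow> ('k, 'm, 'n) KG fps" where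
  "point F G = extend fps_scalar (point_gen F G)"

lemma point_gen_part: "good_pair F G \<Longrightarrow> point_gen F G g \<in> fps_part (odd_gen g)"
  by (cases g) (auto simp: good_pair_def even_fps_mat_def even_mat_def fps_part_def fent_def)

lemma admissible_point:
  assumes "good_pair F G"
  shows "admissible fps_scalar (point_gen F G)"
proof (rule admissible_matI[where P = fps_part, OF fps_scalar_props fps_part_supercommute point_gen_part[OF assms]])
  show "(\<Sum>k\<in>UNIV. point_gen F G (Entry c i k) * point_gen F G (Inv_entry c k j)) = of_bool (i = j)"
    "(\<Sum>k\<in>UNIV. point_gen F G (Inv_entry c i k) * point_gen F G (Entry c k j)) = of_bool (i = j)" for c i j
    using assms fent_mult[of F G i j] fent_mult[of G F i j] by (simp_all add: good_pair_def fent_one)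
qed

lemma alg_hom_point: "good_pair F G \<Longrightarrow> alg_hom fps_scalar (point F G)"
  unfolding point_def by (rule alg_hom_extend[OF admissible_point])

lemma point_of_gen: "good_pair F G \<Longrightarrow> point F G (gen g) = point_gen F G g"
  unfolding point_def by (rule extend_hom(1)[OF admissible_point])

text \<open>Comultiplication is dual to the product of points: the pair of points, viewed as a
  homomorphism on two factors and composed with \<open>\<Delta>\<close>, is the point
  \<open>F * F'\<close>.\<close>

lemma point_product:
  assumes "good_pair F G" "good_pair F' G'"
  defines "\<Psi> \<equiv> join fps_scalar (\<lambda>c. if c then point F' G' else point F G)"
  shows "alg_hom fps_scalar \<Psi>" "\<Psi> (a \<otimes> b) = point F G a * point F' G' b"
    "good_pair (F * F') (G' * G)" "\<Psi> (\<Delta> f) = point (F * F') (G' * G) f"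
proof -
  let ?f = "\<lambda>c. if c then point F' G' else point F G"
  have adm: "admissible fps_scalar (\<lambda>g. ?f (factor g) (gen (unit_gen g)))"
    by (rule admissible_join[where P = fps_part, OF fps_scalar_props fps_part_supercommute, where f = ?f])
       (simp_all add: alg_hom_point assms(1,2) point_of_gen point_gen_part)
  show hom: "alg_hom fps_scalar \<Psi>"
    unfolding \<Psi>_def join_def by (rule alg_hom_extend[OF adm])
  show "\<Psi> (a \<otimes> b) = point F G a * point F' G' b"
    unfolding \<Psi>_def by (subst join_tensor[OF adm]) (simp_all add: alg_hom_point assms(1,2))
  have "F * F' * (G' * G) = F * (F' * G') * G" "G' * G * (F * F') = G' * (G * F) * F'"
    by (simp_all add: mult.assoc)
  then show gp: "good_pair (F * F') (G' * G)"
    using assms(1,2) by (simp add: good_pair_def even_fps_mat_mult)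
  have "\<Psi> (\<Delta> (gen g)) = point (F * F') (G' * G) (gen g)" for g
    by (cases g)
       (simp_all add: comult_hom(1) alg_homD(7,2)[OF hom] join_gen[OF adm, folded \<Psi>_def] point_of_gen assms(1,2) gp fent_mult)
  then show "\<Psi> (\<Delta> f) = point (F * F') (G' * G) f"
    by (rule alg_hom_eqI[OF alg_hom_comp[OF alg_hom_comult hom] alg_hom_point[OF gp]])
qed

text \<open>A lower triangular point kills \<open>borel_ideal\<close>, so the condition defining
  \<open>H_minus\<close> can be evaluated there and gives
  \<open>f(b g) = \<nu>(b) f(g)\<close>.\<close>

lemma point_borel:
  assumes gp: "good_pair F G" "good_pair F' G'" and lower: "\<And>i j. i < j \<Longrightarrow> fent F i j = 0"
    and f: "f \<in> H_minus \<nu>"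
  shows "point (F * F') (G' * G) f = point F G (borel_character \<nu>) * point F' G' f"
proof -
  define \<Psi> where "\<Psi> = join fps_scalar (\<lambda>c. if c then point F' G' else point F G)"
  note \<Psi> = point_product[OF gp, folded \<Psi>_def]
  have ideal: "point F G x = 0" if "x \<in> borel_ideal" for x
    using that unfolding borel_ideal_def
  proof (induction rule: coords.span_induct_alt)
    case base
    show ?case by (rule alg_homD(4)[OF alg_hom_point[OF gp(1)]])
  next
    case (step c x y)
    then show ?case
      by (auto simp: alg_homD(1)[OF alg_hom_point[OF gp(1)]] alg_homD(2)[OF alg_hom_point[OF gp(1)]]
          alg_homD(8)[OF alg_hom_point[OF gp(1)]] point_of_gen[OF gp(1)] lower)
  qed
  have J: "\<Psi> x = 0" if "x \<in> J_ideal" for x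
    using that unfolding tensor_space_def
  proof (induction rule: coords.span_induct_alt)
    case base
    show ?case by (rule alg_homD(4)[OF \<Psi>(1)])
  next
    case (step c x y)
    then show ?case
      by (auto simp: alg_homD(1)[OF \<Psi>(1)] alg_homD(8)[OF \<Psi>(1)] \<Psi>(2) ideal)
  qed
  have "\<Psi> (\<Delta> f - borel_character \<nu> \<otimes> f) = 0"
    by (rule J) (use f in \<open>simp add: H_minus_def\<close>)
  then show ?thesis by (simp add: alg_homD(6)[OF \<Psi>(1)] \<Psi>(2,4))
qed

subsection \<open>Unipotent points\<close>

lemma lookup_single_mult:
  fixes F :: "int \<Rightarrow>\<^sub>0 'a :: ring_1"
  shows "Poly_Mapping.lookup (Poly_Mapping.single k u * F) m = u * Poly_Mapping.lookup F (m - k)"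
proof (induction F rule: pm_induct)
  case (single l v)
  have "k + l = m \<longleftrightarrow> l = m - k" by auto
  then show ?case by (simp add: mult_single lookup_single when_def)
qed (simp_all add: lookup_add distrib_left)

lemma lookup_mult_sum:
  fixes F G :: "int \<Rightarrow>\<^sub>0 'a :: ring_1"
  shows "Poly_Mapping.lookup (F * G) m =
    (\<Sum>k\<in>Poly_Mapping.keys F. Poly_Mapping.lookup F k * Poly_Mapping.lookup G (m - k))"
proof -
  have "F * G = (\<Sum>k\<in>Poly_Mapping.keys F. Poly_Mapping.single k (Poly_Mapping.lookup F k) * G)"
    using arg_cong[OF pm_expand[of F], of "\<lambda>F. F * G"] by (simp only: sum_distrib_right)
  then show ?thesis by (simp only: lookup_sum lookup_single_mult)
qed

text \<open>A Laurent polynomial that is regular at \<open>t = 0\<close> and takes the value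
  \<open>v\<close> there.\<close>

definition nonneg_with :: "(int \<Rightarrow>\<^sub>0 'a :: ring_1) \<Rightarrow> 'a \<Rightarrow> bool" where
  "nonneg_with F v \<longleftrightarrow> (\<forall>k<0. Poly_Mapping.lookup F k = 0) \<and> Poly_Mapping.lookup F 0 = v"

lemma nonneg_with_mult:
  assumes "nonneg_with F u" "nonneg_with G v"
  shows "nonneg_with (F * G) (u * v)"
proof -
  have "Poly_Mapping.lookup (F * G) m = 0" if "m < 0" for m
    unfolding lookup_mult_sum
  proof (rule sum.neutral, rule ballI)
    fix k assume "k \<in> Poly_Mapping.keys F"
    then have "\<not> k < 0" using assms(1) by (auto simp: nonneg_with_def in_keys_iff)
    then show "Poly_Mapping.lookup F k * Poly_Mapping.lookup G (m - k) = 0"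
      using that assms(2) by (simp add: nonneg_with_def)
  qed
  moreover have "Poly_Mapping.lookup (F * G) 0 = u * v"
  proof -
    have "Poly_Mapping.lookup (F * G) 0 =
      (\<Sum>k\<in>Poly_Mapping.keys F. if k = 0 then Poly_Mapping.lookup F 0 * Poly_Mapping.lookup G 0 else 0)"
      unfolding lookup_mult_sum
    proof (rule sum.cong[OF refl])
      fix k assume "k \<in> Poly_Mapping.keys F"
      then have "\<not> k < 0" using assms(1) by (auto simp: nonneg_with_def in_keys_iff)
      then show "Poly_Mapping.lookup F k * Poly_Mapping.lookup G (0 - k) =
        (if k = 0 then Poly_Mapping.lookup F 0 * Poly_Mapping.lookup G 0 else 0)"
        using assms(2) by (auto simp: nonneg_with_def)
    qed
    then show ?thesis
      using assms by (auto simp: nonneg_with_def in_keys_iff)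
  qed
  ultimately show ?thesis by (simp add: nonneg_with_def)
qed

text \<open>The exponents of a one-parameter subgroup of \<open>T\<close>. They increase strictly
  with the index, so conjugation by it gives every entry above the diagonal a positive
  weight.\<close>

definition idx_rank :: "('m :: {finite, linorder}, 'n :: {finite, linorder}) idx \<Rightarrow> int" where
  "idx_rank i = int (card {j. j < i})"

lemma idx_rank_strict: "i < j \<Longrightarrow> idx_rank i < idx_rank j"
  unfolding idx_rank_def by (simp, rule psubset_card_mono) auto

lemma pmap_point_hom:
  fixes h :: "('k :: field, 'm :: {finite, linorder}, 'n :: {finite, linorder}) KG \<Rightarrow> 'a :: ring_1"
  assumes "alg_hom s h"
  shows "alg_hom (\<lambda>r. Poly_Mapping.single 0 (s r)) (\<lambda>f. pmap h (gr a b f))"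
  by (rule alg_hom_pmap) (simp_all only: alg_homD(1-4)[OF assms])

text \<open>Conjugation by the torus contracts a unipotent point to the unit element.\<close>

lemma point_unipotent:
  fixes f :: "('k :: field, 'm :: {finite, linorder}, 'n :: {finite, linorder}) KG"
  assumes gp: "good_pair F G"
    and F: "\<And>i j. j < i \<Longrightarrow> fent F i j = 0" "\<And>i. fent F i i = 1"
    and G: "\<And>i j. j < i \<Longrightarrow> fent G i j = 0" "\<And>i. fent G i i = 1"
    and inv: "gr (\<lambda>i. - idx_rank i) idx_rank f = Poly_Mapping.single 0 f"
  shows "point F G f = fps_scalar (counit f)"
proof -
  let ?\<kappa> = "\<lambda>f. pmap (point F G) (gr (\<lambda>i. - idx_rank i) idx_rank f)"
  note hom = pmap_point_hom[OF alg_hom_point[OF gp], where a = "\<lambda>i. - idx_rank i" and b = idx_rank]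
  note pm = pmap_props[of "point F G", OF alg_homD(4)[OF alg_hom_point[OF gp]]]
  \<comment> \<open>\<open>?\<kappa> h\<close> is the value of \<open>h\<close> at the conjugated
    point, a Laurent polynomial in the torus parameter. The entry at \<open>i < j\<close> carries
    the exponent \<open>idx_rank j - idx_rank i > 0\<close>, so the limit at parameter 0 exists and
    is the value at the unit element. For \<open>f\<close> itself there is no dependence on the
    parameter.\<close>
  have "nonneg_with (?\<kappa> h) (fps_scalar (counit h))" for h
  proof (induction h)
    case (const r)
    show ?case
      by (simp only: alg_homD(3)[OF hom] alg_homD(3)[OF alg_hom_counit])
         (simp add: nonneg_with_def lookup_single when_def)
  next
    case (gen g)
    show ?case
    proof (cases g)
      case (Entry u i j)
      consider "i < j" | "i = j" | "j < i" by (rule linorder_cases)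
      then show ?thesis
        by cases (use idx_rank_strict[of i j] F in \<open>auto simp: Entry gr_of_gen pm point_of_gen[OF gp] counit_gen
          nonneg_with_def lookup_single lookup_one when_def const_hom(1,2)\<close>)
    next
      case (Inv_entry u i j)
      consider "i < j" | "i = j" | "j < i" by (rule linorder_cases)
      then show ?thesis
        by cases (use idx_rank_strict[of i j] G in \<open>auto simp: Inv_entry gr_of_gen pm point_of_gen[OF gp] counit_gen
          nonneg_with_def lookup_single lookup_one when_def const_hom(1,2)\<close>)
    qed
  next
    case (plus a b)
    then show ?case
      by (simp only: alg_homD(1)[OF hom] alg_homD(1)[OF alg_hom_counit] fps_scalar_props(2))
         (simp add: nonneg_with_def lookup_add)
  next
    case (times a b)
    from nonneg_with_mult[OF this] show ?case
      by (simp only: alg_homD(2)[OF hom] alg_homD(2)[OF alg_hom_counit] fps_scalar_props(3))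
  qed
  from this[of f] show ?thesis by (simp add: inv pm nonneg_with_def)
qed

subsection \<open>The generic point near the unit element\<close>

definition generic :: "(('k :: field, 'm :: {finite, linorder}, 'n :: {finite, linorder}) KG, ('m, 'n) idx) sqmat" where
  "generic = Mat (\<lambda>i j. gen (Entry () i j))"

lemma even_generic:
  "even_mat (generic - 1 :: (('k :: field, 'm :: {finite, linorder}, 'n :: {finite, linorder}) KG, ('m, 'n) idx) sqmat)"
proof -
  have "(gen (Entry () i j) - of_bool (i = j) :: ('k, 'm, 'n) KG) \<in> part (odd_gen (Entry () i j))" for i j
  proof (cases "i = j")
    case True
    have "(gen (Entry () i j) :: ('k, 'm, 'n) KG) \<in> part (odd_gen (Entry () i j))" by (rule gen_in_part)
    then show ?thesis using True by (simp add: part_closed(3) one_in_part)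
  next
    case False
    then show ?thesis by (simp add: gen_in_part del: odd_gen.simps)
  qed
  then show ?thesis by (simp add: even_mat_def generic_def)
qed

lemma lu_points:
  fixes Z :: "(('k :: field, 'm :: {finite, linorder}, 'n :: {finite, linorder}) KG, ('m, 'n) idx) sqmat"
  assumes "even_mat Z"
  obtains B B' U U' where "good_pair B B'" "good_pair U U'" "B * U = 1 + fps_X * fps_const Z"
    "\<And>i j. i < j \<Longrightarrow> fent B i j = 0"
    "\<And>i j. j < i \<Longrightarrow> fent U i j = 0" "\<And>i. fent U i i = 1"
    "\<And>i j. j < i \<Longrightarrow> fent U' i j = 0" "\<And>i. fent U' i i = 1"
proof -
  let ?B = "lu_lower Z" and ?U = "lu_upper Z"
  have B0: "fps_nth ?B 0 = 1" and U0: "fps_nth ?U 0 = 1" by (simp_all add: lu_lower_def lu_upper_def)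
  obtain B' where B': "?B * B' = 1" "B' * ?B = 1" "fps_nth B' 0 = 1" using fps_two_sided_inverse[OF B0] by blast
  obtain U' where U': "?U * U' = 1" "U' * ?U = 1" "fps_nth U' 0 = 1" using fps_two_sided_inverse[OF U0] by blast
  have gB: "good_pair ?B B'"
    unfolding good_pair_def using B' lu_even(1)[OF assms] even_fps_mat_inverse[OF B'(1) B0 B'(3)] by blast
  have gU: "good_pair ?U U'"
    unfolding good_pair_def using U' lu_even(2)[OF assms] even_fps_mat_inverse[OF U'(1) U0 U'(3)] by blast
  have Un: "ent (fps_nth ?U n) i j = (if n = 0 then of_bool (i = j) else if i < j then ent (lu_coeff Z (n - 1)) i j else 0)" for n i j
    by (cases n) (simp_all add: lu_upper_def upp_def)
  \<comment> \<open>The higher coefficients of the upper factor are strictly upper triangular, and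
    the recursion for the inverse passes this on to its higher coefficients.\<close>
  have U'n: "ent (fps_nth U' n) i j = 0" if "n > 0" "j \<le> i" for n i j
    using that
  proof (induction n arbitrary: i j rule: less_induct)
    case (less n)
    have "ent (fps_nth ?U l) i k * ent (fps_nth U' (n - l)) k j = 0" if l: "1 \<le> l" "l \<le> n" for l k
    proof (cases "i < k")
      case True
      then have "ent (fps_nth U' (n - l)) k j = 0"
      proof (cases "n - l = 0")
        case True
        then show ?thesis using \<open>i < k\<close> less.prems by (auto simp: U'(3))
      next
        case False
        then show ?thesis using \<open>i < k\<close> less.prems l by (intro less.IH) auto
      qed
      then show ?thesis by simp
    next
      case False
      then show ?thesis using l by (simp add: Un)
    qed
    then show ?case
      using less.prems(1) by (simp add: fps_inverse_recursion[OF U'(1) U0] ent_sum ent_mult)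
  qed
  show ?thesis
  proof (rule that[OF gB gU lu_decomposition])
    show "fent ?B i j = 0" if ij: "i < j" for i j
    proof (rule fps_ext)
      have "\<not> j \<le> i" using ij by simp
      then show "fps_nth (fent ?B i j) n = fps_nth 0 n" for n
        using ij by (cases n) (auto simp: fent_def lu_lower_def low_def)
    qed
    show "fent ?U i j = 0" if "j < i" for i j
      by (rule fps_ext) (use that in \<open>auto simp: fent_def Un\<close>)
    show "fent ?U i i = 1" for i
      by (rule fps_ext) (auto simp: fent_def Un)
    show "fent U' i j = 0" if "j < i" for i j
    proof (rule fps_ext)
      show "fps_nth (fent U' i j) n = fps_nth 0 n" for n
        using that U'n[of n j i] by (cases "n = 0") (auto simp: fent_def U'(3))
    qed
    show "fent U' i i = 1" for i
    proof (rule fps_ext)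
      show "fps_nth (fent U' i i) n = fps_nth 1 n" for n
        using U'n[of n i i] by (cases "n = 0") (auto simp: fent_def U'(3))
    qed
  qed
qed

text \<open>
  The curve \<open>1 + X (x - 1)\<close> leads from the unit element to the generic matrix \<open>x\<close>. Evaluating at
  \<open>X = 1\<close> makes sense only for polynomials in \<open>X\<close>, hence only on the subalgebra generated by the
  entries \<open>x\<^sub>i\<^sub>j\<close>, without those of the inverse matrix.
\<close>

inductive_set entry_alg :: "('k :: field, 'm :: {finite, linorder}, 'n :: {finite, linorder}) KG set" where
  "const r \<in> entry_alg"
| "gen (Entry () i j) \<in> entry_alg"
| "a \<in> entry_alg \<Longrightarrow> b \<in> entry_alg \<Longrightarrow> a + b \<in> entry_alg"
| "a \<in> entry_alg \<Longrightarrow> b \<in> entry_alg \<Longrightarrow> a * b \<in> entry_alg"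

text \<open>\<open>F\<close> is a polynomial and \<open>v\<close> is its value at 1.\<close>

definition sums_to :: "'a :: ring_1 fps \<Rightarrow> 'a \<Rightarrow> bool" where
  "sums_to F v \<longleftrightarrow> (\<exists>N. (\<forall>n\<ge>N. fps_nth F n = 0) \<and> (\<Sum>n<N. fps_nth F n) = v)"

lemma sums_to_shift:
  assumes "\<forall>n\<ge>N. fps_nth F n = (0 :: 'a :: ring_1)" "(\<Sum>n<N. fps_nth F n) = v" "N \<le> M"
  shows "(\<Sum>n<M. fps_nth F n) = v"
proof -
  have "(\<Sum>n<M. fps_nth F n) = (\<Sum>n<N. fps_nth F n)"
    by (rule sum.mono_neutral_right) (use assms in auto)
  with assms(2) show ?thesis by simp
qed

lemma sums_to_add: "sums_to F u \<Longrightarrow> sums_to G v \<Longrightarrow> sums_to (F + G) (u + v)"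
proof -
  assume "sums_to F u" "sums_to G v"
  then obtain N M where *: "\<forall>n\<ge>N. fps_nth F n = 0" "(\<Sum>n<N. fps_nth F n) = u"
    "\<forall>n\<ge>M. fps_nth G n = 0" "(\<Sum>n<M. fps_nth G n) = v" unfolding sums_to_def by blast
  have "(\<Sum>n<max N M. fps_nth F n) = u" "(\<Sum>n<max N M. fps_nth G n) = v"
    by (rule sums_to_shift[OF *(1,2)], simp, rule sums_to_shift[OF *(3,4)], simp)
  with * show ?thesis unfolding sums_to_def by (intro exI[of _ "max N M"]) (simp add: sum.distrib)
qed

lemma sums_to_mult: "sums_to F u \<Longrightarrow> sums_to G v \<Longrightarrow> sums_to (F * G) (u * v)"
proof -
  assume "sums_to F u" "sums_to G v"
  then obtain N M where *: "\<forall>n\<ge>N. fps_nth F n = 0" "(\<Sum>n<N. fps_nth F n) = u"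
    "\<forall>n\<ge>M. fps_nth G n = 0" "(\<Sum>n<M. fps_nth G n) = v" unfolding sums_to_def by blast
  have zero: "fps_nth F i * fps_nth G j = 0" if "\<not> (i < N \<and> j < M)" for i j
    using that *(1,3) by (auto simp: not_less)
  have "fps_nth (F * G) n = 0" if "n \<ge> N + M" for n
    unfolding fps_mult_nth
  proof (rule sum.neutral, rule ballI)
    fix x
    have "\<not> (x < N \<and> n - x < M)" using that by arith
    then show "fps_nth F x * fps_nth G (n - x) = 0" by (rule zero)
  qed
  moreover have "(\<Sum>n<N + M. fps_nth (F * G) n) = u * v"
  proof -
    have "(\<Sum>n<N + M. fps_nth (F * G) n) = (\<Sum>n<N + M. \<Sum>i\<le>n. fps_nth F i * fps_nth G (n - i))"
      by (simp add: fps_mult_nth atLeast0AtMost)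
    also have "\<dots> = (\<Sum>(i, j)\<in>{(i, j). i + j < N + M}. fps_nth F i * fps_nth G j)"
      by (rule sum.triangle_reindex[symmetric])
    also have "\<dots> = (\<Sum>(i, j)\<in>{..<N} \<times> {..<M}. fps_nth F i * fps_nth G j)"
    proof (rule sum.mono_neutral_right)
      show "finite {(i, j). i + j < N + M}"
        by (rule finite_subset[of _ "{..<N + M} \<times> {..<N + M}"]) auto
    qed (use zero in auto)
    also have "\<dots> = u * v"
      by (simp add: sum_product *(2,4)[symmetric] flip: sum.cartesian_product)
    finally show ?thesis .
  qed
  ultimately show ?thesis unfolding sums_to_def by blast
qed

lemma sums_to_const: "sums_to (fps_const c) c"
  unfolding sums_to_def by (rule exI[of _ 1]) simp

lemma sums_to_X: "sums_to (fps_const c + fps_X * fps_const d) (c + d)"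
proof -
  have "fps_nth (fps_const c + fps_X * fps_const d) n = 0" if "n \<ge> 2" for n
    using that by (cases n) auto
  then show ?thesis unfolding sums_to_def by (intro exI[of _ 2]) (simp add: numeral_2_eq_2)
qed

lemma point_sums_to:
  fixes G :: "(('k :: field, 'm :: {finite, linorder}, 'n :: {finite, linorder}) KG, ('m, 'n) idx) sqmat fps"
  assumes gp: "good_pair (1 + fps_X * fps_const (generic - 1)) G" and "f \<in> entry_alg"
  shows "sums_to (point (1 + fps_X * fps_const (generic - 1)) G f) f"
  using assms(2)
proof induction
  case (1 r)
  show ?case by (simp add: alg_homD(3)[OF alg_hom_point[OF gp]] sums_to_const)
next
  case (2 i j)
  let ?F = "1 + fps_X * fps_const (generic - 1) :: (('k, 'm, 'n) KG, ('m, 'n) idx) sqmat fps"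
  have "fent ?F i j = fps_const (of_bool (i = j)) + fps_X * fps_const (gen (Entry () i j) - of_bool (i = j))"
  proof (rule fps_ext)
    fix n
    show "fps_nth (fent ?F i j) n =
      fps_nth (fps_const (of_bool (i = j)) + fps_X * fps_const (gen (Entry () i j) - of_bool (i = j))) n"
      by (cases n) (simp_all add: fent_def generic_def)
  qed
  then show ?case
    using sums_to_X[of "of_bool (i = j)" "gen (Entry () i j) - of_bool (i = j) :: ('k, 'm, 'n) KG"]
    by (simp add: point_of_gen[OF gp])
next
  case (3 a b)
  then show ?case by (simp add: alg_homD(1)[OF alg_hom_point[OF gp]] sums_to_add)
next
  case (4 a b)
  then show ?case by (simp add: alg_homD(2)[OF alg_hom_point[OF gp]] sums_to_mult)
qed

lemma sums_to_zero: "sums_to 0 v \<Longrightarrow> v = 0"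
  unfolding sums_to_def by auto

text \<open>The left and the right weight of \<open>f\<close> cancel under conjugation, so
  \<open>f\<close> takes on the unipotent point \<open>U\<close> its value at the unit element,
  which is 0. Equivariance under \<open>B\<close> makes it vanish on \<open>B * U\<close>, that is,
  along the curve to the generic matrix. The factor \<open>d\<close> brings \<open>f\<close> into
  \<open>entry_alg\<close>, where the curve may be evaluated at its end.\<close>

theorem highest_weight_space:
  fixes f :: "('k :: field, 'm :: {finite, linorder}, 'n :: {finite, linorder}) KG"
  assumes f: "f \<in> H_minus \<nu>"
    and wt: "gr nogr idx_rank f = Poly_Mapping.single (pairing idx_rank \<nu>) f"
    and "counit f = 0" and df: "d * f \<in> entry_alg"
  shows "d * f = 0"
proof -
  obtain B B' U U' :: "(('k, 'm, 'n) KG, ('m, 'n) idx) sqmat fps"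
    where gp: "good_pair B B'" "good_pair U U'" and BU: "B * U = 1 + fps_X * fps_const (generic - 1)"
    and B: "\<And>i j. i < j \<Longrightarrow> fent B i j = 0"
    and U: "\<And>i j. j < i \<Longrightarrow> fent U i j = 0" "\<And>i. fent U i i = 1"
      "\<And>i j. j < i \<Longrightarrow> fent U' i j = 0" "\<And>i. fent U' i i = 1"
    by (rule lu_points[OF even_generic]) blast
  note gpBU = point_product(3)[OF gp]
  have "pairing (\<lambda>i. - idx_rank i) \<nu> = - pairing idx_rank \<nu>"
    by (simp add: pairing_int sum_negf)
  then have "gr (\<lambda>i. - idx_rank i) idx_rank f = Poly_Mapping.single 0 f"
    using left_weight[OF f, of "\<lambda>i. - idx_rank i" idx_rank] by (simp add: wt mult_single)
  from point_unipotent[OF gp(2) U this] have "point U U' f = 0"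
    by (simp add: assms(3) const_hom(1))
  then have "point (B * U) (U' * B') f = 0"
    by (simp add: point_borel[OF gp B f])
  then have "point (B * U) (U' * B') (d * f) = 0"
    by (simp add: alg_homD(2)[OF alg_hom_point[OF gpBU]])
  moreover have "sums_to (point (B * U) (U' * B') (d * f)) (d * f)"
    using point_sums_to[OF gpBU[unfolded BU] df] by (simp add: BU)
  ultimately show ?thesis using sums_to_zero by metis
qed

section \<open>Nilpotency of odd elements\<close>

text \<open>The \<open>k\<close>-th power of the ideal generated by the odd generators, written as a
  span of monomials.\<close>

definition odd_power :: "nat \<Rightarrow> ('c, 'k :: field, 'm :: {finite, linorder}, 'n :: {finite, linorder}) coords set" where
  "odd_power k = coords.span {prod_list (map gen gs) | gs. k \<le> length (filter odd_gen gs)}"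

lemma odd_power_subspace: "coords.subspace (odd_power k)"
  unfolding odd_power_def by (rule coords.subspace_span)

lemma odd_power_mult: "a \<in> odd_power k \<Longrightarrow> b \<in> odd_power l \<Longrightarrow> a * b \<in> odd_power (k + l)"
  unfolding odd_power_def
proof (erule (1) span_mult)
  fix x y :: "('a, 'b, 'c, 'd) coords"
  assume "x \<in> {prod_list (map gen gs) | gs. k \<le> length (filter odd_gen gs)}"
    "y \<in> {prod_list (map gen gs) | gs. l \<le> length (filter odd_gen gs)}"
  then obtain gs hs where "x = prod_list (map gen gs)" "k \<le> length (filter odd_gen gs)"
    "y = prod_list (map gen hs)" "l \<le> length (filter odd_gen hs)" by blast
  then show "x * y \<in> coords.span {prod_list (map gen gs) | gs. k + l \<le> length (filter odd_gen gs)}"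
    by (intro coords.span_base CollectI exI[of _ "gs @ hs"]) auto
qed

lemma odd_power_0: "f \<in> odd_power 0"
proof -
  have "part p \<subseteq> (odd_power 0 :: ('a, 'b, 'c, 'd) coords set)" for p
    unfolding part_def odd_power_def by (rule coords.span_mono) auto
  moreover obtain a b where "a \<in> part False" "b \<in> part True" "f = a + b" using part_decompose by blast
  ultimately show ?thesis using coords.subspace_add[OF odd_power_subspace] by blast
qed

lemma odd_power_gen: "odd_gen g \<Longrightarrow> gen g \<in> odd_power 1"
  unfolding odd_power_def by (rule coords.span_base, rule CollectI, rule exI[of _ "[g]"]) simp

lemma odd_square:
  assumes "(2 :: 'k :: field) \<noteq> 0" "odd_gen g"
  shows "gen g * gen g = (0 :: ('c, 'k, 'm :: {finite, linorder}, 'n :: {finite, linorder}) coords)"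
proof (rule two_cancel[OF assms(1)])
  have "gen g * gen g = - (gen g * gen g :: ('c, 'k, 'm, 'n) coords)"
    using gen_relations(1)[of g g] assms(2) by (simp add: ksign_def)
  then show "gen g * gen g + gen g * gen g = (0 :: ('c, 'k, 'm, 'n) coords)"
    by (simp add: eq_neg_iff_add_eq_0)
qed

lemma odd_repetition:
  assumes "(2 :: 'k :: field) \<noteq> 0" "odd_gen g" "g \<in> set gs"
  shows "gen g * prod_list (map gen gs) = (0 :: ('c, 'k, 'm :: {finite, linorder}, 'n :: {finite, linorder}) coords)"
  using assms(3)
proof (induction gs)
  case (Cons h gs)
  show ?case
  proof (cases "g = h")
    case True
    have "gen g * gen g = (0 :: ('c, 'k, 'm, 'n) coords)" by (rule odd_square[OF assms(1,2)])
    then show ?thesis using True by (simp flip: mult.assoc)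
  next
    case False
    then have "gen g * prod_list (map gen gs) = (0 :: ('c, 'k, 'm, 'n) coords)" using Cons by auto
    moreover have "gen g * (gen h * p) = ksign (odd_gen g) (odd_gen h) * (gen h * (gen g * p))"
      for p :: "('c, 'k, 'm, 'n) coords"
      using arg_cong[OF gen_relations(1)[of g h], of "\<lambda>x. x * p"] by (simp add: mult.assoc)
    ultimately show ?thesis by simp
  qed
qed simp

lemma finite_gens: "finite (UNIV :: (unit, 'm :: finite, 'n :: finite) gen set)"
proof -
  have "(UNIV :: (unit, 'm, 'n) gen set) \<subseteq> (\<lambda>(i, j). Entry () i j) ` UNIV \<union> (\<lambda>(i, j). Inv_entry () i j) ` UNIV"
  proof
    fix g :: "(unit, 'm, 'n) gen"
    show "g \<in> (\<lambda>(i, j). Entry () i j) ` UNIV \<union> (\<lambda>(i, j). Inv_entry () i j) ` UNIV"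
      by (cases g) (auto simp: image_iff)
  qed
  then show ?thesis by (rule finite_subset) simp
qed

text \<open>A monomial with more odd letters than there are generators repeats one of them;
  supercommutation brings the two copies together, and their product is 0.\<close>

lemma odd_nilpotent:
  assumes two: "(2 :: 'k :: field) \<noteq> 0" and "f \<in> odd_power (Suc (card (UNIV :: (unit, 'm, 'n) gen set)))"
  shows "f = (0 :: ('k, 'm :: {finite, linorder}, 'n :: {finite, linorder}) KG)"
proof -
  have 1: "prod_list (map gen gs) = (0 :: ('k, 'm, 'n) KG)" if "\<not> distinct (filter odd_gen gs)" for gs
    using that
  proof (induction gs)
    case (Cons g gs)
    have "odd_gen g \<Longrightarrow> g \<in> set gs \<Longrightarrow> gen g * prod_list (map gen gs) = (0 :: ('k, 'm, 'n) KG)"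
      by (rule odd_repetition[OF two])
    with Cons show ?case by (auto split: if_splits)
  qed simp
  have 2: "\<not> distinct gs" if "card (UNIV :: (unit, 'm, 'n) gen set) < length gs" for gs :: "(unit, 'm, 'n) gen list"
    using that card_mono[OF finite_gens, of "set gs"] by (auto dest: distinct_card)
  show ?thesis using assms(2) unfolding odd_power_def
  proof (induction rule: coords.span_induct_alt)
    case (step c x y)
    then have "x = 0" using 1 2 by (auto simp: Suc_le_eq)
    with step show ?case by simp
  qed simp
qed

section \<open>The even part as a commutative ring\<close>

text \<open>Even elements commute, so determinants of matrices of even elements are available in
  this type.\<close>

typedef (overloaded) ('c, 'k, 'm, 'n) even =
  "part False :: ('c, 'k :: field, 'm :: {finite, linorder}, 'n :: {finite, linorder}) coords set"
  morphisms val Even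
  using part_closed(5) by blast

setup_lifting type_definition_even

lemma even_mult: "a \<in> part False \<Longrightarrow> b \<in> part False \<Longrightarrow> a * b \<in> part False"
  using part_mult[of a False b False] by simp

instantiation even :: (type, field, "{finite, linorder}", "{finite, linorder}") comm_ring_1
begin

lift_definition zero_even :: "('a, 'b, 'c, 'd) even" is 0 by (rule part_closed)
lift_definition one_even :: "('a, 'b, 'c, 'd) even" is 1 by (rule one_in_part)
lift_definition plus_even :: "('a, 'b, 'c, 'd) even \<Rightarrow> ('a, 'b, 'c, 'd) even \<Rightarrow> ('a, 'b, 'c, 'd) even"
  is "(+)" by (rule part_closed)
lift_definition minus_even :: "('a, 'b, 'c, 'd) even \<Rightarrow> ('a, 'b, 'c, 'd) even \<Rightarrow> ('a, 'b, 'c, 'd) even"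
  is "(-)" by (rule part_closed)
lift_definition uminus_even :: "('a, 'b, 'c, 'd) even \<Rightarrow> ('a, 'b, 'c, 'd) even"
  is uminus by (rule part_closed)
lift_definition times_even :: "('a, 'b, 'c, 'd) even \<Rightarrow> ('a, 'b, 'c, 'd) even \<Rightarrow> ('a, 'b, 'c, 'd) even"
  is "(*)" by (rule even_mult)

instance
proof
  fix a b :: "('a, 'b, 'c, 'd) even"
  show "a * b = b * a"
  proof transfer
    fix a b :: "('a, 'b, 'c, 'd) coords"
    assume "a \<in> part False" "b \<in> part False"
    then show "a * b = b * a" using part_supercommute[of a False b False] by simp
  qed
qed (transfer; simp add: algebra_simps)+

end

lemma val_simps [simp]: "val (a + b) = val a + val b" "val (a - b) = val a - val b" "val (- a) = - val a"
  "val (a * b) = val a * val b" "val 0 = 0" "val 1 = 1"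
  by (transfer; simp)+

lemma val_sum: "val (sum f A) = (\<Sum>x\<in>A. val (f x))"
  by (induction A rule: infinite_finite_induct) simp_all

lemma val_power: "val (a ^ n) = val a ^ n"
  by (induction n) simp_all

lemma val_prod_list: "val (prod_list xs) = prod_list (map val xs)"
  by (induction xs) simp_all

lemma val_even: "val a \<in> part False"
  by (rule val)

lemma val_Even: "a \<in> part False \<Longrightarrow> val (Even a) = a"
  by (rule Even_inverse)

lemma val_eqI: "val a = val b \<Longrightarrow> a = b"
  by (simp add: val_inject)

lemma even_central: "a \<in> part False \<Longrightarrow> a * b = b * a"
proof -
  assume a: "a \<in> part False"
  obtain b0 b1 where "b0 \<in> part False" "b1 \<in> part True" "b = b0 + b1" using part_decompose by blast
  then show ?thesis
    using part_supercommute[OF a, of b0 False] part_supercommute[OF a, of b1 True]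
    by (simp add: distrib_left distrib_right)
qed

section \<open>Determinants modulo ideals\<close>

definition is_ideal :: "'a :: comm_ring_1 set \<Rightarrow> bool" where
  "is_ideal I \<longleftrightarrow> 0 \<in> I \<and> (\<forall>a\<in>I. \<forall>b\<in>I. a + b \<in> I) \<and> (\<forall>a\<in>I. \<forall>b. b * a \<in> I)"

definition cong_ideal :: "'a :: comm_ring_1 set \<Rightarrow> 'a \<Rightarrow> 'a \<Rightarrow> bool" where
  "cong_ideal I a b \<longleftrightarrow> a - b \<in> I"

lemma cong_ideal_rules:
  assumes I: "is_ideal I"
  shows "cong_ideal I a a" "cong_ideal I a b \<Longrightarrow> cong_ideal I b a"
    "cong_ideal I a b \<Longrightarrow> cong_ideal I b c \<Longrightarrow> cong_ideal I a c"
    "cong_ideal I a b \<Longrightarrow> cong_ideal I c d \<Longrightarrow> cong_ideal I (a + c) (b + d)"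
    "cong_ideal I a b \<Longrightarrow> cong_ideal I c d \<Longrightarrow> cong_ideal I (a * c) (b * d)"
proof -
  have add: "a + b \<in> I" if "a \<in> I" "b \<in> I" for a b using I that by (auto simp: is_ideal_def)
  have mult: "b * a \<in> I" if "a \<in> I" for a b using I that by (auto simp: is_ideal_def)
  show "cong_ideal I a a" using I by (simp add: cong_ideal_def is_ideal_def)
  show "cong_ideal I a b \<Longrightarrow> cong_ideal I b a" using mult[of "a - b" "- 1"] by (simp add: cong_ideal_def)
  show "cong_ideal I a b \<Longrightarrow> cong_ideal I b c \<Longrightarrow> cong_ideal I a c"
    using add[of "a - b" "b - c"] by (simp add: cong_ideal_def)
  show "cong_ideal I a b \<Longrightarrow> cong_ideal I c d \<Longrightarrow> cong_ideal I (a + c) (b + d)"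
    using add[of "a - b" "c - d"] by (simp add: cong_ideal_def algebra_simps)
  show "cong_ideal I a b \<Longrightarrow> cong_ideal I c d \<Longrightarrow> cong_ideal I (a * c) (b * d)"
    using add[OF mult[of "a - b" c] mult[of "c - d" b]] by (simp add: cong_ideal_def algebra_simps)
qed

lemma cong_ideal_sum:
  assumes "is_ideal I" "\<And>x. x \<in> A \<Longrightarrow> cong_ideal I (f x) (g x)"
  shows "cong_ideal I (sum f A) (sum g A)"
  using assms(2)
  by (induction A rule: infinite_finite_induct)
     (simp_all add: cong_ideal_rules(1)[OF assms(1)] cong_ideal_rules(4)[OF assms(1)])

lemma cong_ideal_prod:
  assumes "is_ideal I" "\<And>x. x \<in> A \<Longrightarrow> cong_ideal I (f x) (g x)"
  shows "cong_ideal I (prod f A) (prod g A)"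
  using assms(2)
  by (induction A rule: infinite_finite_induct)
     (simp_all add: cong_ideal_rules(1)[OF assms(1)] cong_ideal_rules(5)[OF assms(1)])

lemma cong_ideal_det:
  assumes "is_ideal I" "\<And>i j. cong_ideal I (A $ i $ j) (B $ i $ j)"
  shows "cong_ideal I (det A) (det (B :: 'a :: comm_ring_1 ^ 'n ^ 'n))"
  unfolding det_def
  by (intro cong_ideal_sum[OF assms(1)] cong_ideal_rules(5)[OF assms(1)] cong_ideal_prod[OF assms(1)] assms(2)
      cong_ideal_rules(1)[OF assms(1)])

lemma exists_less_perm:
  assumes "p permutes (UNIV :: 'i :: {finite, linorder} set)" "p \<noteq> id"
  shows "\<exists>i. i < p i"
proof (rule ccontr)
  assume "\<not> ?thesis"
  then have le: "p i \<le> i" for i by (simp add: not_less)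
  have "p i = i" for i
  proof (induction "card {j. j < i}" arbitrary: i rule: less_induct)
    case less
    show ?case
    proof (rule ccontr)
      assume "p i \<noteq> i"
      then have "p i < i" using le[of i] by simp
      then have "card {j. j < p i} < card {j. j < i}" by (intro psubset_card_mono) auto
      then have "p (p i) = p i" by (rule less)
      then have "p i = i" using permutes_inj[OF assms(1)] by (auto dest: injD)
      then show False using \<open>p i \<noteq> i\<close> by simp
    qed
  qed
  with assms(2) show False by auto
qed

lemma cong_ideal_det_triangular:
  fixes A :: "(('a :: comm_ring_1, 'i :: {finite, linorder}) vec, 'i) vec"
  assumes I: "is_ideal I" and "\<And>i j. i < j \<Longrightarrow> A $ i $ j \<in> I"
  shows "cong_ideal I (det A) (\<Prod>i\<in>UNIV. A $ i $ i)"
proof -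
  have mult: "b * a \<in> I" if "a \<in> I" for a b using I that by (auto simp: is_ideal_def)
  have zero: "cong_ideal I (of_int (sign p) * (\<Prod>i\<in>UNIV. A $ i $ p i)) 0"
    if p: "p permutes UNIV" "p \<noteq> id" for p
  proof -
    obtain i where "i < p i" using exists_less_perm[OF p] by blast
    then have "A $ i $ p i \<in> I" by (rule assms(2))
    moreover have "(\<Prod>i\<in>UNIV. A $ i $ p i) = (\<Prod>i\<in>UNIV - {i}. A $ i $ p i) * A $ i $ p i"
      by (subst prod.remove[of UNIV i]) (simp_all add: mult.commute)
    ultimately show ?thesis by (simp add: cong_ideal_def mult flip: mult.assoc)
  qed
  have "(\<Prod>i\<in>UNIV. A $ i $ i) = (\<Sum>p\<in>{p :: 'i \<Rightarrow> 'i. p permutes UNIV}. if p = id then (\<Prod>i\<in>UNIV. A $ i $ i) else 0)"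
    by (subst sum.delta) (rule finite, simp add: permutes_id)
  moreover have "cong_ideal I (det A) (\<Sum>p\<in>{p :: 'i \<Rightarrow> 'i. p permutes UNIV}. if p = id then (\<Prod>i\<in>UNIV. A $ i $ i) else 0)"
    unfolding det_def
    by (rule cong_ideal_sum[OF I]) (use zero cong_ideal_rules(1)[OF I] in \<open>auto simp: sign_id\<close>)
  ultimately show ?thesis by simp
qed

lemma det_hom:
  fixes h :: "'a :: comm_ring_1 \<Rightarrow> 'b :: comm_ring_1"
  assumes "\<And>x y. h (x + y) = h x + h y" "\<And>x y. h (x * y) = h x * h y" "h 1 = 1"
  shows "h (det A) = det (\<chi> i j. h (A $ i $ j))"
proof -
  have 0: "h 0 = 0" using assms(1)[of 0 0] by simp
  have neg: "h (- x) = - h x" for x using assms(1)[of x "- x"] 0 by (simp add: minus_unique)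
  have sum: "h (sum f S) = (\<Sum>x\<in>S. h (f x))" for f :: "_ \<Rightarrow> 'a" and S
    by (induction S rule: infinite_finite_induct) (simp_all add: 0 assms)
  have prod: "h (prod f S) = (\<Prod>x\<in>S. h (f x))" for f :: "_ \<Rightarrow> 'a" and S
    by (induction S rule: infinite_finite_induct) (simp_all add: assms)
  have sgn: "h (of_int (sign p)) = of_int (sign p)" for p :: "'c \<Rightarrow> 'c"
    by (simp add: sign_def assms neg)
  show ?thesis unfolding det_def by (simp add: sum prod assms sgn)
qed

lemma det_in_subring:
  fixes A :: "'a :: comm_ring_1 ^ 'i ^ 'i"
  assumes "\<And>x y. P x \<Longrightarrow> P y \<Longrightarrow> P (x + y)" "\<And>x y. P x \<Longrightarrow> P y \<Longrightarrow> P (x * y)" "P 1" "P (- 1)" "P 0"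
    and "\<And>i j. P (A $ i $ j)"
  shows "P (det A)"
proof -
  have sum: "P (sum f S)" if "\<And>x. P (f x)" for f :: "('i \<Rightarrow> 'i) \<Rightarrow> 'a" and S
    by (induction S rule: infinite_finite_induct) (simp_all add: assms that)
  have prod: "P (prod f S)" if "\<And>x. P (f x)" for f :: "'i \<Rightarrow> 'a" and S
    by (induction S rule: infinite_finite_induct) (simp_all add: assms that)
  have sgn: "P (of_int (sign p))" for p :: "'i \<Rightarrow> 'i"
    by (simp add: sign_def assms)
  show ?thesis unfolding det_def
    by (rule sum, rule assms(2)[OF sgn prod], rule assms(6))
qed

text \<open>Cofactors as determinants of \<open>A\<close> with row \<open>k\<close> replaced by a
  unit vector. Multiplying by \<open>A\<close> is then linearity of the determinant in that row, and
  off the diagonal two rows coincide.\<close>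

definition adjugate :: "'a :: comm_ring_1 ^ 'i ^ 'i \<Rightarrow> 'a ^ 'i ^ 'i" where
  "adjugate A = (\<chi> j k. det (\<chi> r. if r = k then axis j 1 else row r A))"

lemma mult_adjugate:
  fixes A :: "'a :: comm_ring_1 ^ 'i ^ 'i"
  shows "(\<Sum>j\<in>UNIV. A $ l $ j * adjugate A $ j $ k) = (if l = k then det A else 0)"
proof -
  have "(\<Sum>j\<in>UNIV. A $ l $ j * adjugate A $ j $ k) =
      (\<Sum>j\<in>UNIV. det (\<chi> r. if r = k then A $ l $ j *s axis j 1 else row r A))"
    unfolding adjugate_def by (subst det_row_mul) simp
  also have "\<dots> = det (\<chi> r. if r = k then (\<Sum>j\<in>UNIV. A $ l $ j *s axis j 1) else row r A)"
    by (rule det_linear_row_sum[symmetric]) simp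
  also have "(\<Sum>j\<in>UNIV. A $ l $ j *s axis j 1) = row l A"
    by (simp add: vec_eq_iff row_def axis_def if_distrib[of "\<lambda>x. _ * x"] cong: if_cong)
  also have "det (\<chi> r. if r = k then row l A else row r A) = (if l = k then det A else 0)"
  proof (cases "l = k")
    case True
    then have "(\<chi> r. if r = k then row l A else row r A) = A"
      by (auto simp: vec_eq_iff row_def)
    then show ?thesis using True by simp
  next
    case False
    then show ?thesis
      by (auto intro!: det_identical_rows[of l k] simp: row_def vec_eq_iff)
  qed
  finally show ?thesis .
qed

lemma one_plus_nilpotent:
  fixes z :: "'a :: comm_ring_1"
  assumes "z ^ n = 0"
  shows "(1 + z) * (\<Sum>i<n. (- z) ^ i) = 1"
proof -
  have "(- z) ^ n = 0" using assms by (simp add: power_minus[of z])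
  then show ?thesis using one_diff_power_eq[of "- z" n] by simp
qed

section \<open>Denominators\<close>

text \<open>
  With the odd entries replaced by 0 the generic matrix is block diagonal, and its determinant is the
  product of those of the blocks. A power of it clears the entries \<open>y\<^sub>i\<^sub>j\<close> of the inverse matrix, because
  the error made by dropping the odd entries is nilpotent.
\<close>

definition even_entry :: "'c \<Rightarrow> ('m, 'n) idx \<Rightarrow> ('m, 'n) idx \<Rightarrow> ('c, 'k :: field, 'm :: {finite, linorder}, 'n :: {finite, linorder}) even" where
  "even_entry c i j = Even (if odd_idx i = odd_idx j then gen (Entry c i j) else 0)"

definition even_inv_entry :: "'c \<Rightarrow> ('m, 'n) idx \<Rightarrow> ('m, 'n) idx \<Rightarrow> ('c, 'k :: field, 'm :: {finite, linorder}, 'n :: {finite, linorder}) even" where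
  "even_inv_entry c i j = Even (if odd_idx i = odd_idx j then gen (Inv_entry c i j) else 0)"

lemma even_gen_part: "\<not> odd_gen g \<Longrightarrow> gen g \<in> part False"
  by (metis gen_in_part)

lemma val_entry: "val (even_entry c i j) = (if odd_idx i = odd_idx j then gen (Entry c i j) else 0)"
  "val (even_inv_entry c i j) = (if odd_idx i = odd_idx j then gen (Inv_entry c i j) else 0)"
  by (simp_all add: even_entry_def even_inv_entry_def val_Even even_gen_part part_closed)

definition body_det :: "('k :: field, 'm :: {finite, linorder}, 'n :: {finite, linorder}) KG itself \<Rightarrow>
    (unit, 'k, 'm, 'n) even" where
  "body_det _ = det (\<chi> i j. even_entry () i j)"

definition body_det_inv :: "('k :: field, 'm :: {finite, linorder}, 'n :: {finite, linorder}) KG itself \<Rightarrow>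
    (unit, 'k, 'm, 'n) even" where
  "body_det_inv _ = det (\<chi> i j. even_inv_entry () i j)"

lemma val_power_odd: "val z \<in> odd_power 1 \<Longrightarrow> val (z ^ n) \<in> odd_power n"
proof (induction n)
  case 0
  show ?case by (rule odd_power_0)
next
  case (Suc n)
  then show ?case using odd_power_mult[of "val z" 1 "val (z ^ n)" n] by simp
qed

text \<open>Modulo odd elements the truncated matrices of the \<open>x\<^sub>i\<^sub>j\<close> and
  of the \<open>y\<^sub>i\<^sub>j\<close> are inverse to each other, so the product of their
  determinants is 1 plus a nilpotent element.\<close>

lemma body_det_unit:
  fixes T :: "('k :: field, 'm :: {finite, linorder}, 'n :: {finite, linorder}) KG itself"
  assumes two: "(2 :: 'k) \<noteq> 0"
  shows "\<exists>u. body_det T * body_det_inv T * u = 1"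
proof -
  let ?I = "{z :: (unit, 'k, 'm, 'n) even. val z \<in> odd_power 1}"
  have I: "is_ideal ?I"
    unfolding is_ideal_def
    using coords.subspace_0[OF odd_power_subspace] coords.subspace_add[OF odd_power_subspace]
      odd_power_mult[OF odd_power_0, of _ 1] by auto
  let ?X = "\<chi> i j. (even_entry () i j :: (unit, 'k, 'm, 'n) even)"
  let ?Y = "\<chi> i j. (even_inv_entry () i j :: (unit, 'k, 'm, 'n) even)"
  have "cong_ideal ?I ((?X ** ?Y) $ i $ j) (mat 1 $ i $ j)" for i j
  proof -
    have "val ((?X ** ?Y) $ i $ j - mat 1 $ i $ j) =
        (\<Sum>k\<in>UNIV. (if odd_idx i = odd_idx k then gen (Entry () i k) else 0) *
          (if odd_idx k = odd_idx j then gen (Inv_entry () k j) else 0)) - of_bool (i = j)"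
      by (simp add: matrix_matrix_mult_def mat_def val_sum val_entry)
    also have "of_bool (i = j) = (\<Sum>k\<in>UNIV. gen (Entry () i k) * gen (Inv_entry () k j) :: ('k, 'm, 'n) KG)"
      by (rule gen_relations(2)[symmetric])
    also have "(\<Sum>k\<in>UNIV. (if odd_idx i = odd_idx k then gen (Entry () i k) else 0) *
          (if odd_idx k = odd_idx j then gen (Inv_entry () k j) else 0)) -
        (\<Sum>k\<in>UNIV. gen (Entry () i k) * gen (Inv_entry () k j)) =
        (\<Sum>k\<in>UNIV. if odd_idx i = odd_idx k \<and> odd_idx k = odd_idx j then 0
          else - (gen (Entry () i k) * gen (Inv_entry () k j)) :: ('k, 'm, 'n) KG)"
      unfolding sum_subtractf[symmetric] by (rule sum.cong) auto
    also have "\<dots> \<in> odd_power 1"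
    proof (rule coords.subspace_sum[OF odd_power_subspace])
      fix k
      have "gen (Entry () i k) * gen (Inv_entry () k j) \<in> (odd_power 1 :: ('k, 'm, 'n) KG set)"
        if "\<not> (odd_idx i = odd_idx k \<and> odd_idx k = odd_idx j)"
      proof (cases "odd_idx i = odd_idx k")
        case True
        with that have "gen (Inv_entry () k j) \<in> (odd_power 1 :: ('k, 'm, 'n) KG set)"
          by (intro odd_power_gen) auto
        from odd_power_mult[OF odd_power_0 this] show ?thesis by simp
      next
        case False
        then have "gen (Entry () i k) \<in> (odd_power 1 :: ('k, 'm, 'n) KG set)"
          by (intro odd_power_gen) auto
        from odd_power_mult[OF this odd_power_0] show ?thesis by simp
      qed
      then show "(if odd_idx i = odd_idx k \<and> odd_idx k = odd_idx j then 0
          else - (gen (Entry () i k) * gen (Inv_entry () k j))) \<in> (odd_power 1 :: ('k, 'm, 'n) KG set)"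
        by (auto intro!: coords.subspace_0[OF odd_power_subspace] coords.subspace_neg[OF odd_power_subspace])
    qed
    finally show ?thesis by (simp add: cong_ideal_def)
  qed
  from cong_ideal_det[OF I this] have "cong_ideal ?I (body_det T * body_det_inv T) 1"
    by (simp add: det_mul body_det_def body_det_inv_def)
  then have z: "val (body_det T * body_det_inv T - 1) \<in> odd_power 1"
    by (simp add: cong_ideal_def)
  define z where "z = body_det T * body_det_inv T - 1"
  let ?n = "Suc (card (UNIV :: (unit, 'm, 'n) gen set))"
  have "val (z ^ ?n) = 0"
    by (rule odd_nilpotent[OF two val_power_odd]) (use z in \<open>simp add: z_def\<close>)
  then have "z ^ ?n = 0" by (intro val_eqI) simp
  from one_plus_nilpotent[OF this] show ?thesis by (intro exI) (simp add: z_def)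
qed

lemma entry_alg_minus_one: "- 1 \<in> entry_alg"
  using entry_alg.intros(1)[of "- 1"] by (simp add: const_minus_1)

lemma entry_alg_0_1: "0 \<in> entry_alg" "1 \<in> entry_alg"
  using entry_alg.intros(1)[of 0] entry_alg.intros(1)[of 1] by (simp_all add: const_hom(1,2))

lemma entry_alg_uminus: "a \<in> entry_alg \<Longrightarrow> - a \<in> entry_alg"
  using entry_alg.intros(4)[OF entry_alg_minus_one, of a] by simp

lemma entry_alg_sum: "(\<And>x. x \<in> A \<Longrightarrow> f x \<in> entry_alg) \<Longrightarrow> sum f A \<in> entry_alg"
  by (induction A rule: infinite_finite_induct) (simp_all add: entry_alg_0_1 entry_alg.intros(3))

lemma entry_alg_power: "a \<in> entry_alg \<Longrightarrow> a ^ n \<in> entry_alg"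
  by (induction n) (simp_all add: entry_alg_0_1 entry_alg.intros(4))

lemma det_entry_alg:
  assumes "\<And>i j. val (A $ i $ j) \<in> entry_alg"
  shows "val (det A) \<in> entry_alg"
  by (rule det_in_subring[where P = "\<lambda>x. val x \<in> entry_alg"])
     (simp_all add: entry_alg.intros(3,4) entry_alg_0_1 entry_alg_minus_one assms)

text \<open>Write the generic matrix as \<open>X0 + X1\<close> with odd part \<open>X1\<close>, its
  inverse as \<open>Y\<close>, and let \<open>Ad\<close> be the adjugate of \<open>X0\<close> and
  \<open>d\<close> its determinant. Then \<open>d Y = Y X0 Ad = (1 - Y X1) Ad = Ad + Y Z\<close>
  with \<open>Z = - X1 Ad\<close>. Iteration gives \<open>d^n Y\<close> as a polynomial matrix plus
  \<open>Y Z^n\<close>, and \<open>Z\<close> is nilpotent because its entries lie in the odd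
  ideal.\<close>

lemma inv_entry_denominator:
  fixes T :: "('k :: field, 'm :: {finite, linorder}, 'n :: {finite, linorder}) KG itself"
  assumes two: "(2 :: 'k) \<noteq> 0"
  shows "\<exists>N. \<forall>i j. val (body_det T) ^ N * gen (Inv_entry () i j) \<in> entry_alg"
proof -
  let ?A = "\<chi> i j. (even_entry () i j :: (unit, 'k, 'm, 'n) even)"
  define d where "d = val (body_det T)"
  have d_comm: "d * a = a * d" for a unfolding d_def by (rule even_central[OF val_even])
  define Y X0 X1 Ad D :: "(('k, 'm, 'n) KG, ('m, 'n) idx) sqmat"
    where "Y = Mat (\<lambda>i j. gen (Inv_entry () i j))"
      and "X0 = Mat (\<lambda>i j. val (even_entry () i j))"
      and "X1 = Mat (\<lambda>i j. if odd_idx i = odd_idx j then 0 else gen (Entry () i j))"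
      and "Ad = Mat (\<lambda>i j. val (adjugate ?A $ i $ j))"
      and "D = Mat (\<lambda>i j. if i = j then d else 0)"
  have YX: "Y * (X0 + X1) = 1"
  proof (rule sqmat_eqI)
    fix i j
    have "ent (Y * (X0 + X1)) i j = (\<Sum>k\<in>UNIV. gen (Inv_entry () i k) * gen (Entry () k j))"
      unfolding ent_mult by (rule sum.cong) (auto simp: Y_def X0_def X1_def val_entry)
    then show "ent (Y * (X0 + X1)) i j = ent 1 i j" by (simp add: gen_relations(3))
  qed
  have XA: "X0 * Ad = D"
  proof (rule sqmat_eqI)
    fix i j
    have "ent (X0 * Ad) i j = val (\<Sum>k\<in>UNIV. ?A $ i $ k * adjugate ?A $ k $ j)"
      by (simp add: ent_mult X0_def Ad_def val_sum)
    also have "(\<Sum>k\<in>UNIV. ?A $ i $ k * adjugate ?A $ k $ j) = (if i = j then det ?A else 0)"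
      by (rule mult_adjugate)
    finally show "ent (X0 * Ad) i j = ent D i j"
      by (simp add: D_def d_def body_det_def)
  qed
  have D_ent: "ent (D * M) i j = d * ent M i j" "ent (M * D) i j = ent M i j * d" for M i j
    by (simp_all add: ent_mult D_def if_distrib[of "\<lambda>x. x * _"] if_distrib[of "\<lambda>x. _ * x"] cong: if_cong)
  have D_comm: "D * M = M * D" for M by (rule sqmat_eqI) (simp add: D_ent d_comm)
  define Z where "Z = - (X1 * Ad)"
  have YD: "D * Y = Ad + Y * Z"
  proof -
    have "D * Y = Y * D" by (rule D_comm)
    also have "\<dots> = Y * X0 * Ad" by (simp only: XA[symmetric] mult.assoc)
    also have "Y * X0 = 1 - Y * X1" using YX by (simp add: distrib_left eq_diff_eq)
    finally show ?thesis by (simp add: Z_def algebra_simps)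
  qed
  let ?E = "\<lambda>M :: (('k, 'm, 'n) KG, ('m, 'n) idx) sqmat. \<forall>i j. ent M i j \<in> entry_alg"
  have E_mult: "?E (M * M')" if "?E M" "?E M'" for M M'
    using that by (auto simp: ent_mult intro!: entry_alg_sum entry_alg.intros(4))
  have E_add: "?E (M + M')" if "?E M" "?E M'" for M M'
    using that by (auto intro!: entry_alg.intros(3))
  have ent_E: "val (even_entry () i j :: (unit, 'k, 'm, 'n) even) \<in> entry_alg" for i j
    by (auto simp: val_entry entry_alg_0_1 entry_alg.intros(2))
  have E_Ad: "?E Ad"
    unfolding Ad_def adjugate_def
    by (auto intro!: det_entry_alg simp: ent_E axis_def row_def entry_alg_0_1)
  have E_d: "d \<in> entry_alg" unfolding d_def body_det_def
    by (rule det_entry_alg) (simp add: ent_E)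
  have E_D: "?E D" using E_d by (auto simp: D_def entry_alg_0_1)
  have E_Z: "?E Z"
  proof -
    have "?E X1" by (auto simp: X1_def entry_alg_0_1 entry_alg.intros(2))
    from E_mult[OF this E_Ad] show ?thesis by (auto simp: Z_def entry_alg_uminus)
  qed
  let ?O = "\<lambda>k (M :: (('k, 'm, 'n) KG, ('m, 'n) idx) sqmat). \<forall>i j. ent M i j \<in> odd_power k"
  have O_mult: "?O (k + l) (M * M')" if "?O k M" "?O l M'" for M M' k l
    using that by (auto simp: ent_mult intro!: coords.subspace_sum[OF odd_power_subspace] odd_power_mult)
  have O_Z: "?O 1 Z"
  proof -
    have "?O 1 X1" by (auto simp: X1_def simp del: One_nat_def intro!: odd_power_gen coords.subspace_0[OF odd_power_subspace])
    moreover have "?O 0 Ad" by (auto intro: odd_power_0)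
    ultimately have "?O (1 + 0) (X1 * Ad)" by (rule O_mult)
    then show ?thesis by (auto simp: Z_def intro!: coords.subspace_neg[OF odd_power_subspace])
  qed
  have O_pow: "?O n (Z ^ n)" for n
  proof (induction n)
    case 0
    show ?case by (auto intro: odd_power_0)
  next
    case (Suc n)
    from O_mult[OF O_Z Suc] show ?case by simp
  qed
  have E_pow: "?E (Z ^ n)" for n
  proof (induction n)
    case 0
    show ?case by (auto simp: entry_alg_0_1)
  next
    case (Suc n)
    from E_mult[OF E_Z Suc] show ?case by simp
  qed
  have main: "\<exists>M. ?E M \<and> D ^ n * Y = M + Y * Z ^ n" for n
  proof (induction n)
    case 0
    show ?case by (rule exI[of _ 0]) (simp add: entry_alg_0_1)
  next
    case (Suc n)
    then obtain M where M: "?E M" "D ^ n * Y = M + Y * Z ^ n" by blast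
    have "D ^ Suc n * Y = D * M + D * Y * Z ^ n"
      by (simp add: mult.assoc M(2) distrib_left)
    also have "\<dots> = (D * M + Ad * Z ^ n) + Y * Z ^ Suc n"
      by (simp add: YD distrib_right mult.assoc)
    finally have "D ^ Suc n * Y = (D * M + Ad * Z ^ n) + Y * Z ^ Suc n" .
    moreover have "?E (D * M + Ad * Z ^ n)"
      by (rule E_add[OF E_mult[OF E_D M(1)] E_mult[OF E_Ad E_pow]])
    ultimately show ?case by blast
  qed
  let ?n = "Suc (card (UNIV :: (unit, 'm, 'n) gen set))"
  have "Z ^ ?n = 0"
  proof (rule sqmat_eqI)
    show "ent (Z ^ ?n) i j = ent 0 i j" for i j
      using odd_nilpotent[OF two O_pow[rule_format]] by (simp only: ent_simps)
  qed
  with main[of ?n] have E: "?E (D ^ ?n * Y)" by (metis add.right_neutral mult_zero_right)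
  have "ent (D ^ n * Y) i j = d ^ n * gen (Inv_entry () i j)" for n i j
  proof (induction n)
    case 0
    show ?case by (simp add: Y_def)
  next
    case (Suc n)
    then show ?case by (simp add: D_ent mult.assoc)
  qed
  with E have "\<forall>i j. d ^ ?n * gen (Inv_entry () i j) \<in> entry_alg" by metis
  then show ?thesis unfolding d_def by blast
qed

lemma denominator:
  fixes f :: "('k :: field, 'm :: {finite, linorder}, 'n :: {finite, linorder}) KG"
  assumes two: "(2 :: 'k) \<noteq> 0"
  shows "\<exists>N. val (body_det TYPE(('k, 'm, 'n) KG)) ^ N * f \<in> entry_alg"
proof -
  define d where "d = val (body_det TYPE(('k, 'm, 'n) KG))"
  have d_comm: "d ^ n * a = a * d ^ n" for a n
    unfolding d_def by (rule even_central[OF power_even_part[OF val_even]])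
  have E_d: "d \<in> entry_alg" unfolding d_def body_det_def
    by (rule det_entry_alg) (auto simp: val_entry entry_alg_0_1 entry_alg.intros(2))
  obtain N where N: "\<And>i j. d ^ N * gen (Inv_entry () i j) \<in> entry_alg"
    using inv_entry_denominator[OF two, of "TYPE(('k, 'm, 'n) KG)"] unfolding d_def by blast
  have "\<exists>N. d ^ N * f \<in> entry_alg"
  proof (induction f)
    case (const r)
    show ?case by (rule exI[of _ 0]) (simp add: entry_alg.intros(1))
  next
    case (gen g)
    show ?case
    proof (cases g)
      case (Entry u i j)
      then show ?thesis by (intro exI[of _ 0]) (simp add: entry_alg.intros(2))
    next
      case (Inv_entry u i j)
      then show ?thesis using N[of i j] by (intro exI[of _ N]) simp
    qed
  next
    case (plus a b)
    then obtain N M where NM: "d ^ N * a \<in> entry_alg" "d ^ M * b \<in> entry_alg" by blast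
    have "d ^ M * (d ^ N * a) + d ^ N * (d ^ M * b) \<in> entry_alg"
      by (rule entry_alg.intros(3)[OF entry_alg.intros(4)[OF entry_alg_power[OF E_d] NM(1)]
            entry_alg.intros(4)[OF entry_alg_power[OF E_d] NM(2)]])
    also have "d ^ M * (d ^ N * a) + d ^ N * (d ^ M * b) = d ^ (N + M) * (a + b)"
      by (simp add: distrib_left power_add mult.assoc) (simp add: mult.assoc[symmetric] flip: power_add, simp add: add.commute)
    finally show ?case by blast
  next
    case (times a b)
    then obtain N M where "d ^ N * a \<in> entry_alg" "d ^ M * b \<in> entry_alg" by blast
    then have "(d ^ N * a) * (d ^ M * b) \<in> entry_alg" by (rule entry_alg.intros(4))
    also have "(d ^ N * a) * (d ^ M * b) = d ^ N * (a * d ^ M) * b"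
      by (simp only: mult.assoc)
    also have "a * d ^ M = d ^ M * a" by (rule d_comm[symmetric])
    also have "d ^ N * (d ^ M * a) * b = d ^ (N + M) * (a * b)"
      by (simp add: power_add mult.assoc)
    finally show ?case by blast
  qed
  then show ?thesis unfolding d_def .
qed

text \<open>The denominator \<open>body_det\<close> is itself a unit of \<open>K[G]\<close>, so an
  element annihilated by a power of it is 0.\<close>

theorem highest_weight_unique:
  fixes f :: "('k :: field, 'm :: {finite, linorder}, 'n :: {finite, linorder}) KG"
  assumes two: "(2 :: 'k) \<noteq> 0" and f: "f \<in> H_minus \<nu>"
    and wt: "gr nogr idx_rank f = Poly_Mapping.single (pairing idx_rank \<nu>) f"
    and "counit f = 0"
  shows "f = 0"
proof -
  let ?d = "body_det TYPE(('k, 'm, 'n) KG)"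
  obtain N where "val ?d ^ N * f \<in> entry_alg" using denominator[OF two] by blast
  from highest_weight_space[OF f wt assms(4) this] have *: "val ?d ^ N * f = 0" .
  obtain u where "?d * (body_det_inv TYPE(('k, 'm, 'n) KG) * u) = 1"
    using body_det_unit[OF two, of "TYPE(('k, 'm, 'n) KG)"] by (auto simp: mult.assoc)
  then obtain e where "e * ?d = 1" by (metis mult.commute)
  then have "e ^ N * ?d ^ N = 1" by (metis power_mult_distrib power_one)
  then have "val (e ^ N) * val (?d ^ N) = 1" by (metis val_simps(4,6))
  then have "f = val (e ^ N) * (val ?d ^ N * f)" by (simp add: val_power flip: mult.assoc)
  then show ?thesis by (simp add: *)
qed

section \<open>Equivariant minors\<close>

lemma borel_mult: "a \<in> borel_ideal \<Longrightarrow> c * a \<in> borel_ideal" "a \<in> borel_ideal \<Longrightarrow> a * c \<in> borel_ideal"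
proof -
  let ?S = "{a * gen (Entry () i j) * b | a b i j. i < j}"
  have "x * y \<in> borel_ideal" if "x \<in> coords.span UNIV" "y \<in> borel_ideal" for x y
    using that unfolding borel_ideal_def
    by (rule span_mult) (auto intro!: coords.span_base simp: mult.assoc, metis mult.assoc)
  then show "a \<in> borel_ideal \<Longrightarrow> c * a \<in> borel_ideal" by simp
  have "x * y \<in> borel_ideal" if "x \<in> borel_ideal" "y \<in> coords.span UNIV" for x y
    using that unfolding borel_ideal_def
    by (rule span_mult) (auto intro!: coords.span_base simp: mult.assoc, metis mult.assoc)
  then show "a \<in> borel_ideal \<Longrightarrow> a * c \<in> borel_ideal" by simp
qed

lemma borel_subspace: "coords.subspace borel_ideal"
  unfolding borel_ideal_def by (rule coords.subspace_span)

lemmas borel_closed = coords.subspace_add[OF borel_subspace] coords.subspace_diff[OF borel_subspace]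
  coords.subspace_0[OF borel_subspace] coords.subspace_sum[OF borel_subspace]
  coords.subspace_scale[OF borel_subspace] coords.subspace_neg[OF borel_subspace]

lemma borel_gen: "i < j \<Longrightarrow> gen (Entry () i j) \<in> borel_ideal"
  unfolding borel_ideal_def
  by (rule coords.span_base, rule CollectI, rule exI[of _ 1], rule exI[of _ 1]) auto

lemma borel_decompose:
  fixes a :: "('k :: field, 'm :: {finite, linorder}, 'n :: {finite, linorder}) KG"
  assumes two: "(2 :: 'k) \<noteq> 0" and a: "a \<in> borel_ideal"
  obtains b c where "b \<in> borel_ideal" "b \<in> part False" "c \<in> borel_ideal" "c \<in> part True" "a = b + c"
proof -
  let ?b = "scale (1 / 2) (a + parity a)" and ?c = "scale (1 / 2) (a - parity a)"
  have "?b + ?c = scale (1 / 2) (a + a)"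
    by (simp flip: coords.scale_right_distrib)
  also have "a + a = scale 2 a"
    using coords.scale_left_distrib[of 1 1 a] by simp
  finally have "a = ?b + ?c" using two by simp
  moreover have "?b \<in> borel_ideal" "?c \<in> borel_ideal"
    using a parity_borel_ideal[OF a] by (auto intro!: borel_closed)
  moreover have "?b \<in> part False" "?c \<in> part True"
    using two by (auto simp: part_iff_parity alg_homD[OF alg_hom_parity] simp flip: scale_def coords.scale_minus_right)
  ultimately show ?thesis using that by blast
qed

lemma J_subspace: "coords.subspace J_ideal"
  unfolding tensor_space_def by (rule coords.subspace_span)

lemma J_tensor: "a \<in> borel_ideal \<Longrightarrow> a \<otimes> b \<in> J_ideal"
  unfolding tensor_space_def by (rule coords.span_base) blast

text \<open>Interchanging factors of tensors costs a sign, which is defined for homogeneous factors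
  only. Elements of \<open>borel_ideal\<close> therefore have to be split into homogeneous parts
  within the ideal, which uses that 2 is invertible.\<close>

lemma J_mult:
  fixes x y :: "('k :: field, 'm :: {finite, linorder}, 'n :: {finite, linorder}) KGG"
  assumes two: "(2 :: 'k) \<noteq> 0" and "x \<in> J_ideal"
  shows "y * x \<in> J_ideal"
proof -
  have "u * v \<in> J_ideal" if uvS: "u \<in> {a \<otimes> b | a b. True}" "v \<in> {a \<otimes> b | a b. a \<in> borel_ideal \<and> b \<in> UNIV}"
    for u v :: "('k, 'm, 'n) KGG"
  proof -
    obtain c d a b where uv: "u = c \<otimes> d" "v = a \<otimes> b" "a \<in> borel_ideal"
      using uvS by blast
    obtain a0 a1 where a: "a0 \<in> borel_ideal" "a0 \<in> part False" "a1 \<in> borel_ideal" "a1 \<in> part True" "a = a0 + a1"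
      using borel_decompose[OF two uv(3)] .
    obtain d0 d1 where d: "d0 \<in> part False" "d1 \<in> part True" "d = d0 + d1" using part_decompose by blast
    show ?thesis
      unfolding uv a(5) d(3) tensor_add(1,2) distrib_left distrib_right
        tensor_mult[OF d(1) a(2)] tensor_mult[OF d(1) a(4)] tensor_mult[OF d(2) a(2)] tensor_mult[OF d(2) a(4)]
      by (intro coords.subspace_add[OF J_subspace] coords.subspace_scale[OF J_subspace] J_tensor borel_mult(1) a(1,3))
  qed
  with span_mult[OF tensor_span[of y] assms(2)[unfolded tensor_space_def], of "{a \<otimes> b | a b. a \<in> borel_ideal \<and> b \<in> UNIV}"]
  show ?thesis unfolding tensor_space_def by blast
qed

text \<open>Forward substitution in row \<open>i\<close> of the equation \<open>x y = 1\<close>: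
  modulo the ideal the entries of \<open>x\<close> to the right of the diagonal vanish, and so do,
  by induction, the entries of \<open>y\<close> beyond the diagonal in the earlier rows. Only
  \<open>x\<^sub>i\<^sub>i y\<^sub>i\<^sub>j\<close> remains for \<open>j \<ge> i\<close>.\<close>

lemma inverse_mod_borel:
  fixes i :: "('m :: {finite, linorder}, 'n :: {finite, linorder}) idx"
  shows "(\<forall>j. i < j \<longrightarrow> gen (Inv_entry () i j) \<in> (borel_ideal :: ('k :: field, 'm, 'n) KG set)) \<and>
    gen (Entry () i i) * gen (Inv_entry () i i) - 1 \<in> (borel_ideal :: ('k, 'm, 'n) KG set)"
proof (induction "card {j. j < i}" arbitrary: i rule: less_induct)
  case less
  let ?B = "borel_ideal :: ('k, 'm, 'n) KG set"
  have IH: "gen (Inv_entry () k j) \<in> ?B" if "k < i" "k < j" for k j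
  proof -
    have "card {j. j < k} < card {j. j < i}" using that(1) by (intro psubset_card_mono) auto
    then show ?thesis using less that(2) by blast
  qed
  have row: "gen (Entry () i i) * gen (Inv_entry () i j) - of_bool (i = j) \<in> ?B" if "i \<le> j" for j
  proof -
    have "(\<Sum>k\<in>UNIV - {i}. gen (Entry () i k) * gen (Inv_entry () k j)) \<in> ?B"
    proof (rule borel_closed(4))
      fix k assume "k \<in> UNIV - {i}"
      then consider "i < k" | "k < i" by force
      then show "gen (Entry () i k) * gen (Inv_entry () k j) \<in> ?B"
      proof cases
        case 1
        then show ?thesis by (intro borel_mult(2) borel_gen)
      next
        case 2
        then show ?thesis using that by (intro borel_mult(1) IH) auto
      qed
    qed
    moreover have "(\<Sum>k\<in>UNIV. gen (Entry () i k) * gen (Inv_entry () k j)) =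
        gen (Entry () i i) * gen (Inv_entry () i j) + (\<Sum>k\<in>UNIV - {i}. gen (Entry () i k) * gen (Inv_entry () k j) :: ('k, 'm, 'n) KG)"
      by (rule sum.remove) auto
    ultimately have "- (gen (Entry () i i) * gen (Inv_entry () i j) - of_bool (i = j)) \<in> ?B"
      by (simp add: gen_relations(2) algebra_simps)
    from borel_closed(6)[OF this] show ?thesis by simp
  qed
  have diag: "gen (Entry () i i) * gen (Inv_entry () i i) - 1 \<in> ?B" using row[of i] by simp
  moreover have "gen (Inv_entry () i j) \<in> ?B" if "i < j" for j
  proof -
    have "gen (Inv_entry () i i) * (gen (Entry () i i) * gen (Inv_entry () i j)) \<in> ?B"
      using row[OF less_imp_le[OF that]] less_imp_neq[OF that] by (intro borel_mult(1)[of "gen (Entry () i i) * gen (Inv_entry () i j)"]) simp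
    moreover have "gen (Inv_entry () i i) * (gen (Entry () i i) * gen (Inv_entry () i j)) =
        (gen (Entry () i i) * gen (Inv_entry () i i) - 1) * gen (Inv_entry () i j) + (gen (Inv_entry () i j) :: ('k, 'm, 'n) KG)"
      using even_central[OF even_gen_part[of "Entry () i i"], of "gen (Inv_entry () i i) :: ('k, 'm, 'n) KG"]
      by (simp add: left_diff_distrib mult.assoc[symmetric])
    ultimately have "(gen (Entry () i i) * gen (Inv_entry () i i) - 1) * gen (Inv_entry () i j) + gen (Inv_entry () i j) -
        (gen (Entry () i i) * gen (Inv_entry () i i) - 1) * gen (Inv_entry () i j) \<in> ?B"
      using borel_closed(2)[OF _ borel_mult(2)[OF diag]] by metis
    then show ?thesis by simp
  qed
  ultimately show ?case by blast
qed

section \<open>Semi-invariant functions under the Borel subgroup\<close>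

type_synonym ('k, 'm, 'n) E = "(unit, 'k, 'm, 'n) even"

definition borel_even :: "('k :: field, 'm :: {finite, linorder}, 'n :: {finite, linorder}) E set" where
  "borel_even = {e. val e \<in> borel_ideal}"

definition J_even :: "(bool, 'k :: field, 'm :: {finite, linorder}, 'n :: {finite, linorder}) even set" where
  "J_even = {e. val e \<in> J_ideal}"

lemma is_ideal_borel_even: "is_ideal borel_even"
  by (auto simp: is_ideal_def borel_even_def borel_closed borel_mult)

lemma is_ideal_J_even:
  assumes "(2 :: 'k :: field) \<noteq> 0"
  shows "is_ideal (J_even :: (bool, 'k, 'm :: {finite, linorder}, 'n :: {finite, linorder}) even set)"
  using J_mult[OF assms]
  by (auto simp: is_ideal_def J_even_def coords.subspace_0[OF J_subspace] coords.subspace_add[OF J_subspace])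

definition lift_even :: "(('c, 'k :: field, 'm :: {finite, linorder}, 'n :: {finite, linorder}) coords \<Rightarrow>
    ('d, 'k, 'm, 'n) coords) \<Rightarrow> ('c, 'k, 'm, 'n) even \<Rightarrow> ('d, 'k, 'm, 'n) even" where
  "lift_even h e = Even (h (val e))"

abbreviation "incl_even c \<equiv> lift_even (incl c)"
abbreviation "comult_even \<equiv> lift_even \<Delta>"

lemma val_lift: "val (incl_even c e) = incl c (val e)" "val (comult_even e) = \<Delta> (val e)"
  by (simp_all add: lift_even_def val_Even incl_part comult_part val_even)

lemma incl_even_hom: "incl_even c (a + b) = incl_even c a + incl_even c b"
  "incl_even c (a * b) = incl_even c a * incl_even c b" "incl_even c 1 = 1"
  by (rule val_eqI, simp add: val_lift alg_homD(1,2,9)[OF alg_hom_incl] const_hom(2))+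

lemma incl_even_0: "incl_even c 0 = 0"
  using incl_even_hom(1)[of c 0 0] by simp

lemma comult_even_hom: "comult_even (a + b) = comult_even a + comult_even b"
  "comult_even (a * b) = comult_even a * comult_even b" "comult_even 1 = 1"
  by (rule val_eqI, simp add: val_lift alg_homD(1,2,9)[OF alg_hom_comult] const_hom(2))+

lemma incl_even_cong:
  assumes "cong_ideal borel_even a b"
  shows "cong_ideal J_even (incl_even False a * incl_even True c) (incl_even False b * incl_even True c)"
proof -
  have "val (incl_even False a * incl_even True c - incl_even False b * incl_even True c) = val (a - b) \<otimes> val c"
    by (simp add: val_lift tensor_def alg_homD(6)[OF alg_hom_incl] left_diff_distrib)
  then show ?thesis using assms J_tensor by (simp add: cong_ideal_def borel_even_def J_even_def)
qed

definition char_even :: "('m, 'n) weight \<Rightarrow> ('k :: field, 'm :: {finite, linorder}, 'n :: {finite, linorder}) E" where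
  "char_even \<nu> = (\<Prod>i\<in>UNIV. even_entry () i i ^ nat (\<nu> i) * even_inv_entry () i i ^ nat (- \<nu> i))"

lemma val_char_even:
  "val (char_even \<nu> :: ('k :: field, 'm :: {finite, linorder}, 'n :: {finite, linorder}) E) = borel_character \<nu>"
proof -
  have "(char_even \<nu> :: ('k, 'm, 'n) E) = (\<Prod>i\<leftarrow>all_idx. even_entry () i i ^ nat (\<nu> i) * even_inv_entry () i i ^ nat (- \<nu> i))"
    unfolding char_even_def by (subst prod.distinct_set_conv_list[symmetric]) simp_all
  then show ?thesis
    by (simp add: val_prod_list borel_character_def comp_def val_power val_entry)
qed

lemma power_pair_cong:
  assumes I: "is_ideal I" and xy: "cong_ideal I (x * y) 1"
  shows "cong_ideal I (x ^ nat a * y ^ nat (- a) * (x ^ nat b * y ^ nat (- b))) (x ^ nat (a + b) * y ^ nat (- (a + b)))"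
proof -
  have pw: "cong_ideal I (x ^ n * y ^ n) 1" for n
  proof (induction n)
    case (Suc n)
    from cong_ideal_rules(5)[OF I xy Suc] show ?case by (simp add: mult_ac)
  qed (simp add: cong_ideal_rules(1)[OF I])
  have *: "cong_ideal I (x ^ (n + l) * y ^ (n' + l)) (x ^ n * y ^ n')" for n n' l
    using cong_ideal_rules(5)[OF I cong_ideal_rules(1)[OF I, of "x ^ n * y ^ n'"] pw[of l]]
    by (simp add: power_add mult_ac)
  \<comment> \<open>The number of pairs \<open>x * y\<close> to be cancelled is the same when
    computed from either exponent.\<close>
  have e: "nat a + nat b = nat (a + b) + (nat a + nat b - nat (a + b))"
    "nat (- a) + nat (- b) = nat (- (a + b)) + (nat a + nat b - nat (a + b))" by auto
  have "x ^ nat a * y ^ nat (- a) * (x ^ nat b * y ^ nat (- b)) = x ^ (nat a + nat b) * y ^ (nat (- a) + nat (- b))"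
    by (simp add: power_add mult_ac)
  also have "\<dots> = x ^ (nat (a + b) + (nat a + nat b - nat (a + b))) * y ^ (nat (- (a + b)) + (nat a + nat b - nat (a + b)))"
    using e by (rule arg_cong2[where f = "\<lambda>n l. x ^ n * y ^ l"])
  finally show ?thesis using *[of "nat (a + b)" "nat a + nat b - nat (a + b)" "nat (- (a + b))"] by (simp only:)
qed

lemma char_even_add:
  "cong_ideal borel_even (char_even \<nu> * char_even \<nu>')
    (char_even (\<nu> + \<nu>') :: ('k :: field, 'm :: {finite, linorder}, 'n :: {finite, linorder}) E)"
  unfolding char_even_def prod.distrib[symmetric] plus_fun_def
proof (rule cong_ideal_prod[OF is_ideal_borel_even])
  fix i :: "('m, 'n) idx"
  have *: "cong_ideal borel_even (even_entry () i i * even_inv_entry () i i) (1 :: ('k, 'm, 'n) E)"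
    by (simp add: cong_ideal_def borel_even_def val_entry inverse_mod_borel)
  from power_pair_cong[OF is_ideal_borel_even *, of "\<nu> i" "\<nu>' i"]
  show "cong_ideal borel_even
    (even_entry () i i ^ nat (\<nu> i) * even_inv_entry () i i ^ nat (- \<nu> i) *
      (even_entry () i i ^ nat (\<nu>' i) * even_inv_entry () i i ^ nat (- \<nu>' i)))
    (even_entry () i i ^ nat (\<nu> i + \<nu>' i) * even_inv_entry () i i ^ nat (- (\<nu> i + \<nu>' i)) :: ('k, 'm, 'n) E)" .
qed

lemma char_even_0: "char_even 0 = 1"
  by (simp add: char_even_def)

text \<open>Membership in \<open>H_minus \<nu>\<close>, stated as a congruence in a commutative
  ring, with the value 1 at the unit element. The normalisation ensures non-vanishing and is
  inherited by products and inverses.\<close>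

definition equivariant :: "('m, 'n) weight \<Rightarrow> ('k :: field, 'm :: {finite, linorder}, 'n :: {finite, linorder}) E \<Rightarrow> bool" where
  "equivariant \<nu> e \<longleftrightarrow> cong_ideal J_even (comult_even e) (incl_even False (char_even \<nu>) * incl_even True e) \<and>
     counit (val e) = 1"

lemma equivariant_H_minus: "equivariant \<nu> e \<Longrightarrow> val e \<in> H_minus \<nu>"
  by (simp add: equivariant_def cong_ideal_def J_even_def H_minus_def val_lift val_char_even tensor_def)

lemma equivariant_one: "equivariant 0 1"
  by (simp add: equivariant_def comult_even_hom incl_even_hom char_even_0 alg_homD(9)[OF alg_hom_counit]
      cong_ideal_def J_even_def coords.subspace_0[OF J_subspace])

lemma equivariant_mult:
  fixes e e' :: "('k :: field, 'm :: {finite, linorder}, 'n :: {finite, linorder}) E"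
  assumes two: "(2 :: 'k) \<noteq> 0" and e: "equivariant \<nu> e" and e': "equivariant \<nu>' e'"
  shows "equivariant (\<nu> + \<nu>') (e * e')"
proof -
  note I = is_ideal_J_even[OF two, where 'm = 'm and 'n = 'n]
  have "cong_ideal J_even (comult_even (e * e'))
      (incl_even False (char_even \<nu>) * incl_even True e * (incl_even False (char_even \<nu>') * incl_even True e'))"
    unfolding comult_even_hom using e e' by (intro cong_ideal_rules(5)[OF I]) (auto simp: equivariant_def)
  moreover have "incl_even False (char_even \<nu>) * incl_even True e * (incl_even False (char_even \<nu>') * incl_even True e') =
      incl_even False (char_even \<nu> * char_even \<nu>') * incl_even True (e * e')"
    by (simp add: incl_even_hom mult_ac)
  ultimately have "cong_ideal J_even (comult_even (e * e')) (incl_even False (char_even (\<nu> + \<nu>')) * incl_even True (e * e'))"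
    using cong_ideal_rules(3)[OF I _ incl_even_cong[OF char_even_add]] by metis
  then show ?thesis
    using e e' by (simp add: equivariant_def alg_homD(2)[OF alg_hom_counit])
qed

text \<open>Supplies the negatives of the weights of the two block determinants, which are
  units.\<close>

lemma equivariant_inverse:
  fixes e :: "('k :: field, 'm :: {finite, linorder}, 'n :: {finite, linorder}) E"
  assumes two: "(2 :: 'k) \<noteq> 0" and e: "equivariant \<nu> e" and u: "e * u = 1"
  shows "equivariant (- \<nu>) u"
proof -
  note I = is_ideal_J_even[OF two, where 'm = 'm and 'n = 'n]
  let ?c = "incl_even False (char_even (- \<nu>)) * incl_even True u"
  have e': "cong_ideal J_even (comult_even e) (incl_even False (char_even \<nu>) * incl_even True e)"
    using e by (simp add: equivariant_def)
  have "?c * (incl_even False (char_even \<nu>) * incl_even True e) =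
      incl_even False (char_even (- \<nu>) * char_even \<nu>) * incl_even True (e * u)"
    by (simp add: incl_even_hom mult_ac)
  moreover have "cong_ideal J_even (incl_even False (char_even (- \<nu>) * char_even \<nu>) * incl_even True (e * u))
      (incl_even False (char_even (- \<nu> + \<nu>)) * incl_even True (e * u))"
    by (rule incl_even_cong[OF char_even_add])
  ultimately have 1: "cong_ideal J_even (?c * (incl_even False (char_even \<nu>) * incl_even True e)) 1"
    by (simp add: u char_even_0 incl_even_hom)
  have "cong_ideal J_even (?c * comult_even e) 1"
    by (rule cong_ideal_rules(3)[OF I cong_ideal_rules(5)[OF I cong_ideal_rules(1)[OF I] e'] 1])
  from cong_ideal_rules(5)[OF I this cong_ideal_rules(1)[OF I, of "comult_even u"]]
  have "cong_ideal J_even (?c * (comult_even e * comult_even u)) (comult_even u)" by (simp add: mult.assoc)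
  then have "cong_ideal J_even ?c (comult_even u)" by (simp add: u comult_even_hom flip: comult_even_hom(2))
  then have "cong_ideal J_even (comult_even u) ?c" by (rule cong_ideal_rules(2)[OF I])
  moreover have "counit (val u) = 1"
  proof -
    have "counit (val e * val u) = 1" using u alg_homD(9)[OF alg_hom_counit] by (metis val_simps(4,6))
    then show ?thesis using e by (simp add: equivariant_def alg_homD(2)[OF alg_hom_counit])
  qed
  ultimately show ?thesis by (simp add: equivariant_def)
qed

text \<open>A minor as a determinant of full size: the rows and columns outside \<open>S\<close> are
  those of the unit matrix, since the index set of a determinant is a type.\<close>

definition block :: "(('m, 'n) idx \<Rightarrow> ('m, 'n) idx \<Rightarrow> 'a :: comm_ring_1) \<Rightarrow> ('m, 'n) idx set \<Rightarrow>
    (('a, ('m :: finite, 'n :: finite) idx) vec, ('m, 'n) idx) vec" where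
  "block z S = (\<chi> i j. if i \<in> S \<and> j \<in> S then z i j else of_bool (i = j))"

lemma block_mult:
  "(block z S ** block z' S) $ i $ j = (if i \<in> S \<and> j \<in> S then \<Sum>l\<in>S. z i l * z' l j else of_bool (i = j))"
proof -
  have "(block z S ** block z' S) $ i $ j = (\<Sum>l\<in>UNIV. (if i \<in> S \<and> l \<in> S then z i l else of_bool (i = l)) *
      (if l \<in> S \<and> j \<in> S then z' l j else of_bool (l = j)))"
    by (simp add: matrix_matrix_mult_def block_def)
  also have "\<dots> = (if i \<in> S \<and> j \<in> S then \<Sum>l\<in>S. z i l * z' l j else of_bool (i = j))"
  proof (cases "i \<in> S \<and> j \<in> S")
    case True
    then have "(\<Sum>l\<in>UNIV. (if i \<in> S \<and> l \<in> S then z i l else of_bool (i = l)) *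
      (if l \<in> S \<and> j \<in> S then z' l j else of_bool (l = j))) = (\<Sum>l\<in>S. z i l * z' l j)"
      by (intro sum.mono_neutral_cong_right) auto
    with True show ?thesis by simp
  next
    case out: False
    have "(\<Sum>l\<in>UNIV. (if i \<in> S \<and> l \<in> S then z i l else of_bool (i = l)) *
      (if l \<in> S \<and> j \<in> S then z' l j else of_bool (l = j))) = (\<Sum>l\<in>UNIV. if l = i then of_bool (i = j) else 0)"
    proof (rule sum.cong[OF refl])
      fix l
      show "(if i \<in> S \<and> l \<in> S then z i l else of_bool (i = l)) *
        (if l \<in> S \<and> j \<in> S then z' l j else of_bool (l = j)) = (if l = i then of_bool (i = j) else 0)"
      proof (cases "i \<in> S")
        case True
        with out show ?thesis by auto
      next
        case False
        then show ?thesis by (cases "l = i") auto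
      qed
    qed
    with out show ?thesis by auto
  qed
  finally show ?thesis .
qed

lemma block_incl:
  "incl_even c (det (block z S)) = det (block (\<lambda>i j. incl_even c (z i j)) S)"
proof -
  have "incl_even c (det (block z S)) = det (\<chi> i j. incl_even c (block z S $ i $ j))"
    by (rule det_hom[OF incl_even_hom])
  also have "(\<chi> i j. incl_even c (block z S $ i $ j)) = block (\<lambda>i j. incl_even c (z i j)) S"
    by (simp add: vec_eq_iff block_def incl_even_hom(3) of_bool_def incl_even_0)
  finally show ?thesis .
qed

text \<open>Modulo \<open>J_even\<close> the block of \<open>\<Delta> z\<close> is the product of
  the blocks in the two tensor factors, so its determinant is multiplicative; modulo
  \<open>borel_even\<close> the block is lower triangular and its determinant reduces to the
  diagonal. The flag \<open>c\<close> records the order of the factors, which is reversed for the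
  inverse matrix.\<close>

lemma minor_equivariant:
  fixes z :: "('m, 'n) idx \<Rightarrow> ('m, 'n) idx \<Rightarrow> ('k :: field, 'm :: {finite, linorder}, 'n :: {finite, linorder}) E"
  assumes two: "(2 :: 'k) \<noteq> 0"
    and comult: "\<And>i j. i \<in> S \<Longrightarrow> j \<in> S \<Longrightarrow> cong_ideal J_even (comult_even (z i j))
      (\<Sum>l\<in>S. incl_even c (z i l) * incl_even (\<not> c) (z l j))"
    and borel: "\<And>i j. i < j \<Longrightarrow> val (z i j) \<in> borel_ideal"
    and counit: "\<And>i j. i \<in> S \<Longrightarrow> j \<in> S \<Longrightarrow> counit (val (z i j)) = of_bool (i = j)"
    and char: "char_even \<nu> = (\<Prod>i\<in>UNIV. if i \<in> S then z i i else 1)"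
  shows "equivariant \<nu> (det (block z S))"
proof -
  note I = is_ideal_J_even[OF two, where 'm = 'm and 'n = 'n]
  let ?D = "det (block z S)"
  have "comult_even ?D = det (\<chi> i j. comult_even (block z S $ i $ j))"
    by (rule det_hom[OF comult_even_hom])
  moreover have "cong_ideal J_even (det (\<chi> i j. comult_even (block z S $ i $ j)))
      (det (block (\<lambda>i j. incl_even c (z i j)) S ** block (\<lambda>i j. incl_even (\<not> c) (z i j)) S))"
  proof (rule cong_ideal_det[OF I])
    fix i j
    have 0: "comult_even 0 = 0" using comult_even_hom(1)[of 0 0] by simp
    show "cong_ideal J_even ((\<chi> i j. comult_even (block z S $ i $ j)) $ i $ j)
      ((block (\<lambda>i j. incl_even c (z i j)) S ** block (\<lambda>i j. incl_even (\<not> c) (z i j)) S) $ i $ j)"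
      unfolding block_mult using comult[of i j] cong_ideal_rules(1)[OF I]
      by (auto simp: block_def of_bool_def 0 comult_even_hom(3))
  qed
  moreover have "det (block (\<lambda>i j. incl_even c (z i j)) S ** block (\<lambda>i j. incl_even (\<not> c) (z i j)) S) =
      incl_even False ?D * incl_even True ?D"
    by (cases c) (simp_all add: det_mul block_incl mult.commute)
  ultimately have 1: "cong_ideal J_even (comult_even ?D) (incl_even False ?D * incl_even True ?D)" by simp
  have "cong_ideal borel_even ?D (\<Prod>i\<in>UNIV. block z S $ i $ i)"
  proof (rule cong_ideal_det_triangular[OF is_ideal_borel_even])
    show "block z S $ i $ j \<in> borel_even" if "i < j" for i j
      using borel[OF that] that by (auto simp: block_def borel_even_def borel_closed(3))
  qed
  moreover have "(\<Prod>i\<in>UNIV. block z S $ i $ i) = char_even \<nu>"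
    unfolding char by (rule prod.cong) (auto simp: block_def)
  ultimately have "cong_ideal borel_even ?D (char_even \<nu>)" by simp
  from cong_ideal_rules(3)[OF I 1 incl_even_cong[OF this]]
  have "cong_ideal J_even (comult_even ?D) (incl_even False (char_even \<nu>) * incl_even True ?D)" .
  moreover have "counit (val ?D) = 1"
  proof -
    have "(\<lambda>e. counit (val e)) ?D = det (\<chi> i j. counit (val (block z S $ i $ j)))"
      by (rule det_hom) (simp_all add: alg_homD(1,2,9)[OF alg_hom_counit])
    also have "(\<chi> i j. counit (val (block z S $ i $ j))) = mat 1"
      using counit by (auto simp: vec_eq_iff block_def mat_def alg_homD(4,9)[OF alg_hom_counit])
    finally show ?thesis by simp
  qed
  ultimately show ?thesis by (simp add: equivariant_def)
qed

text \<open>For an initial segment \<open>S\<close> the terms of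
  \<open>\<Delta> x\<^sub>i\<^sub>j\<close> with \<open>l\<close> outside \<open>S\<close> contain
  \<open>x\<^sub>i\<^sub>l\<close> with \<open>i < l\<close>, which vanishes on the Borel
  subgroup.\<close>

lemma entry_minor:
  assumes two: "(2 :: 'k :: field) \<noteq> 0"
    and S: "\<And>i j. i \<in> S \<Longrightarrow> j \<le> i \<Longrightarrow> j \<in> S" "\<And>i. i \<in> S \<Longrightarrow> \<not> odd_idx i"
  shows "equivariant (\<lambda>i. of_bool (i \<in> S))
    (det (block (even_entry ()) S) :: ('k, 'm :: {finite, linorder}, 'n :: {finite, linorder}) E)"
proof (rule minor_equivariant[OF two, where c = False])
  fix i j :: "('m, 'n) idx" assume ij: "i \<in> S" "j \<in> S"
  have "val (comult_even (even_entry () i j :: ('k, 'm, 'n) E) - (\<Sum>l\<in>S. incl_even False (even_entry () i l) * incl_even (\<not> False) (even_entry () l j))) =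
      (\<Sum>l\<in>UNIV - S. gen (Entry () i l) \<otimes> gen (Entry () l j))"
  proof -
    have "(\<Sum>l\<in>S. incl False (val (even_entry () i l)) * incl True (val (even_entry () l j :: ('k, 'm, 'n) E))) =
        (\<Sum>l\<in>S. gen (Entry () i l) \<otimes> gen (Entry () l j))"
      by (rule sum.cong) (use S(2) ij in \<open>auto simp: val_entry tensor_def\<close>)
    moreover have "\<Delta> (val (even_entry () i j :: ('k, 'm, 'n) E)) = (\<Sum>l\<in>UNIV. gen (Entry () i l) \<otimes> gen (Entry () l j))"
      using S(2) ij by (simp add: val_entry comult_hom(1) tensor_def incl_gen)
    ultimately show ?thesis
      by (simp add: val_sum val_lift sum_diff[of UNIV S])
  qed
  also have "\<dots> \<in> J_ideal"
  proof (rule coords.subspace_sum[OF J_subspace], rule J_tensor, rule borel_gen)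
    show "i < l" if "l \<in> UNIV - S" for l using S(1)[OF ij(1), of l] that by force
  qed
  finally show "cong_ideal J_even (comult_even (even_entry () i j :: ('k, 'm, 'n) E))
      (\<Sum>l\<in>S. incl_even False (even_entry () i l) * incl_even (\<not> False) (even_entry () l j))"
    by (simp add: cong_ideal_def J_even_def)
  show "counit (val (even_entry () i j :: ('k, 'm, 'n) E)) = of_bool (i = j)"
    using S(2) ij by (simp add: val_entry counit_gen)
next
  show "val (even_entry () i j :: ('k, 'm, 'n) E) \<in> borel_ideal" if "i < j" for i j
    using borel_gen[OF that] by (auto simp: val_entry borel_closed(3))
  show "char_even (\<lambda>i. of_bool (i \<in> S)) = (\<Prod>i\<in>UNIV. if i \<in> S then even_entry () i i else 1 :: ('k, 'm, 'n) E)"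
    unfolding char_even_def by (rule prod.cong) auto
qed

text \<open>A nonempty set of odd indices is never an initial segment, as all even indices precede
  it. Final segments of the inverse matrix serve instead: the terms with \<open>l\<close> outside
  \<open>S\<close> contain \<open>y\<^sub>l\<^sub>j\<close> with \<open>l < j\<close>, which lies in
  \<open>borel_ideal\<close>. The weights obtained are negative.\<close>

lemma inv_entry_minor:
  assumes two: "(2 :: 'k :: field) \<noteq> 0"
    and S: "\<And>i j. i \<in> S \<Longrightarrow> i \<le> j \<Longrightarrow> j \<in> S" "\<And>i. i \<in> S \<Longrightarrow> odd_idx i"
  shows "equivariant (\<lambda>i. - of_bool (i \<in> S))
    (det (block (even_inv_entry ()) S) :: ('k, 'm :: {finite, linorder}, 'n :: {finite, linorder}) E)"
proof (rule minor_equivariant[OF two, where c = True])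
  fix i j :: "('m, 'n) idx" assume ij: "i \<in> S" "j \<in> S"
  have "val (comult_even (even_inv_entry () i j :: ('k, 'm, 'n) E) - (\<Sum>l\<in>S. incl_even True (even_inv_entry () i l) * incl_even (\<not> True) (even_inv_entry () l j))) =
      (\<Sum>l\<in>UNIV - S. incl True (gen (Inv_entry () i l)) * incl False (gen (Inv_entry () l j)))"
  proof -
    have "(\<Sum>l\<in>S. incl True (val (even_inv_entry () i l)) * incl False (val (even_inv_entry () l j :: ('k, 'm, 'n) E))) =
        (\<Sum>l\<in>S. incl True (gen (Inv_entry () i l)) * incl False (gen (Inv_entry () l j)))"
      by (rule sum.cong) (use S(2) ij in \<open>auto simp: val_entry\<close>)
    moreover have "\<Delta> (val (even_inv_entry () i j :: ('k, 'm, 'n) E)) = (\<Sum>l\<in>UNIV. incl True (gen (Inv_entry () i l)) * incl False (gen (Inv_entry () l j)))"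
      using S(2) ij by (simp add: val_entry comult_hom(1) incl_gen)
    ultimately show ?thesis
      by (simp add: val_sum val_lift sum_diff[of UNIV S])
  qed
  also have "\<dots> \<in> J_ideal"
  proof (rule coords.subspace_sum[OF J_subspace])
    fix l assume "l \<in> UNIV - S"
    then have "l < j" using S(1)[OF ij(2), of l] by force
    then have "gen (Inv_entry () l j) \<in> (borel_ideal :: ('k, 'm, 'n) KG set)" using inverse_mod_borel by blast
    then have J: "gen (Inv_entry () l j) \<otimes> gen (Inv_entry () i l) \<in> (J_ideal :: ('k, 'm, 'n) KGG set)" by (rule J_tensor)
    have "incl True (gen (Inv_entry () i l)) * incl False (gen (Inv_entry () l j)) =
        ksign (odd_gen (Inv_entry () i l)) (odd_gen (Inv_entry () l j)) *
          (gen (Inv_entry () l j) \<otimes> gen (Inv_entry () i l) :: ('k, 'm, 'n) KGG)"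
      unfolding tensor_def by (rule part_supercommute[OF incl_gen_part incl_gen_part])
    then show "incl True (gen (Inv_entry () i l)) * incl False (gen (Inv_entry () l j)) \<in> (J_ideal :: ('k, 'm, 'n) KGG set)"
      using J coords.subspace_neg[OF J_subspace J] by (simp add: ksign_def)
  qed
  finally show "cong_ideal J_even (comult_even (even_inv_entry () i j :: ('k, 'm, 'n) E))
      (\<Sum>l\<in>S. incl_even True (even_inv_entry () i l) * incl_even (\<not> True) (even_inv_entry () l j))"
    by (simp add: cong_ideal_def J_even_def)
  show "counit (val (even_inv_entry () i j :: ('k, 'm, 'n) E)) = of_bool (i = j)"
    using S(2) ij by (simp add: val_entry counit_gen)
next
  show "val (even_inv_entry () i j :: ('k, 'm, 'n) E) \<in> borel_ideal" if "i < j" for i j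
    using inverse_mod_borel[of i] that by (auto simp: val_entry borel_closed(3))
  show "char_even (\<lambda>i. - of_bool (i \<in> S)) = (\<Prod>i\<in>UNIV. if i \<in> S then even_inv_entry () i i else 1 :: ('k, 'm, 'n) E)"
    unfolding char_even_def by (rule prod.cong) auto
qed

lemma block_split:
  fixes z :: "('m :: finite, 'n :: finite) idx \<Rightarrow> ('m, 'n) idx \<Rightarrow> 'a :: comm_ring_1"
  assumes "\<And>i j. odd_idx i \<noteq> odd_idx j \<Longrightarrow> z i j = 0"
  shows "det (block z {i. \<not> odd_idx i}) * det (block z {i. odd_idx i}) = det (\<chi> i j. z i j)"
proof -
  have "(block z {i. \<not> odd_idx i} ** block z {i. odd_idx i}) $ i $ j = z i j" for i j
  proof (cases "odd_idx i")
    case True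
    then have "(block z {i. \<not> odd_idx i} ** block z {i. odd_idx i}) $ i $ j =
        (\<Sum>l\<in>UNIV. if l = i then block z {i. odd_idx i} $ i $ j else 0)"
      unfolding matrix_matrix_mult_def vec_lambda_beta by (intro sum.cong) (auto simp: block_def)
    then show ?thesis using True assms[of i j] by (auto simp: block_def)
  next
    case False
    then have "(block z {i. \<not> odd_idx i} ** block z {i. odd_idx i}) $ i $ j =
        (\<Sum>l\<in>UNIV. if l = j then block z {i. \<not> odd_idx i} $ i $ j else 0)"
      unfolding matrix_matrix_mult_def vec_lambda_beta by (intro sum.cong) (auto simp: block_def)
    then show ?thesis using False assms[of i j] by (auto simp: block_def)
  qed
  then have "block z {i. \<not> odd_idx i} ** block z {i. odd_idx i} = (\<chi> i j. z i j)"
    by (simp add: vec_eq_iff)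
  then show ?thesis by (metis det_mul)
qed

text \<open>Each block determinant divides the unit of \<open>body_det_unit\<close>.\<close>

lemma minor_units:
  fixes T :: "('k :: field, 'm :: {finite, linorder}, 'n :: {finite, linorder}) KG itself"
  assumes two: "(2 :: 'k) \<noteq> 0"
  shows "\<exists>u. det (block (even_entry ()) {i. \<not> odd_idx i}) * u = (1 :: ('k, 'm, 'n) E)"
    and "\<exists>u. det (block (even_inv_entry ()) {i. odd_idx i}) * u = (1 :: ('k, 'm, 'n) E)"
proof -
  have zero: "(even_entry () i j :: ('k, 'm, 'n) E) = 0" "(even_inv_entry () i j :: ('k, 'm, 'n) E) = 0"
    if "odd_idx i \<noteq> odd_idx j" for i j
    using that by (auto intro!: val_eqI simp: val_entry)
  obtain u where u: "body_det T * body_det_inv T * u = 1" using body_det_unit[OF two] by blast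
  have split: "det (block (even_entry ()) {i. \<not> odd_idx i}) * det (block (even_entry ()) {i. odd_idx i}) = body_det T"
    "det (block (even_inv_entry ()) {i. \<not> odd_idx i}) * det (block (even_inv_entry ()) {i. odd_idx i}) = body_det_inv T"
    unfolding body_det_def body_det_inv_def by (rule block_split, rule zero, assumption)+
  have prod: "a * b * (c * d) * u = 1 \<Longrightarrow> (\<exists>u. a * u = 1) \<and> (\<exists>u. d * u = 1)" for a b c d :: "('k, 'm, 'n) E"
    by (rule conjI, rule exI[of _ "b * (c * d) * u"], simp add: mult_ac, rule exI[of _ "a * b * c * u"], simp add: mult_ac)
  show "\<exists>u. det (block (even_entry ()) {i. \<not> odd_idx i}) * u = (1 :: ('k, 'm, 'n) E)"
    and "\<exists>u. det (block (even_inv_entry ()) {i. odd_idx i}) * u = (1 :: ('k, 'm, 'n) E)"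
    using prod[OF u[folded split]] by blast+
qed

subsection \<open>Non-vanishing for dominant weights\<close>

definition attained :: "('k :: field, 'm, 'n) KG itself \<Rightarrow> ('m :: {finite, linorder}, 'n :: {finite, linorder}) weight set" where
  "attained T = {\<nu>. \<exists>e :: ('k, 'm, 'n) E. equivariant \<nu> e}"

context
  fixes T :: "('k :: field, 'm :: {finite, linorder}, 'n :: {finite, linorder}) KG itself"
  assumes two: "(2 :: 'k) \<noteq> 0"
begin

lemma attained_add: "\<nu> \<in> attained T \<Longrightarrow> \<nu>' \<in> attained T \<Longrightarrow> \<nu> + \<nu>' \<in> attained T"
  using equivariant_mult[OF two] unfolding attained_def by blast

lemma attained_0: "0 \<in> attained T"
  using equivariant_one unfolding attained_def by blast

lemma attained_multiple:
  assumes "\<nu> \<in> attained T" "- \<nu> \<in> attained T"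
  shows "(\<lambda>i. c * \<nu> i) \<in> attained T"
proof -
  have *: "(\<lambda>i. int n * \<mu> i) \<in> attained T" if "\<mu> \<in> attained T" for n \<mu>
  proof (induction n)
    case 0
    have "(\<lambda>i. int 0 * \<mu> i) = 0" by auto
    then show ?case using attained_0 by simp
  next
    case (Suc n)
    have "(\<lambda>i. int (Suc n) * \<mu> i) = \<mu> + (\<lambda>i. int n * \<mu> i)" by (auto simp: algebra_simps)
    then show ?case using attained_add[OF that Suc] by simp
  qed
  show ?thesis
  proof (cases "c \<ge> 0")
    case True
    then show ?thesis using *[OF assms(1), of "nat c"] by simp
  next
    case False
    then show ?thesis using *[OF assms(2), of "nat (- c)"] by simp
  qed
qed

lemma attained_Ev: "(\<lambda>i. of_bool (i \<le> Ev k)) \<in> attained T"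
proof -
  have "equivariant (\<lambda>i. of_bool (i \<in> {i. i \<le> Ev k})) (det (block (even_entry ()) {i. i \<le> Ev k}) :: ('k, 'm, 'n) E)"
  proof (rule entry_minor[OF two])
    show "\<not> odd_idx i" if "i \<in> {i. i \<le> Ev k}" for i :: "('m, 'n) idx" using that by (cases i) auto
  qed auto
  then show ?thesis unfolding attained_def by auto
qed

lemma attained_Od: "(\<lambda>i. - of_bool (Od k \<le> i)) \<in> attained T"
proof -
  have "equivariant (\<lambda>i. - of_bool (i \<in> {i. Od k \<le> i})) (det (block (even_inv_entry ()) {i. Od k \<le> i}) :: ('k, 'm, 'n) E)"
  proof (rule inv_entry_minor[OF two])
    show "odd_idx i" if "i \<in> {i. Od k \<le> i}" for i :: "('m, 'n) idx" using that by (cases i) auto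
  qed auto
  then show ?thesis unfolding attained_def by auto
qed

lemma attained_Ev_all: "(\<lambda>i. of_bool (\<not> odd_idx i)) \<in> attained T" "- (\<lambda>i. of_bool (\<not> odd_idx i)) \<in> attained T"
proof -
  have *: "equivariant (\<lambda>i. of_bool (i \<in> {i. \<not> odd_idx i})) (det (block (even_entry ()) {i. \<not> odd_idx i}) :: ('k, 'm, 'n) E)"
  proof (rule entry_minor[OF two])
    show "j \<in> {i. \<not> odd_idx i}" if "i \<in> {i. \<not> odd_idx i}" "j \<le> i" for i j :: "('m, 'n) idx"
      using that by (cases i; cases j) auto
  qed auto
  then show "(\<lambda>i. of_bool (\<not> odd_idx i)) \<in> attained T" unfolding attained_def by auto
  obtain u where "det (block (even_entry ()) {i. \<not> odd_idx i}) * u = (1 :: ('k, 'm, 'n) E)"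
    using minor_units(1)[OF two] by blast
  from equivariant_inverse[OF two * this]
  show "- (\<lambda>i. of_bool (\<not> odd_idx i)) \<in> attained T" unfolding attained_def by auto
qed

lemma attained_Od_all: "- (\<lambda>i. of_bool (odd_idx i)) \<in> attained T" "(\<lambda>i. of_bool (odd_idx i)) \<in> attained T"
proof -
  have *: "equivariant (\<lambda>i. - of_bool (i \<in> {i. odd_idx i})) (det (block (even_inv_entry ()) {i. odd_idx i}) :: ('k, 'm, 'n) E)"
  proof (rule inv_entry_minor[OF two])
    show "j \<in> {i. odd_idx i}" if "i \<in> {i. odd_idx i}" "i \<le> j" for i j :: "('m, 'n) idx"
      using that by (cases i; cases j) auto
  qed auto
  then show "- (\<lambda>i. of_bool (odd_idx i)) \<in> attained T" unfolding attained_def by (auto simp: fun_Compl_def)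
  obtain u where "det (block (even_inv_entry ()) {i. odd_idx i}) * u = (1 :: ('k, 'm, 'n) E)"
    using minor_units(2)[OF two] by blast
  from equivariant_inverse[OF two * this]
  show "(\<lambda>i. of_bool (odd_idx i)) \<in> attained T" unfolding attained_def by (auto simp: fun_Compl_def)
qed

text \<open>Antitone tuples are sums of fundamental weights and an integral multiple of the weight
  of the block determinant. The induction removes one fundamental weight at a time until the tuple
  is constant.\<close>

lemma attained_even_part:
  fixes g :: "'m \<Rightarrow> int"
  assumes "\<And>i j. i \<le> j \<Longrightarrow> g j \<le> g i"
  shows "(\<lambda>i. case i of Ev k \<Rightarrow> g k | Od _ \<Rightarrow> 0) \<in> attained T"
  using assms
proof (induction "\<Sum>k\<in>UNIV. nat (g k - g (Max UNIV))" arbitrary: g rule: less_induct)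
  case less
  let ?M = "Max UNIV :: 'm"
  have ge: "g ?M \<le> g k" for k by (rule less.prems) simp
  show ?case
  proof (cases "\<exists>k. g ?M < g k")
    case False
    then have "g k = g ?M" for k using ge[of k] by (meson antisym not_less)
    then have "(\<lambda>i :: ('m, 'n) idx. case i of Ev k \<Rightarrow> g k | Od _ \<Rightarrow> 0) = (\<lambda>i. g ?M * of_bool (\<not> odd_idx i))"
      by (auto simp: fun_eq_iff split: idx.splits)
    then show ?thesis using attained_multiple[OF attained_Ev_all] by simp
  next
    case True
    \<comment> \<open>The last index whose value exceeds the final one: the tuple drops right after
      it, so lowering the segment up to \<open>k\<close> by 1 keeps it antitone.\<close>
    define k where "k = Max {k. g ?M < g k}"
    have k: "g ?M < g k" "\<And>i. g ?M < g i \<Longrightarrow> i \<le> k"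
      using Max_in[of "{k. g ?M < g k}"] True by (auto simp: k_def)
    define h where "h i = g i - of_bool (i \<le> k)" for i
    have "?M \<noteq> k" using k(1) by auto
    then have "\<not> ?M \<le> k" by (metis Max_ge UNIV_I finite order.antisym)
    then have hM: "h ?M = g ?M" by (simp add: h_def)
    have anti: "h j \<le> h i" if "i \<le> j" for i j
    proof (cases "i \<le> k \<and> \<not> j \<le> k")
      case True
      have "g k \<le> g i" using True by (intro less.prems) simp
      moreover have "g j \<le> g ?M" using True k(2)[of j] by force
      ultimately show ?thesis using True k(1) by (simp add: h_def)
    next
      case False
      then show ?thesis using less.prems[OF that] that by (auto simp: h_def)
    qed
    have "(\<Sum>i\<in>UNIV. nat (h i - h ?M)) < (\<Sum>i\<in>UNIV. nat (g i - g ?M))"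
    proof (rule sum_strict_mono_ex1)
      have "h k = g k - 1" by (simp add: h_def)
      then show "\<exists>a\<in>UNIV. nat (h a - h ?M) < nat (g a - g ?M)"
        using k(1) hM by (intro bexI[of _ k]) simp_all
      have "h a \<le> g a" for a by (simp add: h_def)
      then show "\<forall>a\<in>UNIV. nat (h a - h ?M) \<le> nat (g a - g ?M)"
        by (simp only: hM) (simp add: nat_mono)
    qed simp
    then have "(\<lambda>i. case i of Ev k \<Rightarrow> h k | Od _ \<Rightarrow> 0) \<in> attained T"
      by (rule less.hyps) (rule anti)
    from attained_add[OF this attained_Ev[of k]]
    have "(\<lambda>i. case i of Ev k \<Rightarrow> h k | Od _ \<Rightarrow> 0) + (\<lambda>i. of_bool (i \<le> Ev k)) \<in> attained T" .
    also have "(\<lambda>i. case i of Ev k \<Rightarrow> h k | Od _ \<Rightarrow> 0) + (\<lambda>i. of_bool (i \<le> Ev k)) =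
        (\<lambda>i :: ('m, 'n) idx. case i of Ev k \<Rightarrow> g k | Od _ \<Rightarrow> 0)"
      by (auto simp: fun_eq_iff h_def split: idx.splits)
    finally show ?thesis .
  qed
qed

text \<open>The same reduction from the other end: the available weights are -1 on final segments,
  so a tail is raised until all values equal the first one.\<close>

lemma attained_odd_part:
  fixes g :: "'n \<Rightarrow> int"
  assumes "\<And>i j. i \<le> j \<Longrightarrow> g j \<le> g i"
  shows "(\<lambda>i. case i of Ev _ \<Rightarrow> 0 | Od k \<Rightarrow> g k) \<in> attained T"
  using assms
proof (induction "\<Sum>k\<in>UNIV. nat (g (Min UNIV) - g k)" arbitrary: g rule: less_induct)
  case less
  let ?M = "Min UNIV :: 'n"
  have ge: "g k \<le> g ?M" for k by (rule less.prems) simp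
  show ?case
  proof (cases "\<exists>k. g k < g ?M")
    case False
    then have "g k = g ?M" for k using ge[of k] by (meson antisym not_less)
    then have "(\<lambda>i :: ('m, 'n) idx. case i of Ev _ \<Rightarrow> 0 | Od k \<Rightarrow> g k) = (\<lambda>i. g ?M * of_bool (odd_idx i))"
      by (auto simp: fun_eq_iff split: idx.splits)
    then show ?thesis using attained_multiple[OF attained_Od_all(2,1)] by simp
  next
    case True
    define k where "k = Min {k. g k < g ?M}"
    have k: "g k < g ?M" "\<And>i. g i < g ?M \<Longrightarrow> k \<le> i"
      using Min_in[of "{k. g k < g ?M}"] True by (auto simp: k_def)
    define h where "h i = g i + of_bool (k \<le> i)" for i
    have "?M \<noteq> k" using k(1) by auto
    then have "\<not> k \<le> ?M" by (metis Min_le UNIV_I finite order.antisym)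
    then have hM: "h ?M = g ?M" by (simp add: h_def)
    have anti: "h j \<le> h i" if "i \<le> j" for i j
    proof (cases "k \<le> j \<and> \<not> k \<le> i")
      case True
      have "g j \<le> g k" using True by (intro less.prems) simp
      moreover have "g ?M \<le> g i" using True k(2)[of i] by force
      ultimately show ?thesis using True k(1) by (simp add: h_def)
    next
      case False
      then show ?thesis using less.prems[OF that] that by (auto simp: h_def)
    qed
    have "(\<Sum>i\<in>UNIV. nat (h ?M - h i)) < (\<Sum>i\<in>UNIV. nat (g ?M - g i))"
    proof (rule sum_strict_mono_ex1)
      have "h k = g k + 1" by (simp add: h_def)
      then show "\<exists>a\<in>UNIV. nat (h ?M - h a) < nat (g ?M - g a)"
        using k(1) hM by (intro bexI[of _ k]) simp_all
      have "g a \<le> h a" for a by (simp add: h_def)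
      then show "\<forall>a\<in>UNIV. nat (h ?M - h a) \<le> nat (g ?M - g a)"
        by (simp only: hM) (simp add: nat_mono)
    qed simp
    then have "(\<lambda>i. case i of Ev _ \<Rightarrow> 0 | Od k \<Rightarrow> h k) \<in> attained T"
      by (rule less.hyps) (rule anti)
    from attained_add[OF this attained_Od[of k]]
    have "(\<lambda>i. case i of Ev _ \<Rightarrow> 0 | Od k \<Rightarrow> h k) + (\<lambda>i. - of_bool (Od k \<le> i)) \<in> attained T" .
    also have "(\<lambda>i. case i of Ev _ \<Rightarrow> 0 | Od k \<Rightarrow> h k) + (\<lambda>i. - of_bool (Od k \<le> i)) =
        (\<lambda>i :: ('m, 'n) idx. case i of Ev _ \<Rightarrow> 0 | Od k \<Rightarrow> g k)"
      by (auto simp: fun_eq_iff h_def split: idx.splits)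
    finally show ?thesis .
  qed
qed

lemma attained_dominant:
  assumes "\<nu> \<in> dominant_weights"
  shows "\<nu> \<in> attained T"
proof -
  have "(\<lambda>i. case i of Ev k \<Rightarrow> \<nu> (Ev k) | Od _ \<Rightarrow> 0) \<in> attained T"
    "(\<lambda>i. case i of Ev _ \<Rightarrow> 0 | Od k \<Rightarrow> \<nu> (Od k)) \<in> attained T"
    using assms attained_even_part[of "\<lambda>k. \<nu> (Ev k)"] attained_odd_part[of "\<lambda>k. \<nu> (Od k)"]
    by (auto simp: dominant_weights_def)
  from attained_add[OF this]
  have "(\<lambda>i. case i of Ev k \<Rightarrow> \<nu> (Ev k) | Od _ \<Rightarrow> 0) + (\<lambda>i. case i of Ev _ \<Rightarrow> 0 | Od k \<Rightarrow> \<nu> (Od k)) \<in> attained T" .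
  also have "(\<lambda>i. case i of Ev k \<Rightarrow> \<nu> (Ev k) | Od _ \<Rightarrow> 0) + (\<lambda>i. case i of Ev _ \<Rightarrow> 0 | Od k \<Rightarrow> \<nu> (Od k)) = \<nu>"
    by (auto simp: fun_eq_iff split: idx.splits)
  finally show ?thesis .
qed

end

lemma H_minus_nonzero:
  assumes "(2 :: 'k :: field) \<noteq> 0" "\<nu> \<in> dominant_weights"
  shows "\<exists>f\<in>H_minus \<nu>. counit f = 1 \<and> f \<noteq> (0 :: ('k, 'm :: {finite, linorder}, 'n :: {finite, linorder}) KG)"
proof -
  obtain e :: "('k, 'm, 'n) E" where e: "equivariant \<nu> e"
    using attained_dominant[OF assms, of "TYPE(('k, 'm, 'n) KG)"] unfolding attained_def by blast
  then have "counit (val e) = 1" by (simp add: equivariant_def)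
  moreover from this have "val e \<noteq> 0" by (auto simp: alg_homD(4)[OF alg_hom_counit])
  ultimately show ?thesis using equivariant_H_minus[OF e] by blast
qed

section \<open>Simplicity of the socle\<close>

text \<open>By the left weight of elements of \<open>H_minus \<nu>\<close>, only their component of
  weight \<open>pairing idx_rank \<nu>\<close> is visible at the unit element, so projecting to it
  keeps the counit equal to 1.\<close>

lemma exists_highest_weight_vector:
  fixes N :: "('k :: field, 'm :: {finite, linorder}, 'n :: {finite, linorder}) KG set"
  assumes two: "(2 :: 'k) \<noteq> 0" and N: "subsupermodule N" "N \<noteq> {0}" "N \<subseteq> H_minus \<nu>"
  shows "\<exists>f\<in>N. counit f = 1 \<and> gr nogr idx_rank f = Poly_Mapping.single (pairing idx_rank \<nu>) f"
proof -
  obtain f' where f': "f' \<in> N" "counit f' = 1" using exists_counit_one[OF two N(1,2)] by blast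
  let ?g = "pairing idx_rank \<nu>"
  define f where "f = weight_coeff idx_rank ?g \<rhd> f'"
  have "f \<in> N" unfolding f_def by (rule subD(7)[OF two N(1) f'(1) linfun_weight_coeff])
  moreover have "f' \<in> H_minus \<nu>" using f'(1) N(3) by blast
  then have "weight_coeff idx_rank ?g f' = 1"
    by (simp add: f'(2) left_weight_torus flip: weight_coeff_left)
  then have "counit f = 1" by (simp add: f_def counit_act[OF linfun_weight_coeff])
  moreover have "gr nogr idx_rank f = Poly_Mapping.single ?g f"
    unfolding f_def weight_coeff_act by (rule component_homogeneous[where \<phi> = "\<lambda>x. x"]) simp_all
  ultimately show ?thesis by blast
qed

text \<open>Two normalised vectors of highest weight differ by one that vanishes at the unit element
  and hence is 0. So both simple subsupermodules contain the same nonzero vector.\<close>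

lemma simple_in_H_minus_unique:
  fixes N N' :: "('k :: field, 'm :: {finite, linorder}, 'n :: {finite, linorder}) KG set"
  assumes two: "(2 :: 'k) \<noteq> 0"
    and N: "irreducible_quotient N {0}" "N \<subseteq> H_minus \<nu>"
    and N': "irreducible_quotient N' {0}" "N' \<subseteq> H_minus \<nu>"
  shows "N = N'"
proof -
  have sub: "subsupermodule N" "subsupermodule N'" "N \<noteq> {0}" "N' \<noteq> {0}"
    using N(1) N'(1) unfolding irreducible_quotient_def by auto
  obtain f where f: "f \<in> N" "counit f = 1" "gr nogr idx_rank f = Poly_Mapping.single (pairing idx_rank \<nu>) f"
    using exists_highest_weight_vector[OF two sub(1,3) N(2)] by blast
  obtain g where g: "g \<in> N'" "counit g = 1" "gr nogr idx_rank g = Poly_Mapping.single (pairing idx_rank \<nu>) g"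
    using exists_highest_weight_vector[OF two sub(2,4) N'(2)] by blast
  have "f - g = 0"
  proof (rule highest_weight_unique[OF two])
    show "f - g \<in> H_minus \<nu>"
      using f(1) g(1) N(2) N'(2) subD(4)[OF two H_minus_subsupermodule[OF two]] by blast
    show "gr nogr idx_rank (f - g) = Poly_Mapping.single (pairing idx_rank \<nu>) (f - g)"
      by (simp add: alg_homD(1-9)[OF alg_hom_gr] f(3) g(3) single_diff)
    show "counit (f - g) = 0"
      by (simp add: alg_homD(1-9)[OF alg_hom_counit] f(2) g(2))
  qed
  then have "f \<in> N \<inter> N'" using f(1) g(1) by simp
  moreover have "f \<noteq> 0" using f(2) by (auto simp: alg_homD(4)[OF alg_hom_counit])
  ultimately have ne: "N \<inter> N' \<noteq> {0}" by blast
  have sb: "subsupermodule (N \<inter> N')" by (rule sub_inter[OF two sub(1,2)])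
  have z: "{0} \<subseteq> N \<inter> N'" using subD(2)[OF two sub(1)] subD(2)[OF two sub(2)] by blast
  have "N \<inter> N' = N" using N(1) sb z ne unfolding irreducible_quotient_def by blast
  moreover have "N \<inter> N' = N'" using N'(1) sb z ne unfolding irreducible_quotient_def by blast
  ultimately show ?thesis by simp
qed

lemma L_minus_irreducible:
  fixes \<nu> :: "('m :: {finite, linorder}, 'n :: {finite, linorder}) weight"
  assumes two: "(2 :: 'k :: field) \<noteq> 0" and \<nu>: "\<nu> \<in> dominant_weights"
  shows "irreducible_quotient (L_minus \<nu> :: ('k, 'm, 'n) KG set) {0}"
proof -
  let ?H = "H_minus \<nu> :: ('k, 'm, 'n) KG set"
  have "?H \<noteq> {0}" using H_minus_nonzero[OF two \<nu>] by blast
  then obtain N where N: "N \<subseteq> ?H" "irreducible_quotient N {0}"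
    using exists_simple[OF two H_minus_subsupermodule[OF two]] by blast
  have "{N'. N' \<subseteq> ?H \<and> irreducible_quotient N' {0}} = {N}"
    using simple_in_H_minus_unique[OF two _ _ N(2,1)] N by blast
  then have "L_minus \<nu> = coords.span N" unfolding L_minus_def socle_def by simp
  moreover have "coords.subspace N"
    using N(2) unfolding irreducible_quotient_def subsupermodule_def by blast
  then have "coords.span N = N" by (rule coords.span_eq_iff[THEN iffD2])
  ultimately show ?thesis using N(2) by simp
qed

lemma L_minus_in_C_sub:
  fixes \<nu> :: "('m :: {finite, linorder}, 'n :: {finite, linorder}) weight"
  assumes two: "(2 :: 'k :: field) \<noteq> 0" and \<nu>: "\<nu> \<in> dominant_weights" "\<nu> \<in> \<Gamma>"
  shows "(L_minus \<nu> :: ('k, 'm, 'n) KG set) \<subseteq> C_sub \<Gamma>"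
proof (rule C_sub_greatest(2)[OF two])
  let ?L = "L_minus \<nu> :: ('k, 'm, 'n) KG set"
  have irr: "irreducible_quotient ?L {0}" by (rule L_minus_irreducible[OF two \<nu>(1)])
  then have sub: "subsupermodule ?L" by (simp add: irreducible_quotient_def)
  show "belongs_to \<Gamma> ?L"
    unfolding belongs_to_def
  proof (intro conjI allI impI, rule sub, elim conjE)
    fix N\<^sub>1 N\<^sub>2 :: "('k, 'm, 'n) KG set"
    assume N: "N\<^sub>1 \<subseteq> ?L" "irreducible_quotient N\<^sub>1 N\<^sub>2"
    then have s: "subsupermodule N\<^sub>1" "subsupermodule N\<^sub>2" "N\<^sub>2 \<subset> N\<^sub>1"
      by (simp_all add: irreducible_quotient_def)
    have z: "0 \<in> N\<^sub>1" "0 \<in> N\<^sub>2" using subD(2)[OF two s(1)] subD(2)[OF two s(2)] by auto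
    have "N\<^sub>1 \<noteq> {0}" using s(3) z by blast
    then have 1: "N\<^sub>1 = ?L" using irr N(1) s(1) z unfolding irreducible_quotient_def by blast
    have "N\<^sub>2 \<noteq> ?L" using s(3) 1 by blast
    then have 2: "N\<^sub>2 = {0}" using irr N(1) s(2,3) z unfolding irreducible_quotient_def by blast
    have "supermodule_hom False ?L ?L (\<lambda>f. f)"
      unfolding supermodule_hom_iff[OF two sub] lin_on_def by simp
    then have "quotient_iso N\<^sub>1 N\<^sub>2 ?L"
      unfolding quotient_iso_def 1 2 using subD(2)[OF two sub] by (intro exI[of _ False] exI[of _ "\<lambda>f. f"]) auto
    then show "\<exists>\<nu>\<in>\<Gamma>. quotient_iso N\<^sub>1 N\<^sub>2 (L_minus \<nu>)" using \<nu>(2) by blast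
  qed
qed

lemma character_in_res_C_sub:
  fixes \<nu> :: "('m :: {finite, linorder}, 'n :: {finite, linorder}) weight"
  assumes two: "(2 :: 'k :: field) \<noteq> 0" and \<nu>: "\<nu> \<in> dominant_weights" "\<nu> \<in> \<Gamma>"
  shows "\<exists>f\<in>C_sub \<Gamma>. res_T (f :: ('k, 'm, 'n) KG) = Poly_Mapping.single \<nu> 1"
proof -
  have "irreducible_quotient (L_minus \<nu> :: ('k, 'm, 'n) KG set) {0}" by (rule L_minus_irreducible[OF two \<nu>(1)])
  then have "subsupermodule (L_minus \<nu> :: ('k, 'm, 'n) KG set)" "(L_minus \<nu> :: ('k, 'm, 'n) KG set) \<noteq> {0}"
    by (auto simp: irreducible_quotient_def)
  then obtain f :: "('k, 'm, 'n) KG" where f: "f \<in> L_minus \<nu>" "counit f = 1"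
    using exists_counit_one[OF two] by blast
  then have "res_T f = Poly_Mapping.single \<nu> 1"
    using res_T_H_minus L_minus_subset[of \<nu>] by fastforce
  then show ?thesis using f(1) L_minus_in_C_sub[OF two \<nu>] by blast
qed

section \<open>Dominant weights with prescribed residues\<close>

text \<open>Prescribed row and column sums with equal totals, reached by moving one unit at a time.
  It yields the coefficients of the differences
  \<open>\<epsilon>\<^sub>i - \<epsilon>\<^sub>j\<close> in the dominance order.\<close>

lemma transport_matrix:
  fixes a :: "'a :: finite \<Rightarrow> nat" and b :: "'b :: finite \<Rightarrow> nat"
  assumes "(\<Sum>i\<in>UNIV. a i) = (\<Sum>j\<in>UNIV. b j)"
  shows "\<exists>c. (\<forall>i. (\<Sum>j\<in>UNIV. c i j) = a i) \<and> (\<forall>j. (\<Sum>i\<in>UNIV. c i j) = b j)"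
  using assms
proof (induction "\<Sum>i\<in>UNIV. a i" arbitrary: a b)
  case 0
  then have "(\<Sum>i\<in>UNIV. a i) = 0" "(\<Sum>j\<in>UNIV. b j) = 0" by simp_all
  then have "a i = 0" "b j = 0" for i j by simp_all
  then show ?case by (intro exI[of _ "\<lambda>_ _. 0"]) simp
next
  case (Suc s)
  have "\<exists>i. a i \<noteq> 0"
  proof (rule ccontr)
    assume "\<not> ?thesis"
    with Suc.hyps(2) show False by simp
  qed
  then obtain i\<^sub>0 where i: "a i\<^sub>0 \<noteq> 0" ..
  have "\<exists>j. b j \<noteq> 0"
  proof (rule ccontr)
    assume "\<not> ?thesis"
    with Suc.hyps(2) Suc.prems show False by simp
  qed
  then obtain j\<^sub>0 where j: "b j\<^sub>0 \<noteq> 0" ..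
  define a' where "a' i = a i - of_bool (i = i\<^sub>0)" for i
  define b' where "b' j = b j - of_bool (j = j\<^sub>0)" for j
  have a: "a i = a' i + of_bool (i = i\<^sub>0)" for i using i by (auto simp: a'_def)
  have b: "b j = b' j + of_bool (j = j\<^sub>0)" for j using j by (auto simp: b'_def)
  have of: "(\<Sum>i\<in>UNIV. of_bool (i = k)) = (1 :: nat)" for k :: "'c :: finite"
    by (simp add: of_bool_def)
  have sa: "(\<Sum>i\<in>UNIV. a i) = (\<Sum>i\<in>UNIV. a' i) + 1" by (simp only: a sum.distrib of)
  have sb: "(\<Sum>i\<in>UNIV. b i) = (\<Sum>i\<in>UNIV. b' i) + 1" by (simp only: b sum.distrib of)
  have "\<exists>c. (\<forall>i. (\<Sum>j\<in>UNIV. c i j) = a' i) \<and> (\<forall>j. (\<Sum>i\<in>UNIV. c i j) = b' j)"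
    by (rule Suc.hyps(1)) (use Suc.hyps(2) Suc.prems sa sb in linarith)+
  then obtain c where c: "\<And>i. (\<Sum>j\<in>UNIV. c i j) = a' i" "\<And>j. (\<Sum>i\<in>UNIV. c i j) = b' j" by blast
  have *: "of_bool (P \<and> Q) = (of_bool P * of_bool Q :: nat)" for P Q by simp
  show ?case
    by (intro exI[of _ "\<lambda>i j. c i j + of_bool (i = i\<^sub>0) * of_bool (j = j\<^sub>0)"])
       (simp only: sum.distrib c a b of flip: sum_distrib_left sum_distrib_right, simp)
qed

lemma sum_idx: "(\<Sum>i\<in>UNIV. f i) = (\<Sum>i\<in>UNIV. f (Ev i)) + (\<Sum>j\<in>UNIV. f (Od j))"
  for f :: "('m :: finite, 'n :: finite) idx \<Rightarrow> 'a :: comm_monoid_add"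
proof -
  have "(\<Sum>i\<in>UNIV. f i) = sum f (range Ev) + sum f (range Od)"
    unfolding UNIV_idx by (rule sum.union_disjoint) auto
  then show ?thesis by (simp add: sum.reindex inj_on_def)
qed

text \<open>Differences with \<open>i\<close> even and \<open>j\<close> odd suffice: what the even
  coordinates lose is distributed over what the odd ones gain.\<close>

lemma dominatedI:
  fixes \<mu> \<nu> :: "('m :: {finite, linorder}, 'n :: {finite, linorder}) weight"
  assumes "\<And>i. \<mu> (Ev i) \<le> \<nu> (Ev i)" "\<And>j. \<nu> (Od j) \<le> \<mu> (Od j)" "wt_degree \<mu> = wt_degree \<nu>"
  shows "\<mu> \<unlhd> \<nu>"
proof -
  have "int (\<Sum>i\<in>UNIV. nat (\<nu> (Ev i) - \<mu> (Ev i))) = int (\<Sum>j\<in>UNIV. nat (\<mu> (Od j) - \<nu> (Od j)))"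
    using assms by (simp add: wt_degree_def sum_idx sum_subtractf)
  then have "(\<Sum>i\<in>UNIV. nat (\<nu> (Ev i) - \<mu> (Ev i))) = (\<Sum>j\<in>UNIV. nat (\<mu> (Od j) - \<nu> (Od j)))"
    by (simp only: of_nat_eq_iff)
  from transport_matrix[OF this] obtain c :: "'m \<Rightarrow> 'n \<Rightarrow> nat"
    where c: "\<And>i. (\<Sum>j\<in>UNIV. c i j) = nat (\<nu> (Ev i) - \<mu> (Ev i))"
      "\<And>j. (\<Sum>i\<in>UNIV. c i j) = nat (\<mu> (Od j) - \<nu> (Od j))" by blast
  have ci: "(\<Sum>j\<in>UNIV. int (c i j)) = \<nu> (Ev i) - \<mu> (Ev i)"
    "(\<Sum>i\<in>UNIV. int (c i j)) = \<mu> (Od j) - \<nu> (Od j)" for i j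
    using c(1)[of i] c(2)[of j] assms(1)[of i] assms(2)[of j] by (simp_all flip: of_nat_sum)
  define d where "d x y = (case (x, y) of (Ev i, Od j) \<Rightarrow> c i j | _ \<Rightarrow> 0)" for x y :: "('m, 'n) idx"
  have "\<nu> k - \<mu> k = (\<Sum>(i, j)\<in>{(i, j). i < j}. int (d i j) * (unit_wt i k - unit_wt j k))" for k
  proof -
    have "(\<Sum>(i, j)\<in>{(i, j). i < j}. int (d i j) * (unit_wt i k - unit_wt j k)) =
        (\<Sum>(i, j)\<in>UNIV. int (d i j) * (unit_wt i k - unit_wt j k))"
    proof (rule sum.mono_neutral_left)
      show "\<forall>x\<in>UNIV - {(i, j). i < j}. (case x of (i, j) \<Rightarrow> int (d i j) * (unit_wt i k - unit_wt j k)) = 0"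
      proof
        fix x :: "('m, 'n) idx \<times> ('m, 'n) idx" assume x: "x \<in> UNIV - {(i, j). i < j}"
        obtain i j where "x = (i, j)" by (cases x)
        with x show "(case x of (i, j) \<Rightarrow> int (d i j) * (unit_wt i k - unit_wt j k)) = 0"
          by (cases i; cases j) (auto simp: d_def less_idx_def)
      qed
    qed auto
    also have "\<dots> = (\<Sum>i\<in>UNIV. \<Sum>j\<in>UNIV. int (d i j) * (unit_wt i k - unit_wt j k))"
      by (simp add: sum.cartesian_product)
    also have "\<dots> = (\<Sum>i\<in>UNIV. \<Sum>j\<in>UNIV. int (c i j) * (unit_wt (Ev i) k - unit_wt (Od j) k))"
      by (simp add: sum_idx d_def)
    also have "\<dots> = \<nu> k - \<mu> k"
    proof (cases k)
      case (Ev x)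
      have "(\<Sum>i\<in>UNIV. \<Sum>j\<in>UNIV. int (c i j) * (unit_wt (Ev i) k - unit_wt (Od j) k)) =
          (\<Sum>i\<in>UNIV. if i = x then \<Sum>j\<in>UNIV. int (c i j) else 0)"
        by (intro sum.cong refl) (auto simp: Ev unit_wt_def)
      then show ?thesis by (simp add: ci Ev)
    next
      case (Od x)
      have "(\<Sum>i\<in>UNIV. \<Sum>j\<in>UNIV. int (c i j) * (unit_wt (Ev i) k - unit_wt (Od j) k)) =
          (\<Sum>i\<in>UNIV. \<Sum>j\<in>UNIV. if j = x then - int (c i j) else 0)"
        by (intro sum.cong refl) (auto simp: Od unit_wt_def)
      also have "\<dots> = - (\<Sum>i\<in>UNIV. int (c i x))" by (simp add: sum_negf)
      finally show ?thesis by (simp add: ci Od)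
    qed
    finally show ?thesis by simp
  qed
  then show ?thesis unfolding dominated_def by blast
qed

text \<open>
  All even coordinates but the last are moved far down and all odd coordinates far up; the last even
  coordinate is then determined by the degree, and its residue by the congruence of degrees.
\<close>

lemma exists_dominated_congruent:
  fixes \<kappa> \<alpha> :: "('m :: {finite, linorder}, 'n :: {finite, linorder}) weight"
  assumes q: "q > 0" and \<alpha>: "[wt_degree \<alpha> = wt_degree \<kappa>] (mod q)"
  shows "\<exists>\<nu>\<in>dominant_weights. \<nu> \<unlhd> \<kappa> \<and> (\<forall>i. [\<nu> i = \<alpha> i] (mod q))"
proof -
  define K where "K = (\<Sum>i\<in>UNIV. \<bar>\<kappa> i\<bar>)"
  define M where "M = (Max UNIV :: 'm)"
  \<comment> \<open>\<open>K\<close> bounds all coordinates of \<open>\<kappa>\<close>. Subtracting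
    \<open>q * (K + 1)\<close> brings the value below \<open>- K\<close> whatever the residue, and
    the rank of \<open>i\<close> makes the values antitone, since a step of \<open>q\<close> exceeds
    any difference of residues.\<close>
  define g where "g i = \<alpha> (Ev i) mod q - q * (K + 1 + int (card {k. k < i}))" for i :: 'm
  define S where "S = (\<Sum>i\<in>UNIV - {M}. g i)"
  \<comment> \<open>At least one \<open>h j \<ge> L\<close> is subtracted in \<open>D\<close> and
    none is negative; this choice of \<open>L\<close> then forces \<open>D\<close> below
    \<open>- K\<close> and below every \<open>g i\<close>.\<close>
  define L where "L = K + (\<Sum>i\<in>UNIV. \<bar>g i\<bar>) + \<bar>wt_degree \<kappa> - S\<bar>"
  define h where "h j = \<alpha> (Od j) mod q + q * (L + int (card {k. j < k}))" for j :: 'n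
  define D where "D = wt_degree \<kappa> - S - (\<Sum>j\<in>UNIV. h j)"
  define \<nu> where "\<nu> i = (case i of Ev i \<Rightarrow> if i = M then D else g i | Od j \<Rightarrow> h j)" for i
  have K: "K \<ge> 0" "\<bar>\<kappa> i\<bar> \<le> K" for i
    unfolding K_def by (auto intro: sum_nonneg member_le_sum)
  have L: "L \<ge> K" unfolding L_def by (auto intro: sum_nonneg add_nonneg_nonneg)
  have mods: "0 \<le> x mod q" "x mod q < q" for x using q by simp_all
  have qm: "x \<le> q * x" if "x \<ge> 0" for x using q that by (simp add: mult_le_cancel_right1)
  have h_ge: "L \<le> h j" for j
  proof -
    have "L \<le> q * L" using L K(1) by (intro qm) simp
    moreover have "0 \<le> q * int (card {k. j < k})" using q by simp
    ultimately show ?thesis using mods(1)[of "\<alpha> (Od j)"] by (simp add: h_def algebra_simps)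
  qed
  have g_le: "g i \<le> - K" for i
  proof -
    have "K \<le> q * K" using K(1) by (rule qm)
    moreover have "0 \<le> q * int (card {k. k < i})" using q by simp
    ultimately show ?thesis using mods(2)[of "\<alpha> (Ev i)"] by (simp add: g_def algebra_simps)
  qed
  have D_le: "D \<le> - K - (\<Sum>i\<in>UNIV. \<bar>g i\<bar>)"
  proof -
    have "h (Max UNIV) \<le> (\<Sum>j\<in>UNIV. h j)"
      using h_ge L K(1) by (intro member_le_sum) (auto intro: order_trans)
    with h_ge[of "Max UNIV"] show ?thesis unfolding D_def L_def by linarith
  qed
  moreover have "0 \<le> (\<Sum>i\<in>UNIV. \<bar>g i\<bar>)" by (simp add: sum_nonneg)
  ultimately have D_K: "D \<le> - K" by linarith
  have D_g: "D \<le> g i" for i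
  proof -
    have "\<bar>g i\<bar> \<le> (\<Sum>i\<in>UNIV. \<bar>g i\<bar>)" by (intro member_le_sum) auto
    then show ?thesis using D_le K(1) by linarith
  qed
  have g_anti: "g j \<le> g i" if "i \<le> j" for i j
  proof (cases "i = j")
    case False
    with that have "i < j" by simp
    then have "card {k. k < i} < card {k. k < j}" by (intro psubset_card_mono) (simp, auto)
    then have "q * (K + 1 + int (card {k. k < i}) + 1) \<le> q * (K + 1 + int (card {k. k < j}))"
      using q by (intro mult_left_mono) simp_all
    then show ?thesis
      using mods(2)[of "\<alpha> (Ev j)"] mods(1)[of "\<alpha> (Ev i)"] unfolding g_def distrib_left[of q _ 1] by linarith
  qed simp
  have h_anti: "h j \<le> h i" if "i \<le> j" for i j
  proof (cases "i = j")
    case False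
    with that have "i < j" by simp
    then have "card {k. j < k} < card {k. i < k}" by (intro psubset_card_mono) (simp, auto)
    then have "q * (L + int (card {k. j < k}) + 1) \<le> q * (L + int (card {k. i < k}))"
      using q by (intro mult_left_mono) simp_all
    then show ?thesis
      using mods(2)[of "\<alpha> (Od j)"] mods(1)[of "\<alpha> (Od i)"] unfolding h_def distrib_left[of q _ 1] by linarith
  qed simp
  have "\<nu> \<in> dominant_weights"
  proof -
    have "j = M" if "M \<le> j" for j using that by (simp add: M_def antisym)
    then show ?thesis by (auto simp: dominant_weights_def \<nu>_def D_g g_anti h_anti)
  qed
  moreover have sumg: "(\<Sum>i\<in>UNIV. if i = M then D else g i) = D + S"
    unfolding S_def by (subst sum.remove[of UNIV M]) auto
  then have deg: "wt_degree \<nu> = wt_degree \<kappa>" by (simp add: wt_degree_def sum_idx \<nu>_def D_def)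
  have "\<nu> \<unlhd> \<kappa>"
  proof (rule dominatedI[OF _ _ deg])
    show "\<nu> (Ev i) \<le> \<kappa> (Ev i)" for i using D_K g_le[of i] K(2)[of "Ev i"] by (auto simp: \<nu>_def)
    show "\<kappa> (Od j) \<le> \<nu> (Od j)" for j using h_ge[of j] L(1) K(2)[of "Od j"] by (simp add: \<nu>_def)
  qed
  moreover have "[\<nu> i = \<alpha> i] (mod q)" for i
  proof -
    have g: "[g i = \<alpha> (Ev i)] (mod q)" for i
      unfolding g_def cong_iff_dvd_diff by (simp add: dvd_diff_right_iff flip: minus_mult_div_eq_mod)
    have h: "[h j = \<alpha> (Od j)] (mod q)" for j by (simp add: h_def cong_def)
    have "[wt_degree \<alpha> = \<alpha> (Ev M) + S + (\<Sum>j\<in>UNIV. h j)] (mod q)"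
    proof -
      have "[\<alpha> (Ev M) + (\<Sum>i\<in>UNIV - {M}. \<alpha> (Ev i)) + (\<Sum>j\<in>UNIV. \<alpha> (Od j)) = \<alpha> (Ev M) + S + (\<Sum>j\<in>UNIV. h j)] (mod q)"
        unfolding S_def by (intro cong_add cong_sum cong_refl cong_sym[OF g] cong_sym[OF h])
      moreover have "(\<Sum>i\<in>UNIV. \<alpha> (Ev i)) = \<alpha> (Ev M) + (\<Sum>i\<in>UNIV - {M}. \<alpha> (Ev i))"
        by (rule sum.remove) auto
      ultimately show ?thesis by (simp add: wt_degree_def sum_idx)
    qed
    from cong_trans[OF cong_sym[OF \<alpha>] this] have "[D = \<alpha> (Ev M)] (mod q)"
      unfolding D_def cong_iff_dvd_diff by (simp add: algebra_simps)
    with g h show ?thesis by (cases i) (auto simp: \<nu>_def)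
  qed
  ultimately show ?thesis by blast
qed

section \<open>Distributions on the torus\<close>

text \<open>The generating series of the binomial coefficients of \<open>a\<close> plays the role of
  \<open>(1 + X)^a\<close>, also for negative \<open>a\<close>. In characteristic \<open>p\<close> a
  shift by \<open>q\<close> multiplies it by \<open>1 + X^q\<close>, which changes no coefficient
  below \<open>q\<close>.\<close>

lemma fps_binomial_shift:
  assumes "prime CHAR('k :: field)" "q = CHAR('k) ^ r" "k < q"
  shows "(of_int (int_binom (a + int q) k) :: 'k) = of_int (int_binom a k)"
proof -
  define F :: "int \<Rightarrow> 'k fps" where "F a = Abs_fps (\<lambda>k. of_int (int_binom a k))" for a
  have "int_binom (a + 1) (Suc s) = int_binom a (Suc s) + int_binom a s" for a s
    using gbinomial_int_Suc_Suc[of a s] unfolding int_binom_def gbinomial_prod_rev by simp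
  then have *: "(of_int (int_binom (a + 1) (Suc s)) :: 'k) = of_int (int_binom a (Suc s)) + of_int (int_binom a s)"
    for a s by (simp only: of_int_add)
  have zero: "int_binom a 0 = 1" for a by (simp add: int_binom_def)
  have "F (a + 1) = (1 + fps_X) * F a" for a
  proof (rule fps_ext)
    fix n show "fps_nth (F (a + 1)) n = fps_nth ((1 + fps_X) * F a) n"
      by (cases n) (simp_all add: F_def * zero distrib_right)
  qed
  then have step: "F (a + 1) = (1 + fps_X) * F a" for a .
  have "F (a + int m) = (1 + fps_X) ^ m * F a" for m
  proof (induction m)
    case (Suc m)
    then show ?case using step[of "a + int m"] by (simp add: ac_simps)
  qed simp
  then have "F (a + int q) = (1 + fps_X) ^ q * F a" .
  also have "(1 + fps_X) ^ q = (1 + fps_X ^ q :: 'k fps)"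
    using freshmans_dream'[of q r "1 :: 'k fps" fps_X] assms(1,2) by simp
  finally have "fps_nth (F (a + int q)) k = fps_nth (F a) k"
    using assms(3) by (simp add: distrib_right fps_X_power_mult_nth)
  then show ?thesis by (simp add: F_def)
qed

lemma int_binom_cong:
  assumes "prime CHAR('k :: field)" "q = CHAR('k) ^ r" "k < q" "[a = b] (mod int q)"
  shows "(of_int (int_binom a k) :: 'k) = of_int (int_binom b k)"
proof -
  have shift: "(of_int (int_binom (a + int q * int m) k) :: 'k) = of_int (int_binom a k)" for a m
  proof (induction m)
    case (Suc m)
    show ?case
      using fps_binomial_shift[OF assms(1-3), of "a + int q * int m"] Suc by (simp add: algebra_simps)
  qed simp
  from assms(4) obtain c where c: "b = a + int q * c" by (auto simp: cong_iff_lin)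
  show ?thesis
  proof (cases "c \<ge> 0")
    case True
    then show ?thesis using shift[of a "nat c"] c by simp
  next
    case False
    then show ?thesis using shift[of b "nat (- c)"] c by simp
  qed
qed

text \<open>Binomial inversion, which is where the coefficients of \<open>h\<^sub>t\<close> come
  from.\<close>

lemma alternating_binomial_sum:
  fixes a t m :: nat
  assumes "a \<le> m"
  shows "(\<Sum>k\<in>{t..m}. (- 1) ^ (k - t) * int (k choose t) * int (a choose k)) = of_bool (a = t)"
proof (cases "t \<le> a")
  case False
  then have "(\<Sum>k\<in>{t..m}. (- 1) ^ (k - t) * int (k choose t) * int (a choose k)) = 0"
    by (intro sum.neutral) auto
  then show ?thesis using False by simp
next
  case True
  have "(\<Sum>k\<in>{t..m}. (- 1) ^ (k - t) * int (k choose t) * int (a choose k)) =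
      (\<Sum>k\<in>{t..a}. (- 1) ^ (k - t) * int (k choose t) * int (a choose k))"
    using assms by (intro sum.mono_neutral_right) auto
  also have "\<dots> = (\<Sum>k\<in>{t..a}. int (a choose t) * ((- 1) ^ (k - t) * int ((a - t) choose (k - t))))"
  proof (rule sum.cong[OF refl])
    fix k assume "k \<in> {t..a}"
    then have "(a choose k) * (k choose t) = (a choose t) * ((a - t) choose (k - t))"
      by (intro choose_mult) auto
    from arg_cong[OF this, of int]
    show "(- 1) ^ (k - t) * int (k choose t) * int (a choose k) =
        int (a choose t) * ((- 1) ^ (k - t) * int ((a - t) choose (k - t)))"
      by (simp add: algebra_simps)
  qed
  also have "\<dots> = int (a choose t) * (\<Sum>j\<le>a - t. (- 1) ^ j * int ((a - t) choose j))"
    unfolding sum_distrib_left[symmetric]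
    by (rule arg_cong[of _ _ "\<lambda>x. int (a choose t) * x"],
        rule sum.reindex_bij_witness[of _ "\<lambda>j. j + t" "\<lambda>k. k - t"]) (use True in auto)
  also have "(\<Sum>j\<le>a - t. (- 1) ^ j * int ((a - t) choose j)) = of_bool (a = t)"
  proof (cases "a = t")
    case False
    with True have "a - t > 0" by simp
    from choose_alternating_sum[OF this, where ?'a = int] False show ?thesis by simp
  qed simp
  finally show ?thesis by (cases "a = t") simp_all
qed

text \<open>As only \<open>k < q\<close> occurs, \<open>\<mu> i\<close> may be replaced by its
  representative between 0 and \<open>q - 1\<close>; there the coefficients are ordinary binomials
  and inversion applies.\<close>

lemma h_T_single:
  fixes i :: "('m, 'n) idx"
  assumes "prime CHAR('k :: field)" "q = CHAR('k) ^ r" "t \<le> q - 1"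
  shows "(h_T q t i (Poly_Mapping.single \<mu> 1) :: 'k) = of_bool ([\<mu> i = int t] (mod int q))"
proof -
  have q: "q > 0" using assms(1,2) prime_gt_0_nat by simp
  define a where "a = nat (\<mu> i mod int q)"
  have a: "int a = \<mu> i mod int q" using q by (simp add: a_def)
  then have "int a < int q" using q by simp
  then have aq: "a \<le> q - 1" by linarith
  have binom: "of_int (int_binom (\<mu> i) k) = (of_nat (a choose k) :: 'k)" if "k \<le> q - 1" for k
  proof -
    have "[\<mu> i = int a] (mod int q)" by (simp add: a cong_def)
    moreover have "int_binom (int a) k = int (a choose k)"
      by (simp add: int_binom_def gbinomial_int_binomial flip: gbinomial_prod_rev)
    ultimately show ?thesis using int_binom_cong[OF assms(1,2), of k "\<mu> i" "int a"] that q by simp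
  qed
  have "h_T q t i (Poly_Mapping.single \<mu> 1) =
      (\<Sum>k\<in>{t..q - 1}. (- 1) ^ (k - t) * of_nat (k choose t) * (of_nat (a choose k) :: 'k))"
    unfolding h_T_def e_binom_def by (rule sum.cong) (auto simp: binom)
  also have "\<dots> = of_int (\<Sum>k\<in>{t..q - 1}. (- 1) ^ (k - t) * int (k choose t) * int (a choose k))"
    by simp
  also have "\<dots> = of_bool (a = t)" by (simp only: alternating_binomial_sum[OF aq] of_int_of_bool)
  also have "a = t \<longleftrightarrow> [\<mu> i = int t] (mod int q)"
  proof -
    have "int t mod int q = int t" using assms(3) q by simp
    then show ?thesis using a unfolding cong_def by (metis of_nat_eq_iff)
  qed
  finally show ?thesis .
qed

lemma h_elem_eq:
  fixes \<alpha> :: "('m :: {finite, linorder}, 'n :: {finite, linorder}) idx \<Rightarrow> nat"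
  assumes "prime CHAR('k :: field)" "q = CHAR('k) ^ r" "\<And>i. \<alpha> i \<le> q - 1"
  shows "(h_elem q \<alpha> :: ('k, 'm, 'n) KG \<Rightarrow> 'k) =
    on_characters (\<lambda>\<mu>. of_bool (\<forall>i. [\<mu> i = int (\<alpha> i)] (mod int q))) \<circ> res_T"
proof -
  have "foldr (\<lambda>i. conv_T (h_T q (\<alpha> i) i)) xs counit_T =
      on_characters (\<lambda>\<mu>. of_bool (\<forall>i\<in>set xs. [\<mu> i = int (\<alpha> i)] (mod int q)) :: 'k)"
    for xs :: "('m, 'n) idx list"
    by (induction xs) (simp_all add: counit_T_def conv_T_def h_T_single[OF assms(1,2) assms(3)] of_bool_conj)
  from this[of all_idx] show ?thesis by (simp add: h_elem_def)
qed

section \<open>Functionals on \<open>K[T]\<close> as functions on characters\<close>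

lemma on_characters_superset:
  assumes "finite A" "Poly_Mapping.keys f \<subseteq> A"
  shows "on_characters c f = (\<Sum>\<mu>\<in>A. Poly_Mapping.lookup f \<mu> * c \<mu>)"
  unfolding on_characters_def using assms by (intro sum.mono_neutral_left) (auto simp: in_keys_iff)

lemma on_characters_add: "on_characters c (f + g) = on_characters c f + on_characters c g"
proof -
  let ?A = "Poly_Mapping.keys f \<union> Poly_Mapping.keys g"
  have "Poly_Mapping.keys (f + g) \<subseteq> ?A" by (rule Poly_Mapping.keys_add)
  then show ?thesis
    by (subst (1 2 3) on_characters_superset[of ?A]) (auto simp: lookup_add distrib_right sum.distrib)
qed

lemma on_characters_monom: "on_characters c (Poly_Mapping.single \<mu> v) = v * c \<mu>"
  by (simp add: on_characters_def)

lemma on_characters_zero: "on_characters c 0 = 0"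
  by (simp add: on_characters_def)

lemma on_characters_uminus: "on_characters c (- f) = - on_characters c f"
  using on_characters_add[of c f "- f"] by (simp add: on_characters_zero eq_neg_iff_add_eq_0 add.commute)

lemma on_characters_scale: "on_characters c (scale_T v f) = v * on_characters c f"
  by (induction f rule: pm_induct)
     (simp_all add: on_characters_zero on_characters_add on_characters_monom scale_T_def mult_single distrib_left mult.assoc)

lemma on_characters_mult_single:
  "on_characters c (f * Poly_Mapping.single \<nu> v) = v * on_characters (\<lambda>\<mu>. c (\<mu> + \<nu>)) f"
  by (induction f rule: pm_induct)
     (simp_all add: on_characters_zero on_characters_add on_characters_monom mult_single distrib_left distrib_right
       ac_simps plus_fun_def)

lemma linear_on_characters: "Vector_Spaces.linear scale_T (*) (on_characters c)"
  by unfold_locales (simp_all add: on_characters_add on_characters_scale distrib_left distrib_right mult.assoc)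

lemma linear_eq_on_characters:
  assumes "Vector_Spaces.linear scale_T (*) \<xi>"
  shows "\<xi> = on_characters (\<lambda>\<mu>. \<xi> (Poly_Mapping.single \<mu> 1))"
proof
  interpret Vector_Spaces.linear scale_T "(*)" \<xi> by (rule assms)
  fix f
  have *: "\<xi> (Poly_Mapping.single \<mu> v) = v * \<xi> (Poly_Mapping.single \<mu> 1)" for \<mu> v
    using scale[of v "Poly_Mapping.single \<mu> 1"] by (simp add: scale_T_def mult_single)
  show "\<xi> f = on_characters (\<lambda>\<mu>. \<xi> (Poly_Mapping.single \<mu> 1)) f"
  proof (induction f rule: pm_induct)
    case (single \<mu> v)
    then show ?case unfolding on_characters_monom by (rule *)
  qed (simp_all only: zero add on_characters_zero on_characters_add)
qed

lemma alg_hom_counit_T: "counit_T (f * g) = counit_T f * counit_T g" "counit_T 1 = 1"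
proof -
  show "counit_T (f * g) = counit_T f * counit_T g"
    unfolding counit_T_def
    by (induction g rule: pm_induct)
       (simp_all add: on_characters_zero on_characters_add on_characters_monom on_characters_mult_single distrib_left)
  show "counit_T 1 = 1" unfolding counit_T_def single_one[symmetric] by (simp only: on_characters_single)
qed

lemma counit_res_T: "counit_T (res_T f) = counit f"
  for f :: "('k :: field, 'm :: {finite, linorder}, 'n :: {finite, linorder}) KG"
proof (rule alg_hom_eqI[OF _ alg_hom_counit])
  show "alg_hom (\<lambda>r. r) (\<lambda>f :: ('k, 'm, 'n) KG. counit_T (res_T f))"
    by (simp add: alg_hom_def res_T_hom alg_hom_counit_T)
       (simp_all add: counit_T_def on_characters_add on_characters_monom)
  show "counit_T (res_T (gen g)) = counit (gen g :: ('k, 'm, 'n) KG)" for g :: "(unit, 'm, 'n) gen"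
    by (cases g) (auto simp: res_T_hom(1) counit_gen counit_T_def on_characters_zero)
qed

definition periodic :: "nat \<Rightarrow> (('m, 'n) weight \<Rightarrow> 'a) \<Rightarrow> bool" where
  "periodic q c \<longleftrightarrow> (\<forall>\<mu> \<nu>. (\<forall>i. [\<mu> i = \<nu> i] (mod int q)) \<longrightarrow> c \<mu> = c \<nu>)"

lemma single_power:
  "Poly_Mapping.single \<kappa> 1 ^ n = (Poly_Mapping.single (\<lambda>i. int n * \<kappa> i) 1 :: ('k :: field, 'm, 'n) KT)"
  by (induction n) (simp_all add: mult_single plus_fun_def distrib_right zero_fun_def flip: single_one)

lemma CHAR_KT: "CHAR(('k :: field, 'm, 'n) KT) = CHAR('k)"
proof (rule CHAR_eqI)
  have *: "of_nat n = (Poly_Mapping.single 0 (of_nat n) :: ('k, 'm, 'n) KT)" for n by simp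
  show "of_nat CHAR('k) = (0 :: ('k, 'm, 'n) KT)" by (simp only: * of_nat_CHAR single_zero)
  fix n assume "of_nat n = (0 :: ('k, 'm, 'n) KT)"
  from arg_cong[OF this, of "\<lambda>f. Poly_Mapping.lookup f 0"] have "of_nat n = (0 :: 'k)"
    by (simp only: * lookup_single_eq lookup_zero)
  then show "CHAR('k) dvd n" by (simp add: of_nat_eq_0_iff_char_dvd)
qed

lemma frobenius_character:
  assumes "prime CHAR('k :: field)" "q = CHAR('k) ^ r"
  shows "(Poly_Mapping.single \<kappa> 1 - 1) ^ q = (Poly_Mapping.single (\<lambda>i. int q * \<kappa> i) 1 - 1 :: ('k, 'm, 'n) KT)"
proof -
  have "(Poly_Mapping.single \<kappa> 1 - 1 + 1 :: ('k, 'm, 'n) KT) ^ q = (Poly_Mapping.single \<kappa> 1 - 1) ^ q + 1 ^ q"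
    by (rule freshmans_dream'[of q r]) (use assms in \<open>simp_all only: CHAR_KT\<close>)
  then show ?thesis by (simp add: single_power)
qed

lemma distribution_periodic:
  fixes \<xi> :: "('k :: field, 'm, 'n) KT \<Rightarrow> 'k"
  assumes p: "prime CHAR('k)" and \<xi>: "\<xi> \<in> distributions scale_T counit_T"
  shows "\<exists>r. periodic (CHAR('k) ^ r) (\<lambda>\<mu>. \<xi> (Poly_Mapping.single \<mu> 1))"
proof -
  obtain t where lin: "Vector_Spaces.linear scale_T (*) \<xi>"
    and t: "\<And>f. f \<in> ideal_power scale_T {f. counit_T f = 0} (t + 1) \<Longrightarrow> \<xi> f = 0"
    using \<xi> unfolding distributions_def by blast
  interpret Vector_Spaces.linear scale_T "(*)" \<xi> by (rule lin)
  \<comment> \<open>Any power of \<open>p\<close> that exceeds \<open>t\<close> would do, since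
    \<open>(t^\<kappa> - 1)^q\<close> must lie in the power \<open>t + 1\<close> of the augmentation
    ideal.\<close>
  define q where "q = CHAR('k) ^ t"
  have "t < 2 ^ t" by (rule less_exp)
  also have "(2 :: nat) ^ t \<le> q" unfolding q_def by (intro power_mono prime_ge_2_nat p) simp
  finally have tq: "t < q" .
  have shift: "\<xi> (Poly_Mapping.single (\<lambda>i. int q * \<kappa> i + \<mu> i) 1) = \<xi> (Poly_Mapping.single \<mu> 1)" for \<kappa> \<mu>
  proof -
    define x :: "('k, 'm, 'n) KT" where "x = Poly_Mapping.single \<kappa> 1 - 1"
    \<comment> \<open>The product has to be displayed with exactly \<open>t + 1\<close> factors from
      the augmentation ideal; \<open>y\<close> absorbs the surplus powers and the character
      \<open>\<mu>\<close>.\<close>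
    define y where "y = x ^ (q - t) * Poly_Mapping.single \<mu> 1"
    have counit_x: "counit_T x = 0"
      unfolding x_def counit_T_def diff_conv_add_uminus on_characters_add on_characters_uminus single_one[symmetric]
      by (simp only: on_characters_single) simp
    have "q - t = Suc (q - t - 1)" using tq by simp
    then have "y = x * (x ^ (q - t - 1) * Poly_Mapping.single \<mu> 1)"
      unfolding y_def by (metis mult.assoc power_Suc)
    then have "counit_T y = 0" by (simp add: alg_hom_counit_T counit_x)
    moreover have "x ^ q * Poly_Mapping.single \<mu> 1 = prod_list (replicate t x @ [y])"
      using tq by (simp add: y_def flip: mult.assoc power_add)
    ultimately have "x ^ q * Poly_Mapping.single \<mu> 1 \<in> ideal_power scale_T {f. counit_T f = 0} (t + 1)"
      unfolding ideal_power_def using counit_x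
      by (intro KT.span_base CollectI exI[of _ "replicate t x @ [y]"]) auto
    then have "\<xi> (x ^ q * Poly_Mapping.single \<mu> 1) = 0" by (rule t)
    moreover have "x ^ q * Poly_Mapping.single \<mu> 1 =
        Poly_Mapping.single (\<lambda>i. int q * \<kappa> i + \<mu> i) 1 - Poly_Mapping.single \<mu> 1"
      unfolding x_def frobenius_character[OF p q_def]
      by (simp add: left_diff_distrib mult_single plus_fun_def)
    ultimately show ?thesis by (simp add: diff)
  qed
  have "periodic q (\<lambda>\<mu>. \<xi> (Poly_Mapping.single \<mu> 1))"
    unfolding periodic_def
  proof (intro allI impI)
    fix \<mu> \<nu> :: "('m, 'n) weight" assume *: "\<forall>i. [\<mu> i = \<nu> i] (mod int q)"
    have "\<mu> = (\<lambda>i. int q * ((\<mu> i - \<nu> i) div int q) + \<nu> i)"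
      using * by (auto simp: fun_eq_iff cong_iff_dvd_diff)
    then show "\<xi> (Poly_Mapping.single \<mu> 1) = \<xi> (Poly_Mapping.single \<nu> 1)"
      using shift[of "\<lambda>i. (\<mu> i - \<nu> i) div int q" \<nu>] by simp
  qed
  then show ?thesis unfolding q_def by blast
qed

section \<open>Nilpotency modulo an ideal\<close>

definition nilpotent_mod :: "'a :: comm_ring_1 set \<Rightarrow> 'a set \<Rightarrow> bool" where
  "nilpotent_mod J A \<longleftrightarrow> (\<exists>N. \<forall>as. length as = N \<and> set as \<subseteq> A \<longrightarrow> prod_list as \<in> J)"

lemma nilpotent_mod_mono: "nilpotent_mod J A \<Longrightarrow> B \<subseteq> A \<Longrightarrow> nilpotent_mod J B"
  unfolding nilpotent_mod_def by (meson order_trans)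

text \<open>A product of \<open>N\<close> elements of the larger set is a product of
  \<open>N\<close> elements of \<open>A\<close>, which lies in \<open>J\<close>, plus a multiple of
  \<open>x\<close>. Hence \<open>q\<close> blocks of length \<open>N\<close> give a multiple of
  \<open>x ^ q\<close> modulo \<open>J\<close>.\<close>

lemma nilpotent_mod_extend:
  fixes J A :: "'a :: comm_ring_1 set"
  assumes J: "0 \<in> J" "\<And>a b. a \<in> J \<Longrightarrow> b \<in> J \<Longrightarrow> a + b \<in> J" "\<And>a b. a \<in> J \<Longrightarrow> a * b \<in> J"
    and A: "nilpotent_mod J A" and x: "x ^ q \<in> J"
  shows "nilpotent_mod J {a + r * x | a r. a \<in> A}"
proof -
  obtain N where N: "\<And>as. length as = N \<Longrightarrow> set as \<subseteq> A \<Longrightarrow> prod_list as \<in> J"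
    using A unfolding nilpotent_mod_def by blast
  let ?B = "{a + r * x | a r. a \<in> A}"
  have expand: "\<exists>as s. length as = length bs \<and> set as \<subseteq> A \<and> prod_list bs = prod_list as + s * x"
    if "set bs \<subseteq> ?B" for bs
    using that
  proof (induction bs)
    case Nil
    show ?case by (intro exI[of _ "[]"] exI[of _ 0]) simp
  next
    case (Cons b bs)
    then obtain as s where as: "length as = length bs" "set as \<subseteq> A" "prod_list bs = prod_list as + s * x" by auto
    obtain a r where b: "b = a + r * x" "a \<in> A" using Cons.prems by auto
    have "prod_list (b # bs) = prod_list (a # as) + (a * s + r * prod_list as + r * s * x) * x"
      by (simp add: b as algebra_simps)
    with as b show ?case by (intro exI[of _ "a # as"] exI) auto
  qed
  have power: "\<exists>j s. j \<in> J \<and> prod_list bs = j + s * x ^ m"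
    if "length bs = N * m" "set bs \<subseteq> ?B" for m bs
    using that
  proof (induction m arbitrary: bs)
    case 0
    then show ?case using J(1) by (intro exI[of _ 0] exI[of _ 1]) simp
  next
    case (Suc m)
    let ?u = "take N bs" and ?v = "drop N bs"
    have sets: "set ?u \<subseteq> ?B" "set ?v \<subseteq> ?B" using Suc.prems(2) set_take_subset set_drop_subset by fast+
    have len: "length ?u = N" "length ?v = N * m" using Suc.prems(1) by simp_all
    obtain j s where v: "j \<in> J" "prod_list ?v = j + s * x ^ m"
      using Suc.IH[OF len(2) sets(2)] by blast
    obtain as s' where u: "length as = N" "set as \<subseteq> A" "prod_list ?u = prod_list as + s' * x"
      using expand[OF sets(1)] len(1) by auto
    have "prod_list bs = prod_list ?u * prod_list ?v" by (simp flip: prod_list.append)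
    also have "\<dots> = (j * (prod_list as + s' * x) + prod_list as * (s * x ^ m)) + (s' * s) * x ^ Suc m"
      by (simp add: u v algebra_simps)
    finally show ?case using J(2)[OF J(3)[OF v(1)] J(3)[OF N[OF u(1,2)]]] by blast
  qed
  have "prod_list bs \<in> J" if bs: "length bs = N * q" "set bs \<subseteq> ?B" for bs
  proof -
    obtain j s where "j \<in> J" "prod_list bs = j + s * x ^ q" using power[OF bs] by blast
    then show ?thesis using J(2)[OF _ J(3)[OF x]] by (simp add: mult.commute)
  qed
  then show ?thesis unfolding nilpotent_mod_def by blast
qed

lemma nilpotent_mod_generated:
  fixes J :: "'a :: comm_ring_1 set"
  assumes J: "0 \<in> J" "\<And>a b. a \<in> J \<Longrightarrow> b \<in> J \<Longrightarrow> a + b \<in> J" "\<And>a b. a \<in> J \<Longrightarrow> a * b \<in> J"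
    and "finite S" and x: "\<And>i. i \<in> S \<Longrightarrow> x i ^ q \<in> J"
  shows "nilpotent_mod J {j + (\<Sum>i\<in>S. r i * x i) | j r. j \<in> J}"
  using assms(4) x
proof (induction S)
  case empty
  have "prod_list as \<in> J" if "length as = 1" "set as \<subseteq> {j + (\<Sum>i\<in>{}. r i * x i) | j r. j \<in> J}" for as
    using that by (cases as) auto
  then show ?case unfolding nilpotent_mod_def by blast
next
  case (insert k S)
  let ?A = "{j + (\<Sum>i\<in>S. r i * x i) | j r. j \<in> J}"
  have "nilpotent_mod J {a + s * x k | a s. a \<in> ?A}"
    by (rule nilpotent_mod_extend[OF J _ insert.prems]) (use insert in auto)
  moreover have "{j + (\<Sum>i\<in>insert k S. r i * x i) | j r. j \<in> J} \<subseteq> {a + s * x k | a s. a \<in> ?A}"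
  proof
    fix y assume "y \<in> {j + (\<Sum>i\<in>insert k S. r i * x i) | j r. j \<in> J}"
    then obtain j r where y: "y = j + (\<Sum>i\<in>insert k S. r i * x i)" "j \<in> J" by blast
    then have "y = (j + (\<Sum>i\<in>S. r i * x i)) + r k * x k" using insert.hyps by (simp add: ac_simps)
    moreover have "j + (\<Sum>i\<in>S. r i * x i) \<in> ?A" using y(2) by blast
    ultimately show "y \<in> {a + s * x k | a s. a \<in> ?A}" by blast
  qed
  ultimately show ?case by (rule nilpotent_mod_mono)
qed

definition residues :: "nat \<Rightarrow> (('m, 'n) idx \<Rightarrow> nat) set" where
  "residues q = {\<alpha>. \<forall>i. \<alpha> i \<le> q - 1}"

lemma finite_residues: "finite (residues q :: (('m :: finite, 'n :: finite) idx \<Rightarrow> nat) set)"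
proof -
  have "residues q = (PiE UNIV (\<lambda>_. {..q - 1}) :: (('m, 'n) idx \<Rightarrow> nat) set)"
    by (auto simp: residues_def PiE_def)
  then show ?thesis by (simp add: finite_PiE)
qed

definition residue :: "nat \<Rightarrow> ('m, 'n) weight \<Rightarrow> ('m, 'n) idx \<Rightarrow> nat" where
  "residue q \<mu> i = nat (\<mu> i mod int q)"

lemma residue:
  assumes "q > 0"
  shows "residue q \<mu> \<in> residues q" "[\<mu> i = int (residue q \<mu> i)] (mod int q)"
    "\<alpha> \<in> residues q \<Longrightarrow> (\<forall>i. [\<mu> i = int (\<alpha> i)] (mod int q)) \<longleftrightarrow> \<alpha> = residue q \<mu>"
proof -
  have r: "int (residue q \<mu> i) = \<mu> i mod int q" for i using assms by (simp add: residue_def)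
  have "int (residue q \<mu> i) < int q" for i unfolding r using assms by simp
  then have "residue q \<mu> i < q" for i by simp
  then have le: "residue q \<mu> i \<le> q - 1" for i by (metis Suc_leI diff_Suc_1 diff_le_mono)
  then show "residue q \<mu> \<in> residues q" by (simp add: residues_def)
  show cong: "[\<mu> i = int (residue q \<mu> i)] (mod int q)" for i by (simp add: r cong_def)
  assume \<alpha>: "\<alpha> \<in> residues q"
  have "\<alpha> i = residue q \<mu> i" if "[\<mu> i = int (\<alpha> i)] (mod int q)" for i
  proof -
    have "\<alpha> i \<le> q - 1" using \<alpha> by (simp add: residues_def)
    then have "int (\<alpha> i) mod int q = int (\<alpha> i)" using assms by simp
    with that r[of i] have "int (\<alpha> i) = int (residue q \<mu> i)" by (simp add: cong_def)
    then show ?thesis by simp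
  qed
  then show "(\<forall>i. [\<mu> i = int (\<alpha> i)] (mod int q)) \<longleftrightarrow> \<alpha> = residue q \<mu>" using cong by auto
qed

text \<open>
  The ideal \<open>J\<close> killed by all \<open>q\<close>-periodic functionals contains \<open>(t\<^sup>\<mu> - 1)\<^sup>q = t\<^bsup>q \<mu>\<^esup> - 1\<close>. Modulo \<open>J\<close>
  the augmentation ideal is generated by the finitely many \<open>t\<^sup>\<alpha> - 1\<close> with \<open>0 \<le> \<alpha>\<^sub>i < q\<close>, hence nilpotent.
\<close>

lemma periodic_distribution:
  fixes c :: "('m :: finite, 'n :: finite) weight \<Rightarrow> 'k :: field"
  assumes p: "prime CHAR('k)" and q: "q = CHAR('k) ^ r" and c: "periodic q c"
  shows "on_characters c \<in> distributions scale_T counit_T"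
proof -
  have q0: "q > 0" using p q prime_gt_0_nat by simp
  define J :: "('k, 'm, 'n) KT set" where "J = {f. \<forall>c. periodic q c \<longrightarrow> on_characters c f = 0}"
  have J0: "0 \<in> J" by (simp add: J_def on_characters_zero)
  have Jadd: "f + g \<in> J" if "f \<in> J" "g \<in> J" for f g
    using that by (simp add: J_def on_characters_add)
  have Jmult: "f * g \<in> J" if f: "f \<in> J" for f g
  proof (induction g rule: pm_induct)
    case (single \<nu> v)
    have "on_characters d (f * Poly_Mapping.single \<nu> v) = 0" if d: "periodic q d" for d
    proof -
      have "periodic q (\<lambda>\<mu>. d (\<mu> + \<nu>))"
        unfolding periodic_def
      proof (intro allI impI)
        fix \<mu> \<mu>' :: "('m, 'n) weight" assume "\<forall>i. [\<mu> i = \<mu>' i] (mod int q)"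
        then have "\<forall>i. [(\<mu> + \<nu>) i = (\<mu>' + \<nu>) i] (mod int q)" by (simp add: cong_add_rcancel)
        then show "d (\<mu> + \<nu>) = d (\<mu>' + \<nu>)" using d unfolding periodic_def by blast
      qed
      then show ?thesis using f by (simp add: on_characters_mult_single J_def)
    qed
    then show ?case by (simp add: J_def)
  qed (use J0 Jadd in \<open>simp_all add: distrib_left\<close>)
  have Jdiff: "Poly_Mapping.single \<mu> 1 - Poly_Mapping.single \<nu> 1 \<in> J" if "\<And>i. [\<mu> i = \<nu> i] (mod int q)" for \<mu> \<nu>
  proof -
    have "on_characters d (Poly_Mapping.single \<mu> 1 - Poly_Mapping.single \<nu> 1) = 0" if d: "periodic q d"
      for d :: "('m, 'n) weight \<Rightarrow> 'k"
    proof -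
      have "d \<mu> = d \<nu>"
        using d \<open>\<And>i. [\<mu> i = \<nu> i] (mod int q)\<close> unfolding periodic_def by blast
      then show ?thesis
        by (simp add: diff_conv_add_uminus on_characters_add on_characters_uminus del: add_uminus_conv_diff)
    qed
    then show ?thesis by (simp add: J_def)
  qed
  define x :: "(('m, 'n) idx \<Rightarrow> nat) \<Rightarrow> ('k, 'm, 'n) KT" where
    "x \<alpha> = Poly_Mapping.single (\<lambda>i. int (\<alpha> i)) 1 - 1" for \<alpha>
  have "x \<alpha> ^ q \<in> J" for \<alpha>
    using Jdiff[of "\<lambda>i. int q * int (\<alpha> i)" 0] unfolding x_def frobenius_character[OF p q]
    by (simp add: cong_def flip: single_one)
  from nilpotent_mod_generated[OF J0 Jadd Jmult finite_residues[of q] this]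
  have nil: "nilpotent_mod J {j + (\<Sum>\<alpha>\<in>residues q. r \<alpha> * x \<alpha>) | j r. j \<in> J}" (is "nilpotent_mod J ?A") .
  have Aadd: "a + b \<in> ?A" if ab: "a \<in> ?A" "b \<in> ?A" for a b
  proof -
    obtain j r where a: "a = j + (\<Sum>\<alpha>\<in>residues q. r \<alpha> * x \<alpha>)" "j \<in> J" using ab(1) by blast
    obtain k s where b: "b = k + (\<Sum>\<alpha>\<in>residues q. s \<alpha> * x \<alpha>)" "k \<in> J" using ab(2) by blast
    have "a + b = (j + k) + (\<Sum>\<alpha>\<in>residues q. (r \<alpha> + s \<alpha>) * x \<alpha>)"
      unfolding a b distrib_right sum.distrib by (simp only: ac_simps)
    then show ?thesis
      using Jadd[OF a(2) b(2)] by (intro CollectI exI[of _ "j + k"] exI[of _ "\<lambda>\<alpha>. r \<alpha> + s \<alpha>"] conjI)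
  qed
  have monom: "Poly_Mapping.single \<mu> v - Poly_Mapping.single 0 v \<in> ?A" for \<mu> v
  proof -
    let ?\<alpha> = "residue q \<mu>" and ?v = "Poly_Mapping.single 0 v :: ('k, 'm, 'n) KT"
    let ?j = "(Poly_Mapping.single \<mu> 1 - Poly_Mapping.single (\<lambda>i. int (?\<alpha> i)) 1) * ?v"
    have "(\<Sum>\<alpha>\<in>residues q. (if \<alpha> = ?\<alpha> then ?v else 0) * x \<alpha>) = (\<Sum>\<alpha>\<in>residues q. if \<alpha> = ?\<alpha> then ?v * x \<alpha> else 0)"
      by (rule sum.cong) auto
    also have "\<dots> = ?v * x ?\<alpha>" by (simp add: residue(1)[OF q0] finite_residues)
    finally have "?j + (\<Sum>\<alpha>\<in>residues q. (if \<alpha> = ?\<alpha> then ?v else 0) * x \<alpha>) =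
        Poly_Mapping.single \<mu> v - Poly_Mapping.single 0 v"
      by (simp add: x_def mult_single algebra_simps)
    moreover have "?j \<in> J" by (rule Jmult[OF Jdiff]) (rule residue(2)[OF q0])
    ultimately show ?thesis by (intro CollectI exI conjI) (rule sym)
  qed
  have A0: "0 \<in> ?A" using monom[of 0 0] by simp
  have kerA: "f \<in> ?A" if f: "counit_T f = 0" for f
  proof -
    have "f - Poly_Mapping.single 0 (counit_T f) \<in> ?A" for f
    proof (induction f rule: pm_induct)
      case zero
      then show ?case using A0 by (simp add: counit_T_def on_characters_zero)
    next
      case (single \<mu> v)
      then show ?case using monom[of \<mu> v] by (simp add: counit_T_def on_characters_monom zero_fun_def)
    next
      case (add a b)
      have "a + b - Poly_Mapping.single 0 (counit_T (a + b)) =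
          (a - Poly_Mapping.single 0 (counit_T a)) + (b - Poly_Mapping.single 0 (counit_T b))"
        by (simp add: counit_T_def on_characters_add single_add)
      then show ?case using Aadd[OF add] by (simp only:)
    qed
    from this[of f] f show ?thesis by simp
  qed
  obtain N where N: "\<And>as. length as = N \<Longrightarrow> set as \<subseteq> ?A \<Longrightarrow> prod_list as \<in> J"
    using nil unfolding nilpotent_mod_def by blast
  \<comment> \<open>\<open>N\<close> factors already give an element of \<open>J\<close>; the
    additional one matches the exponent \<open>t + 1\<close> in
    \<open>distributions\<close>.\<close>
  have "on_characters c f = 0" if "f \<in> ideal_power scale_T {f. counit_T f = 0} (N + 1)" for f
    using that unfolding ideal_power_def
  proof (induction rule: KT.span_induct_alt)
    case (step a g h)
    then obtain as where as: "g = prod_list as" "length as = N + 1" "set as \<subseteq> {f. counit_T f = 0}" by blast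
    obtain b bs where bs: "as = b # bs" "length bs = N" using as(2) by (cases as) auto
    have "set bs \<subseteq> ?A" using as(3) kerA unfolding bs by auto
    from N[OF bs(2) this] have "prod_list bs * b \<in> J" by (rule Jmult)
    then have "on_characters c g = 0" using c by (simp add: J_def as(1) bs(1) mult.commute)
    then show ?case using step by (simp add: on_characters_add on_characters_scale)
  qed (rule on_characters_zero)
  then show ?thesis unfolding distributions_def using linear_on_characters by blast
qed

lemma Dist_T_eq:
  assumes "prime CHAR('k :: field)"
  shows "(Dist_T :: (('k, 'm :: {finite, linorder}, 'n :: {finite, linorder}) KG \<Rightarrow> 'k) set) =
    {on_characters c \<circ> res_T | c r. periodic (CHAR('k) ^ r) c}"
proof -
  have "distributions scale_T counit_T = {on_characters c | c r. periodic (CHAR('k) ^ r) (c :: ('m, 'n) weight \<Rightarrow> 'k)}"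
  proof (intro equalityI subsetI)
    fix \<xi> :: "('k, 'm, 'n) KT \<Rightarrow> 'k" assume \<xi>: "\<xi> \<in> distributions scale_T counit_T"
    then have "Vector_Spaces.linear scale_T (*) \<xi>" by (simp add: distributions_def)
    from linear_eq_on_characters[OF this] distribution_periodic[OF assms \<xi>]
    show "\<xi> \<in> {on_characters c | c r. periodic (CHAR('k) ^ r) c}" by blast
  qed (use periodic_distribution[OF assms refl] in blast)
  then show ?thesis unfolding Dist_T_def by (auto simp only: mem_Collect_eq set_eq_iff)
qed

text \<open>Restriction to \<open>T\<close> sends the augmentation ideal of \<open>K[G]\<close>, and
  hence each of its powers, into that of \<open>K[T]\<close>.\<close>

lemma Dist_T_subset_Dist_G:
  "(Dist_T :: (('k :: field, 'm :: {finite, linorder}, 'n :: {finite, linorder}) KG \<Rightarrow> 'k) set) \<subseteq> Dist_G"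
proof
  fix \<xi> :: "('k, 'm, 'n) KG \<Rightarrow> 'k" assume "\<xi> \<in> Dist_T"
  then obtain \<eta> t where \<xi>: "\<xi> = \<eta> \<circ> res_T" and lin: "Vector_Spaces.linear scale_T (*) \<eta>"
    and t: "\<And>f. f \<in> ideal_power scale_T {f. counit_T f = 0} (t + 1) \<Longrightarrow> \<eta> f = 0"
    unfolding Dist_T_def distributions_def by blast
  interpret Vector_Spaces.linear scale_T "(*)" \<eta> by (rule lin)
  have hom: "alg_hom (Poly_Mapping.single 0) (res_T :: ('k, 'm, 'n) KG \<Rightarrow> _)"
    unfolding res_T_def by (rule alg_hom_extend[OF admissible_res])
  have \<xi>_add: "\<xi> (f + g) = \<xi> f + \<xi> g" and \<xi>_scale: "\<xi> (scale v f) = v * \<xi> f" for f g v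
    using add scale by (simp_all add: \<xi> alg_homD(1,8)[OF hom] flip: scale_T_def)
  have "Vector_Spaces.linear scale (*) \<xi>"
    by unfold_locales (simp_all add: \<xi>_add \<xi>_scale distrib_left distrib_right mult.assoc)
  moreover have "\<xi> f = 0" if "f \<in> ideal_power scale {f. counit f = 0} (t + 1)" for f
    using that unfolding ideal_power_def
  proof (induction rule: coords.span_induct_alt)
    case base
    show ?case using \<xi>_scale[of 0 0] by simp
  next
    case (step a g h)
    then obtain as where as: "g = prod_list as" "length as = t + 1" "set as \<subseteq> {f. counit f = 0}" by blast
    have "res_T g = prod_list (map res_T as)"
      unfolding as(1) by (induction as) (simp_all add: res_T_hom)
    moreover have "set (map res_T as) \<subseteq> {f. counit_T f = 0}" using as(3) by (auto simp: counit_res_T)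
    ultimately have "res_T g \<in> ideal_power scale_T {f. counit_T f = 0} (t + 1)"
      unfolding ideal_power_def using as(2) by (intro KT.span_base CollectI exI[of _ "map res_T as"]) auto
    then have "\<xi> g = 0" by (simp add: \<xi> t)
    then show ?case using step by (simp add: \<xi>_add \<xi>_scale)
  qed
  ultimately show "\<xi> \<in> Dist_G" unfolding Dist_G_def distributions_def by blast
qed

section \<open>The kernel inside \<open>Dist(T)\<close>\<close>

lemma ker_pi_Dist_T: "ker_pi \<Gamma> \<inter> Dist_T = {\<xi> \<in> Dist_T. \<forall>f\<in>C_sub \<Gamma>. \<xi> f = 0}"
  using Dist_T_subset_Dist_G by (auto simp: ker_pi_def pi_map_def)

lemma periodic_mono:
  assumes "periodic q c" "q dvd q'"
  shows "periodic q' c"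
  using assms unfolding periodic_def by (meson cong_dvd_modulus int_dvd_int_iff)

lemma on_characters_sum: "on_characters (\<lambda>\<mu>. \<Sum>a\<in>A. d a * e a \<mu>) f = (\<Sum>a\<in>A. d a * on_characters (e a) f)"
  by (simp add: on_characters_def sum_distrib_left mult.left_commute sum.swap[of _ A])

lemma subspace_ker_pi_Dist_T:
  assumes p: "prime CHAR('k :: field)"
  shows "functionals.subspace (ker_pi \<Gamma> \<inter> (Dist_T :: (('k, 'm :: {finite, linorder}, 'n :: {finite, linorder}) KG \<Rightarrow> 'k) set))"
proof -
  have oc: "on_characters (\<lambda>\<mu>. u * c \<mu> + v * d \<mu>) f = u * on_characters c f + v * on_characters d f" for u v c d
    and f :: "('k, 'm, 'n) KT"
    by (simp add: on_characters_def distrib_left sum.distrib sum_distrib_left mult.left_commute)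
  have comb: "(\<lambda>f. u * \<xi> f + v * \<eta> f) \<in> Dist_T" if mem: "\<xi> \<in> Dist_T" "\<eta> \<in> Dist_T"
    for u v and \<xi> \<eta> :: "('k, 'm, 'n) KG \<Rightarrow> 'k"
  proof -
    obtain c r where c: "\<xi> = on_characters c \<circ> res_T" "periodic (CHAR('k) ^ r) c"
      using mem(1) unfolding Dist_T_eq[OF p] by blast
    obtain d s where d: "\<eta> = on_characters d \<circ> res_T" "periodic (CHAR('k) ^ s) d"
      using mem(2) unfolding Dist_T_eq[OF p] by blast
    \<comment> \<open>Two periods that are powers of the same prime divide the larger of
      them.\<close>
    have "periodic (CHAR('k) ^ max r s) c" "periodic (CHAR('k) ^ max r s) d"
      by (rule periodic_mono[OF c(2) le_imp_power_dvd] periodic_mono[OF d(2) le_imp_power_dvd], simp)+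
    then have "periodic (CHAR('k) ^ max r s) (\<lambda>\<mu>. u * c \<mu> + v * d \<mu>)"
      unfolding periodic_def by metis
    moreover have "(\<lambda>f. u * \<xi> f + v * \<eta> f) = on_characters (\<lambda>\<mu>. u * c \<mu> + v * d \<mu>) \<circ> res_T"
      by (simp add: c(1) d(1) oc fun_eq_iff)
    ultimately show ?thesis unfolding Dist_T_eq[OF p] by blast
  qed
  have "(\<lambda>f. 0) \<in> (Dist_T :: (('k, 'm, 'n) KG \<Rightarrow> 'k) set)"
    unfolding Dist_T_eq[OF p]
    by (intro CollectI exI[of _ "\<lambda>_. 0"] exI[of _ 0]) (simp add: periodic_def on_characters_def fun_eq_iff)
  then show ?thesis
    unfolding functionals.subspace_def ker_pi_Dist_T scale_fun_def
    using comb[of _ _ 1 1] comb[of _ _ _ 0] by (auto simp: zero_fun_def plus_fun_def)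
qed

theorem proposition11p5:
  fixes \<Gamma> :: "('m :: {finite, linorder}, 'n :: {finite, linorder}) weight set" and p :: nat
  assumes "CHAR('k :: field) = p" and "p > 2"
    and "weight_ideal \<Gamma>"
  shows "ker_pi \<Gamma> \<inter> (Dist_T :: (('k, 'm, 'n) KG \<Rightarrow> 'k) set) =
    functionals.span {h_elem q \<alpha> | r q \<alpha>. q = p ^ r \<and> (\<forall>i. \<alpha> i \<le> q - 1) \<and>
      (\<forall>l\<in>degree_set \<Gamma>. \<not> [(\<Sum>i\<in>UNIV. int (\<alpha> i)) = l] (mod int q))}"
    (is "?L = functionals.span ?S")
proof
  have p: "prime CHAR('k)" using assms(1,2) by (intro prime_CHAR_semidom) simp
  have two: "(2 :: 'k) \<noteq> 0"
  proof
    assume "(2 :: 'k) = 0"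
    then have "p dvd 2" using of_nat_eq_0_iff_char_dvd[where ?'a = 'k, of 2] assms(1) by simp
    from dvd_imp_le[OF this] show False using assms(2) by simp
  qed
  have h: "h_elem q \<alpha> = on_characters (\<lambda>\<mu>. of_bool (\<forall>i. [\<mu> i = int (\<alpha> i)] (mod int q))) \<circ> (res_T :: ('k, 'm, 'n) KG \<Rightarrow> _)"
    if "q = p ^ r" "\<forall>i. \<alpha> i \<le> q - 1" for q r \<alpha>
    by (rule h_elem_eq[OF p]) (use that assms(1) in auto)
  show "functionals.span ?S \<subseteq> ?L"
  proof (rule functionals.span_minimal[OF _ subspace_ker_pi_Dist_T[OF p]], rule subsetI)
    fix \<xi> assume "\<xi> \<in> ?S"
    then obtain q r \<alpha> where q: "q = p ^ r" and \<alpha>: "\<forall>i. \<alpha> i \<le> q - 1"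
      "\<forall>l\<in>degree_set \<Gamma>. \<not> [(\<Sum>i\<in>UNIV. int (\<alpha> i)) = l] (mod int q)" and "\<xi> = h_elem q \<alpha>" by blast
    then have \<xi>: "\<xi> = on_characters (\<lambda>\<mu>. of_bool (\<forall>i. [\<mu> i = int (\<alpha> i)] (mod int q))) \<circ> res_T" using h by blast
    have "periodic q (\<lambda>\<mu>. of_bool (\<forall>i. [\<mu> i = int (\<alpha> i)] (mod int q)) :: 'k)"
      by (simp add: periodic_def cong_def)
    then have "\<xi> \<in> Dist_T" unfolding Dist_T_eq[OF p] \<xi> using q assms(1) by blast
    moreover have "\<xi> f = 0" if f: "f \<in> C_sub \<Gamma>" for f
    proof -
      have zero: "Poly_Mapping.lookup (res_T f) \<mu> * of_bool (\<forall>i. [\<mu> i = int (\<alpha> i)] (mod int q)) = 0" for \<mu>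
      proof (cases "Poly_Mapping.lookup (res_T f) \<mu> = 0")
        case False
        have "\<not> (\<forall>i. [\<mu> i = int (\<alpha> i)] (mod int q))"
        proof
          assume "\<forall>i. [\<mu> i = int (\<alpha> i)] (mod int q)"
          then have "[(\<Sum>i\<in>UNIV. int (\<alpha> i)) = wt_degree \<mu>] (mod int q)"
            unfolding wt_degree_def by (intro cong_sum) (simp add: cong_sym)
          with \<alpha>(2) degree_in_C_sub[OF two f False] show False by blast
        qed
        then show ?thesis by simp
      qed simp
      then show ?thesis by (simp only: \<xi> comp_apply on_characters_def zero sum.neutral_const)
    qed
    ultimately show "\<xi> \<in> ?L" unfolding ker_pi_Dist_T by blast
  qed
  show "?L \<subseteq> functionals.span ?S"
  proof
    fix \<xi> :: "('k, 'm, 'n) KG \<Rightarrow> 'k" assume "\<xi> \<in> ?L"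
    then have "\<xi> \<in> Dist_T" and ker: "\<And>f. f \<in> C_sub \<Gamma> \<Longrightarrow> \<xi> f = 0" unfolding ker_pi_Dist_T by auto
    then obtain c r where \<xi>: "\<xi> = on_characters c \<circ> res_T" and c: "periodic (p ^ r) c"
      unfolding Dist_T_eq[OF p] assms(1) by blast
    define q where "q = p ^ r"
    have q: "q > 0" using assms(2) by (simp add: q_def)
    let ?e = "\<lambda>\<alpha> \<mu>. of_bool (\<forall>i. [\<mu> i = int (\<alpha> i)] (mod int q)) :: 'k"
    \<comment> \<open>A periodic function is the combination of the indicators of the residue
      classes, with its values at the representatives as coefficients.\<close>
    have "c \<mu> = (\<Sum>\<alpha>\<in>residues q. c (\<lambda>i. int (\<alpha> i)) * ?e \<alpha> \<mu>)" for \<mu>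
    proof -
      have "(\<Sum>\<alpha>\<in>residues q. c (\<lambda>i. int (\<alpha> i)) * ?e \<alpha> \<mu>) =
          (\<Sum>\<alpha>\<in>residues q. if \<alpha> = residue q \<mu> then c (\<lambda>i. int (\<alpha> i)) else 0)"
        by (rule sum.cong[OF refl]) (simp add: residue(3)[OF q] cong del: if_weak_cong)
      also have "\<dots> = c (\<lambda>i. int (residue q \<mu> i))" by (simp add: residue(1)[OF q] finite_residues)
      also have "\<dots> = c \<mu>"
        using c residue(2)[OF q, of \<mu>] unfolding periodic_def q_def[symmetric] by metis
      finally show ?thesis by simp
    qed
    then have "on_characters c f = (\<Sum>\<alpha>\<in>residues q. c (\<lambda>i. int (\<alpha> i)) * on_characters (?e \<alpha>) f)" for f
      unfolding on_characters_sum[symmetric] by metis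
    then have "\<xi> = (\<Sum>\<alpha>\<in>residues q. scale_fun (c (\<lambda>i. int (\<alpha> i))) (h_elem q \<alpha>))"
      by (simp add: fun_eq_iff fun_sum_apply \<xi> scale_fun_def h[OF q_def] residues_def)
    also have "\<dots> \<in> functionals.span ?S"
    proof (rule functionals.span_sum)
      fix \<alpha> :: "('m, 'n) idx \<Rightarrow> nat" assume "\<alpha> \<in> residues q"
      then have \<alpha>: "\<forall>i. \<alpha> i \<le> q - 1" by (simp add: residues_def)
      show "scale_fun (c (\<lambda>i. int (\<alpha> i))) (h_elem q \<alpha>) \<in> functionals.span ?S"
      proof (cases "\<forall>l\<in>degree_set \<Gamma>. \<not> [(\<Sum>i\<in>UNIV. int (\<alpha> i)) = l] (mod int q)")
        case True
        then have "h_elem q \<alpha> \<in> ?S" using \<alpha> q_def by blast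
        then show ?thesis by (intro functionals.span_scale functionals.span_base)
      next
        case False
        \<comment> \<open>For a class outside the list the coefficient itself is 0: the class
          contains a weight of \<open>\<Gamma>\<close>, and \<open>\<xi>\<close> vanishes on an
          element of \<open>C_sub \<Gamma>\<close> that restricts to its character.\<close>
        then obtain \<kappa> where \<kappa>: "\<kappa> \<in> \<Gamma>" "[wt_degree (\<lambda>i. int (\<alpha> i)) = wt_degree \<kappa>] (mod int q)"
          unfolding degree_set_def wt_degree_def by blast
        obtain \<nu> where \<nu>: "\<nu> \<in> dominant_weights" "\<nu> \<unlhd> \<kappa>" "\<forall>i. [\<nu> i = int (\<alpha> i)] (mod int q)"
          using exists_dominated_congruent[OF _ \<kappa>(2)] q by auto
        have "\<nu> \<in> \<Gamma>" using assms(3) \<kappa>(1) \<nu>(1,2) unfolding weight_ideal_def by blast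
        from character_in_res_C_sub[OF two \<nu>(1) this]
        obtain f :: "('k, 'm, 'n) KG" where f: "f \<in> C_sub \<Gamma>" "res_T f = Poly_Mapping.single \<nu> 1" by blast
        have "c (\<lambda>i. int (\<alpha> i)) = c \<nu>"
          using c \<nu>(3) unfolding periodic_def q_def[symmetric] by metis
        also have "\<dots> = 0" using ker[OF f(1)] by (simp add: \<xi> f(2))
        finally show ?thesis by (simp add: functionals.span_zero)
      qed
    qed
    finally show "\<xi> \<in> functionals.span ?S" .
  qed
qed

end
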